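(* Let $C$ be a strict $\omega$-category and $\mathcal N(C)$ its Street nerve. The following three assertions are equivalent: 1. $\mathcal N(C)$ has the right lifting property with respect to the inclusions $\Lambda^2[n+1]\to\Delta[n+1]$ for all $n>0$; 2. $\mathcal N(C)$ is a Kan complex; 3. $C$ is $0$-trivial. Likewise, the following three assertions are equivalent: 1'. $\mathcal N(C)$ has the right lifting property with respect to the inclusions $\Lambda^2[n+1]\to\Delta[n+1]$ for all $n>1$; 2'. $\mathcal N(C)$ is a quasi-category; 3'. $C$ is $1$-trivial.
   Context: **$\omega$-categories.** A (strict) $\omega$-category $C$ has sets $C_n$ of $n$-cells ($n\ge0$), source and target maps $d_k^-,d_k^+:C_n\to C_k$ ($k<n$) satisfying the globular identities, compositions $d*_k c$ of $n$-cells defined for $k<n$ whenever $d_k^+c=d_k^-d$, and units $1^m_c\in C_m$ for $c\in C_n$, $m>n$ (with $1_c:=1_c^{n+1}$), satisfying the usual strict associativity, interchange and unit laws. For an $n$-cell $c$, $c:a\to b$ means $d_{n-1}^-c=a$, $d_{n-1}^+c=b$. **Weakly invertible cells.** An invertibility set is a set $E\subset\coprod_{n>0}C_n$ such that for every $n\ge 0$ and every $(n+1)$-cell $b\in E$ there exist $\tilde b,c,c'\in E$ with $\tilde b\in C_{n+1}$, $c,c'\in C_{n+2}$ and $c:1_{d_n^-b}\to\tilde b*_n b$, $c':1_{d_n^+b}\to b*_n\tilde b$. A cell of positive dimension is weakly invertible if it belongs to some invertibility set. $C$ is $k$-trivial if all its cells of dimension $>k$ are weakly invertible. **Orientals and Street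 nerve.** For $n\ge0$ let $C_\bullet(\Delta[n])$ be the normalized chain complex: $C_k(\Delta[n])$ is the free abelian group on the nondegenerate $k$-simplices of $\Delta[n]$, with $\partial_{k}:C_{k+1}\to C_{k}$, $\partial v=\sum_i(-1)^i d_iv$ (degenerate faces counted as $0$), augmentation $e$ sending each vertex to $1$, and $C_k^*(\Delta[n])\subset C_k(\Delta[n])$ the submonoid generated by the nondegenerate simplices. The $n$-th oriental $|\Delta[n]|$ is the $\omega$-category whose $p$-cells are the families $(x_k^\alpha)_{0\le k\le p,\ \alpha\in\{-,+\}}$ with $x_k^\alpha\in C_k^*(\Delta[n])$, $x_p^-=x_p^+$, $\partial_{k-1}(x_k^\alpha)=x_{k-1}^+-x_{k-1}^-$ for $0<k\le p$, and $e(x_0^\pm)=1$. The cell $d_k^\alpha x$ ($k<p$) keeps the entries of index $<k$ and has both entries of index $k$ equal to $x_k^\alpha$; $1^m_x$ is obtained by adding zero entries; and for $d_k^-x=d_k^+y=z$, $x*_ky=x-z+y$ (entrywise, where $z$ is extended by $0$). These form a cosimplicial $\omega$-category, and $\mathcal N(C)_n:=\mathrm{Hom}_{\omega\text{-}\mathrm{cat}}(|\Delta[n]|,C)$. $\Lambda^i[n]\subset\Delta[n]$ is the union of all codimension-one faces except the one opposite to vertex $i$. *)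

theory Defs
  imports "HOL-Algebra.Free_Abelian_Groups"
begin

section \<open>Strict \<open>\<omega>\<close>-categories\<close>

datatype polarity = Neg | Pos

text \<open>
  All operations carry the dimension of their arguments, so the sets of cells of different
  dimensions need not be disjoint. For \<open>x\<close> an \<open>n\<close>-cell, \<open>bd C \<alpha> n k x\<close> is \<open>d\<^sub>k\<^sup>\<alpha> x\<close>
  and \<open>unit_cell C n m x\<close> is \<open>1\<close> of dimension \<open>m\<close> on \<open>x\<close>;
  \<open>ccomp C n k x y\<close> is \<open>x *\<^sub>k y\<close> (first \<open>y\<close>, then \<open>x\<close>) for \<open>n\<close>-cells \<open>x\<close>, \<open>y\<close>.
\<close>

record 'c omega_cat =
  cells :: "nat \<Rightarrow> 'c set"
  bd :: "polarity \<Rightarrow> nat \<Rightarrow> nat \<Rightarrow> 'c \<Rightarrow> 'c"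
  ccomp :: "nat \<Rightarrow> nat \<Rightarrow> 'c \<Rightarrow> 'c \<Rightarrow> 'c"
  unit_cell :: "nat \<Rightarrow> nat \<Rightarrow> 'c \<Rightarrow> 'c"

definition composable :: "('c, 'e) omega_cat_scheme \<Rightarrow> nat \<Rightarrow> nat \<Rightarrow> 'c \<Rightarrow> 'c \<Rightarrow> bool" where
  "composable C n k x y \<longleftrightarrow>
     k < n \<and> x \<in> cells C n \<and> y \<in> cells C n \<and> bd C Neg n k x = bd C Pos n k y"

locale strict_omega_category =
  fixes C :: "('c, 'e) omega_cat_scheme"
  assumes bd_closed: "\<lbrakk>k < n; x \<in> cells C n\<rbrakk> \<Longrightarrow> bd C \<alpha> n k x \<in> cells C k"
    and globular: "\<lbrakk>j < k; k < n; x \<in> cells C n\<rbrakk>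
      \<Longrightarrow> bd C \<beta> k j (bd C \<alpha> n k x) = bd C \<beta> n j x"
    and comp_closed: "composable C n k x y \<Longrightarrow> ccomp C n k x y \<in> cells C n"
    and bd_Neg_comp: "composable C n k x y \<Longrightarrow> bd C Neg n k (ccomp C n k x y) = bd C Neg n k y"
    and bd_Pos_comp: "composable C n k x y \<Longrightarrow> bd C Pos n k (ccomp C n k x y) = bd C Pos n k x"
    and bd_comp: "\<lbrakk>composable C n k x y; k < j; j < n\<rbrakk>
      \<Longrightarrow> bd C \<alpha> n j (ccomp C n k x y) = ccomp C j k (bd C \<alpha> n j x) (bd C \<alpha> n j y)"
    and unit_closed: "\<lbrakk>n < m; x \<in> cells C n\<rbrakk> \<Longrightarrow> unit_cell C n m x \<in> cells C m"
    and bd_unit_lower: "\<lbrakk>n < m; j < n; x \<in> cells C n\<rbrakk>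
      \<Longrightarrow> bd C \<alpha> m j (unit_cell C n m x) = bd C \<alpha> n j x"
    and bd_unit: "\<lbrakk>n < m; x \<in> cells C n\<rbrakk> \<Longrightarrow> bd C \<alpha> m n (unit_cell C n m x) = x"
    and bd_unit_upper: "\<lbrakk>n < j; j < m; x \<in> cells C n\<rbrakk>
      \<Longrightarrow> bd C \<alpha> m j (unit_cell C n m x) = unit_cell C n j x"
    and unit_unit: "\<lbrakk>n < j; j < m; x \<in> cells C n\<rbrakk>
      \<Longrightarrow> unit_cell C j m (unit_cell C n j x) = unit_cell C n m x"
    and comp_assoc: "\<lbrakk>composable C n k x y; composable C n k y z\<rbrakk>
      \<Longrightarrow> ccomp C n k (ccomp C n k x y) z = ccomp C n k x (ccomp C n k y z)"
    and comp_unit_left: "\<lbrakk>k < n; x \<in> cells C n\<rbrakk>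
      \<Longrightarrow> ccomp C n k (unit_cell C k n (bd C Pos n k x)) x = x"
    and comp_unit_right: "\<lbrakk>k < n; x \<in> cells C n\<rbrakk>
      \<Longrightarrow> ccomp C n k x (unit_cell C k n (bd C Neg n k x)) = x"
    and unit_comp: "\<lbrakk>composable C n k x y; n < m\<rbrakk>
      \<Longrightarrow> unit_cell C n m (ccomp C n k x y)
        = ccomp C m k (unit_cell C n m x) (unit_cell C n m y)"
    and interchange: "\<lbrakk>j < k; composable C n k x y; composable C n k z w; composable C n j x z\<rbrakk>
      \<Longrightarrow> ccomp C n j (ccomp C n k x y) (ccomp C n k z w)
        = ccomp C n k (ccomp C n j x z) (ccomp C n j y w)"

text \<open>
  Maps of \<open>\<omega>\<close>-categories are taken to be \<open>undefined\<close> outside the cells, so that two of them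
  are equal as soon as they agree on all cells.
\<close>

definition omega_hom ::
  "('a, 'e) omega_cat_scheme \<Rightarrow> ('b, 'f) omega_cat_scheme \<Rightarrow> (nat \<Rightarrow> 'a \<Rightarrow> 'b) set" where
  "omega_hom C D = {F.
     (\<forall>n. F n \<in> cells C n \<rightarrow>\<^sub>E cells D n) \<and>
     (\<forall>\<alpha> n k. \<forall>x\<in>cells C n. k < n \<longrightarrow> F k (bd C \<alpha> n k x) = bd D \<alpha> n k (F n x)) \<and>
     (\<forall>n k x y. composable C n k x y \<longrightarrow> F n (ccomp C n k x y) = ccomp D n k (F n x) (F n y)) \<and>
     (\<forall>n m. \<forall>x\<in>cells C n. n < m \<longrightarrow> F m (unit_cell C n m x) = unit_cell D n m (F n x))}"


subsection \<open>Weakly invertible cells\<close>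

text \<open>\<open>cell_from_to C n c a b\<close> is \<open>c : a \<rightarrow> b\<close> for an \<open>(n+1)\<close>-cell \<open>c\<close>.\<close>

definition cell_from_to :: "('c, 'e) omega_cat_scheme \<Rightarrow> nat \<Rightarrow> 'c \<Rightarrow> 'c \<Rightarrow> 'c \<Rightarrow> bool" where
  "cell_from_to C n c a b \<longleftrightarrow>
     c \<in> cells C (Suc n) \<and> bd C Neg (Suc n) n c = a \<and> bd C Pos (Suc n) n c = b"

definition invertibility_set :: "('c, 'e) omega_cat_scheme \<Rightarrow> (nat \<times> 'c) set \<Rightarrow> bool" where
  "invertibility_set C E \<longleftrightarrow>
     E \<subseteq> (SIGMA n:{0<..}. cells C n) \<and>
     (\<forall>n b. (Suc n, b) \<in> E \<longrightarrow>
        (\<exists>b' c c'. (Suc n, b') \<in> E \<and> (n + 2, c) \<in> E \<and> (n + 2, c') \<in> E \<and>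
           composable C (Suc n) n b' b \<and> composable C (Suc n) n b b' \<and>
           cell_from_to C (Suc n) c
             (unit_cell C n (Suc n) (bd C Neg (Suc n) n b)) (ccomp C (Suc n) n b' b) \<and>
           cell_from_to C (Suc n) c'
             (unit_cell C n (Suc n) (bd C Pos (Suc n) n b)) (ccomp C (Suc n) n b b')))"

definition weakly_invertible :: "('c, 'e) omega_cat_scheme \<Rightarrow> nat \<Rightarrow> 'c \<Rightarrow> bool" where
  "weakly_invertible C n x \<longleftrightarrow> (\<exists>E. invertibility_set C E \<and> (n, x) \<in> E)"

definition k_trivial :: "nat \<Rightarrow> ('c, 'e) omega_cat_scheme \<Rightarrow> bool" where
  "k_trivial k C \<longleftrightarrow> (\<forall>n>k. \<forall>x\<in>cells C n. weakly_invertible C n x)"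


section \<open>Simplicial sets\<close>

text \<open>The ordinal \<open>[m]\<close> is \<open>{..m}\<close>; morphisms of the simplex category are \<open>undefined\<close> outside it.\<close>

definition simplex_hom :: "nat \<Rightarrow> nat \<Rightarrow> (nat \<Rightarrow> nat) set" where
  "simplex_hom m n = {f \<in> {..m} \<rightarrow>\<^sub>E {..n}. mono_on {..m} f}"

text \<open>For \<open>f : [m] \<rightarrow> [n]\<close>, \<open>act K m n f\<close> is the induced map from \<open>n\<close>- to \<open>m\<close>-simplices.\<close>

record 'x sset =
  simplices :: "nat \<Rightarrow> 'x set"
  act :: "nat \<Rightarrow> nat \<Rightarrow> (nat \<Rightarrow> nat) \<Rightarrow> 'x \<Rightarrow> 'x"

locale simplicial_set =
  fixes K :: "('x, 'e) sset_scheme"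
  assumes act_closed: "\<lbrakk>f \<in> simplex_hom m n; x \<in> simplices K n\<rbrakk> \<Longrightarrow> act K m n f x \<in> simplices K m"
    and act_id: "x \<in> simplices K n \<Longrightarrow> act K n n (restrict id {..n}) x = x"
    and act_compose: "\<lbrakk>f \<in> simplex_hom l m; g \<in> simplex_hom m n; x \<in> simplices K n\<rbrakk>
      \<Longrightarrow> act K l n (compose {..l} g f) x = act K l m f (act K m n g x)"

definition sset_map ::
  "('x, 'e) sset_scheme \<Rightarrow> ('y, 'f) sset_scheme \<Rightarrow> (nat \<Rightarrow> 'x \<Rightarrow> 'y) \<Rightarrow> bool" where
  "sset_map K L F \<longleftrightarrow>
     (\<forall>n. \<forall>x\<in>simplices K n. F n x \<in> simplices L n) \<and>
     (\<forall>m n. \<forall>f\<in>simplex_hom m n. \<forall>x\<in>simplices K n. F m (act K m n f x) = act L m n f (F n x))"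

text \<open>The right lifting property of the map from \<open>X\<close> to the point with respect to \<open>i : A \<rightarrow> B\<close>.\<close>

definition right_lifting ::
  "('x, 'e) sset_scheme \<Rightarrow> ('a, 'f) sset_scheme \<Rightarrow> ('b, 'g) sset_scheme
    \<Rightarrow> (nat \<Rightarrow> 'a \<Rightarrow> 'b) \<Rightarrow> bool" where
  "right_lifting X A B i \<longleftrightarrow>
     (\<forall>F. sset_map A X F \<longrightarrow>
        (\<exists>G. sset_map B X G \<and> (\<forall>n. \<forall>a\<in>simplices A n. G n (i n a) = F n a)))"

definition standard_simplex :: "nat \<Rightarrow> (nat \<Rightarrow> nat) sset" where
  "standard_simplex n =
     \<lparr>simplices = (\<lambda>m. simplex_hom m n), act = (\<lambda>m k f s. compose {..m} s f)\<rparr>"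

text \<open>The codimension-one face of \<open>\<Delta>[n]\<close> opposite to \<open>j\<close> consists of the simplices avoiding the vertex \<open>j\<close>.\<close>

definition opposite_face :: "nat \<Rightarrow> nat \<Rightarrow> nat \<Rightarrow> (nat \<Rightarrow> nat) set" where
  "opposite_face n j m = {s \<in> simplices (standard_simplex n) m. j \<notin> s ` {..m}}"

definition horn :: "nat \<Rightarrow> nat \<Rightarrow> (nat \<Rightarrow> nat) sset" where
  "horn i n =
     \<lparr>simplices = (\<lambda>m. \<Union>j\<in>{..n} - {i}. opposite_face n j m), act = act (standard_simplex n)\<rparr>"

definition has_horn_fillers :: "('x, 'e) sset_scheme \<Rightarrow> nat \<Rightarrow> nat \<Rightarrow> bool" where
  "has_horn_fillers X i n \<longleftrightarrow> right_lifting X (horn i n) (standard_simplex n) (\<lambda>m s. s)"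

definition kan_complex :: "('x, 'e) sset_scheme \<Rightarrow> bool" where
  "kan_complex X \<longleftrightarrow> simplicial_set X \<and> (\<forall>n>0. \<forall>i\<le>n. has_horn_fillers X i n)"

definition quasi_category :: "('x, 'e) sset_scheme \<Rightarrow> bool" where
  "quasi_category X \<longleftrightarrow>
     simplicial_set X \<and> (\<forall>n i. 0 < i \<and> i < n \<longrightarrow> has_horn_fillers X i n)"


section \<open>Normalized chains\<close>

definition coface :: "nat \<Rightarrow> nat \<Rightarrow> nat \<Rightarrow> nat" where
  "coface n i = restrict (\<lambda>j. if j < i then j else Suc j) {..n}"

definition codegeneracy :: "nat \<Rightarrow> nat \<Rightarrow> nat \<Rightarrow> nat" where
  "codegeneracy n i = restrict (\<lambda>j. if j \<le> i then j else j - 1) {..Suc n}"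

definition nondegenerate :: "('x, 'e) sset_scheme \<Rightarrow> nat \<Rightarrow> 'x set" where
  "nondegenerate K k = simplices K k -
     {act K (Suc m) m (codegeneracy m i) y | m i y. k = Suc m \<and> i \<le> m \<and> y \<in> simplices K m}"

text \<open>Degenerate simplices count as \<open>0\<close> in the normalized chain groups.\<close>

definition simplex_chain :: "('x, 'e) sset_scheme \<Rightarrow> nat \<Rightarrow> 'x \<Rightarrow> 'x \<Rightarrow>\<^sub>0 int" where
  "simplex_chain K k x = (if x \<in> nondegenerate K k then frag_of x else 0)"

definition chain_boundary :: "('x, 'e) sset_scheme \<Rightarrow> nat \<Rightarrow> ('x \<Rightarrow>\<^sub>0 int) \<Rightarrow> ('x \<Rightarrow>\<^sub>0 int)" where
  "chain_boundary K k = frag_extend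
     (\<lambda>v. \<Sum>i\<le>Suc k. frag_cmul ((-1) ^ i) (simplex_chain K k (act K k (Suc k) (coface k i) v)))"

definition augmentation :: "('x \<Rightarrow>\<^sub>0 int) \<Rightarrow> int" where
  "augmentation c = (\<Sum>v\<in>Poly_Mapping.keys c. Poly_Mapping.lookup c v)"

text \<open>The submonoid \<open>C\<^sub>k\<^sup>*\<close> generated by the nondegenerate \<open>k\<close>-simplices.\<close>

inductive_set positive_chains :: "('x, 'e) sset_scheme \<Rightarrow> nat \<Rightarrow> ('x \<Rightarrow>\<^sub>0 int) set"
  for K :: "('x, 'e) sset_scheme" and k :: nat where
  zero: "0 \<in> positive_chains K k"
| generator: "x \<in> nondegenerate K k \<Longrightarrow> frag_of x \<in> positive_chains K k"
| plus: "\<lbrakk>c \<in> positive_chains K k; d \<in> positive_chains K k\<rbrakk> \<Longrightarrow> c + d \<in> positive_chains K k"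

definition chain_map ::
  "('y, 'f) sset_scheme \<Rightarrow> (nat \<Rightarrow> 'x \<Rightarrow> 'y) \<Rightarrow> nat \<Rightarrow> ('x \<Rightarrow>\<^sub>0 int) \<Rightarrow> ('y \<Rightarrow>\<^sub>0 int)" where
  "chain_map L F k = frag_extend (\<lambda>v. simplex_chain L k (F k v))"


section \<open>Orientals and the Street nerve\<close>

text \<open>
  A family indexed by \<open>k \<le> p\<close> is encoded as a function on all of \<open>nat\<close> that vanishes above \<open>p\<close>.
  With this convention the units, which add zero entries, do not change the underlying function.
\<close>

type_synonym oriental_cell = "nat \<Rightarrow> polarity \<Rightarrow> ((nat \<Rightarrow> nat) \<Rightarrow>\<^sub>0 int)"

definition oriental_cells :: "nat \<Rightarrow> nat \<Rightarrow> oriental_cell set" where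
  "oriental_cells n p = {x.
     (\<forall>k\<le>p. \<forall>\<alpha>. x k \<alpha> \<in> positive_chains (standard_simplex n) k) \<and>
     (\<forall>k>p. \<forall>\<alpha>. x k \<alpha> = 0) \<and>
     x p Neg = x p Pos \<and>
     (\<forall>k \<alpha>. 0 < k \<and> k \<le> p \<longrightarrow>
        chain_boundary (standard_simplex n) (k - 1) (x k \<alpha>) = x (k - 1) Pos - x (k - 1) Neg) \<and>
     (\<forall>\<alpha>. augmentation (x 0 \<alpha>) = 1)}"

definition oriental_bd :: "polarity \<Rightarrow> nat \<Rightarrow> oriental_cell \<Rightarrow> oriental_cell" where
  "oriental_bd \<alpha> k x = (\<lambda>j \<beta>. if j < k then x j \<beta> else if j = k then x k \<alpha> else 0)"

definition oriental :: "nat \<Rightarrow> oriental_cell omega_cat" where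
  "oriental n =
     \<lparr>cells = oriental_cells n,
      bd = (\<lambda>\<alpha> p k x. oriental_bd \<alpha> k x),
      ccomp = (\<lambda>p k x y j \<alpha>. x j \<alpha> - oriental_bd Neg k x j \<alpha> + y j \<alpha>),
      unit_cell = (\<lambda>p m x. x)\<rparr>"

text \<open>The map of orientals from \<open>|\<Delta>[m]|\<close> to \<open>|\<Delta>[n]|\<close> induced by \<open>f : [m] \<rightarrow> [n]\<close>.\<close>

definition oriental_map ::
  "nat \<Rightarrow> nat \<Rightarrow> (nat \<Rightarrow> nat) \<Rightarrow> nat \<Rightarrow> oriental_cell \<Rightarrow> oriental_cell" where
  "oriental_map m n f p = restrict
     (\<lambda>x k \<alpha>. chain_map (standard_simplex n) (\<lambda>k s. compose {..k} f s) k (x k \<alpha>))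
     (cells (oriental m) p)"

definition nerve :: "('c, 'e) omega_cat_scheme \<Rightarrow> (nat \<Rightarrow> oriental_cell \<Rightarrow> 'c) sset" where
  "nerve C =
     \<lparr>simplices = (\<lambda>n. omega_hom (oriental n) C),
      act = (\<lambda>m n f F p. compose (cells (oriental m) p) (F p) (oriental_map m n f p))\<rparr>"

end

(*
  Orientals are free on their atoms: a composable family of k-cells is recovered by demoting a
  generator of dimension k + 1 to dimension k and substituting its source or target for it.
  A filler of a horn therefore only needs a value g for the missing face and a cell T for the interior.
  The boundary of T contains g exactly once, whiskered by cells that the horn determines; dividing
  by these weakly invertible whiskers yields g and T. For inner horns no whisker has dimension 1,
  because the interior simplex runs from the first to the last vertex.
  Conversely, an n-cell b is placed on a horn \<Lambda>^2[n+1] through a map of chain complexes to the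
  n-globe that sends the face opposite to 0 to b and the other n-dimensional faces to 0. In a filler,
  the target is b composed with the value X of the remaining face and the source is an identity, so X
  is a right inverse of b; right inverses in all dimensions are two-sided.
*)
theory Submission
  imports Defs
begin

text \<open>Weak inverses cancel only up to higher cells, so division cannot be done by equations.
  Equality of \<open>q\<close>-cells is replaced by the relation \<open>arrow q\<close>. The cell
  linking an identity to \<open>Y' Y\<close> becomes, after cancelling, a whisker one dimension
  higher; division is thus an induction on the codimension of the whisker. The arrow that remains at
  the end is the interior cell itself. Freeness is proved for general based complexes, because
  demotion leaves the class of orientals. An integer function on generators takes the place of an
  order and survives demotion unchanged. The steps of a cell can be listed in many orders; the
  obstacle is that two steps which can both come first must commute. All cells up to a fixed
  dimension \<open>N\<close> are viewed as \<open>N\<close>-cells by means of units, so that cells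
  of different dimensions compose directly. \<open>N\<close> exceeds the dimension of the simplex to
  be filled, which leaves room for witnesses of invertibility. In the converse the horn with index 2
  fits because the face opposite 2 is the only one whose boundary would have to be mapped to the
  reversed boundary of the globe: the horn leaves out just what a globe cannot provide.\<close>

fun flip :: "polarity \<Rightarrow> polarity" where
  "flip Neg = Pos" | "flip Pos = Neg"

section \<open>One-sorted strict omega-categories and division by weakly invertible cells\<close>

text \<open>A \<open>k\<close>-cell is identified with the units on it, so all cells share one
  carrier, faces are again elements of it, and dimension becomes the predicate
  \<open>cell k\<close>. No dimension bound restricts the operations: from the dimension of a cell
  upwards its faces are the cell itself.\<close>

locale one_sorted =
  fixes M :: "'m set" and d :: "polarity \<Rightarrow> nat \<Rightarrow> 'm \<Rightarrow> 'm" and cmp :: "nat \<Rightarrow> 'm \<Rightarrow> 'm \<Rightarrow> 'm"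
  assumes d_closed: "x \<in> M \<Longrightarrow> d \<alpha> k x \<in> M"
    and d_d_less: "\<lbrakk>x \<in> M; j < k\<rbrakk> \<Longrightarrow> d \<beta> j (d \<alpha> k x) = d \<beta> j x"
    and d_d_ge: "\<lbrakk>x \<in> M; k \<le> j\<rbrakk> \<Longrightarrow> d \<beta> j (d \<alpha> k x) = d \<alpha> k x"
    and cmp_closed: "\<lbrakk>x \<in> M; y \<in> M; d Neg k x = d Pos k y\<rbrakk> \<Longrightarrow> cmp k x y \<in> M"
    and d_Neg_cmp: "\<lbrakk>x \<in> M; y \<in> M; d Neg k x = d Pos k y\<rbrakk> \<Longrightarrow> d Neg k (cmp k x y) = d Neg k y"
    and d_Pos_cmp: "\<lbrakk>x \<in> M; y \<in> M; d Neg k x = d Pos k y\<rbrakk> \<Longrightarrow> d Pos k (cmp k x y) = d Pos k x"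
    and d_cmp: "\<lbrakk>x \<in> M; y \<in> M; d Neg k x = d Pos k y; k < j\<rbrakk>
      \<Longrightarrow> d \<alpha> j (cmp k x y) = cmp k (d \<alpha> j x) (d \<alpha> j y)"
    and cmp_unit_right: "x \<in> M \<Longrightarrow> cmp k x (d Neg k x) = x"
    and cmp_unit_left: "x \<in> M \<Longrightarrow> cmp k (d Pos k x) x = x"
    and cmp_assoc: "\<lbrakk>x \<in> M; y \<in> M; z \<in> M; d Neg k x = d Pos k y; d Neg k y = d Pos k z\<rbrakk>
      \<Longrightarrow> cmp k (cmp k x y) z = cmp k x (cmp k y z)"
    and cmp_interchange: "\<lbrakk>j < k; x \<in> M; y \<in> M; z \<in> M; w \<in> M; d Neg k x = d Pos k y;
        d Neg k z = d Pos k w; d Neg j x = d Pos j z\<rbrakk>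
      \<Longrightarrow> cmp j (cmp k x y) (cmp k z w) = cmp k (cmp j x z) (cmp j y w)"
begin

definition cell :: "nat \<Rightarrow> 'm \<Rightarrow> bool" where
  "cell k x \<longleftrightarrow> x \<in> M \<and> d Neg k x = x"

lemma cell_closed: "cell k x \<Longrightarrow> x \<in> M"
  by (simp add: cell_def)

lemma cell_d: "x \<in> M \<Longrightarrow> cell k (d \<alpha> k x)"
  by (simp add: cell_def d_closed d_d_ge)

lemma d_cell: "\<lbrakk>cell k x; k \<le> j\<rbrakk> \<Longrightarrow> d \<alpha> j x = x"
  unfolding cell_def by (metis d_d_ge)

lemma cell_mono: "\<lbrakk>cell k x; k \<le> j\<rbrakk> \<Longrightarrow> cell j x"
  using d_cell by (simp add: cell_def)

lemma cellI: "\<lbrakk>x \<in> M; d \<alpha> k x = x\<rbrakk> \<Longrightarrow> cell k x"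
  using cell_d by metis

lemma d_cmp_less:
  assumes "x \<in> M" "y \<in> M" "d Neg k x = d Pos k y" "j < k"
  shows "d \<alpha> j (cmp k x y) = d \<alpha> j y" "d \<alpha> j (cmp k x y) = d \<alpha> j x"
  using assms d_d_less cmp_closed d_Neg_cmp d_Pos_cmp by metis+

lemma cell_cmp:
  assumes "cell q x" "cell q y" "d Neg k x = d Pos k y"
  shows "cell q (cmp k x y)"
proof (cases "k < q")
  case True
  then show ?thesis using assms d_cmp[of x y k q Neg] cmp_closed unfolding cell_def by metis
next
  case False
  then have "x = y" using assms d_cell by (metis not_le)
  then show ?thesis using assms cmp_unit_right[of x k] d_cell False
    by (metis cell_def not_le)
qed

lemma cmp_cell: "\<lbrakk>cell k x; cell k y; d Neg k x = d Pos k y\<rbrakk> \<Longrightarrow> cmp k x y = x"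
  using cmp_unit_right d_cell cell_closed by (metis order_refl)

lemma cmp_unit_right': "\<lbrakk>x \<in> M; cell k y; d Neg k x = d Pos k y\<rbrakk> \<Longrightarrow> cmp k x y = x"
  using cmp_unit_right d_cell by (metis order_refl)

lemma cmp_unit_left': "\<lbrakk>x \<in> M; cell k y; d Neg k y = d Pos k x\<rbrakk> \<Longrightarrow> cmp k y x = x"
  using cmp_unit_left d_cell by (metis order_refl)

text \<open>Interchange, after padding \<open>x\<close> and \<open>y\<close> with their
  \<open>j\<close>-dimensional units. Composites along \<open>k\<close> become composites along
  \<open>j\<close> of two whiskered cells, in either order; this exchange is what later moves a
  whisker up in dimension.\<close>

lemma cmp_slide:
  assumes "x \<in> M" "y \<in> M" "d Neg k x = d Pos k y" "k < j"
  shows "cmp k x y = cmp j (cmp k (d Pos j x) y) (cmp k x (d Neg j y))"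
    and "cmp k x y = cmp j (cmp k x (d Pos j y)) (cmp k (d Neg j x) y)"
proof -
  have "cmp k (cmp j (d Pos j x) x) (cmp j y (d Neg j y))
      = cmp j (cmp k (d Pos j x) y) (cmp k x (d Neg j y))"
    by (rule cmp_interchange) (use assms in \<open>simp_all add: d_closed d_d_ge d_d_less\<close>)
  then show "cmp k x y = cmp j (cmp k (d Pos j x) y) (cmp k x (d Neg j y))"
    using assms cmp_unit_left cmp_unit_right by simp
  have "cmp k (cmp j x (d Neg j x)) (cmp j (d Pos j y) y)
      = cmp j (cmp k x (d Pos j y)) (cmp k (d Neg j x) y)"
    by (rule cmp_interchange) (use assms in \<open>simp_all add: d_closed d_d_ge d_d_less\<close>)
  then show "cmp k x y = cmp j (cmp k x (d Pos j y)) (cmp k (d Neg j x) y)"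
    using assms cmp_unit_left cmp_unit_right by simp
qed

text \<open>The substitute for equality of parallel \<open>q\<close>-cells. It is reflexive,
  transitive and stable under whiskering; symmetry needs invertible \<open>(q+1)\<close>-cells, see
  \<open>arrow_sym\<close>.\<close>

definition arrow :: "nat \<Rightarrow> 'm \<Rightarrow> 'm \<Rightarrow> bool" where
  "arrow q A B \<longleftrightarrow> (\<exists>Z. cell (Suc q) Z \<and> d Neg q Z = A \<and> d Pos q Z = B)"

lemma arrow_refl: "cell q A \<Longrightarrow> arrow q A A"
  unfolding arrow_def using cell_mono d_cell by (metis le_SucI order_refl)

lemma arrow_trans:
  assumes "arrow q A B" "arrow q B C"
  shows "arrow q A C"
proof -
  obtain Z W where Z: "cell (Suc q) Z" "d Neg q Z = A" "d Pos q Z = B"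
    and W: "cell (Suc q) W" "d Neg q W = B" "d Pos q W = C"
    using assms unfolding arrow_def by blast
  show ?thesis unfolding arrow_def
    by (rule exI[of _ "cmp q W Z"]) (use Z W cell_cmp cell_closed d_Neg_cmp d_Pos_cmp in auto)
qed

lemma arrow_whisker_left:
  assumes "arrow q A B" "cell q W" "k < q" "d Neg k W = d Pos k A"
  shows "arrow q (cmp k W A) (cmp k W B)"
proof -
  obtain Z where Z: "cell (Suc q) Z" "d Neg q Z = A" "d Pos q Z = B"
    using assms unfolding arrow_def by blast
  have c: "d Neg k W = d Pos k Z" using Z assms cell_closed d_d_less by metis
  show ?thesis unfolding arrow_def
    by (rule exI[of _ "cmp k W Z"])
      (use Z assms c cell_cmp cell_closed cell_mono d_cmp d_cell in auto)
qed

lemma arrow_whisker_right: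
  assumes "arrow q A B" "cell q W" "k < q" "d Neg k A = d Pos k W"
  shows "arrow q (cmp k A W) (cmp k B W)"
proof -
  obtain Z where Z: "cell (Suc q) Z" "d Neg q Z = A" "d Pos q Z = B"
    using assms unfolding arrow_def by blast
  have c: "d Neg k Z = d Pos k W" using Z assms cell_closed d_d_less by metis
  show ?thesis unfolding arrow_def
    by (rule exI[of _ "cmp k Z W"])
      (use Z assms c cell_cmp cell_closed cell_mono d_cmp d_cell in auto)
qed

text \<open>The connecting arrows are demanded in both directions. This makes the notion invariant
  under reversal of all cells, on which \<open>dual_invertible_dim\<close> depends.\<close>

definition inverts :: "nat \<Rightarrow> 'm \<Rightarrow> 'm \<Rightarrow> bool" where
  "inverts k Y' Y \<longleftrightarrow> cell (Suc k) Y' \<and> d Neg k Y' = d Pos k Y \<and> d Pos k Y' = d Neg k Y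
     \<and> arrow (Suc k) (d Neg k Y) (cmp k Y' Y) \<and> arrow (Suc k) (d Pos k Y) (cmp k Y Y')
     \<and> arrow (Suc k) (cmp k Y' Y) (d Neg k Y) \<and> arrow (Suc k) (cmp k Y Y') (d Pos k Y)"

text \<open>The index is that of the composition: the condition concerns cells of dimension
  \<open>k + 1\<close>, and its witnesses have dimension \<open>k + 2\<close>.\<close>

definition invertible_dim :: "nat \<Rightarrow> bool" where
  "invertible_dim k \<longleftrightarrow> (\<forall>Y. cell (Suc k) Y \<longrightarrow> (\<exists>Y'. inverts k Y' Y))"

lemma arrow_sym:
  assumes "invertible_dim q" "arrow q A B"
  shows "arrow q B A"
  using assms unfolding invertible_dim_def arrow_def inverts_def by metis

text \<open>Multiplying by a weak inverse \<open>Y'\<close> leaves the factor \<open>Y' Y\<close>,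
  which a \<open>(k+2)\<close>-cell \<open>e\<close> links to an identity. If
  \<open>q = Suc k\<close>, the composites of \<open>e\<close> with \<open>A\<close> and
  \<open>B\<close> are arrows and finish the proof. Otherwise sliding \<open>e\<close> past
  \<open>A\<close> and \<open>B\<close> replaces the whisker \<open>Y\<close> along \<open>k\<close>
  by a whisker \<open>Z\<close> along \<open>k + 1\<close>, and the induction on
  \<open>q - k\<close> applies.\<close>

lemma cancel_left:
  assumes "k < q" "cell q A" "cell q B" "cell (Suc k) Y" "d Pos k A = d Neg k Y"
    "\<forall>\<alpha>. d \<alpha> (q - 1) A = d \<alpha> (q - 1) B" "\<forall>j. k \<le> j \<and> j \<le> q \<longrightarrow> invertible_dim j"
    "arrow q (cmp k Y A) (cmp k Y B)"
  shows "arrow q A B"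
  using assms
proof (induction "q - k" arbitrary: k Y)
  case 0
  then show ?case by simp
next
  case (Suc n)
  have cl: "A \<in> M" "B \<in> M" "Y \<in> M" using Suc.prems cell_closed by auto
  have par: "d \<alpha> j A = d \<alpha> j B" if "j < q" for \<alpha> j
    using that Suc.prems(2,3,6) cl d_d_less by (metis Suc_pred' less_Suc_eq less_nat_zero_code not_gr_zero)
  obtain Y' where Y': "inverts k Y' Y"
    using Suc.prems unfolding invertible_dim_def by (meson less_imp_le order_refl)
  have Y'c: "cell (Suc k) Y'" "Y' \<in> M" "d Neg k Y' = d Pos k Y" "d Pos k Y' = d Neg k Y"
    using Y' cell_closed unfolding inverts_def by auto
  obtain e where e: "cell (Suc (Suc k)) e" "d Neg (Suc k) e = d Neg k Y" "d Pos (Suc k) e = cmp k Y' Y"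
    using Y' unfolding inverts_def arrow_def by blast
  have eM: "e \<in> M" using e cell_closed by auto
  have YB: "d Neg k Y = d Pos k B" using Suc.prems par by metis
  have kA: "d Pos k (cmp k Y A) = d Pos k Y" "d Pos k (cmp k Y B) = d Pos k Y"
    using Suc.prems cl YB d_Pos_cmp by metis+
  have "cell q Y'" using Y'c Suc.prems cell_mono by (metis Suc_leI)
  then have "arrow q (cmp k Y' (cmp k Y A)) (cmp k Y' (cmp k Y B))"
    using arrow_whisker_left Suc.prems Y'c kA by simp
  then have ar: "arrow q (cmp k (cmp k Y' Y) A) (cmp k (cmp k Y' Y) B)"
    using cmp_assoc Suc.prems Y'c cl YB by simp
  have ek: "d Neg k e = d Neg k Y" "d Pos k e = d Neg k Y"
    using e eM cl Y'c by (metis d_d_less lessI d_d_ge order_refl)+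
  show ?case
  proof (cases "q = Suc k")
    case True
    have 1: "arrow q X (cmp k (cmp k Y' Y) X)" if X: "cell q X" "d Pos k X = d Neg k Y" for X
    proof -
      have XM: "X \<in> M" using X cell_closed by auto
      have "cell (Suc q) (cmp k e X)" using cell_cmp e X True ek cell_mono by (metis le_SucI order_refl)
      moreover have "d Neg q (cmp k e X) = X"
        using True d_cmp[of e X k q Neg] e X XM eM ek cmp_unit_left[of X k] d_cell[of q X q] by simp
      moreover have "d Pos q (cmp k e X) = cmp k (cmp k Y' Y) X"
        using True d_cmp[of e X k q Pos] e X XM eM ek d_cell[of q X q] by simp
      ultimately show ?thesis unfolding arrow_def by blast
    qed
    have "arrow q A (cmp k (cmp k Y' Y) A)" "arrow q B (cmp k (cmp k Y' Y) B)"
      using 1 Suc.prems YB by auto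
    then show ?thesis using ar arrow_trans arrow_sym Suc.prems(1,7) by (meson less_imp_le order_refl)
  next
    case False
    then have q: "Suc k < q" using Suc.prems by simp
    \<comment> \<open>As \<open>A\<close> and \<open>B\<close> are parallel and
      \<open>q > Suc k\<close>, they share their faces of dimension \<open>k + 1\<close>. So the
      same \<open>Z\<close>, and the same last factor in \<open>nat\<close>, serve both.\<close>
    define Z where "Z = cmp k e (d Pos (Suc k) A)"
    have pA: "d Pos k (d Pos (Suc k) A) = d Neg k Y" using cl Suc.prems d_d_less by simp
    have Zc: "cell (Suc (Suc k)) Z" unfolding Z_def
      using cell_cmp e pA ek cell_d cl cell_mono by (metis le_SucI order_refl)
    have ZN: "d Neg (Suc k) Z = d Pos (Suc k) A"
      unfolding Z_def using d_cmp[of e "d Pos (Suc k) A" k "Suc k" Neg] e eM cl pA ek d_closed d_d_ge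
        cmp_unit_left by (metis lessI order_refl)
    have nat: "cmp (Suc k) Z X = cmp (Suc k) (cmp k (cmp k Y' Y) X) (cmp k e (d Neg (Suc k) X))"
      if "X \<in> M" "d Pos (Suc k) X = d Pos (Suc k) A" "d Pos k X = d Neg k Y" for X
      using cmp_slide[of e X k "Suc k"] that e eM ek cmp_unit_left[of X k] unfolding Z_def by simp
    have natA: "cmp (Suc k) Z A = cmp (Suc k) (cmp k (cmp k Y' Y) A) (cmp k e (d Neg (Suc k) A))"
      using nat cl Suc.prems by auto
    have natB: "cmp (Suc k) Z B = cmp (Suc k) (cmp k (cmp k Y' Y) B) (cmp k e (d Neg (Suc k) A))"
      using nat[of B] cl q par YB by auto
    have eN: "d Pos k (d Neg (Suc k) A) = d Neg k Y" using cl Suc.prems d_d_less by simp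
    have ec: "cell q (cmp k e (d Neg (Suc k) A))"
      using cell_cmp e eN ek cell_d cl cell_mono q by (metis Suc_leI less_imp_le)
    have YYM: "cmp k Y' Y \<in> M" using cmp_closed Y'c cl by auto
    have YYk: "d Neg k (cmp k Y' Y) = d Neg k Y" using d_Neg_cmp Y'c cl by auto
    have "d Neg (Suc k) (cmp k (cmp k Y' Y) A) = cmp k (cmp k Y' Y) (d Neg (Suc k) A)"
      using d_cmp[of "cmp k Y' Y" A k "Suc k" Neg] cl YYM YYk Suc.prems e eM
      by (metis d_d_ge lessI order_refl)
    moreover have "d Pos (Suc k) (cmp k e (d Neg (Suc k) A)) = cmp k (cmp k Y' Y) (d Neg (Suc k) A)"
      using d_cmp[of e "d Neg (Suc k) A" k "Suc k" Pos] cl eM e eN ek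
      by (metis d_closed d_d_ge lessI order_refl)
    ultimately have "arrow q (cmp (Suc k) (cmp k (cmp k Y' Y) A) (cmp k e (d Neg (Suc k) A)))
        (cmp (Suc k) (cmp k (cmp k Y' Y) B) (cmp k e (d Neg (Suc k) A)))"
      using arrow_whisker_right[OF ar ec q] by simp
    then have "arrow q (cmp (Suc k) Z A) (cmp (Suc k) Z B)" using natA natB by simp
    then show ?thesis
      using Suc.hyps(1)[of "Suc k" Z] Suc.hyps(2) Suc.prems q Zc ZN by auto
  qed
qed

text \<open>Cells of all dimensions are reversed simultaneously. The notions used here are then
  self-dual, so that only left whiskers have to be treated by hand.\<close>

lemma dual: "one_sorted M (\<lambda>\<alpha>. d (flip \<alpha>)) (\<lambda>k x y. cmp k y x)"
proof unfold_locales
  fix j k x y z w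
  assume *: "j < k" "x \<in> M" "y \<in> M" "z \<in> M" "w \<in> M" "d (flip Neg) k x = d (flip Pos) k y"
    "d (flip Neg) k z = d (flip Pos) k w" "d (flip Neg) j x = d (flip Pos) j z"
  have "d Neg j w = d Pos j y"
    using * d_d_less[of y j k Pos Neg] d_d_less[of x j k Pos Pos] d_d_less[of w j k Neg Neg]
      d_d_less[of z j k Neg Pos] by simp
  then show "cmp j (cmp k w z) (cmp k y x) = cmp k (cmp j w y) (cmp j z x)"
    using * by (intro cmp_interchange) auto
qed (auto simp: d_closed d_d_less d_d_ge cmp_closed d_Neg_cmp d_Pos_cmp d_cmp cmp_unit_left
      cmp_unit_right cmp_assoc)

lemma dual_cell: "one_sorted.cell M (\<lambda>\<alpha>. d (flip \<alpha>)) k x \<longleftrightarrow> cell k x"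
proof -
  interpret D: one_sorted M "\<lambda>\<alpha>. d (flip \<alpha>)" "\<lambda>k x y. cmp k y x" by (rule dual)
  show ?thesis unfolding D.cell_def using cellI d_cell by (metis cell_def flip.simps(1) order_refl)
qed

lemma dual_arrow: "one_sorted.arrow M (\<lambda>\<alpha>. d (flip \<alpha>)) q A B \<longleftrightarrow> arrow q B A"
proof -
  interpret D: one_sorted M "\<lambda>\<alpha>. d (flip \<alpha>)" "\<lambda>k x y. cmp k y x" by (rule dual)
  show ?thesis unfolding D.arrow_def arrow_def dual_cell by auto
qed

lemma dual_invertible_dim:
  "one_sorted.invertible_dim M (\<lambda>\<alpha>. d (flip \<alpha>)) (\<lambda>k x y. cmp k y x) q \<longleftrightarrow> invertible_dim q"
proof -
  interpret D: one_sorted M "\<lambda>\<alpha>. d (flip \<alpha>)" "\<lambda>k x y. cmp k y x" by (rule dual)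
  have "D.inverts q Y' Y \<longleftrightarrow> inverts q Y' Y" for Y Y'
    unfolding D.inverts_def inverts_def dual_cell dual_arrow by auto
  then show ?thesis unfolding D.invertible_dim_def invertible_dim_def dual_cell by simp
qed

lemma cancel_right:
  assumes "k < q" "cell q A" "cell q B" "cell (Suc k) Y" "d Neg k A = d Pos k Y"
    "\<forall>\<alpha>. d \<alpha> (q - 1) A = d \<alpha> (q - 1) B" "\<forall>j. k \<le> j \<and> j \<le> q \<longrightarrow> invertible_dim j"
    "arrow q (cmp k A Y) (cmp k B Y)"
  shows "arrow q A B"
proof -
  interpret D: one_sorted M "\<lambda>\<alpha>. d (flip \<alpha>)" "\<lambda>k x y. cmp k y x" by (rule dual)
  have cl: "A \<in> M" "B \<in> M" using assms(2,3) cell_closed by auto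
  have "d Neg k A = d Neg k B"
  proof (cases "k = q - 1")
    case False
    then have "k < q - 1" using assms(1) by simp
    then show ?thesis using assms(6) d_d_less[OF cl(1), of k "q - 1" Neg Neg] d_d_less[OF cl(2), of k "q - 1" Neg Neg]
      by simp
  qed (use assms(6) in simp)
  then have "D.arrow q B A"
    by (intro D.cancel_left[of k q B A Y])
      (use assms in \<open>simp_all add: dual_cell dual_arrow dual_invertible_dim\<close>)
  then show ?thesis by (simp add: dual_arrow)
qed

text \<open>The condition under which \<open>T\<close> can be compared with \<open>Y *_k X\<close>
  for a \<open>q\<close>-cell \<open>X\<close> from \<open>s\<close> to \<open>t\<close>. When
  \<open>q = Suc k\<close>, the composition takes place along the boundary of \<open>X\<close>
  itself, so \<open>t\<close> is consumed and the target is that of \<open>Y\<close>; otherwise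
  \<open>s\<close> and \<open>t\<close> are whiskered.\<close>

definition whisker_boundary :: "nat \<Rightarrow> nat \<Rightarrow> 'm \<Rightarrow> 'm \<Rightarrow> 'm \<Rightarrow> 'm \<Rightarrow> bool" where
  "whisker_boundary k q Y s t T \<longleftrightarrow> (if q = Suc k then t = d Neg k Y \<and> d Neg k T = s \<and> d Pos k T = d Pos k Y
     else d Neg (q - 1) T = cmp k Y s \<and> d Pos (q - 1) T = cmp k Y t)"

text \<open>The existence counterpart of \<open>cancel_left\<close>, by the same induction. For
  \<open>q = Suc k\<close> the solution is \<open>Y' T\<close>. Otherwise the equation is multiplied
  by \<open>Y'\<close> and by a cell \<open>E\<close>, which turns it into one with a whisker along
  \<open>k + 1\<close>. The induction hypothesis solves the latter, and cancelling \<open>E\<close>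
  and \<open>Y'\<close> shows that its solution solves the original equation.\<close>

lemma solve_left:
  assumes "k < q" "cell q T" "cell (q - 1) s" "cell (q - 1) t" "cell (Suc k) Y"
    "q = Suc k \<or> d Pos k s = d Neg k Y" "q = Suc k \<or> (\<forall>\<alpha>. d \<alpha> (q - 2) s = d \<alpha> (q - 2) t)"
    "\<forall>j. k \<le> j \<and> j \<le> q \<longrightarrow> invertible_dim j" "whisker_boundary k q Y s t T"
  shows "\<exists>X. cell q X \<and> d Neg (q - 1) X = s \<and> d Pos (q - 1) X = t \<and> arrow q (cmp k Y X) T"
  using assms
proof (induction "q - k" arbitrary: k Y T)
  case 0
  then show ?case by simp
next
  case (Suc n)
  have cl: "T \<in> M" "s \<in> M" "t \<in> M" "Y \<in> M" using Suc.prems cell_closed by auto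
  obtain Y' where Y': "inverts k Y' Y"
    using Suc.prems unfolding invertible_dim_def by (meson less_imp_le order_refl)
  have Y'c: "cell (Suc k) Y'" "Y' \<in> M" "d Neg k Y' = d Pos k Y" "d Pos k Y' = d Neg k Y"
    using Y' cell_closed unfolding inverts_def by auto
  show ?case
  proof (cases "q = Suc k")
    case True
    have T: "t = d Neg k Y" "d Neg k T = s" "d Pos k T = d Pos k Y"
      using Suc.prems True by (auto simp: whisker_boundary_def)
    obtain e where e: "cell (Suc (Suc k)) e" "d Neg (Suc k) e = d Pos k Y" "d Pos (Suc k) e = cmp k Y Y'"
      using Y' unfolding inverts_def arrow_def by blast
    have eM: "e \<in> M" using e cell_closed by auto
    have ek: "d Neg k e = d Pos k Y" using e eM cl by (metis d_d_less lessI d_d_ge order_refl)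
    have "cell (Suc q) (cmp k e T)"
      using cell_cmp[of "Suc q" e T k] e True ek T cell_mono[OF Suc.prems(2)] by simp
    moreover have "d Neg q (cmp k e T) = T"
      using True d_cmp[of e T k q Neg] e T cl eM ek cmp_unit_left[of T k] d_cell[OF Suc.prems(2)] by simp
    moreover have "d Pos q (cmp k e T) = cmp k (cmp k Y Y') T"
      using True d_cmp[of e T k q Pos] e T cl eM ek d_cell[OF Suc.prems(2)] by simp
    ultimately have "arrow q T (cmp k (cmp k Y Y') T)" unfolding arrow_def by blast
    then have "arrow q (cmp k (cmp k Y Y') T) T" using arrow_sym Suc.prems(1,8) by simp
    moreover have "cmp k (cmp k Y Y') T = cmp k Y (cmp k Y' T)"
      using cmp_assoc cl Y'c T by simp
    moreover have "cell q (cmp k Y' T)" using cell_cmp Y'c T Suc.prems(2) True by simp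
    moreover have "d Neg k (cmp k Y' T) = s" "d Pos k (cmp k Y' T) = t"
      using d_Neg_cmp d_Pos_cmp cl Y'c T by auto
    ultimately show ?thesis using True by auto
  next
    case False
    then have q: "Suc k < q" using Suc.prems by simp
    then obtain r where r: "q = Suc (Suc r)" "k \<le> r" by (metis Suc_leD Suc_le_eq less_natE le_add1 add_Suc_right Suc_le_D Suc_le_mono)
    have T: "d Neg (Suc r) T = cmp k Y s" "d Pos (Suc r) T = cmp k Y t"
      using Suc.prems False r by (auto simp: whisker_boundary_def)
    have st: "d \<alpha> r s = d \<alpha> r t" for \<alpha> using Suc.prems False r by simp
    have stj: "d \<alpha> j s = d \<alpha> j t" if "j \<le> r" for \<alpha> j
      using that st[of Neg] st[of \<alpha>] d_d_less[of s j r \<alpha> Neg] d_d_less[of t j r \<alpha> Neg] cl by (cases "j = r") auto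
    have sk: "d Pos k s = d Neg k Y" "d Pos k t = d Neg k Y" using Suc.prems False stj r by auto
    have scell: "cell (Suc r) s" "cell (Suc r) t" using Suc.prems r by auto
    have Tk: "d Pos k T = d Pos k Y" "d Neg k T = d Neg k s"
      using d_d_less[of T k "Suc r" Pos Neg] d_d_less[of T k "Suc r" Neg Neg] T r cl d_Pos_cmp[of Y s k]
        d_Neg_cmp[of Y s k] sk by auto
    obtain e where e: "cell (Suc (Suc k)) e" "d Neg (Suc k) e = d Neg k Y" "d Pos (Suc k) e = cmp k Y' Y"
      using Y' unfolding inverts_def arrow_def by blast
    have eM: "e \<in> M" using e cell_closed by auto
    have ek: "d Neg k e = d Neg k Y" "d Pos k e = d Neg k Y"
      using e eM cl Y'c by (metis d_d_less lessI d_d_ge order_refl)+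
    define u v where "u = d Neg (Suc k) s" and "v = d Pos (Suc k) t"
    have uv: "cell (Suc k) u" "cell (Suc k) v" "u \<in> M" "v \<in> M" "d Pos k u = d Neg k Y" "d Pos k v = d Neg k Y"
      unfolding u_def v_def using cell_d cl d_closed d_d_less sk by auto
    define E where "E = cmp k e u"
    define Z where "Z = cmp k e v"
    define YY where "YY = cmp k Y' Y"
    have YY: "cell (Suc k) YY" "YY \<in> M" "d Neg k YY = d Neg k Y" "d Pos k YY = d Neg k Y"
      unfolding YY_def using cell_cmp Y'c Suc.prems cmp_closed d_Neg_cmp d_Pos_cmp cl by auto
    have EZ: "cell (Suc (Suc k)) E" "cell (Suc (Suc k)) Z" "E \<in> M" "Z \<in> M"
      unfolding E_def Z_def using cell_cmp[of "Suc (Suc k)"] cmp_closed e uv ek cell_mono eM by auto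
    have dE: "d Neg (Suc k) E = u" "d Pos (Suc k) E = cmp k YY u"
      and dZ: "d Neg (Suc k) Z = v" "d Pos (Suc k) Z = cmp k YY v"
      unfolding E_def Z_def using d_cmp[of e _ k "Suc k"] e ek uv eM d_cell[OF uv(1), of "Suc k"]
        d_cell[OF uv(2), of "Suc k"] cmp_unit_left[of u k] cmp_unit_left[of v k] by (auto simp: YY_def)
    have nat: "cmp (Suc k) Z X = cmp (Suc k) (cmp k YY X) E"
      if "X \<in> M" "d Pos (Suc k) X = v" "d Neg (Suc k) X = u" "d Pos k X = d Neg k Y" for X
      using cmp_slide[of e X k "Suc k"] that e eM ek cmp_unit_left[of X k] unfolding Z_def E_def YY_def by simp
    \<comment> \<open>By \<open>nat\<close>, composing \<open>Y' (Y X)\<close> with \<open>E\<close>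
      along \<open>k + 1\<close> gives the composite of \<open>Z\<close> and \<open>X\<close>; hence
      \<open>T2\<close> is the right-hand side that corresponds to \<open>T\<close>.\<close>
    define T2 where "T2 = cmp (Suc k) (cmp k Y' T) E"
    have Y'T: "cell q (cmp k Y' T)" "cmp k Y' T \<in> M"
      using cell_cmp[of q Y' T k] cell_mono[OF Y'c(1)] q Suc.prems(2) Tk Y'c cell_closed by auto
    have as: "cmp k Y' (cmp k Y s) = cmp k YY s" "cmp k Y' (cmp k Y t) = cmp k YY t"
      unfolding YY_def using cmp_assoc cl Y'c sk by auto
    have Y'Tr: "d Neg (Suc r) (cmp k Y' T) = cmp k YY s" "d Pos (Suc r) (cmp k Y' T) = cmp k YY t"
      using d_cmp[of Y' T k "Suc r"] Y'c cl Tk T r as d_cell[OF Y'c(1), of "Suc r"] by auto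
    have YYs: "d \<alpha> (Suc k) (cmp k YY x) = cmp k YY (d \<alpha> (Suc k) x)" if "x \<in> M" "d Pos k x = d Neg k Y" for \<alpha> x
      using d_cmp[of YY x k "Suc k"] that YY d_cell[OF YY(1)] by simp
    have Y'Tu: "d Neg (Suc k) (cmp k Y' T) = cmp k YY u"
    proof (cases "k = r")
      case True
      then show ?thesis using Y'Tr u_def d_cell[OF scell(1)] by simp
    next
      case False
      then have "d Neg (Suc k) (cmp k Y' T) = d Neg (Suc k) (cmp k YY s)"
        using d_d_less[OF Y'T(2), of "Suc k" "Suc r" Neg Neg] Y'Tr r by simp
      then show ?thesis using YYs[of s] cl sk u_def by simp
    qed
    have Y'Tv: "d Pos (Suc k) (cmp k Y' T) = cmp k YY v"
    proof (cases "k = r")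
      case True
      then show ?thesis using Y'Tr v_def d_cell[OF scell(2)] by simp
    next
      case False
      then have "d Pos (Suc k) (cmp k Y' T) = d Pos (Suc k) (cmp k YY t)"
        using d_d_less[OF Y'T(2), of "Suc k" "Suc r" Pos Pos] Y'Tr r by simp
      then show ?thesis using YYs[of t] cl sk v_def by simp
    qed
    have T2: "cell q T2" unfolding T2_def
      using cell_cmp[OF Y'T(1), of E "Suc k"] cell_mono[OF EZ(1), of q] q Y'Tu dE by simp
    have wb: "whisker_boundary (Suc k) q Z s t T2"
    proof (cases "k = r")
      case True
      have "d Neg (Suc k) T2 = u" "d Pos (Suc k) T2 = cmp k YY v"
        unfolding T2_def using d_Neg_cmp d_Pos_cmp Y'T EZ Y'Tu Y'Tv dE by auto
      then show ?thesis unfolding whisker_boundary_def using True r dZ u_def v_def scell d_cell by simp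
    next
      case False
      then have kr: "Suc k < Suc r" using r by simp
      have "d \<alpha> (Suc r) T2 = cmp (Suc k) (d \<alpha> (Suc r) (cmp k Y' T)) E" for \<alpha>
        unfolding T2_def using d_cmp[OF Y'T(2) EZ(3) _ kr] Y'Tu dE d_cell[OF EZ(1), of "Suc r"] kr by simp
      moreover have "d Neg (Suc k) s = u" "d Neg (Suc k) t = u" "d Pos (Suc k) s = v" "d Pos (Suc k) t = v"
        using stj[of "Suc k"] kr u_def v_def by auto
      ultimately show ?thesis unfolding whisker_boundary_def using r False Y'Tr nat cl sk by auto
    qed
    have Zs: "q = Suc (Suc k) \<or> d Pos (Suc k) s = d Neg (Suc k) Z"
      using stj[of "Suc k" Pos] r dZ v_def by (cases "k = r") auto
    have n: "n = q - Suc k" using Suc.hyps(2) by arith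
    have par: "q = Suc (Suc k) \<or> (\<forall>\<alpha>. d \<alpha> (q - 2) s = d \<alpha> (q - 2) t)" using Suc.prems(7) False by simp
    have inv': "\<forall>j. Suc k \<le> j \<and> j \<le> q \<longrightarrow> invertible_dim j" using Suc.prems(8) by simp
    obtain X where X: "cell q X" "d Neg (q - 1) X = s" "d Pos (q - 1) X = t" "arrow q (cmp (Suc k) Z X) T2"
      using Suc.hyps(1)[OF n q T2 Suc.prems(3,4) EZ(2) Zs par inv' wb] by blast
    have XM: "X \<in> M" using X cell_closed by auto
    have Xr: "d Neg (Suc r) X = s" "d Pos (Suc r) X = t" using X r by auto
    have Xk: "d Pos k X = d Neg k Y" "d Neg k X = d Neg k s"
      using d_d_less[OF XM, of k "Suc r" Pos Neg] d_d_less[OF XM, of k "Suc r" Neg Neg] Xr sk r by auto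
    have Xuv: "d Pos (Suc k) X = v" "d Neg (Suc k) X = u"
    proof (atomize (full), cases "k = r")
      case True
      then show "d Pos (Suc k) X = v \<and> d Neg (Suc k) X = u"
        using Xr u_def v_def d_cell[OF scell(1), of "Suc r"] d_cell[OF scell(2), of "Suc r"] by simp
    next
      case False
      then show "d Pos (Suc k) X = v \<and> d Neg (Suc k) X = u"
        using d_d_less[OF XM, of "Suc k" "Suc r" Pos Pos] d_d_less[OF XM, of "Suc k" "Suc r" Neg Neg] Xr r
          u_def v_def by simp
    qed
    have ar: "arrow q (cmp (Suc k) (cmp k YY X) E) (cmp (Suc k) (cmp k Y' T) E)"
      using X(4) nat[OF XM] Xk Xuv unfolding T2_def by simp
    have YX: "cell q (cmp k Y X)" "cmp k Y X \<in> M"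
      using cell_cmp[of q Y X k] cell_mono[OF Suc.prems(5)] q X Xk cell_closed by auto
    have YXk: "d Pos k (cmp k Y X) = d Pos k Y" using d_Pos_cmp cl XM Xk by simp
    have YXr: "d Neg (Suc r) (cmp k Y X) = cmp k Y s" "d Pos (Suc r) (cmp k Y X) = cmp k Y t"
      using d_cmp[of Y X k "Suc r"] cl XM Xk Xr r d_cell[OF Suc.prems(5), of "Suc r"] by auto
    have YYX: "cell q (cmp k YY X)" "cmp k YY X = cmp k Y' (cmp k Y X)" "cmp k YY X \<in> M"
      using cell_cmp[of q YY X k] cell_mono[OF YY(1)] q X Xk YY cmp_assoc[of Y' Y X k] Y'c cl XM cell_closed
      by (auto simp: YY_def)
    have YYXr: "d Neg (Suc r) (cmp k YY X) = cmp k YY s" "d Pos (Suc r) (cmp k YY X) = cmp k YY t"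
      using d_cmp[of YY X k "Suc r"] YY XM Xk Xr r d_cell[OF YY(1), of "Suc r"] by auto
    have YYXu: "d Neg (Suc k) (cmp k YY X) = cmp k YY u" using YYs[OF XM] Xk Xuv by simp
    have inv: "\<forall>j. k \<le> j \<and> j \<le> q \<longrightarrow> invertible_dim j" using Suc.prems by simp
    have "\<forall>\<alpha>. d \<alpha> (q - 1) (cmp k YY X) = d \<alpha> (q - 1) (cmp k Y' T)"
      using YYXr Y'Tr r by (metis diff_Suc_1 polarity.exhaust)
    \<comment> \<open>\<open>E\<close> is cancelled on the right along \<open>k + 1\<close>, and
      afterwards \<open>Y'\<close> on the left along \<open>k\<close>; each time the two cells have
      first been shown to be parallel.\<close>
    then have ar2: "arrow q (cmp k Y' (cmp k Y X)) (cmp k Y' T)"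
      using cancel_right[OF q YYX(1) Y'T(1) EZ(1) _ _ _ ar] YYXu dE inv YYX(2) by simp
    have "\<forall>\<alpha>. d \<alpha> (q - 1) (cmp k Y X) = d \<alpha> (q - 1) T"
      using YXr T r by (metis diff_Suc_1 polarity.exhaust)
    then have "arrow q (cmp k Y X) T"
      using cancel_left[OF Suc.prems(1) YX(1) Suc.prems(2) Y'c(1) _ _ inv ar2] YXk Y'c by simp
    then show ?thesis using X by blast
  qed
qed

definition whisker_boundary' :: "nat \<Rightarrow> nat \<Rightarrow> 'm \<Rightarrow> 'm \<Rightarrow> 'm \<Rightarrow> 'm \<Rightarrow> bool" where
  "whisker_boundary' k q Y s t T \<longleftrightarrow> (if q = Suc k then s = d Pos k Y \<and> d Pos k T = t \<and> d Neg k T = d Neg k Y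
     else d Neg (q - 1) T = cmp k s Y \<and> d Pos (q - 1) T = cmp k t Y)"

lemma solve_right:
  assumes "k < q" "cell q T" "cell (q - 1) s" "cell (q - 1) t" "cell (Suc k) Y"
    "q = Suc k \<or> d Neg k s = d Pos k Y" "q = Suc k \<or> (\<forall>\<alpha>. d \<alpha> (q - 2) s = d \<alpha> (q - 2) t)"
    "\<forall>j. k \<le> j \<and> j \<le> q \<longrightarrow> invertible_dim j" "whisker_boundary' k q Y s t T"
  shows "\<exists>X. cell q X \<and> d Neg (q - 1) X = s \<and> d Pos (q - 1) X = t \<and> arrow q (cmp k X Y) T"
proof -
  interpret D: one_sorted M "\<lambda>\<alpha>. d (flip \<alpha>)" "\<lambda>k x y. cmp k y x" by (rule dual)
  have st: "q = Suc k \<or> d Neg k t = d Pos k Y"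
  proof (cases "q = Suc k")
    case False
    then obtain r where r: "q = Suc (Suc r)" "k \<le> r" using assms(1)
      by (metis Suc_leI Suc_le_D Suc_le_mono le_neq_implies_less)
    have "d Neg k s = d Neg k t"
      using assms(7) False r d_d_less[of s k r Neg Neg] d_d_less[of t k r Neg Neg] assms(3,4) cell_closed
      by (cases "k = r") auto
    then show ?thesis using assms(6) by simp
  qed simp
  have "\<exists>X. D.cell q X \<and> d (flip Neg) (q - 1) X = t \<and> d (flip Pos) (q - 1) X = s \<and> D.arrow q (cmp k X Y) T"
    by (intro D.solve_left)
      (use assms st in \<open>auto simp: dual_cell dual_invertible_dim D.whisker_boundary_def whisker_boundary'_def\<close>)
  then obtain X where "cell q X" "d Neg (q - 1) X = s" "d Pos (q - 1) X = t" "arrow q T (cmp k X Y)"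
    by (auto simp: dual_cell dual_arrow)
  \<comment> \<open>Duality has also reversed the resulting arrow, so symmetry is needed once
    more.\<close>
  moreover have "invertible_dim q" using assms(1,8) by simp
  ultimately show ?thesis using arrow_sym by blast
qed

end

section \<open>Chains with integer coefficients, their positive and negative parts\<close>

abbreviation lk :: "('b \<Rightarrow>\<^sub>0 int) \<Rightarrow> 'b \<Rightarrow> int" where "lk \<equiv> Poly_Mapping.lookup"
abbreviation ks :: "('b \<Rightarrow>\<^sub>0 int) \<Rightarrow> 'b set" where "ks \<equiv> Poly_Mapping.keys"

definition nonneg :: "('b \<Rightarrow>\<^sub>0 int) \<Rightarrow> bool" where "nonneg c \<longleftrightarrow> (\<forall>a. 0 \<le> lk c a)"

definition posp :: "('b \<Rightarrow>\<^sub>0 int) \<Rightarrow> ('b \<Rightarrow>\<^sub>0 int)" where "posp c = Poly_Mapping.map (\<lambda>z. max z 0) c"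

text \<open>Indexed by a polarity because it will be applied to boundaries: the two parts are then
  the source chain and the target chain.\<close>

definition part :: "polarity \<Rightarrow> ('b \<Rightarrow>\<^sub>0 int) \<Rightarrow> ('b \<Rightarrow>\<^sub>0 int)" where
  "part \<alpha> c = (case \<alpha> of Neg \<Rightarrow> posp (- c) | Pos \<Rightarrow> posp c)"

lemma lookup_posp [simp]: "lk (posp c) a = max (lk c a) 0"
  by (simp add: posp_def map.rep_eq when_def)

lemma lookup_part: "lk (part \<alpha> c) a = (case \<alpha> of Neg \<Rightarrow> max (- lk c a) 0 | Pos \<Rightarrow> max (lk c a) 0)"
  by (cases \<alpha>) (simp_all add: part_def)

lemma part_diff: "part Pos c - part Neg c = c"
  by (rule poly_mapping_eqI) (simp add: lookup_minus lookup_part)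

lemma part_Pos: "part Pos c = part Neg c + c"
  using part_diff[of c] by (metis diff_add_cancel add.commute)

lemma nonneg_part: "nonneg (part \<alpha> c)"
  by (cases \<alpha>) (simp_all add: nonneg_def lookup_part)

lemma keys_part: "ks (part \<alpha> c) \<subseteq> ks c"
  by (cases \<alpha>) (auto simp: in_keys_iff lookup_part)

lemma part_zero [simp]: "part \<alpha> 0 = 0"
  by (rule poly_mapping_eqI) (cases \<alpha>; simp add: lookup_part)

lemma part_disjoint:
  assumes "nonneg s" "nonneg t" "ks s \<inter> ks t = {}"
  shows "part \<alpha> (t - s) = (case \<alpha> of Neg \<Rightarrow> s | Pos \<Rightarrow> t)"
proof (rule poly_mapping_eqI)
  fix a
  have "lk s a = 0 \<or> lk t a = 0" "0 \<le> lk s a" "0 \<le> lk t a"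
    using assms by (auto simp: nonneg_def in_keys_iff)
  then show "lk (part \<alpha> (t - s)) a = lk (case \<alpha> of Neg \<Rightarrow> s | Pos \<Rightarrow> t) a"
    by (cases \<alpha>) (auto simp: lookup_part lookup_minus)
qed

lemma nonneg_add: "\<lbrakk>nonneg c; nonneg c'\<rbrakk> \<Longrightarrow> nonneg (c + c')"
  by (simp add: nonneg_def lookup_add)

lemma nonneg_zero [simp]: "nonneg 0"
  by (simp add: nonneg_def)

lemma nonneg_frag_of [simp]: "nonneg (frag_of a)"
  by (simp add: nonneg_def)

lemma lookup_frag_extend: "lk (frag_extend f c) a = (\<Sum>b\<in>ks c. lk c b * lk (f b) a)"
  by (simp add: frag_extend_def lookup_sum)

lemma nonneg_frag_extend:
  assumes "nonneg c" "\<And>b. b \<in> ks c \<Longrightarrow> nonneg (f b)"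
  shows "nonneg (frag_extend f c)"
  using assms by (auto simp: nonneg_def lookup_frag_extend intro!: sum_nonneg)

lemma keys_frag_extend_subset:
  assumes "\<And>b. b \<in> ks c \<Longrightarrow> ks (f b) \<subseteq> A"
  shows "ks (frag_extend f c) \<subseteq> A"
  using keys_frag_extend[of f c] assms by blast

lemma frag_extend_extend: "frag_extend g (frag_extend f c) = frag_extend (\<lambda>b. frag_extend g (f b)) c"
proof (rule frag_induction[of c UNIV])
  fix x y
  assume "frag_extend g (frag_extend f x) = frag_extend (\<lambda>b. frag_extend g (f b)) x"
    "frag_extend g (frag_extend f y) = frag_extend (\<lambda>b. frag_extend g (f b)) y"
  then show "frag_extend g (frag_extend f (x - y)) = frag_extend (\<lambda>b. frag_extend g (f b)) (x - y)"
    by (simp add: frag_extend_diff)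
qed auto

lemma lookup_frag_extend_neg:
  assumes "nonneg c" "lk (frag_extend f c) a < 0"
  shows "\<exists>b\<in>ks c. lk (f b) a < 0"
proof (rule ccontr)
  assume "\<not> ?thesis"
  then have "0 \<le> (\<Sum>b\<in>ks c. lk c b * lk (f b) a)" using assms(1) by (intro sum_nonneg) (auto simp: nonneg_def not_less)
  then show False using assms(2) by (simp add: lookup_frag_extend)
qed

lemma lookup_frag_extend_pos:
  assumes "nonneg c" "0 < lk (frag_extend f c) a"
  shows "\<exists>b\<in>ks c. 0 < lk (f b) a"
proof (rule ccontr)
  assume "\<not> ?thesis"
  then have "(\<Sum>b\<in>ks c. lk c b * lk (f b) a) \<le> 0"
    using assms(1) by (intro sum_nonpos) (auto simp: nonneg_def not_less mult_nonneg_nonpos)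
  then show False using assms(2) by (simp add: lookup_frag_extend)
qed

lemma frag_extend_id: "(\<And>b. b \<in> ks c \<Longrightarrow> f b = frag_of b) \<Longrightarrow> frag_extend f c = c"
  using frag_expansion frag_extend_eq by metis

lemma augmentation_superset:
  assumes "finite S" "ks c \<subseteq> S"
  shows "augmentation c = (\<Sum>b\<in>S. lk c b)"
  unfolding augmentation_def
  by (rule sum.mono_neutral_left) (use assms in \<open>auto simp: in_keys_iff\<close>)

lemma augmentation_add: "augmentation (c + c') = augmentation c + augmentation c'"
proof -
  have "ks (c + c') \<subseteq> ks c \<union> ks c'" by (rule Poly_Mapping.keys_add)
  then show ?thesis
    using augmentation_superset[of "ks c \<union> ks c'"] by (simp add: lookup_add sum.distrib)
qed

lemma augmentation_zero [simp]: "augmentation 0 = 0"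
  by (simp add: augmentation_def)

lemma augmentation_minus: "augmentation (- c) = - augmentation c"
  using augmentation_add[of c "- c"] by simp

lemma augmentation_diff: "augmentation (c - c') = augmentation c - augmentation c'"
  using augmentation_add[of c "- c'"] augmentation_minus[of c'] by simp

lemma augmentation_frag_of [simp]: "augmentation (frag_of a) = 1"
  by (simp add: augmentation_def)

lemma augmentation_cmul: "augmentation (frag_cmul z c) = z * augmentation c"
proof -
  have "ks (frag_cmul z c) \<subseteq> ks c" by (rule keys_cmul)
  then show ?thesis
    using augmentation_superset[of "ks c"] by (simp add: sum_distrib_left)
qed

lemma augmentation_sum: "augmentation (sum f A) = (\<Sum>a\<in>A. augmentation (f a))"
  by (induction A rule: infinite_finite_induct) (simp_all add: augmentation_add)

lemma augmentation_frag_extend: "augmentation (frag_extend f c) = (\<Sum>b\<in>ks c. lk c b * augmentation (f b))"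
  by (simp add: frag_extend_def augmentation_sum augmentation_cmul)

lemma augmentation_frag_extend_1:
  assumes "\<And>b. b \<in> ks c \<Longrightarrow> augmentation (f b) = 1"
  shows "augmentation (frag_extend f c) = augmentation c"
  unfolding augmentation_frag_extend augmentation_def[of c] using assms by simp

lemma augmentation_frag_extend_0:
  assumes "\<And>b. b \<in> ks c \<Longrightarrow> augmentation (f b) = 0"
  shows "augmentation (frag_extend f c) = 0"
  unfolding augmentation_frag_extend using assms by simp

lemma augmentation_nonneg: "nonneg c \<Longrightarrow> 0 \<le> augmentation c"
  unfolding augmentation_def nonneg_def by (simp add: sum_nonneg)

lemma lookup_le_augmentation:
  assumes "nonneg c" shows "lk c a \<le> augmentation c"
proof (cases "a \<in> ks c")
  case True
  then show ?thesis unfolding augmentation_def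
    by (intro member_le_sum) (use assms in \<open>auto simp: nonneg_def\<close>)
next
  case False
  then show ?thesis using augmentation_nonneg[OF assms] by (simp add: in_keys_iff)
qed

lemma nonneg_augmentation_0: "\<lbrakk>nonneg c; augmentation c = 0\<rbrakk> \<Longrightarrow> c = 0"
  by (rule poly_mapping_eqI) (metis lookup_le_augmentation lookup_zero nonneg_def order_antisym)

lemma nonneg_minus_frag_of:
  assumes "nonneg c" "a \<in> ks c" shows "nonneg (c - frag_of a)"
proof -
  have "0 \<le> lk c b" "b = a \<Longrightarrow> lk c b \<noteq> 0" for b using assms by (auto simp: nonneg_def in_keys_iff)
  then have "0 \<le> lk c b - lk (frag_of a) b" for b by (cases "b = a") (auto simp: order.strict_iff_order)
  then show ?thesis by (simp add: nonneg_def lookup_minus)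
qed

lemma nonneg_augmentation_1:
  assumes "nonneg c" "augmentation c = 1"
  obtains a where "c = frag_of a"
proof -
  have "c \<noteq> 0" using assms by auto
  then obtain a where a: "a \<in> ks c" by (metis keys_eq_empty ex_in_conv)
  have "c - frag_of a = 0"
    using nonneg_augmentation_0[OF nonneg_minus_frag_of[OF assms(1) a]] assms(2)
    by (simp add: augmentation_diff)
  then show ?thesis using that by auto
qed

section \<open>Cells of a based chain complex as tables of chains\<close>

type_synonym 'b table = "nat \<Rightarrow> polarity \<Rightarrow> ('b \<Rightarrow>\<^sub>0 int)"

text \<open>Steiner's omega-category of an augmented directed complex with basis \<open>B\<close>
  and boundary \<open>D\<close>. Orientals are the instance of simplices; the inductions below
  change basis and boundary, so both are parameters. Entries above \<open>p\<close> are zero, whence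
  a \<open>p\<close>-cell is literally a cell of every higher dimension and units are
  invisible.\<close>

definition tcells :: "(nat \<Rightarrow> 'b set) \<Rightarrow> ('b \<Rightarrow> 'b \<Rightarrow>\<^sub>0 int) \<Rightarrow> nat \<Rightarrow> 'b table set" where
  "tcells B D p = {x. (\<forall>k\<le>p. \<forall>\<alpha>. nonneg (x k \<alpha>) \<and> ks (x k \<alpha>) \<subseteq> B k) \<and> (\<forall>k>p. \<forall>\<alpha>. x k \<alpha> = 0)
     \<and> x p Neg = x p Pos \<and> (\<forall>k<p. \<forall>\<alpha>. frag_extend D (x (Suc k) \<alpha>) = x k Pos - x k Neg)
     \<and> (\<forall>\<alpha>. augmentation (x 0 \<alpha>) = 1)}"

definition tbd :: "polarity \<Rightarrow> nat \<Rightarrow> 'b table \<Rightarrow> 'b table" where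
  "tbd \<alpha> k x = (\<lambda>j \<beta>. if j < k then x j \<beta> else if j = k then x k \<alpha> else 0)"

definition tcmp :: "nat \<Rightarrow> 'b table \<Rightarrow> 'b table \<Rightarrow> 'b table" where
  "tcmp k x y = (\<lambda>j \<alpha>. x j \<alpha> - tbd Neg k x j \<alpha> + y j \<alpha>)"

lemma tcellsD:
  assumes "x \<in> tcells B D p"
  shows "nonneg (x k \<alpha>)" "k \<le> p \<Longrightarrow> ks (x k \<alpha>) \<subseteq> B k" "p < k \<Longrightarrow> x k \<alpha> = 0" "x p Neg = x p Pos"
    "k < p \<Longrightarrow> frag_extend D (x (Suc k) \<alpha>) = x k Pos - x k Neg" "augmentation (x 0 \<alpha>) = 1"
proof -
  have x: "\<And>k \<alpha>. k \<le> p \<Longrightarrow> nonneg (x k \<alpha>) \<and> ks (x k \<alpha>) \<subseteq> B k" "\<And>k \<alpha>. k > p \<Longrightarrow> x k \<alpha> = 0" "x p Neg = x p Pos"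
    "\<And>k \<alpha>. k < p \<Longrightarrow> frag_extend D (x (Suc k) \<alpha>) = x k Pos - x k Neg" "\<And>\<alpha>. augmentation (x 0 \<alpha>) = 1"
    using assms by (auto simp: tcells_def)
  show "nonneg (x k \<alpha>)" using x(1,2)[of k \<alpha>] by (cases "k \<le> p") auto
qed (use assms in \<open>auto simp: tcells_def\<close>)

lemma tbd_tcells:
  assumes "x \<in> tcells B D p" "k \<le> p" shows "tbd \<alpha> k x \<in> tcells B D k"
proof -
  note X = tcellsD[OF assms(1)]
  have "nonneg (tbd \<alpha> k x j \<beta>) \<and> ks (tbd \<alpha> k x j \<beta>) \<subseteq> B j" if "j \<le> k" for j \<beta>
    using X(1)[of j \<beta>] X(2)[of j \<beta>] X(1)[of j \<alpha>] X(2)[of j \<alpha>] that assms(2) by (auto simp: tbd_def)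
  moreover have "frag_extend D (tbd \<alpha> k x (Suc j) \<beta>) = tbd \<alpha> k x j Pos - tbd \<alpha> k x j Neg" if "j < k" for j \<beta>
    using X(5)[of j \<beta>] X(5)[of j \<alpha>] that assms(2) by (cases "Suc j = k") (auto simp: tbd_def)
  moreover have "augmentation (tbd \<alpha> k x 0 \<beta>) = 1" for \<beta>
    using X(6)[of \<alpha>] X(6)[of \<beta>] by (simp add: tbd_def)
  moreover have "tbd \<alpha> k x j \<beta> = 0" if "k < j" for j \<beta> using that by (simp add: tbd_def)
  ultimately show ?thesis unfolding tcells_def mem_Collect_eq by (simp add: tbd_def)
qed

lemma tcells_Suc:
  assumes "x \<in> tcells B D p" shows "x \<in> tcells B D (Suc p)"
proof -
  note X = tcellsD[OF assms]
  have 1: "nonneg (x k \<alpha>) \<and> ks (x k \<alpha>) \<subseteq> B k" if "k \<le> Suc p" for k \<alpha>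
    using X(1)[of k \<alpha>] X(2)[of k \<alpha>] X(3)[of k \<alpha>] that by (cases "k \<le> p") auto
  have 2: "frag_extend D (x (Suc k) \<alpha>) = x k Pos - x k Neg" if "k < Suc p" for k \<alpha>
  proof (cases "k = p")
    case True
    then show ?thesis using X(3)[of "Suc p" \<alpha>] X(4) by simp
  qed (use X(5) that in auto)
  show ?thesis unfolding tcells_def mem_Collect_eq
    using 1 2 X(3) X(6) by (metis Suc_lessD lessI)
qed

lemma tcells_mono: "\<lbrakk>x \<in> tcells B D p; p \<le> q\<rbrakk> \<Longrightarrow> x \<in> tcells B D q"
  by (induction q rule: nat_induct) (auto simp: le_Suc_eq intro: tcells_Suc)

lemma tcells_Suc_zero:
  assumes "x \<in> tcells B D (Suc q)" "x (Suc q) Neg = 0" shows "x \<in> tcells B D q"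
proof -
  note X = tcellsD[OF assms(1)]
  have z: "x k \<alpha> = 0" if "q < k" for k \<alpha>
  proof (cases "k = Suc q")
    case True
    then show ?thesis using X(4) assms(2) by (cases \<alpha>) auto
  qed (use X(3) that in simp)
  have "x q Pos - x q Neg = 0" using X(5)[of q Neg] z[of "Suc q" Neg] by simp
  then have "x q Neg = x q Pos" by simp
  then show ?thesis unfolding tcells_def mem_Collect_eq
    using X(1,2,5,6) z by (metis le_SucI less_SucI)
qed

lemma tbd_id:
  assumes "x \<in> tcells B D p" "p \<le> k" shows "tbd \<alpha> k x = x"
proof (intro ext)
  fix j \<beta>
  show "tbd \<alpha> k x j \<beta> = x j \<beta>"
    using tcellsD(3)[OF assms(1), of j \<beta>] tcellsD(3)[OF assms(1), of k \<alpha>] tcellsD(3)[OF assms(1), of k \<beta>]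
      tcellsD(4)[OF assms(1)] assms(2) by (cases "k = p"; cases \<alpha>; cases \<beta>) (auto simp: tbd_def)
qed

lemma tbd_tbd_less: "j < k \<Longrightarrow> tbd \<beta> j (tbd \<alpha> k x) = tbd \<beta> j x"
  unfolding tbd_def by (intro ext) auto

lemma tbd_tbd_ge: "k \<le> j \<Longrightarrow> tbd \<beta> j (tbd \<alpha> k x) = tbd \<alpha> k x"
  unfolding tbd_def by (intro ext) auto

lemma tcmp_entry:
  assumes "tbd Neg k x = tbd Pos k y"
  shows "tcmp k x y j \<alpha> = (if j < k then y j \<alpha> else if j = k then (if \<alpha> = Neg then y k Neg else x k Pos)
     else x j \<alpha> + y j \<alpha>)"
  using fun_cong[OF fun_cong[OF assms], of k \<alpha>] by (cases \<alpha>) (auto simp: tcmp_def tbd_def)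

lemma tbd_eqD:
  assumes "tbd \<alpha> k x = tbd \<beta> k y"
  shows "j < k \<Longrightarrow> x j \<gamma> = y j \<gamma>" "x k \<alpha> = y k \<beta>"
  using fun_cong[OF fun_cong[OF assms], of j \<gamma>] fun_cong[OF fun_cong[OF assms], of k \<gamma>] by (auto simp: tbd_def)

lemma tcmp_tcells:
  assumes "x \<in> tcells B D p" "y \<in> tcells B D p" "tbd Neg k x = tbd Pos k y" "k < p"
  shows "tcmp k x y \<in> tcells B D p"
proof -
  note e = tcmp_entry[OF assms(3)]
  note X = tcellsD[OF assms(1)] and Y = tcellsD[OF assms(2)]
  have "ks (x j \<alpha> + y j \<alpha>) \<subseteq> B j" if "j \<le> p" for j \<alpha>
    using that X(2) Y(2) Poly_Mapping.keys_add[of "x j \<alpha>" "y j \<alpha>"] by blast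
  moreover have "frag_extend D (tcmp k x y (Suc j) \<alpha>) = tcmp k x y j Pos - tcmp k x y j Neg" if "j < p" for j \<alpha>
  proof -
    consider "Suc j < k" | "Suc j = k" | "j = k" | "k < j" by linarith
    then show ?thesis
    proof cases
      case 3
      then show ?thesis using that X(5)[of j \<alpha>] Y(5)[of j \<alpha>] tbd_eqD(2)[OF assms(3)]
        by (simp add: e frag_extend_add)
    qed (use that X(5)[of j \<alpha>] Y(5)[of j \<alpha>] X(5)[of j Pos] Y(5)[of j Neg] tbd_eqD(1)[OF assms(3), of j] in
      \<open>auto simp: e frag_extend_add\<close>)
  qed
  moreover have "augmentation (tcmp k x y 0 \<alpha>) = 1" for \<alpha>
    using X(6) Y(6) by (auto simp: e)
  ultimately show ?thesis
    using X(1-3) Y(1-3) X(4) Y(4) assms(4) unfolding tcells_def mem_Collect_eq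
    by (intro conjI allI impI) (auto simp: e nonneg_add)
qed

lemma tcells_cong:
  assumes "\<And>k. k \<le> p \<Longrightarrow> B k = B' k" "\<And>k b. \<lbrakk>k < p; b \<in> B (Suc k)\<rbrakk> \<Longrightarrow> D b = D' b"
  shows "tcells B D p = tcells B' D' p"
proof -
  have *: "frag_extend D c = frag_extend D' c" if "k < p" "ks c \<subseteq> B (Suc k)" for k c
    by (rule frag_extend_eq) (use assms(2) that in auto)
  have "x \<in> tcells B D p \<longleftrightarrow> x \<in> tcells B' D' p" for x
  proof
    assume x: "x \<in> tcells B D p"
    have "frag_extend D' (x (Suc k) \<alpha>) = frag_extend D (x (Suc k) \<alpha>)" if "k < p" for k \<alpha>
      using *[OF that] tcellsD(2)[OF x, of "Suc k"] that by (metis Suc_leI)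
    then show "x \<in> tcells B' D' p" using x assms(1) unfolding tcells_def by auto
  next
    assume x: "x \<in> tcells B' D' p"
    have "frag_extend D' (x (Suc k) \<alpha>) = frag_extend D (x (Suc k) \<alpha>)" if "k < p" for k \<alpha>
      using *[OF that] tcellsD(2)[OF x, of "Suc k"] that assms(1) by (metis Suc_leI)
    then show "x \<in> tcells B D p" using x assms(1) unfolding tcells_def by auto
  qed
  then show ?thesis by blast
qed

lemma tcells_subset:
  assumes "\<And>k. k \<le> p \<Longrightarrow> B k \<subseteq> B' k" shows "tcells B D p \<subseteq> tcells B' D p"
proof
  fix x assume x: "x \<in> tcells B D p"
  have "\<forall>k\<le>p. \<forall>\<alpha>. nonneg (x k \<alpha>) \<and> ks (x k \<alpha>) \<subseteq> B' k"
    using tcellsD(1,2)[OF x] assms by (meson subset_trans)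
  then show "x \<in> tcells B' D p" using x by (simp add: tcells_def)
qed

subsection \<open>Atoms\<close>

primrec spine :: "('b \<Rightarrow> 'b \<Rightarrow>\<^sub>0 int) \<Rightarrow> 'b \<Rightarrow> nat \<Rightarrow> ('b \<Rightarrow>\<^sub>0 int)" where
  "spine D b 0 = frag_of b"
| "spine D b (Suc i) = part Neg (frag_extend D (spine D b i))"

text \<open>Steiner's atom on \<open>b\<close>. One usually iterates positive parts for the positive
  entries; here the sequence \<open>spine\<close> of iterated negative parts serves both signs,
  because the two parts of a chain with zero boundary have equal boundaries.\<close>

definition atom :: "('b \<Rightarrow> 'b \<Rightarrow>\<^sub>0 int) \<Rightarrow> nat \<Rightarrow> 'b \<Rightarrow> 'b table" where
  "atom D k b = (\<lambda>j \<alpha>. if j = k then frag_of b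
     else if j < k then part \<alpha> (frag_extend D (spine D b (k - Suc j))) else 0)"

text \<open>The function \<open>\<kappa>\<close> witnesses the absence of loops: source faces lie
  strictly below a generator, target faces strictly above. Its values are integers, so that
  minimising it yields a generator that can be split off. The last clause is unitality of the
  basis.\<close>

definition loop_free :: "('b \<Rightarrow> int) \<Rightarrow> (nat \<Rightarrow> 'b set) \<Rightarrow> ('b \<Rightarrow> 'b \<Rightarrow>\<^sub>0 int) \<Rightarrow> bool" where
  "loop_free \<kappa> B D \<longleftrightarrow> (\<forall>i j. i \<noteq> j \<longrightarrow> B i \<inter> B j = {}) \<and> (\<forall>k. \<forall>b\<in>B (Suc k). ks (D b) \<subseteq> B k)
     \<and> (\<forall>k. \<forall>b\<in>B (Suc (Suc k)). frag_extend D (D b) = 0) \<and> (\<forall>b\<in>B (Suc 0). augmentation (D b) = 0)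
     \<and> (\<forall>k. \<forall>b\<in>B (Suc k). \<forall>a. (lk (D b) a < 0 \<longrightarrow> \<kappa> a < \<kappa> b) \<and> (0 < lk (D b) a \<longrightarrow> \<kappa> b < \<kappa> a))
     \<and> (\<forall>k. \<forall>b\<in>B k. \<forall>\<alpha>. augmentation (atom D k b 0 \<alpha>) = 1)"

lemma loop_freeD:
  assumes "loop_free \<kappa> B D"
  shows "i \<noteq> j \<Longrightarrow> B i \<inter> B j = {}" "b \<in> B (Suc k) \<Longrightarrow> ks (D b) \<subseteq> B k"
    "b \<in> B (Suc (Suc k)) \<Longrightarrow> frag_extend D (D b) = 0" "b \<in> B (Suc 0) \<Longrightarrow> augmentation (D b) = 0"
    "\<lbrakk>b \<in> B (Suc k); lk (D b) a < 0\<rbrakk> \<Longrightarrow> \<kappa> a < \<kappa> b"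
    "\<lbrakk>b \<in> B (Suc k); 0 < lk (D b) a\<rbrakk> \<Longrightarrow> \<kappa> b < \<kappa> a"
    "b \<in> B k \<Longrightarrow> augmentation (atom D k b 0 \<alpha>) = 1"
  using assms unfolding loop_free_def by blast+

lemma frag_extend_D_D:
  assumes "loop_free \<kappa> B D" "ks c \<subseteq> B (Suc (Suc k))"
  shows "frag_extend D (frag_extend D c) = 0"
proof -
  show ?thesis unfolding frag_extend_extend
    by (rule frag_extend_eq_0) (use loop_freeD(3)[OF assms(1)] assms(2) in auto)
qed

lemma keys_D: "\<lbrakk>loop_free \<kappa> B D; ks c \<subseteq> B (Suc k)\<rbrakk> \<Longrightarrow> ks (frag_extend D c) \<subseteq> B k"
  by (rule keys_frag_extend_subset) (meson loop_freeD(2) subsetD)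

lemma spine_chain:
  assumes "loop_free \<kappa> B D" "b \<in> B k" "i \<le> k"
  shows "ks (spine D b i) \<subseteq> B (k - i)" "nonneg (spine D b i)"
  using assms(3)
proof (induction i)
  case (Suc i)
  { case 1
    have "ks (frag_extend D (spine D b i)) \<subseteq> B (k - Suc i)"
      by (rule keys_D[OF assms(1)]) (use Suc 1 in \<open>simp add: Suc_diff_Suc Suc_le_lessD\<close>)
    then show ?case using keys_part by fastforce
  }
  { case 2 show ?case by (simp add: nonneg_part) }
qed (use assms in \<open>auto simp: keys_frag_of\<close>)

lemma atom_tcells:
  assumes "loop_free \<kappa> B D" "b \<in> B k"
  shows "atom D k b \<in> tcells B D k"
proof -
  have sp: "ks (frag_extend D (spine D b (k - Suc j))) \<subseteq> B j" if "j < k" for j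
    using spine_chain(1)[OF assms, of "k - Suc j"] keys_D[OF assms(1)] that
    by (metis Suc_leI diff_diff_cancel diff_le_self)
  have bd: "frag_extend D (atom D k b (Suc j) \<alpha>) = atom D k b j Pos - atom D k b j Neg" if "j < k" for j \<alpha>
  proof (cases "Suc j = k")
    case True
    then show ?thesis using that part_diff[of "D b"] by (simp add: atom_def)
  next
    case False
    define c where "c = spine D b (k - Suc (Suc j))"
    have s: "spine D b (k - Suc j) = part Neg (frag_extend D c)"
      using False that unfolding c_def by (metis Suc_diff_Suc Suc_lessI spine.simps(2))
    have "ks c \<subseteq> B (Suc (Suc j))"
      using spine_chain(1)[OF assms, of "k - Suc (Suc j)"] that False unfolding c_def
      by (metis Suc_leI Suc_lessI diff_diff_cancel diff_le_self)
    then have "frag_extend D (frag_extend D c) = 0" by (rule frag_extend_D_D[OF assms(1)])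
    then have "frag_extend D (part \<alpha> (frag_extend D c)) = frag_extend D (part Neg (frag_extend D c))"
      by (cases \<alpha>) (simp_all add: part_Pos frag_extend_add)
    then show ?thesis using that False s by (simp add: atom_def c_def part_diff)
  qed
  have "ks (atom D k b j \<alpha>) \<subseteq> B j" if "j \<le> k" for j \<alpha>
    using that subset_trans[OF keys_part sp, of j \<alpha>] assms(2) by (simp add: atom_def keys_frag_of)
  then show ?thesis
    using bd loop_freeD(7)[OF assms] unfolding tcells_def
    by (auto simp: nonneg_part) (auto simp: atom_def nonneg_part)
qed

lemma atom_0: 
  assumes "x \<in> tcells B D 0"
  obtains b where "b \<in> B 0" "x = atom D 0 b"
proof -
  note X = tcellsD[OF assms]
  obtain b where b: "x 0 Neg = frag_of b" using nonneg_augmentation_1 X(1,6) by metis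
  have "x = atom D 0 b"
  proof (intro ext)
    fix j \<alpha>
    show "x j \<alpha> = atom D 0 b j \<alpha>" using X(3)[of j \<alpha>] X(4) b by (cases "j = 0"; cases \<alpha>) (auto simp: atom_def)
  qed
  then show ?thesis using that b X(2)[of 0 Neg] by (simp add: keys_frag_of)
qed

subsection \<open>Demoting generators\<close>

text \<open>The complex is cut off above dimension \<open>q\<close>, but the
  \<open>(q+1)\<close>-generators in \<open>E\<close> are kept as extra generators of dimension
  \<open>q\<close>. Such a generator takes the place of its own source in a cell, which is why
  \<open>demD\<close> gives it the boundary of its source chain.\<close>

definition demB :: "'b set \<Rightarrow> nat \<Rightarrow> (nat \<Rightarrow> 'b set) \<Rightarrow> nat \<Rightarrow> 'b set" where
  "demB E q B k = (if k < q then B k else if k = q then B q \<union> E else {})"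

definition demD :: "'b set \<Rightarrow> ('b \<Rightarrow> 'b \<Rightarrow>\<^sub>0 int) \<Rightarrow> 'b \<Rightarrow> ('b \<Rightarrow>\<^sub>0 int)" where
  "demD E D b = (if b \<in> E then frag_extend D (part Neg (D b)) else D b)"

context
  fixes \<kappa> :: "'b \<Rightarrow> int" and B D E q
  assumes lf: "loop_free \<kappa> B D" and E: "E \<subseteq> B (Suc q)"
begin

lemma notE: "\<lbrakk>k \<le> q; b \<in> B k\<rbrakk> \<Longrightarrow> b \<notin> E"
  using E loop_freeD(1)[OF lf, of k "Suc q"] by auto

lemma extend_demD: "\<lbrakk>k \<le> q; ks c \<subseteq> B k\<rbrakk> \<Longrightarrow> frag_extend (demD E D) c = frag_extend D c"
  by (rule frag_extend_eq) (use notE in \<open>auto simp: demD_def\<close>)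

lemma spine_demD: "\<lbrakk>k \<le> q; b \<in> B k; i \<le> k\<rbrakk> \<Longrightarrow> spine (demD E D) b i = spine D b i"
proof (induction i)
  case (Suc i)
  then have "ks (spine D b i) \<subseteq> B (k - i)" "k - i \<le> q" using spine_chain[OF lf] by auto
  then show ?case using Suc extend_demD by simp
qed simp

lemma atom_demD: "\<lbrakk>k \<le> q; b \<in> B k\<rbrakk> \<Longrightarrow> atom (demD E D) k b = atom D k b"
proof (intro ext)
  fix j \<alpha>
  assume k: "k \<le> q" "b \<in> B k"
  have "frag_extend (demD E D) (spine D b (k - Suc j)) = frag_extend D (spine D b (k - Suc j))"
    by (rule extend_demD[of "k - (k - Suc j)"]) (use k spine_chain[OF lf, of b k "k - Suc j"] in auto)
  then show "atom (demD E D) k b j \<alpha> = atom D k b j \<alpha>"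
    using spine_demD[OF k, of "k - Suc j"] by (simp add: atom_def)
qed

lemma spine_demD_E: "\<lbrakk>b \<in> E; 0 < i; i \<le> q\<rbrakk> \<Longrightarrow> spine (demD E D) b i = spine D b (Suc i)"
proof (induction i)
  case (Suc i)
  show ?case
  proof (cases "i = 0")
    case True
    then show ?thesis using Suc by (simp add: demD_def)
  next
    case False
    have "ks (spine D b (Suc i)) \<subseteq> B (Suc q - Suc i)" using spine_chain[OF lf, of b "Suc q" "Suc i"] Suc E by auto
    then have "frag_extend (demD E D) (spine D b (Suc i)) = frag_extend D (spine D b (Suc i))"
      by (intro extend_demD[of "q - i"]) auto
    then show ?thesis using Suc False by simp
  qed
qed simp

lemma atom_demD_E:
  assumes "b \<in> E"
  shows "atom (demD E D) q b j \<alpha> = (if j = q then frag_of b else if j < q then atom D (Suc q) b j \<alpha> else 0)"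
proof -
  have "frag_extend (demD E D) (spine (demD E D) b (q - Suc j)) = frag_extend D (spine D b (Suc q - Suc j))"
    if "j < q" for j
  proof (cases "q - Suc j")
    case 0
    then have "Suc q - Suc j = Suc 0" using that by simp
    then show ?thesis using 0 assms by (simp add: demD_def)
  next
    case (Suc i)
    have eq: "Suc (q - Suc j) = Suc q - Suc j" using that by simp
    have "ks (spine D b (Suc q - Suc j)) \<subseteq> B (Suc q - (Suc q - Suc j))"
      by (rule spine_chain(1)[OF lf]) (use E assms in auto)
    then have "frag_extend (demD E D) (spine D b (Suc q - Suc j)) = frag_extend D (spine D b (Suc q - Suc j))"
      using that by (intro extend_demD[of "Suc j"]) auto
    moreover have "spine (demD E D) b (q - Suc j) = spine D b (Suc q - Suc j)"
      unfolding eq[symmetric] by (rule spine_demD_E[OF assms]) (use Suc that in auto)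
    ultimately show ?thesis by simp
  qed
  then show ?thesis by (simp add: atom_def)
qed

text \<open>The same \<open>\<kappa>\<close> works: a negative face of a demoted \<open>b\<close> is
  a negative face of some negative face of \<open>b\<close>, so two strict inequalities combine. For
  positive faces the inequalities run through the target of \<open>b\<close> instead.\<close>

lemma loop_free_dem: "loop_free \<kappa> (demB E q B) (demD E D)"
proof -
  have sub: "ks (part \<alpha> (D b)) \<subseteq> B q" if "b \<in> E" for b \<alpha>
    by (rule subset_trans[OF keys_part loop_freeD(2)[OF lf subsetD[OF E that]]])
  have key: "(lk (demD E D b) a < 0 \<longrightarrow> \<kappa> a < \<kappa> b) \<and> (0 < lk (demD E D b) a \<longrightarrow> \<kappa> b < \<kappa> a)"
    if k: "b \<in> demB E q B (Suc k)" for k a b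
  proof (cases "b \<in> E")
    case True
    then have q: "q = Suc k" using k notE[of "Suc k" b] by (auto simp: demB_def split: if_splits)
    have bB: "b \<in> B (Suc q)" using True E by auto
    have "frag_extend D (frag_extend D (frag_of b)) = 0" using loop_freeD(3)[OF lf, of b k] bB q by simp
    \<comment> \<open>\<open>demD\<close> is defined by the source of \<open>b\<close>, but its
      positive coefficients are controlled by the target, which has the same boundary.\<close>
    then have eqP: "frag_extend D (part Pos (D b)) = frag_extend D (part Neg (D b))"
      by (simp add: part_Pos frag_extend_add)
    have "\<kappa> a < \<kappa> b" if neg: "lk (frag_extend D (part Neg (D b))) a < 0"
    proof -
      obtain c where c: "c \<in> ks (part Neg (D b))" "lk (D c) a < 0"
        using lookup_frag_extend_neg[OF nonneg_part neg] by blast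
      then have "c \<in> B q" using sub[OF True] by blast
      have "lk (D b) c < 0" using c(1) by (auto simp: in_keys_iff lookup_part)
      then show ?thesis using loop_freeD(5)[OF lf bB] loop_freeD(5)[OF lf, of c k a] c q \<open>c \<in> B q\<close> \<open>lk (D b) c < 0\<close> by fastforce
    qed
    moreover have "\<kappa> b < \<kappa> a" if pos: "0 < lk (frag_extend D (part Pos (D b))) a"
    proof -
      obtain c where c: "c \<in> ks (part Pos (D b))" "0 < lk (D c) a"
        using lookup_frag_extend_pos[OF nonneg_part pos] by blast
      then have "c \<in> B q" using sub[OF True] by blast
      have "0 < lk (D b) c" using c(1) by (auto simp: in_keys_iff lookup_part)
      then show ?thesis using loop_freeD(6)[OF lf bB] loop_freeD(6)[OF lf, of c k a] c q \<open>c \<in> B q\<close> \<open>0 < lk (D b) c\<close> by fastforce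
    qed
    ultimately show ?thesis using True eqP by (simp add: demD_def)
  next
    case False
    then show ?thesis using k loop_freeD(5,6)[OF lf] by (auto simp: demB_def demD_def split: if_splits)
  qed
  have keys: "ks (demD E D b) \<subseteq> demB E q B k" if k: "b \<in> demB E q B (Suc k)" for k b
  proof (cases "b \<in> E")
    case True
    then have q: "q = Suc k" using k notE[of "Suc k" b] by (auto simp: demB_def split: if_splits)
    then show ?thesis using keys_D[OF lf sub[OF True, unfolded q]] True by (simp add: demB_def demD_def)
  next
    case False
    then show ?thesis using k loop_freeD(2)[OF lf, of b k] by (auto simp: demB_def demD_def split: if_splits)
  qed
  have sq: "frag_extend (demD E D) (demD E D b) = 0" if k: "b \<in> demB E q B (Suc (Suc k))" for k b
  proof -
    have Sk: "Suc k < q" "Suc (Suc k) \<le> q" using k by (auto simp: demB_def split: if_splits)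
    have "ks (demD E D b) \<subseteq> B (Suc k)" using keys[OF k] Sk by (simp add: demB_def)
    then have "frag_extend (demD E D) (demD E D b) = frag_extend D (demD E D b)" using Sk by (intro extend_demD[of "Suc k"]) auto
    also have "\<dots> = 0"
    proof (cases "b \<in> E")
      case True
      then have q: "q = Suc (Suc k)" using k notE[of "Suc (Suc k)" b] by (auto simp: demB_def split: if_splits)
      then show ?thesis using frag_extend_D_D[OF lf sub[OF True, unfolded q]] True by (simp add: demD_def)
    next
      case False
      then show ?thesis using k loop_freeD(3)[OF lf, of b k] by (auto simp: demB_def demD_def split: if_splits)
    qed
    finally show ?thesis .
  qed
  have aug: "augmentation (demD E D b) = 0" if k: "b \<in> demB E q B (Suc 0)" for b
  proof (cases "b \<in> E")
    case True
    then have q: "q = Suc 0" using k notE[of "Suc 0" b] by (auto simp: demB_def split: if_splits)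
    have "augmentation (frag_extend D (part Neg (D b))) = 0"
      by (rule augmentation_frag_extend_0) (use sub[OF True, of Neg] q loop_freeD(4)[OF lf] in auto)
    then show ?thesis using True by (simp add: demD_def)
  next
    case False
    then show ?thesis using k loop_freeD(4)[OF lf] by (auto simp: demB_def demD_def split: if_splits)
  qed
  have uni: "augmentation (atom (demD E D) k b 0 \<alpha>) = 1" if k: "b \<in> demB E q B k" for k b \<alpha>
  proof (cases "b \<in> E")
    case True
    then have q: "k = q" using k notE[of k b] by (auto simp: demB_def split: if_splits)
    then show ?thesis using atom_demD_E[OF True, of 0 \<alpha>] loop_freeD(7)[OF lf, of b "Suc q" \<alpha>] True E by auto
  next
    case False
    then have "b \<in> B k" "k \<le> q" using k by (auto simp: demB_def split: if_splits)
    then show ?thesis using atom_demD loop_freeD(7)[OF lf] by metis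
  qed
  have dis: "demB E q B i \<inter> demB E q B j = {}" if "i \<noteq> j" for i j
    using that loop_freeD(1)[OF lf, of i j] notE[of i] notE[of j] by (auto simp: demB_def)
  show ?thesis unfolding loop_free_def using dis keys sq aug key uni by blast
qed

end

section \<open>Promoting, substituting and splitting off generators\<close>

lemma frag_extend_fun_diff: "frag_extend f c - frag_extend g c = frag_extend (\<lambda>b. f b - g b) c"
  by (rule poly_mapping_eqI)
    (simp add: lookup_minus lookup_frag_extend right_diff_distrib sum_subtractf)

lemma tcmp_eq: "tcmp k x y j \<alpha> = x j \<alpha> - (if j < k then x j \<alpha> else if j = k then x k Neg else 0) + y j \<alpha>"
  by (simp add: tcmp_def tbd_def)

lemma tbd_eq: "tbd \<alpha> k x j \<beta> = (if j < k then x j \<beta> else if j = k then x k \<alpha> else 0)"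
  by (simp add: tbd_def)

lemma tbd_tcmp: "k < q \<Longrightarrow> tbd \<alpha> q (tcmp k x y) = tcmp k (tbd \<alpha> q x) (tbd \<alpha> q y)"
  by (intro ext) (simp add: tcmp_eq tbd_eq)

text \<open>Undoes the demotion: a \<open>q\<close>-cell with demoted generators is read as the
  \<open>(q+1)\<close>-cell in which all of these act side by side.\<close>

definition prom :: "'b set \<Rightarrow> ('b \<Rightarrow> 'b \<Rightarrow>\<^sub>0 int) \<Rightarrow> nat \<Rightarrow> 'b table \<Rightarrow> 'b table" where
  "prom E D q y = (\<lambda>k \<alpha>. if k < q then y k \<alpha>
     else if k = q then frag_extend (\<lambda>g. if g \<in> E then part \<alpha> (D g) else frag_of g) (y q \<alpha>)
     else if k = Suc q then frag_extend (\<lambda>g. if g \<in> E then frag_of g else 0) (y q \<alpha>) else 0)"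

text \<open>Shows the state in dimension \<open>q\<close> before (\<open>Neg\<close>) or after
  (\<open>Pos\<close>) the generators in \<open>A\<close> have acted, while the other demoted
  generators stay in place.\<close>

definition subst :: "'b set \<Rightarrow> polarity \<Rightarrow> ('b \<Rightarrow> 'b \<Rightarrow>\<^sub>0 int) \<Rightarrow> nat \<Rightarrow> 'b table \<Rightarrow> 'b table" where
  "subst A \<alpha> D q y = (\<lambda>k \<beta>. if k = q then frag_extend (\<lambda>g. if g \<in> A then part \<alpha> (D g) else frag_of g) (y q \<beta>)
     else y k \<beta>)"

lemma tbd_prom: "k < q \<Longrightarrow> tbd \<alpha> k (prom E D q y) = tbd \<alpha> k y"
  by (intro ext) (simp add: tbd_eq prom_def)

lemma prom_tbd: "k < q \<Longrightarrow> prom E D q (tbd \<alpha> k y) = tbd \<alpha> k y"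
  by (intro ext) (simp add: tbd_eq prom_def)

lemma prom_tcmp: "k < q \<Longrightarrow> prom E D q (tcmp k x y) = tcmp k (prom E D q x) (prom E D q y)"
  by (intro ext) (simp add: tcmp_eq prom_def frag_extend_add)

lemma tbd_subst: "k < q \<Longrightarrow> tbd \<alpha> k (subst A \<beta> D q y) = tbd \<alpha> k y"
  by (intro ext) (simp add: tbd_eq subst_def)

lemma subst_tbd: "k < q \<Longrightarrow> subst A \<beta> D q (tbd \<alpha> k y) = tbd \<alpha> k y"
  by (intro ext) (simp add: tbd_eq subst_def)

lemma subst_tcmp: "k < q \<Longrightarrow> subst A \<beta> D q (tcmp k x y) = tcmp k (subst A \<beta> D q x) (subst A \<beta> D q y)"
  by (intro ext) (simp add: tcmp_eq subst_def frag_extend_add)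

text \<open>\<open>rem\<close> is what remains of \<open>x\<close> once \<open>b\<close> has acted
  first: the source moves past \<open>b\<close>. \<open>lift\<close> is that first step, seen in the
  demoted complex with \<open>b\<close> standing where its source was.
  \<open>peel_composable\<close> joins the two again.\<close>

definition rem :: "('b \<Rightarrow> 'b \<Rightarrow>\<^sub>0 int) \<Rightarrow> nat \<Rightarrow> 'b \<Rightarrow> 'b table \<Rightarrow> 'b table" where
  "rem D q b x = (\<lambda>k \<alpha>. if k = q \<and> \<alpha> = Neg then x q Neg + D b
     else if k = Suc q then x k \<alpha> - frag_of b else x k \<alpha>)"

definition lift :: "('b \<Rightarrow> 'b \<Rightarrow>\<^sub>0 int) \<Rightarrow> nat \<Rightarrow> 'b \<Rightarrow> 'b table \<Rightarrow> 'b table" where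
  "lift D q b x = (\<lambda>k \<alpha>. if k < q then x k \<alpha>
     else if k = q then x q Neg - part Neg (D b) + frag_of b else 0)"

text \<open>As for a transition of a Petri net: the current \<open>q\<close>-source holds everything
  that \<open>b\<close> consumes.\<close>

definition enabled :: "('b \<Rightarrow> 'b \<Rightarrow>\<^sub>0 int) \<Rightarrow> nat \<Rightarrow> 'b \<Rightarrow> 'b table \<Rightarrow> bool" where
  "enabled D q b x \<longleftrightarrow> (\<forall>a. lk (part Neg (D b)) a \<le> lk (x q Neg) a)"

text \<open>No generator of \<open>x\<close> produces anything that \<open>m\<close> consumes. This
  implies \<open>enabled\<close> for a cell \<open>x\<close>, and unlike \<open>enabled\<close> it
  also controls \<open>m\<close> jointly with a second generator, see
  \<open>removable_joint\<close>.\<close>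

definition removable :: "('b \<Rightarrow> 'b \<Rightarrow>\<^sub>0 int) \<Rightarrow> nat \<Rightarrow> 'b \<Rightarrow> 'b table \<Rightarrow> bool" where
  "removable D q m x \<longleftrightarrow> m \<in> ks (x (Suc q) Neg) \<and>
     (\<forall>a. lk (D m) a < 0 \<longrightarrow> (\<forall>b\<in>ks (x (Suc q) Neg). lk (D b) a \<le> 0))"

text \<open>A generator \<open>m\<close> with least \<open>\<kappa>\<close> works: if some
  \<open>b\<close> produced a face \<open>a\<close> that \<open>m\<close> consumes, then
  \<open>\<kappa> b < \<kappa> a < \<kappa> m\<close>.\<close>

lemma removable_exists:
  assumes "loop_free \<kappa> B D" "x \<in> tcells B D (Suc q)" "x (Suc q) Neg \<noteq> 0"
  shows "\<exists>m. removable D q m x"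
proof -
  let ?S = "ks (x (Suc q) Neg)"
  have "?S \<noteq> {}" using assms(3) by simp
  then obtain m where m: "m \<in> ?S" "\<And>b. b \<in> ?S \<Longrightarrow> \<kappa> m \<le> \<kappa> b"
    using finite_keys[of "x (Suc q) Neg"] by (metis arg_min_if_finite(1) arg_min_least)
  have S: "?S \<subseteq> B (Suc q)" using tcellsD(2)[OF assms(2)] by simp
  have "lk (D b) a \<le> 0" if "lk (D m) a < 0" "b \<in> ?S" for a b
  proof (rule ccontr)
    assume "\<not> ?thesis"
    then have "\<kappa> b < \<kappa> a" using loop_freeD(6)[OF assms(1), of b q a] S that by auto
    moreover have "\<kappa> a < \<kappa> m" using loop_freeD(5)[OF assms(1), of m q a] S m that by auto
    ultimately show False using m(2)[OF that(2)] by simp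
  qed
  then show ?thesis using m unfolding removable_def by blast
qed

text \<open>Nothing in \<open>x\<close> produces the face \<open>a\<close>, so the
  \<open>q\<close>-source of \<open>x\<close> must supply all that the generators of
  \<open>x\<close> consume there.\<close>

lemma removable_bound:
  assumes "x \<in> tcells B D (Suc q)" "removable D q m x" "lk (D m) a < 0" "A \<subseteq> ks (x (Suc q) Neg)"
  shows "(\<Sum>b\<in>A. - lk (D b) a) \<le> lk (x q Neg) a"
proof -
  let ?c = "x (Suc q) Neg"
  note X = tcellsD[OF assms(1)]
  have eq: "x q Neg = x q Pos - frag_extend D ?c" using X(5)[of q Neg] by simp
  have neg: "lk (D b) a \<le> 0" if "b \<in> ks ?c" for b
    using assms(2,3) that unfolding removable_def by blast
  have pos: "1 \<le> lk ?c b" if "b \<in> ks ?c" for b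
    using X(1)[of "Suc q" Neg] that unfolding nonneg_def in_keys_iff by (metis int_one_le_iff_zero_less order_le_less)
  have "(\<Sum>b\<in>A. - lk (D b) a) \<le> (\<Sum>b\<in>A. lk ?c b * (- lk (D b) a))"
  proof (rule sum_mono)
    fix b assume "b \<in> A"
    then show "- lk (D b) a \<le> lk ?c b * (- lk (D b) a)"
      using mult_right_mono[OF pos[of b], of "- lk (D b) a"] neg[of b] assms(4) by auto
  qed
  also have "\<dots> \<le> (\<Sum>b\<in>ks ?c. lk ?c b * (- lk (D b) a))"
  proof (rule sum_mono2)
    fix b assume "b \<in> ks ?c - A"
    then show "0 \<le> lk ?c b * (- lk (D b) a)"
      using mult_nonneg_nonneg[of "lk ?c b" "- lk (D b) a"] pos[of b] neg[of b] by auto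
  qed (use assms in auto)
  also have "\<dots> = - lk (frag_extend D ?c) a" by (simp add: lookup_frag_extend sum_negf)
  also have "\<dots> \<le> lk (x q Neg) a" using X(1)[of q Pos] by (simp add: eq lookup_minus nonneg_def)
  finally show ?thesis .
qed

lemma removable_enabled:
  assumes "x \<in> tcells B D (Suc q)" "removable D q m x"
  shows "enabled D q m x"
  unfolding enabled_def
proof
  fix a
  show "lk (part Neg (D m)) a \<le> lk (x q Neg) a"
  proof (cases "lk (D m) a < 0")
    case True
    then show ?thesis using removable_bound[OF assms True, of "{m}"] assms(2)
      by (simp add: removable_def lookup_part)
  next
    case False
    then show ?thesis using tcellsD(1)[OF assms(1), of q Neg] by (simp add: nonneg_def lookup_part)
  qed
qed

text \<open>Prepares the diamond in \<open>thom_extend\<close>: the source is large enough for both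
  generators at once, so either of them may act first.\<close>

lemma removable_joint:
  assumes "x \<in> tcells B D (Suc q)" "removable D q m x" "b \<in> ks (x (Suc q) Neg)" "b \<noteq> m" "enabled D q b x"
  shows "lk (part Neg (D m)) a + lk (part Neg (D b)) a \<le> lk (x q Neg) a"
proof (cases "lk (D m) a < 0")
  case True
  have "lk (D b) a \<le> 0" using assms(2,3) True unfolding removable_def by blast
  then show ?thesis using removable_bound[OF assms(1,2) True, of "{m, b}"] assms(2,3,4) True
    by (simp add: removable_def lookup_part)
next
  case False
  then have "lk (part Neg (D m)) a = 0" by (simp add: lookup_part)
  then show ?thesis using assms(5) by (simp add: enabled_def)
qed

lemma enabled_rem:
  assumes "\<And>a. lk (part Neg (D m)) a + lk (part Neg (D b)) a \<le> lk (x q Neg) a"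
  shows "enabled D q b (rem D q m x)"
  unfolding enabled_def
proof
  fix a
  have "lk (D m) a = lk (part Pos (D m)) a - lk (part Neg (D m)) a" using part_diff[of "D m"] lookup_minus by metis
  moreover have "0 \<le> lk (part Pos (D m)) a" using nonneg_part[of Pos "D m"] by (simp add: nonneg_def)
  ultimately show "lk (part Neg (D b)) a \<le> lk (rem D q m x q Neg) a"
    using assms[of a] by (simp add: rem_def lookup_add)
qed

definition mass :: "nat \<Rightarrow> 'b table \<Rightarrow> nat" where "mass q x = nat (augmentation (x (Suc q) Neg))"

lemma mass_rem:
  assumes "x \<in> tcells B D (Suc q)" "b \<in> ks (x (Suc q) Neg)"
  shows "mass q x = Suc (mass q (rem D q b x))"
proof -
  let ?c = "x (Suc q) Neg"
  have "0 \<le> augmentation (?c - frag_of b)"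
    by (rule augmentation_nonneg[OF nonneg_minus_frag_of[OF tcellsD(1)[OF assms(1)] assms(2)]])
  then have "1 \<le> augmentation ?c" by (simp add: augmentation_diff)
  then have "nat (augmentation ?c) = Suc (nat (augmentation ?c - 1))" by simp
  then show ?thesis unfolding mass_def rem_def by (simp add: augmentation_diff)
qed

lemma mass_0: "\<lbrakk>x \<in> tcells B D (Suc q); mass q x = 0\<rbrakk> \<Longrightarrow> x (Suc q) Neg = 0"
  unfolding mass_def using tcellsD(1)[of x B D "Suc q" "Suc q" Neg] nonneg_augmentation_0 augmentation_nonneg by fastforce

lemma mass_0_tcells: "\<lbrakk>x \<in> tcells B D (Suc q); mass q x = 0\<rbrakk> \<Longrightarrow> x \<in> tcells B D q"
  using mass_0 tcells_Suc_zero by metis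

lemma mass_tcells: "x \<in> tcells B D q \<Longrightarrow> mass q x = 0"
  unfolding mass_def using tcellsD(3)[of x B D q "Suc q" Neg] by simp

context
  fixes \<kappa> :: "'b \<Rightarrow> int" and B D E q
  assumes lf: "loop_free \<kappa> B D" and E: "E \<subseteq> B (Suc q)"
begin

lemma part_D_keys: "b \<in> E \<Longrightarrow> ks (part \<alpha> (D b)) \<subseteq> B q"
  by (rule subset_trans[OF keys_part loop_freeD(2)[OF lf subsetD[OF E]]])

lemma extend_part_D:
  assumes "b \<in> E" "0 < q" shows "frag_extend D (part \<alpha> (D b)) = demD E D b"
proof -
  have "frag_extend D (D b) = 0" using loop_freeD(3)[OF lf, of b "q - 1"] E assms by auto
  then show ?thesis using assms by (cases \<alpha>) (auto simp: demD_def part_Pos frag_extend_add)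
qed

lemma augmentation_part_D:
  assumes "b \<in> E" "q = 0" shows "augmentation (part \<alpha> (D b)) = 1"
  using loop_freeD(7)[OF lf, of b "Suc 0" \<alpha>] E assms by (auto simp: atom_def)

lemma E_disjoint: "\<lbrakk>k \<le> q; b \<in> B k\<rbrakk> \<Longrightarrow> b \<notin> E"
  using notE[OF lf E] .

lemma demD_old: "\<lbrakk>k \<le> q; b \<in> B k\<rbrakk> \<Longrightarrow> demD E D b = D b"
  using E_disjoint by (simp add: demD_def)

lemma tcells_dem_lower: "p < q \<Longrightarrow> tcells (demB E q B) (demD E D) p = tcells B D p"
proof (rule tcells_cong)
  fix k b assume "p < q" "k < p" "b \<in> demB E q B (Suc k)"
  then show "demD E D b = D b" using demD_old[of "Suc k" b] by (simp add: demB_def)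
qed (simp add: demB_def)

lemma tcells_dem_upper: "tcells B D q \<subseteq> tcells (demB E q B) (demD E D) q"
proof -
  have "tcells B D q = tcells B (demD E D) q"
    by (rule tcells_cong) (auto simp: demD_old[OF Suc_leI])
  also have "\<dots> \<subseteq> tcells (demB E q B) (demD E D) q"
    by (rule tcells_subset) (auto simp: demB_def)
  finally show ?thesis .
qed

text \<open>Below \<open>q\<close> the boundaries fit because source and target of a demoted
  generator both have the boundary given to it by \<open>demD\<close>; at \<open>q\<close> the
  difference of the two sides is, generator by generator, target minus source.\<close>

lemma prom_tcells:
  assumes "y \<in> tcells (demB E q B) (demD E D) q"
  shows "prom E D q y \<in> tcells B D (Suc q)"
proof -
  note Y = tcellsD[OF assms]
  let ?r = "\<lambda>\<alpha> g. if g \<in> E then part \<alpha> (D g) else frag_of g" and ?s = "\<lambda>g. if g \<in> E then frag_of g else 0"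
  have yq: "ks (y q \<alpha>) \<subseteq> B q \<union> E" for \<alpha> using Y(2)[of q \<alpha>] by (simp add: demB_def)
  have r: "ks (frag_extend (?r \<alpha>) (y q \<alpha>)) \<subseteq> B q" for \<alpha>
  proof (rule keys_frag_extend_subset)
    fix g assume "g \<in> ks (y q \<alpha>)"
    then show "ks (?r \<alpha> g) \<subseteq> B q" using yq[of \<alpha>] part_D_keys[of g \<alpha>] by (auto simp: keys_frag_of)
  qed
  have s: "ks (frag_extend ?s (y q \<alpha>)) \<subseteq> B (Suc q)" for \<alpha>
    by (rule keys_frag_extend_subset) (use E in \<open>auto simp: keys_frag_of\<close>)
  have n: "nonneg (frag_extend (?r \<alpha>) (y q \<alpha>))" "nonneg (frag_extend ?s (y q \<alpha>))" for \<alpha>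
    by (rule nonneg_frag_extend[OF Y(1)]; simp add: nonneg_part)+
  have 1: "nonneg (prom E D q y k \<alpha>) \<and> ks (prom E D q y k \<alpha>) \<subseteq> B k" if k: "k \<le> Suc q" for k \<alpha>
  proof -
    consider "k < q" | "k = q" | "k = Suc q" using k by linarith
    then show ?thesis
      using r[of \<alpha>] s[of \<alpha>] n[of \<alpha>] Y(1)[of k \<alpha>] Y(2)[of k \<alpha>] by cases (simp_all add: prom_def demB_def)
  qed
  have 2: "frag_extend D (prom E D q y (Suc k) \<alpha>) = prom E D q y k Pos - prom E D q y k Neg" if k: "k < Suc q" for k \<alpha>
  proof -
    consider "Suc k < q" | "Suc k = q" | "k = q" using k by linarith
    then show ?thesis
    proof cases
      case 1
      then have "frag_extend D (y (Suc k) \<alpha>) = frag_extend (demD E D) (y (Suc k) \<alpha>)"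
        by (intro extend_demD[OF lf E, of "Suc k", symmetric]) (use Y(2)[of "Suc k" \<alpha>] in \<open>auto simp: demB_def\<close>)
      then show ?thesis using 1 Y(5)[of k \<alpha>] by (simp add: prom_def)
    next
      case 2
      have "frag_extend D (frag_extend (?r \<alpha>) (y q \<alpha>)) = frag_extend (demD E D) (y q \<alpha>)"
        unfolding frag_extend_extend
      proof (rule frag_extend_eq)
        fix g
        show "frag_extend D (?r \<alpha> g) = demD E D g"
        proof (cases "g \<in> E")
          case True
          then show ?thesis using extend_part_D[OF True, of \<alpha>] 2 by simp
        qed (simp add: demD_def)
      qed
      then show ?thesis using 2 Y(5)[of k \<alpha>] by (auto simp: prom_def)
    next
      case 3
      have "frag_extend D (frag_extend ?s (y q \<alpha>)) = frag_extend (\<lambda>g. ?r Pos g - ?r Neg g) (y q \<alpha>)"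
        unfolding frag_extend_extend by (rule frag_extend_eq) (simp add: part_diff)
      also have "\<dots> = frag_extend (?r Pos) (y q \<alpha>) - frag_extend (?r Neg) (y q \<alpha>)"
        by (simp add: frag_extend_fun_diff)
      finally show ?thesis using 3 Y(4) by (cases \<alpha>) (simp_all add: prom_def)
    qed
  qed
  have 3: "augmentation (prom E D q y 0 \<alpha>) = 1" for \<alpha>
  proof (cases "q = 0")
    case True
    have "augmentation (frag_extend (?r \<alpha>) (y q \<alpha>)) = augmentation (y q \<alpha>)"
      by (rule augmentation_frag_extend_1) (use augmentation_part_D True in auto)
    then show ?thesis using True Y(6)[of \<alpha>] by (simp add: prom_def)
  qed (use Y(6) in \<open>simp add: prom_def\<close>)
  show ?thesis unfolding tcells_def mem_Collect_eq
    using 1 2 3 Y(4) by (auto simp: prom_def)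
qed

lemma subst_tcells:
  assumes "y \<in> tcells (demB E q B) (demD E D) q" "A \<subseteq> E"
  shows "subst A \<beta> D q y \<in> tcells (demB E q B) (demD E D) q"
proof -
  note Y = tcellsD[OF assms(1)]
  let ?r = "\<lambda>g. if g \<in> A then part \<beta> (D g) else frag_of g"
  have yq: "ks (y q \<alpha>) \<subseteq> B q \<union> E" for \<alpha> using Y(2)[of q \<alpha>] by (simp add: demB_def)
  have r: "ks (frag_extend ?r (y q \<alpha>)) \<subseteq> demB E q B q" for \<alpha>
  proof (rule keys_frag_extend_subset)
    fix g assume "g \<in> ks (y q \<alpha>)"
    then show "ks (?r g) \<subseteq> demB E q B q" using yq[of \<alpha>] part_D_keys[of g \<beta>] assms(2)
      by (auto simp: keys_frag_of demB_def)
  qed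
  have n: "nonneg (frag_extend ?r (y q \<alpha>))" for \<alpha>
    by (rule nonneg_frag_extend[OF Y(1)]) (simp add: nonneg_part)
  have 1: "nonneg (subst A \<beta> D q y k \<alpha>) \<and> ks (subst A \<beta> D q y k \<alpha>) \<subseteq> demB E q B k" if "k \<le> q" for k \<alpha>
    using that r n Y(1)[of k \<alpha>] Y(2)[of k \<alpha>] by (auto simp: subst_def)
  have 2: "frag_extend (demD E D) (subst A \<beta> D q y (Suc k) \<alpha>) = subst A \<beta> D q y k Pos - subst A \<beta> D q y k Neg"
    if k: "k < q" for k \<alpha>
  proof (cases "Suc k = q")
    case True
    have "frag_extend (demD E D) (frag_extend ?r (y q \<alpha>)) = frag_extend (demD E D) (y q \<alpha>)"
      unfolding frag_extend_extend
    proof (rule frag_extend_eq)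
      fix g assume "g \<in> ks (y q \<alpha>)"
      show "frag_extend (demD E D) (?r g) = demD E D g"
      proof (cases "g \<in> A")
        case g: True
        then have "frag_extend (demD E D) (part \<beta> (D g)) = frag_extend D (part \<beta> (D g))"
          using part_D_keys[of g \<beta>] assms(2) by (intro extend_demD[OF lf E, of q]) auto
        then show ?thesis using g extend_part_D[of g \<beta>] assms(2) True by auto
      qed simp
    qed
    then show ?thesis using True Y(5)[of k \<alpha>] by (auto simp: subst_def)
  next
    case False
    then show ?thesis using k Y(5)[of k \<alpha>] by (simp add: subst_def)
  qed
  have 3: "augmentation (subst A \<beta> D q y 0 \<alpha>) = 1" for \<alpha>
  proof (cases "q = 0")
    case True
    have "augmentation (frag_extend ?r (y q \<alpha>)) = augmentation (y q \<alpha>)"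
      by (rule augmentation_frag_extend_1) (use augmentation_part_D True assms(2) in auto)
    then show ?thesis using True Y(6)[of \<alpha>] by (simp add: subst_def)
  qed (use Y(6) in \<open>simp add: subst_def\<close>)
  show ?thesis unfolding tcells_def mem_Collect_eq
    using 1 2 3 Y(3,4) by (auto simp: subst_def)
qed

lemma extend_no_E: "ks c \<subseteq> B q \<Longrightarrow> A \<subseteq> E \<Longrightarrow> frag_extend (\<lambda>g. if g \<in> A then f g else frag_of g) c = c"
  by (rule frag_extend_id) (use E_disjoint[of q] in auto)

lemma extend_no_E_0: "ks c \<subseteq> B q \<Longrightarrow> frag_extend (\<lambda>g. if g \<in> E then f g else 0) c = 0"
  by (rule frag_extend_eq_0) (use E_disjoint[of q] in auto)

lemma prom_old:
  assumes "y \<in> tcells B D q" shows "prom E D q y = y"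
proof (intro ext)
  fix k \<alpha>
  show "prom E D q y k \<alpha> = y k \<alpha>"
    using tcellsD(2)[OF assms, of q \<alpha>] extend_no_E[of "y q \<alpha>" E] extend_no_E_0[of "y q \<alpha>" frag_of] tcellsD(3)[OF assms, of k \<alpha>]
    by (simp add: prom_def)
qed

lemma subst_old:
  assumes "y \<in> tcells B D q" "A \<subseteq> E" shows "subst A \<beta> D q y = y"
proof (intro ext)
  fix k \<alpha>
  show "subst A \<beta> D q y k \<alpha> = y k \<alpha>"
    using tcellsD(2)[OF assms(1), of q \<alpha>] extend_no_E[of "y q \<alpha>" A] assms(2) by (simp add: subst_def)
qed

lemma prom_atom:
  assumes "b \<in> E" shows "prom E D q (atom (demD E D) q b) = atom D (Suc q) b"
proof (intro ext)
  fix k \<alpha>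
  show "prom E D q (atom (demD E D) q b) k \<alpha> = atom D (Suc q) b k \<alpha>"
    using assms atom_demD_E[OF lf E assms] by (auto simp: prom_def) (auto simp: atom_def)
qed

lemma subst_atom:
  assumes "b \<in> A" "A \<subseteq> E" shows "subst A \<beta> D q (atom (demD E D) q b) = tbd \<beta> q (atom D (Suc q) b)"
proof (intro ext)
  fix k \<alpha>
  show "subst A \<beta> D q (atom (demD E D) q b) k \<alpha> = tbd \<beta> q (atom D (Suc q) b) k \<alpha>"
    using assms atom_demD_E[OF lf E subsetD[OF assms(2,1)]] by (auto simp: subst_def tbd_eq) (auto simp: atom_def)
qed

lemma subst_atom_other:
  assumes "b \<in> E" "b \<notin> A" shows "subst A \<beta> D q (atom (demD E D) q b) = atom (demD E D) q b"
proof (intro ext)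
  fix k \<alpha>
  show "subst A \<beta> D q (atom (demD E D) q b) k \<alpha> = atom (demD E D) q b k \<alpha>"
    using assms atom_demD_E[OF lf E assms(1)] by (auto simp: subst_def)
qed

text \<open>The new source \<open>x q Neg + D b\<close> has no negative coefficient because
  \<open>b\<close> is enabled; its boundary is unchanged since \<open>D b\<close> is itself a
  boundary.\<close>

lemma rem_tcells:
  assumes "x \<in> tcells B D (Suc q)" "b \<in> ks (x (Suc q) Neg)" "enabled D q b x"
  shows "rem D q b x \<in> tcells B D (Suc q)"
proof -
  note X = tcellsD[OF assms(1)]
  have b: "b \<in> B (Suc q)" using X(2)[of "Suc q" Neg] assms(2) by auto
  have bP: "b \<in> ks (x (Suc q) \<alpha>)" for \<alpha> using X(4) assms(2) by (cases \<alpha>) auto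
  have "0 \<le> lk (x q Neg) a + lk (D b) a" for a
  proof -
    have "lk (D b) a = lk (part Pos (D b)) a - lk (part Neg (D b)) a" using part_diff[of "D b"] lookup_minus by metis
    then show ?thesis using assms(3) nonneg_part[of Pos "D b"] by (auto simp: enabled_def nonneg_def) (smt (verit))
  qed
  then have n: "nonneg (x q Neg + D b)" by (simp add: nonneg_def lookup_add)
  have k1: "ks (x q Neg + D b) \<subseteq> B q"
    using Poly_Mapping.keys_add[of "x q Neg" "D b"] X(2)[of q Neg] loop_freeD(2)[OF lf b] by auto
  have k2: "ks (x (Suc q) \<alpha> - frag_of b) \<subseteq> B (Suc q)" for \<alpha>
    using keys_diff[of "x (Suc q) \<alpha>" "frag_of b"] X(2)[of "Suc q" \<alpha>] b by (auto simp: keys_frag_of)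
  have 1: "nonneg (rem D q b x k \<alpha>) \<and> ks (rem D q b x k \<alpha>) \<subseteq> B k" if "k \<le> Suc q" for k \<alpha>
    using n k1 k2 X(1)[of k \<alpha>] X(2)[of k \<alpha>] nonneg_minus_frag_of[OF X(1) bP] that by (simp add: rem_def)
  have 2: "frag_extend D (rem D q b x (Suc k) \<alpha>) = rem D q b x k Pos - rem D q b x k Neg" if k: "k < Suc q" for k \<alpha>
  proof -
    consider "Suc k < q" | "Suc k = q" | "k = q" using k by linarith
    then show ?thesis
    proof cases
      case 2
      have "frag_extend D (D b) = 0" using loop_freeD(3)[OF lf, of b k] b 2 by simp
      then show ?thesis using 2 X(5)[of k \<alpha>] X(5)[of k Neg] by (auto simp: rem_def frag_extend_add)
    qed (use X(5)[of k \<alpha>] in \<open>auto simp: rem_def frag_extend_diff\<close>)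
  qed
  have 3: "augmentation (rem D q b x 0 \<alpha>) = 1" for \<alpha>
    using X(6) loop_freeD(4)[OF lf, of b] b by (auto simp: rem_def augmentation_add)
  show ?thesis unfolding tcells_def mem_Collect_eq
    using 1 2 3 X(3,4) by (auto simp: rem_def)
qed

lemma lift_tcells:
  assumes "x \<in> tcells B D (Suc q)" "b \<in> E" "enabled D q b x"
  shows "lift D q b x \<in> tcells (demB E q B) (demD E D) q"
proof -
  note X = tcellsD[OF assms(1)]
  let ?c = "x q Neg - part Neg (D b) + frag_of b"
  have "nonneg (x q Neg - part Neg (D b))" using assms(3) by (simp add: enabled_def nonneg_def lookup_minus)
  then have n: "nonneg ?c" by (simp add: nonneg_add)
  have k0: "ks (x q Neg - part Neg (D b)) \<subseteq> B q"
    using keys_diff[of "x q Neg" "part Neg (D b)"] X(2)[of q Neg] part_D_keys[OF assms(2), of Neg] by auto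
  then have k1: "ks ?c \<subseteq> demB E q B q"
    using Poly_Mapping.keys_add[of "x q Neg - part Neg (D b)" "frag_of b"] assms(2) by (auto simp: keys_frag_of demB_def)
  have 1: "nonneg (lift D q b x k \<alpha>) \<and> ks (lift D q b x k \<alpha>) \<subseteq> demB E q B k" if "k \<le> q" for k \<alpha>
    using n k1 X(1)[of k \<alpha>] X(2)[of k \<alpha>] that by (auto simp: lift_def demB_def)
  have 2: "frag_extend (demD E D) (lift D q b x (Suc k) \<alpha>) = lift D q b x k Pos - lift D q b x k Neg" if k: "k < q" for k \<alpha>
  proof (cases "Suc k = q")
    case True
    have "frag_extend (demD E D) ?c = frag_extend D (x q Neg - part Neg (D b)) + demD E D b"
      using extend_demD[OF lf E, of q, OF _ k0] by (simp add: frag_extend_add)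
    also have "\<dots> = frag_extend D (x q Neg)" using assms(2) by (simp add: frag_extend_diff demD_def)
    finally show ?thesis using True X(5)[of k Neg] by (auto simp: lift_def)
  next
    case False
    then have "frag_extend (demD E D) (x (Suc k) \<alpha>) = frag_extend D (x (Suc k) \<alpha>)"
      using X(2)[of "Suc k" \<alpha>] k by (intro extend_demD[OF lf E, of "Suc k"]) auto
    then show ?thesis using k False X(5)[of k \<alpha>] by (simp add: lift_def)
  qed
  have 3: "augmentation (lift D q b x 0 \<alpha>) = 1" for \<alpha>
    using X(6) augmentation_part_D[OF assms(2), of Neg] by (auto simp: lift_def augmentation_add augmentation_diff)
  show ?thesis unfolding tcells_def mem_Collect_eq
    using 1 2 3 by (auto simp: lift_def)
qed

lemma prom_lift:
  assumes "x \<in> tcells B D (Suc q)" "b \<in> E"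
  shows "prom E D q (lift D q b x) k \<alpha> = (if k < q then x k \<alpha> else if k = q then (if \<alpha> = Neg then x q Neg else x q Neg + D b)
     else if k = Suc q then frag_of b else 0)"
proof -
  have k: "ks (x q Neg - part Neg (D b)) \<subseteq> B q"
    using keys_diff[of "x q Neg" "part Neg (D b)"] tcellsD(2)[OF assms(1), of q Neg] part_D_keys[OF assms(2), of Neg] by auto
  show ?thesis using extend_no_E[OF k, of E] extend_no_E_0[OF k, of frag_of] assms(2)
    by (cases \<alpha>) (auto simp: prom_def lift_def frag_extend_add part_Pos)
qed

text \<open>The factor acting first is written on the right: \<open>b\<close> in its context comes
  first, \<open>rem D q b x\<close> follows. All inductions on \<open>mass\<close> rest on this
  decomposition.\<close>

lemma peel_composable:
  assumes "x \<in> tcells B D (Suc q)" "b \<in> E"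
  shows "tbd Neg q (rem D q b x) = tbd Pos q (prom E D q (lift D q b x))"
    "tbd Neg q (prom E D q (lift D q b x)) = tbd Neg q x"
    "tbd Pos q (rem D q b x) = tbd Pos q x"
    "tcmp q (rem D q b x) (prom E D q (lift D q b x)) = x"
proof -
  show "tbd Neg q (rem D q b x) = tbd Pos q (prom E D q (lift D q b x))"
    by (intro ext) (simp add: tbd_eq prom_lift[OF assms] rem_def)
  show "tbd Neg q (prom E D q (lift D q b x)) = tbd Neg q x"
    by (intro ext) (simp add: tbd_eq prom_lift[OF assms])
  show "tbd Pos q (rem D q b x) = tbd Pos q x"
    by (intro ext) (simp add: tbd_eq rem_def)
  show "tcmp q (rem D q b x) (prom E D q (lift D q b x)) = x"
  proof (intro ext)
    fix k \<alpha>
    show "tcmp q (rem D q b x) (prom E D q (lift D q b x)) k \<alpha> = x k \<alpha>"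
      using tcellsD(3)[OF assms(1), of k \<alpha>]
      by (cases \<alpha>) (auto simp: tcmp_eq prom_lift[OF assms] rem_def)
  qed
qed

end

subsection \<open>Maps out of complexes\<close>

context one_sorted
begin

text \<open>One function serves all dimensions up to \<open>q\<close>, since lower cells are
  \<open>q\<close>-cells too. Only faces and composites below \<open>q\<close> are constrained, so
  values on \<open>q\<close>-cells may have any dimension; \<open>thom_extend\<close> exploits this
  freedom.\<close>

definition thom :: "nat \<Rightarrow> (nat \<Rightarrow> 'b set) \<Rightarrow> ('b \<Rightarrow> 'b \<Rightarrow>\<^sub>0 int) \<Rightarrow> ('b table \<Rightarrow> 'm) \<Rightarrow> bool" where
  "thom q B D F \<longleftrightarrow> (\<forall>x\<in>tcells B D q. F x \<in> M \<and> (\<forall>k<q. \<forall>\<alpha>. F (tbd \<alpha> k x) = d \<alpha> k (F x))) \<and>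
     (\<forall>x\<in>tcells B D q. \<forall>y\<in>tcells B D q. \<forall>k<q. tbd Neg k x = tbd Pos k y \<longrightarrow> F (tcmp k x y) = cmp k (F x) (F y))"

lemma thomD:
  assumes "thom q B D F"
  shows "x \<in> tcells B D q \<Longrightarrow> F x \<in> M" "\<lbrakk>x \<in> tcells B D q; k < q\<rbrakk> \<Longrightarrow> F (tbd \<alpha> k x) = d \<alpha> k (F x)"
    "\<lbrakk>x \<in> tcells B D q; y \<in> tcells B D q; k < q; tbd Neg k x = tbd Pos k y\<rbrakk> \<Longrightarrow> F (tcmp k x y) = cmp k (F x) (F y)"
    "\<lbrakk>x \<in> tcells B D q; y \<in> tcells B D q; k < q; tbd Neg k x = tbd Pos k y\<rbrakk> \<Longrightarrow> d Neg k (F x) = d Pos k (F y)"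
  using assms unfolding thom_def by auto metis

lemma thom_mono: "\<lbrakk>thom q B D F; p \<le> q; tcells B' D' p \<subseteq> tcells B D q\<rbrakk> \<Longrightarrow> thom p B' D' F"
  unfolding thom_def by (meson less_le_trans subsetD)

lemma tcells_le: "p \<le> q \<Longrightarrow> tcells B D p \<subseteq> tcells B D q"
  using tcells_mono by blast

lemma thom_cell: "\<lbrakk>thom q B D F; x \<in> tcells B D p; p < q\<rbrakk> \<Longrightarrow> cell p (F x)"
  using thomD(1,2)[of q B D F x] tbd_id[of x B D p p] tcells_mono[of x B D p q]
  by (metis cellI less_imp_le order_refl)

lemma thom_prom:
  assumes "loop_free \<kappa> B D" "E \<subseteq> B (Suc q)" "thom (Suc q) B D F"
  shows "thom q (demB E q B) (demD E D) (\<lambda>y. F (prom E D q y))"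
proof -
  note F = thomD[OF assms(3)] and p = prom_tcells[OF assms(1,2)]
  have "F (prom E D q (tbd \<alpha> k x)) = d \<alpha> k (F (prom E D q x))"
    if "x \<in> tcells (demB E q B) (demD E D) q" "k < q" for x k \<alpha>
    using F(2)[OF p[OF that(1)], of k \<alpha>] that by (simp add: tbd_prom prom_tbd)
  moreover have "F (prom E D q (tcmp k x y)) = cmp k (F (prom E D q x)) (F (prom E D q y))"
    if "x \<in> tcells (demB E q B) (demD E D) q" "y \<in> tcells (demB E q B) (demD E D) q" "k < q"
      "tbd Neg k x = tbd Pos k y" for x y k
    using F(3)[OF p[OF that(1)] p[OF that(2)], of k] that by (simp add: tbd_prom prom_tcmp)
  ultimately show ?thesis unfolding thom_def using F(1) p by auto
qed

text \<open>Splitting off generators writes a \<open>(q+1)\<close>-cell as a composite of promoted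
  \<open>q\<close>-cells of the demoted complex. Both maps induce maps on that complex, where the
  induction on \<open>q\<close> applies; hence \<open>B\<close> and \<open>D\<close> vary in the
  induction.\<close>

lemma thom_unique:
  assumes "loop_free \<kappa> B D" "thom q B D F" "thom q B D F'"
    "\<And>x. \<lbrakk>0 < q; x \<in> tcells B D (q - 1)\<rbrakk> \<Longrightarrow> F x = F' x"
    "\<And>b. b \<in> B q \<Longrightarrow> F (atom D q b) = F' (atom D q b)" "x \<in> tcells B D q"
  shows "F x = F' x"
  using assms
proof (induction q arbitrary: B D F F' x)
  case 0
  then show ?case using atom_0 by metis
next
  case (Suc q)
  let ?E = "B (Suc q)"
  note lf = Suc.prems(1)
  have P: "F (prom ?E D q y) = F' (prom ?E D q y)" if y: "y \<in> tcells (demB ?E q B) (demD ?E D) q" for y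
  proof (rule Suc.IH[OF loop_free_dem[OF lf subset_refl] thom_prom[OF lf subset_refl Suc.prems(2)]
        thom_prom[OF lf subset_refl Suc.prems(3)] _ _ y])
    fix y assume "0 < q" "y \<in> tcells (demB ?E q B) (demD ?E D) (q - 1)"
    then have "y \<in> tcells B D q" using tcells_dem_lower[OF lf subset_refl, where p="q - 1" and q=q] tcells_mono[of y B D "q - 1" q] by auto
    then show "F (prom ?E D q y) = F' (prom ?E D q y)" using prom_old[OF lf subset_refl] Suc.prems(4) by simp
  next
    fix b assume b: "b \<in> demB ?E q B q"
    show "F (prom ?E D q (atom (demD ?E D) q b)) = F' (prom ?E D q (atom (demD ?E D) q b))"
    proof (cases "b \<in> ?E")
      case True
      then show ?thesis using prom_atom[OF lf subset_refl True] Suc.prems(5) by simp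
    next
      case False
      then have "b \<in> B q" using b by (simp add: demB_def)
      then show ?thesis using atom_demD[OF lf subset_refl, where k=q and b=b and q=q] prom_old[OF lf subset_refl] atom_tcells[OF lf]
        Suc.prems(4)[of "atom D q b"] by simp
    qed
  qed
  show ?case using Suc.prems(6)
  proof (induction "mass q x" arbitrary: x)
    case 0
    then show ?case using Suc.prems(4) mass_0_tcells by (metis diff_Suc_1 zero_less_Suc)
  next
    case (Suc n)
    have "x (Suc q) Neg \<noteq> 0" using Suc.hyps(2) by (auto simp: mass_def)
    then obtain m where m: "removable D q m x" using removable_exists[OF lf Suc.prems] by blast
    have mk: "m \<in> ks (x (Suc q) Neg)" using m by (simp add: removable_def)
    have mE: "m \<in> ?E" using tcellsD(2)[OF Suc.prems, of "Suc q" Neg] mk by auto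
    note en = removable_enabled[OF Suc.prems m]
    note r = rem_tcells[OF lf subset_refl Suc.prems mk en] and l = lift_tcells[OF lf subset_refl Suc.prems mE en]
    note pc = peel_composable[OF lf subset_refl Suc.prems mE]
    note p = prom_tcells[OF lf subset_refl l]
    have eq: "G x = cmp q (G (rem D q m x)) (G (prom ?E D q (lift D q m x)))" if "thom (Suc q) B D G" for G
      using thomD(3)[OF that r p _ pc(1)] pc(4) by simp
    show ?case using eq[OF \<open>thom (Suc q) B D F\<close>] eq[OF \<open>thom (Suc q) B D F'\<close>] P[OF l]
      Suc.hyps(1)[OF _ r] Suc.hyps(2) mass_rem[OF Suc.prems mk] by simp
  qed
qed

end

lemma rem_comm: "rem D q b (rem D q m x) = rem D q m (rem D q b x)"
  by (intro ext) (simp add: rem_def algebra_simps)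

text \<open>Here and in the next two lemmas, splitting off from a composite takes place in one
  factor. Along \<open>q\<close> it is the factor \<open>y\<close> that acts first; along
  \<open>k < q\<close> it can be either one, and in the first step the other factor appears only
  through its \<open>q\<close>-source.\<close>

lemma tcmp_comm_rem:
  assumes "tbd Neg q x = tbd Pos q y"
  shows "rem D q m (tcmp q x y) = tcmp q x (rem D q m y)" "lift D q m (tcmp q x y) = lift D q m y"
    "tbd Neg q x = tbd Pos q (rem D q m y)"
proof -
  note e = tbd_eqD[OF assms]
  show "rem D q m (tcmp q x y) = tcmp q x (rem D q m y)"
    by (intro ext) (simp add: rem_def tcmp_eq algebra_simps)
  show "lift D q m (tcmp q x y) = lift D q m y"
    by (intro ext) (simp add: lift_def tcmp_eq algebra_simps)
  show "tbd Neg q x = tbd Pos q (rem D q m y)"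
    unfolding assms by (intro ext) (simp add: rem_def tbd_eq)
qed

lemma tcmp_comm_rem_right:
  assumes "k < q" "tbd Neg k x = tbd Pos k y"
  shows "rem D q m (tcmp k x y) = tcmp k x (rem D q m y)"
    "lift D q m (tcmp k x y) = tcmp k (tbd Neg q x) (lift D q m y)"
    "tbd Neg k x = tbd Pos k (rem D q m y)" "tbd Neg k (tbd Neg q x) = tbd Pos k (lift D q m y)"
proof -
  show "rem D q m (tcmp k x y) = tcmp k x (rem D q m y)"
    using assms(1) by (intro ext) (simp add: rem_def tcmp_eq algebra_simps)
  show "lift D q m (tcmp k x y) = tcmp k (tbd Neg q x) (lift D q m y)"
    using assms(1) by (intro ext) (simp add: lift_def tcmp_eq tbd_eq algebra_simps)
  show "tbd Neg k x = tbd Pos k (rem D q m y)"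
    unfolding assms(2) using assms(1) by (intro ext) (simp add: rem_def tbd_eq)
  show "tbd Neg k (tbd Neg q x) = tbd Pos k (lift D q m y)"
    unfolding tbd_tbd_less[OF assms(1)] assms(2) using assms(1) by (intro ext) (simp add: lift_def tbd_eq)
qed

lemma tcmp_comm_rem_left:
  assumes "k < q" "tbd Neg k x = tbd Pos k y"
  shows "rem D q m (tcmp k x y) = tcmp k (rem D q m x) y"
    "lift D q m (tcmp k x y) = tcmp k (lift D q m x) (tbd Neg q y)"
    "tbd Neg k (rem D q m x) = tbd Pos k y" "tbd Neg k (lift D q m x) = tbd Pos k (tbd Neg q y)"
proof -
  show "rem D q m (tcmp k x y) = tcmp k (rem D q m x) y"
    using assms(1) by (intro ext) (simp add: rem_def tcmp_eq algebra_simps)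
  show "lift D q m (tcmp k x y) = tcmp k (lift D q m x) (tbd Neg q y)"
    using assms(1) by (intro ext) (simp add: lift_def tcmp_eq tbd_eq algebra_simps)
  show "tbd Neg k (rem D q m x) = tbd Pos k y"
    unfolding assms(2)[symmetric] using assms(1) by (intro ext) (simp add: rem_def tbd_eq)
  show "tbd Neg k (lift D q m x) = tbd Pos k (tbd Neg q y)"
    unfolding tbd_tbd_less[OF assms(1)] assms(2)[symmetric] using assms(1) by (intro ext) (simp add: lift_def tbd_eq)
qed

lemma keys_nonneg_add: "\<lbrakk>nonneg c; nonneg c'\<rbrakk> \<Longrightarrow> ks (c + c') = ks c \<union> ks c'"
  unfolding nonneg_def
  by (auto simp: in_keys_iff lookup_add) (metis add_nonneg_eq_0_iff)+

context one_sorted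
begin

text \<open>Compatibility with composites along \<open>k < q\<close> is interchange. On cells of
  dimension below \<open>q\<close> the two maps agree, and composing them along \<open>q\<close>
  changes nothing.\<close>

lemma thom_cmp:
  assumes "thom q B D F" "thom q B D G" "\<And>y. y \<in> tcells B D q \<Longrightarrow> d Neg q (G y) = d Pos q (F y)"
  shows "thom q B D (\<lambda>y. cmp q (G y) (F y))"
proof -
  note F = thomD[OF assms(1)] and G = thomD[OF assms(2)]
  have c: "cmp q (G y) (F y) \<in> M" if "y \<in> tcells B D q" for y
    using cmp_closed F(1) G(1) assms(3) that by simp
  have 1: "cmp q (G (tbd \<alpha> k y)) (F (tbd \<alpha> k y)) = d \<alpha> k (cmp q (G y) (F y))" if y: "y \<in> tcells B D q" "k < q" for y k \<alpha>
  proof -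
    have "d \<alpha> k (cmp q (G y) (F y)) = d \<alpha> k (F y)" "d \<alpha> k (cmp q (G y) (F y)) = d \<alpha> k (G y)"
      using d_cmp_less[of "G y" "F y" q k \<alpha>] F(1) G(1) assms(3) y by auto
    moreover have "G (tbd \<alpha> k y) = d \<alpha> k (G y)" "F (tbd \<alpha> k y) = d \<alpha> k (F y)" using F(2) G(2) y by auto
    moreover have "cell q (d \<alpha> k (F y))" using cell_d[of "F y" k \<alpha>] F(1) y cell_mono[of k _ q] by simp
    ultimately show ?thesis using cmp_cell[of q "d \<alpha> k (F y)" "d \<alpha> k (F y)"] d_cell[of q "d \<alpha> k (F y)" q] by simp
  qed
  have 2: "cmp q (G (tcmp k x y)) (F (tcmp k x y)) = cmp k (cmp q (G x) (F x)) (cmp q (G y) (F y))"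
    if "x \<in> tcells B D q" "y \<in> tcells B D q" "k < q" "tbd Neg k x = tbd Pos k y" for x y k
  proof -
    have "cmp q (cmp k (G x) (G y)) (cmp k (F x) (F y)) = cmp k (cmp q (G x) (F x)) (cmp q (G y) (F y))"
      by (rule cmp_interchange[symmetric])
        (use that F(1) G(1) assms(3) G(4) in auto)
    then show ?thesis using F(3) G(3) that by simp
  qed
  show ?thesis unfolding thom_def using c 1 2 by simp
qed

lemma thom_subst:
  assumes "loop_free \<kappa> B D" "E \<subseteq> B (Suc q)" "A \<subseteq> E" "thom q (demB E q B) (demD E D) F"
  shows "thom q (demB E q B) (demD E D) (\<lambda>y. F (subst A \<beta> D q y))"
proof -
  note F = thomD[OF assms(4)] and s = subst_tcells[OF assms(1,2) _ assms(3)]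
  have "F (subst A \<beta> D q (tbd \<alpha> k x)) = d \<alpha> k (F (subst A \<beta> D q x))"
    if "x \<in> tcells (demB E q B) (demD E D) q" "k < q" for x k \<alpha>
    using F(2)[OF s[OF that(1)] that(2), of \<alpha> \<beta>] that by (simp add: tbd_subst subst_tbd)
  moreover have "F (subst A \<beta> D q (tcmp k x y)) = cmp k (F (subst A \<beta> D q x)) (F (subst A \<beta> D q y))"
    if "x \<in> tcells (demB E q B) (demD E D) q" "y \<in> tcells (demB E q B) (demD E D) q" "k < q"
      "tbd Neg k x = tbd Pos k y" for x y k
    using F(3)[OF s[OF that(1)] s[OF that(2)] that(3), of \<beta> \<beta>] that by (simp add: tbd_subst subst_tcmp)
  ultimately show ?thesis unfolding thom_def using F(1) s by auto
qed

lemma thom_d: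
  assumes "thom q B D F" shows "thom q B D (\<lambda>y. d \<alpha> q (F y))"
proof -
  note F = thomD[OF assms]
  have "d \<alpha> q (F (tbd \<beta> k x)) = d \<beta> k (d \<alpha> q (F x))" if "x \<in> tcells B D q" "k < q" for x k \<beta>
    using F(1,2) that d_d_ge d_d_less by simp
  moreover have "d \<alpha> q (F (tcmp k x y)) = cmp k (d \<alpha> q (F x)) (d \<alpha> q (F y))"
    if "x \<in> tcells B D q" "y \<in> tcells B D q" "k < q" "tbd Neg k x = tbd Pos k y" for x y k
    using F(1,3,4) that d_cmp by simp
  ultimately show ?thesis unfolding thom_def using F(1) d_closed by auto
qed

lemma thom_tbd_prom:
  assumes "loop_free \<kappa> B D" "E \<subseteq> B (Suc q)" "thom q B D F"
  shows "thom q (demB E q B) (demD E D) (\<lambda>y. F (tbd \<alpha> q (prom E D q y)))"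
proof -
  note F = thomD[OF assms(3)] and p = prom_tcells[OF assms(1,2)]
  have t: "tbd \<alpha> q (prom E D q y) \<in> tcells B D q" if "y \<in> tcells (demB E q B) (demD E D) q" for y
    using tbd_tcells[OF p[OF that]] by simp
  have "F (tbd \<alpha> q (prom E D q (tbd \<beta> k x))) = d \<beta> k (F (tbd \<alpha> q (prom E D q x)))"
    if "x \<in> tcells (demB E q B) (demD E D) q" "k < q" for x k \<beta>
    using F(2)[OF t[OF that(1)] that(2), of \<beta>] that by (simp add: tbd_prom prom_tbd tbd_tbd_less tbd_tbd_ge)
  moreover have "F (tbd \<alpha> q (prom E D q (tcmp k x y))) = cmp k (F (tbd \<alpha> q (prom E D q x))) (F (tbd \<alpha> q (prom E D q y)))"
    if "x \<in> tcells (demB E q B) (demD E D) q" "y \<in> tcells (demB E q B) (demD E D) q" "k < q"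
      "tbd Neg k x = tbd Pos k y" for x y k
    using F(3)[OF t[OF that(1)] t[OF that(2)] that(3)] that by (simp add: tbd_prom prom_tcmp tbd_tcmp tbd_tbd_less)
  ultimately show ?thesis unfolding thom_def using F(1) t by auto
qed

text \<open>The universal property, one dimension at a time. For the demoted complex the induction
  hypothesis yields \<open>Ft\<close>, which gives the value of one generator in its context; a
  \<open>(q+1)\<close>-cell goes to the composite of the values of its successive steps. These steps
  can be taken in many orders, and the work lies in the independence of the order
  (\<open>peel\<close>). Functoriality follows by peeling a composite in a convenient order.\<close>

lemma thom_extend:
  assumes "loop_free \<kappa> B D" "0 < q \<Longrightarrow> thom (q - 1) B D F" "\<And>x. \<lbrakk>0 < q; x \<in> tcells B D (q - 1)\<rbrakk> \<Longrightarrow> cell (q - 1) (F x)"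
    "\<And>b. b \<in> B q \<Longrightarrow> \<phi> b \<in> M" "\<And>b \<alpha>. \<lbrakk>0 < q; b \<in> B q\<rbrakk> \<Longrightarrow> d \<alpha> (q - 1) (\<phi> b) = F (tbd \<alpha> (q - 1) (atom D q b))"
  shows "\<exists>F'. thom q B D F' \<and> (0 < q \<longrightarrow> (\<forall>x\<in>tcells B D (q - 1). F' x = F x)) \<and> (\<forall>b\<in>B q. F' (atom D q b) = \<phi> b)"
  using assms
proof (induction q arbitrary: B D F \<phi>)
  case 0
  define F' where "F' = (\<lambda>x. \<phi> (SOME b. b \<in> B 0 \<and> x = atom D 0 b))"
  have "F' (atom D 0 b) = \<phi> b" if "b \<in> B 0" for b
  proof -
    have "(SOME b'. b' \<in> B 0 \<and> atom D 0 b = atom D 0 b') = b"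
    proof (rule some_equality)
      fix b' assume b': "b' \<in> B 0 \<and> atom D 0 b = atom D 0 b'"
      then have "atom D 0 b 0 Neg = atom D 0 b' 0 Neg" by simp
      then show "b' = b" by (simp add: atom_def frag_of_eq)
    qed (use that in simp)
    then show ?thesis by (simp add: F'_def)
  qed
  moreover have "thom 0 B D F'" unfolding thom_def using calculation 0(4) atom_0 by (metis less_nat_zero_code)
  ultimately show ?case by auto
next
  case (Suc q)
  define E where "E = B (Suc q)"
  define B' where "B' = demB E q B"
  define D' where "D' = demD E D"
  note lf = Suc.prems(1)
  have E: "E \<subseteq> B (Suc q)" by (simp add: E_def)
  have F: "thom q B D F" using Suc.prems(2) by simp
  have Fc: "cell q (F x)" if "x \<in> tcells B D q" for x using Suc.prems(3) that by simp
  have phi: "\<phi> b \<in> M" "d \<alpha> q (\<phi> b) = F (tbd \<alpha> q (atom D (Suc q) b))" if "b \<in> E" for b \<alpha>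
    using Suc.prems(4,5)[of b] that unfolding E_def by auto
  have lf': "loop_free \<kappa> B' D'" unfolding B'_def D'_def by (rule loop_free_dem[OF lf E])
  have low: "tcells B' D' p = tcells B D p" if "p < q" for p
    unfolding B'_def D'_def using tcells_dem_lower[OF lf E that] .
  have up: "tcells B D q \<subseteq> tcells B' D' q"
    unfolding B'_def D'_def using tcells_dem_upper[OF lf E] .
  have atB: "atom D' q g = atom D q g" if "g \<in> B q" for g
    unfolding D'_def using atom_demD[OF lf E _ that] by simp
  have atE: "tbd \<alpha> (q - 1) (atom D' q b) = tbd \<alpha> (q - 1) (atom D (Suc q) b)" if "b \<in> E" "0 < q" for b \<alpha>
  proof (intro ext)
    fix j \<beta>
    show "tbd \<alpha> (q - 1) (atom D' q b) j \<beta> = tbd \<alpha> (q - 1) (atom D (Suc q) b) j \<beta>"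
      unfolding D'_def tbd_eq using atom_demD_E[OF lf E that(1)] that(2) by (cases "j < q") auto
  qed
  have B'q: "g \<in> B' q \<longleftrightarrow> g \<in> B q \<or> g \<in> E" for g by (simp add: B'_def demB_def)
  have BE: "g \<notin> E" if "g \<in> B q" for g using E_disjoint[OF lf E _ that] by simp
  \<comment> \<open>A demoted generator receives its prescribed \<open>(q+1)\<close>-dimensional
    value, although it has dimension \<open>q\<close> in the demoted complex. This is legitimate
    because a map on \<open>q\<close>-cells only has to respect faces below
    \<open>q\<close>.\<close>
  define \<psi> where "\<psi> = (\<lambda>g. if g \<in> E then \<phi> g else F (atom D q g))"
  have "\<exists>F'. thom q B' D' F' \<and> (0 < q \<longrightarrow> (\<forall>x\<in>tcells B' D' (q - 1). F' x = F x)) \<and> (\<forall>b\<in>B' q. F' (atom D' q b) = \<psi> b)"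
  proof (rule Suc.IH[OF lf'])
    show "thom (q - 1) B' D' F" if "0 < q"
      by (rule thom_mono[OF F]) (use low[of "q - 1"] tcells_le[of "q - 1" q B D] that in auto)
    show "cell (q - 1) (F x)" if "0 < q" "x \<in> tcells B' D' (q - 1)" for x
      using thom_cell[OF F, of x "q - 1"] low[of "q - 1"] that by simp
    show "\<psi> b \<in> M" if "b \<in> B' q" for b
      using that B'q phi thomD(1)[OF F] atom_tcells[OF lf] by (auto simp: \<psi>_def)
    show "d \<alpha> (q - 1) (\<psi> b) = F (tbd \<alpha> (q - 1) (atom D' q b))" if "0 < q" "b \<in> B' q" for b \<alpha>
    proof (cases "b \<in> E")
      case True
      have "b \<in> B (Suc q)" using True by (simp add: E_def)
      then have t: "tbd \<beta> q (atom D (Suc q) b) \<in> tcells B D q" for \<beta> by (intro tbd_tcells[OF atom_tcells[OF lf]]) auto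
      have "d \<alpha> (q - 1) (\<phi> b) = d \<alpha> (q - 1) (d Neg q (\<phi> b))"
        using d_d_less[OF phi(1)[OF True], of "q - 1" q \<alpha> Neg] that by simp
      also have "\<dots> = d \<alpha> (q - 1) (F (tbd Neg q (atom D (Suc q) b)))" using phi(2)[OF True] by simp
      also have "\<dots> = F (tbd \<alpha> (q - 1) (tbd Neg q (atom D (Suc q) b)))"
        using thomD(2)[OF F t, of "q - 1" \<alpha>] that by simp
      finally show ?thesis using True atE[OF True that(1)] that by (simp add: \<psi>_def tbd_tbd_less)
    next
      case False
      then have "b \<in> B q" using that B'q by simp
      then show ?thesis using False thomD(2)[OF F atom_tcells[OF lf], of b "q - 1" \<alpha>] that atB by (simp add: \<psi>_def)
    qed
  qed
  then obtain Ft where Ft: "thom q B' D' Ft" and Ft1: "\<And>x. \<lbrakk>0 < q; x \<in> tcells B D (q - 1)\<rbrakk> \<Longrightarrow> Ft x = F x"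
    and Ft2: "\<And>b. b \<in> B' q \<Longrightarrow> Ft (atom D' q b) = \<psi> b"
    using low[of "q - 1"] by (metis diff_less less_numeral_extra(1))
  have Fta: "Ft (atom D q g) = F (atom D q g)" if "g \<in> B q" for g
    using Ft2[of g] B'q BE[OF that] atB[OF that] that by (simp add: \<psi>_def)
  have FtE: "Ft (atom D' q g) = \<phi> g" if "g \<in> E" for g
    using Ft2[of g] B'q that by (simp add: \<psi>_def)
  have FtF: "Ft x = F x" if "x \<in> tcells B D q" for x
  proof (rule thom_unique[OF lf thom_mono[OF Ft order_refl up] F _ _ that])
    show "Ft x = F x" if "0 < q" "x \<in> tcells B D (q - 1)" for x using Ft1 that by blast
    show "Ft (atom D q b) = F (atom D q b)" if "b \<in> B q" for b using Fta that by blast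
  qed
  define P where "P = prom E D q"
  have P: "P y \<in> tcells B D (Suc q)" if "y \<in> tcells B' D' q" for y
    unfolding P_def using prom_tcells[OF lf E] that unfolding B'_def D'_def by blast
  have P_old: "P y = y" if "y \<in> tcells B D q" for y unfolding P_def by (rule prom_old[OF lf E that])
  \<comment> \<open>The \<open>q\<close>-faces of \<open>Ft y\<close> are not covered by
    \<open>thom q\<close>. They are found by uniqueness: both sides are maps on the demoted complex
    with the same values on atoms.\<close>
  have dFt: "d \<alpha> q (Ft y) = F (tbd \<alpha> q (P y))" if y: "y \<in> tcells B' D' q" for \<alpha> y
  proof (rule thom_unique[OF lf' thom_d[OF Ft] _ _ _ y])
    show "thom q B' D' (\<lambda>y. F (tbd \<alpha> q (P y)))"
      unfolding B'_def D'_def P_def by (rule thom_tbd_prom[OF lf E F])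
    fix x assume x: "0 < q" "x \<in> tcells B' D' (q - 1)"
    then have xq: "x \<in> tcells B D q" using low[of "q - 1"] tcells_mono[of x B D "q - 1" q] by simp
    then show "d \<alpha> q (Ft x) = F (tbd \<alpha> q (P x))"
      using FtF[OF xq] P_old[OF xq] tbd_id[OF xq, of q] d_cell[OF Fc[OF xq]] by simp
  next
    fix b assume b: "b \<in> B' q"
    show "d \<alpha> q (Ft (atom D' q b)) = F (tbd \<alpha> q (P (atom D' q b)))"
    proof (cases "b \<in> E")
      case True
      then show ?thesis using FtE phi(2) prom_atom[OF lf E True] by (simp add: P_def D'_def)
    next
      case False
      then have bq: "b \<in> B q" using b B'q by simp
      then show ?thesis using Fta[OF bq] atB[OF bq] P_old[OF atom_tcells[OF lf bq]] tbd_id[OF atom_tcells[OF lf bq], of q]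
          d_cell[OF Fc[OF atom_tcells[OF lf bq]]] by simp
    qed
  qed
  \<comment> \<open>When all demoted generators of \<open>y\<close> act side by side,
    \<open>a\<close> may act first and the others afterwards. The right factor shows the others
    replaced by their sources, the left one shows \<open>a\<close> replaced by its target. Both
    sides are maps in \<open>y\<close> that agree on atoms.\<close>
  have split: "Ft y = cmp q (Ft (subst {a} Pos D q y)) (Ft (subst (E - {a}) Neg D q y))"
    if y: "y \<in> tcells B' D' q" and a: "a \<in> E" for y a
  proof (rule thom_unique[OF lf' Ft _ _ _ y])
    have s1: "thom q B' D' (\<lambda>y. Ft (subst {a} Pos D q y))" and s2: "thom q B' D' (\<lambda>y. Ft (subst (E - {a}) Neg D q y))"
      using thom_subst[OF lf E _ Ft[unfolded B'_def D'_def]] a unfolding B'_def D'_def by auto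
    show "thom q B' D' (\<lambda>y. cmp q (Ft (subst {a} Pos D q y)) (Ft (subst (E - {a}) Neg D q y)))"
    proof (rule thom_cmp[OF s2 s1])
      fix y assume y: "y \<in> tcells B' D' q"
      have t: "subst A \<beta> D q y \<in> tcells B' D' q" if "A \<subseteq> E" for A \<beta>
        using subst_tcells[OF lf E _ that] y unfolding B'_def D'_def by blast
      have Bq: "ks (part \<alpha> (D b)) \<subseteq> B q" if "b \<in> E" for b \<alpha> using part_D_keys[OF lf E that] .
      have id: "frag_extend (\<lambda>g. if g \<in> E then part \<gamma> (D g) else frag_of g) (part \<alpha> (D b)) = part \<alpha> (D b)" if "b \<in> E" for b \<alpha> \<gamma>
        by (rule extend_no_E[OF lf E Bq[OF that]]) simp
      have "frag_extend (\<lambda>g. if g \<in> E then part Neg (D g) else frag_of g)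
            (frag_extend (\<lambda>g. if g \<in> {a} then part Pos (D g) else frag_of g) (y q Neg))
          = frag_extend (\<lambda>g. if g \<in> E then part Pos (D g) else frag_of g)
            (frag_extend (\<lambda>g. if g \<in> E - {a} then part Neg (D g) else frag_of g) (y q Neg))"
        unfolding frag_extend_extend
      proof (rule frag_extend_eq)
        fix g
        show "frag_extend (\<lambda>g. if g \<in> E then part Neg (D g) else frag_of g) (if g \<in> {a} then part Pos (D g) else frag_of g)
          = frag_extend (\<lambda>g. if g \<in> E then part Pos (D g) else frag_of g) (if g \<in> E - {a} then part Neg (D g) else frag_of g)"
          using id[of g] a by (cases "g = a"; cases "g \<in> E") auto
      qed
      then have "tbd Neg q (P (subst {a} Pos D q y)) = tbd Pos q (P (subst (E - {a}) Neg D q y))"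
        using tcellsD(4)[OF y] by (intro ext) (simp add: tbd_eq P_def prom_def subst_def)
      then show "d Neg q (Ft (subst {a} Pos D q y)) = d Pos q (Ft (subst (E - {a}) Neg D q y))"
        using dFt t a by simp
    qed
    have old: "Ft x = cmp q (Ft (subst {a} Pos D q x)) (Ft (subst (E - {a}) Neg D q x))" if x: "x \<in> tcells B D q" for x
      using subst_old[OF lf E x] a FtF[OF x] cmp_cell[OF Fc[OF x] Fc[OF x]] d_cell[OF Fc[OF x]] by simp
    show "Ft x = cmp q (Ft (subst {a} Pos D q x)) (Ft (subst (E - {a}) Neg D q x))" if "0 < q" "x \<in> tcells B' D' (q - 1)" for x
      using old low[of "q - 1"] tcells_mono[of x B D "q - 1" q] that by simp
    show "Ft (atom D' q b) = cmp q (Ft (subst {a} Pos D q (atom D' q b))) (Ft (subst (E - {a}) Neg D q (atom D' q b)))"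
      if b: "b \<in> B' q" for b
    proof (cases "b \<in> E")
      case True
      have bS: "b \<in> B (Suc q)" using True by (simp add: E_def)
      have t: "tbd \<beta> q (atom D (Suc q) b) \<in> tcells B D q" for \<beta> by (rule tbd_tcells[OF atom_tcells[OF lf bS]]) simp
      have e: "Ft (tbd \<beta> q (atom D (Suc q) b)) = d \<beta> q (\<phi> b)" for \<beta> using FtF[OF t] phi(2)[OF True] by simp
      show ?thesis
      proof (cases "b = a")
        case ba: True
        then show ?thesis
          using subst_atom[OF lf E, of a "{a}" Pos] subst_atom_other[OF lf E a, of "E - {a}" Neg] a e[of Pos] FtE[OF True]
            cmp_unit_left[OF phi(1)[OF True]] by (simp add: D'_def)
      next
        case False
        then show ?thesis
          using subst_atom[OF lf E, of b "E - {a}" Neg] subst_atom_other[OF lf E True, of "{a}" Pos] True e[of Neg] FtE[OF True]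
            cmp_unit_right[OF phi(1)[OF True]] by (simp add: D'_def)
      qed
    next
      case False
      then have "b \<in> B q" using b B'q by simp
      then show ?thesis using old[OF atom_tcells[OF lf]] atB by simp
    qed
  qed
  \<comment> \<open>Splitting one and the same cell, in which both generators act side by side, at
    \<open>a\<close> and at \<open>b\<close> produces the two orders.\<close>
  have swap: "cmp q (Ft (lift D q b (rem D q a x))) (Ft (lift D q a x)) = cmp q (Ft (lift D q a (rem D q b x))) (Ft (lift D q b x))"
    if x: "x \<in> tcells B D (Suc q)" and ab: "a \<in> E" "b \<in> E" "a \<noteq> b"
      and le: "\<And>c. lk (part Neg (D a)) c + lk (part Neg (D b)) c \<le> lk (x q Neg) c" for x a b
  proof -
    \<comment> \<open>The source of \<open>x\<close> with \<open>a\<close> and \<open>b\<close> put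
      in the place of what they consume.\<close>
    define y where "y = (\<lambda>k \<alpha>. if k < q then x k \<alpha> else if k = q then x q Neg - part Neg (D a) - part Neg (D b) + frag_of a + frag_of b else 0)"
    have two: "Ft y = cmp q (Ft (lift D q b' (rem D q a' x))) (Ft (lift D q a' x))"
      if c: "a' = a \<and> b' = b \<or> a' = b \<and> b' = a" for a' b'
    proof -
      have ab': "a' \<in> E" "b' \<in> E" "a' \<noteq> b'" using ab c by auto
      let ?r = "x q Neg - part Neg (D a') - part Neg (D b')"
      have yq: "y q \<alpha> = ?r + frag_of a' + frag_of b'" for \<alpha> using c by (auto simp: y_def algebra_simps)
      have kr: "ks ?r \<subseteq> B q"
        by (rule subset_trans[OF keys_diff Un_least[OF subset_trans[OF keys_diff Un_least[OF
          tcellsD(2)[OF x, of q] part_D_keys[OF lf E ab'(1)]]] part_D_keys[OF lf E ab'(2)]]]) simp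
      have e: "frag_extend (\<lambda>g. if g \<in> A then part \<gamma> (D g) else frag_of g) ?r = ?r" if "A \<subseteq> E" for A \<gamma>
        by (rule extend_no_E[OF lf E kr that])
      have s2: "subst (E - {a'}) Neg D q y = lift D q a' x"
      proof (intro ext)
        fix k \<alpha>
        show "subst (E - {a'}) Neg D q y k \<alpha> = lift D q a' x k \<alpha>"
          using e[of "E - {a'}" Neg] ab' by (simp add: subst_def lift_def frag_extend_add yq) (simp add: y_def)
      qed
      have s1: "subst {a'} Pos D q y = lift D q b' (rem D q a' x)"
      proof (intro ext)
        fix k \<alpha>
        show "subst {a'} Pos D q y k \<alpha> = lift D q b' (rem D q a' x) k \<alpha>"
          using e[of "{a'}" Pos] ab' part_Pos[of "D a'"]
          by (simp add: subst_def lift_def rem_def frag_extend_add yq) (simp add: y_def)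
      qed
      have "y \<in> tcells B' D' q"
      proof -
        have en: "enabled D q a' x" unfolding enabled_def
        proof
          fix e
          have "0 \<le> lk (part Neg (D b')) e" using nonneg_part[of Neg "D b'"] by (simp add: nonneg_def)
          then show "lk (part Neg (D a')) e \<le> lk (x q Neg) e" using le[of e] c by auto
        qed
        note X = tcellsD[OF x]
        have l: "lift D q a' x \<in> tcells B' D' q" unfolding B'_def D'_def by (rule lift_tcells[OF lf E x ab'(1) en])
        note L = tcellsD[OF l]
        have r: "nonneg ?r" unfolding nonneg_def lookup_minus using le c by (auto simp: algebra_simps)
        have yk: "ks (y q \<alpha>) \<subseteq> B' q" for \<alpha>
          unfolding yq
        proof (rule subset_trans[OF Poly_Mapping.keys_add Un_least[OF subset_trans[OF Poly_Mapping.keys_add Un_least]]])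
          show "ks ?r \<subseteq> B' q" using kr B'q by blast
        qed (use ab' in \<open>simp_all add: keys_frag_of B'q\<close>)
        have yl: "y k \<alpha> = lift D q a' x k \<alpha>" if "k \<noteq> q" for k \<alpha> using that by (simp add: y_def lift_def)
        have yL: "y q \<alpha> = lift D q a' x q \<alpha> + (frag_of b' - part Neg (D b'))" for \<alpha> by (simp add: yq lift_def)
        have kD: "frag_extend D' (part Neg (D b')) = demD E D b'" 
          using extend_demD[OF lf E order_refl part_D_keys[OF lf E ab'(2), of Neg]] ab'(2) by (simp add: D'_def demD_def)
        have 1: "nonneg (y k \<alpha>) \<and> ks (y k \<alpha>) \<subseteq> B' k" if "k \<le> q" for k \<alpha>
          using L(1)[of k \<alpha>] L(2)[of k \<alpha>] yl[of k \<alpha>] yk[of \<alpha>] that yq[of \<alpha>]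
            nonneg_add[OF nonneg_add[OF r nonneg_frag_of] nonneg_frag_of] by (cases "k = q") auto
        have 2: "frag_extend D' (y (Suc k) \<alpha>) = y k Pos - y k Neg" if "k < q" for k \<alpha>
        proof (cases "Suc k = q")
          case True
          then have "frag_extend D' (y (Suc k) \<alpha>) = frag_extend D' (lift D q a' x (Suc k) \<alpha>)"
            using kD by (simp add: yL frag_extend_add frag_extend_diff D'_def)
          then show ?thesis using L(5)[OF that, of \<alpha>] yl[of k] that by simp
        next
          case False
          then show ?thesis using L(5)[OF that, of \<alpha>] yl[of k] yl[of "Suc k"] that by simp
        qed
        have 3: "augmentation (y 0 \<alpha>) = 1" for \<alpha>
          using L(6)[of \<alpha>] yl[of 0 \<alpha>] yL[of \<alpha>] augmentation_part_D[OF lf E ab'(2), of Neg]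
          by (cases "q = 0") (auto simp: augmentation_add augmentation_diff)
        show ?thesis unfolding tcells_def mem_Collect_eq using 1 2 3 by (auto simp: y_def)
      qed
      from split[OF this ab'(1)] show ?thesis unfolding s1 s2 .
    qed
    show ?thesis using two[of a b] two[of b a] by simp
  qed
  define pick where "pick = (\<lambda>x. SOME m. removable D q m x)"
  \<comment> \<open>Recursion on the mass, with an arbitrary removable generator at each stage;
    \<open>FF\<close> then starts with the number of stages that \<open>x\<close> requires.\<close>
  define G where "G = rec_nat F (\<lambda>n g x. cmp q (g (rem D q (pick x) x)) (Ft (lift D q (pick x) x)))"
  define FF where "FF = (\<lambda>x. G (mass q x) x)"
  have FF0: "FF x = F x" if "x \<in> tcells B D q" for x
    using mass_tcells[OF that] by (simp add: FF_def G_def)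
  have pick: "removable D q (pick x) x" if "x \<in> tcells B D (Suc q)" "mass q x \<noteq> 0" for x
  proof -
    have "x (Suc q) Neg \<noteq> 0" using that(2) by (auto simp: mass_def)
    then show ?thesis unfolding pick_def using someI_ex[OF removable_exists[OF lf that(1)]] by blast
  qed
  have keysE: "b \<in> E" if "x \<in> tcells B D (Suc q)" "b \<in> ks (x (Suc q) Neg)" for x b
    using tcellsD(2)[OF that(1), of "Suc q" Neg] that(2) by (auto simp: E_def)
  have pick': "pick x \<in> ks (x (Suc q) Neg)" "pick x \<in> E" "enabled D q (pick x) x"
    "rem D q (pick x) x \<in> tcells B D (Suc q)" "mass q x = Suc (mass q (rem D q (pick x) x))"
    if "x \<in> tcells B D (Suc q)" "mass q x \<noteq> 0" for x
  proof -
    show 1: "pick x \<in> ks (x (Suc q) Neg)" using pick[OF that] by (simp add: removable_def)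
    show "pick x \<in> E" using keysE[OF that(1) 1] .
    show 2: "enabled D q (pick x) x" using removable_enabled[OF that(1) pick[OF that]] .
    show "rem D q (pick x) x \<in> tcells B D (Suc q)" using rem_tcells[OF lf E that(1) 1 2] .
    show "mass q x = Suc (mass q (rem D q (pick x) x))" using mass_rem[OF that(1) 1] .
  qed
  have FFS: "FF x = cmp q (FF (rem D q (pick x) x)) (Ft (lift D q (pick x) x))"
    if "x \<in> tcells B D (Suc q)" "mass q x \<noteq> 0" for x
    using pick'(5)[OF that] by (simp add: FF_def G_def)
  have lift: "lift D q b x \<in> tcells B' D' q" "d Pos q (Ft (lift D q b x)) = F (tbd Neg q (rem D q b x))"
      "d Neg q (Ft (lift D q b x)) = F (tbd Neg q x)" "Ft (lift D q b x) \<in> M"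
    if "x \<in> tcells B D (Suc q)" "b \<in> E" "enabled D q b x" for x b
  proof -
    show 1: "lift D q b x \<in> tcells B' D' q" unfolding B'_def D'_def by (rule lift_tcells[OF lf E that])
    note pc = peel_composable[OF lf E that(1,2)]
    show "d Pos q (Ft (lift D q b x)) = F (tbd Neg q (rem D q b x))" "d Neg q (Ft (lift D q b x)) = F (tbd Neg q x)"
      using dFt[OF 1] pc by (simp_all add: P_def)
    show "Ft (lift D q b x) \<in> M" using thomD(1)[OF Ft 1] .
  qed
  have dFF: "FF x \<in> M \<and> d \<alpha> q (FF x) = F (tbd \<alpha> q x)" if "x \<in> tcells B D (Suc q)" for x \<alpha>
    using that
  proof (induction "mass q x" arbitrary: x \<alpha>)
    case 0
    then have x: "x \<in> tcells B D q" using mass_0_tcells by metis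
    then show ?case using FF0 Fc[OF x] tbd_id[OF x, of q] d_cell[OF Fc[OF x]] cell_closed by simp
  next
    case (Suc n)
    then have m: "mass q x \<noteq> 0" by simp
    note p = pick'[OF Suc.prems m]
    note l = lift[OF Suc.prems p(2,3)]
    have IH: "FF (rem D q (pick x) x) \<in> M \<and> d \<beta> q (FF (rem D q (pick x) x)) = F (tbd \<beta> q (rem D q (pick x) x))" for \<beta>
      using Suc.hyps(1)[OF _ p(4)] Suc.hyps(2) p(5) by simp
    have c: "d Neg q (FF (rem D q (pick x) x)) = d Pos q (Ft (lift D q (pick x) x))" using IH l by simp
    show ?case unfolding FFS[OF Suc.prems m]
      using cmp_closed d_Neg_cmp d_Pos_cmp IH l c peel_composable(3)[OF lf E Suc.prems p(2)] by (cases \<alpha>) auto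
  qed
  \<comment> \<open>Independence of the choice. The picked \<open>m\<close> and any enabled
    \<open>b\<close> can act in either order by \<open>removable_joint\<close>, so the induction
    hypothesis for the two remainders and \<open>swap\<close> close a diamond.\<close>
  have peel: "FF x = cmp q (FF (rem D q b x)) (Ft (lift D q b x))"
    if "x \<in> tcells B D (Suc q)" "b \<in> ks (x (Suc q) Neg)" "enabled D q b x" for x b
    using that
  proof (induction "mass q x" arbitrary: x b)
    case 0
    then show ?case using mass_rem[OF 0(2,3)] by simp
  next
    case (Suc n)
    note x = Suc.prems(1)
    have m0: "mass q x \<noteq> 0" using Suc.hyps(2) by simp
    define m where "m = pick x"
    note p = pick'[OF x m0, folded m_def]
    show ?case
    proof (cases "b = m")
      case True
      then show ?thesis using FFS[OF x m0] m_def by simp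
    next
      case False
      have bE: "b \<in> E" using keysE[OF x Suc.prems(2)] .
      have J: "lk (part Neg (D m)) c + lk (part Neg (D b)) c \<le> lk (x q Neg) c" for c
        using removable_joint[OF x pick[OF x m0, folded m_def] Suc.prems(2) False Suc.prems(3)] .
      have xb: "rem D q b x \<in> tcells B D (Suc q)" using rem_tcells[OF lf E x Suc.prems(2,3)] .
      have eb: "enabled D q b (rem D q m x)" by (rule enabled_rem) (rule J)
      have em: "enabled D q m (rem D q b x)" using enabled_rem[of D b m x q] J by (simp add: add.commute)
      have kb: "b \<in> ks (rem D q m x (Suc q) Neg)" "m \<in> ks (rem D q b x (Suc q) Neg)"
        using Suc.prems(2) p(1) False by (auto simp: rem_def in_keys_iff lookup_minus)
      have mb: "mass q x = Suc (mass q (rem D q b x))" using mass_rem[OF x Suc.prems(2)] .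
      have xmb: "rem D q b (rem D q m x) \<in> tcells B D (Suc q)" using rem_tcells[OF lf E p(4) kb(1) eb] .
      have 1: "FF (rem D q m x) = cmp q (FF (rem D q b (rem D q m x))) (Ft (lift D q b (rem D q m x)))"
        using Suc.hyps(1)[OF _ p(4) kb(1) eb] Suc.hyps(2) p(5) by simp
      have 2: "FF (rem D q b x) = cmp q (FF (rem D q m (rem D q b x))) (Ft (lift D q m (rem D q b x)))"
        using Suc.hyps(1)[OF _ xb kb(2) em] Suc.hyps(2) mb by simp
      note l1 = lift[OF p(4) bE eb] and l2 = lift[OF xb p(2) em] and l3 = lift[OF x bE Suc.prems(3)] and l4 = lift[OF x p(2,3)]
      have dR: "d Neg q (FF (rem D q b (rem D q m x))) = F (tbd Neg q (rem D q b (rem D q m x)))"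
        "FF (rem D q b (rem D q m x)) \<in> M" using dFF[OF xmb] by auto
      have "FF x = cmp q (FF (rem D q m x)) (Ft (lift D q m x))" using FFS[OF x m0] m_def by simp
      also have "\<dots> = cmp q (FF (rem D q b (rem D q m x))) (cmp q (Ft (lift D q b (rem D q m x))) (Ft (lift D q m x)))"
        unfolding 1 using dR l1 l4 by (intro cmp_assoc) auto
      also have "cmp q (Ft (lift D q b (rem D q m x))) (Ft (lift D q m x)) = cmp q (Ft (lift D q m (rem D q b x))) (Ft (lift D q b x))"
        by (rule swap[OF x p(2) bE]) (use False J in auto)
      also have "cmp q (FF (rem D q b (rem D q m x))) \<dots> = cmp q (cmp q (FF (rem D q b (rem D q m x))) (Ft (lift D q m (rem D q b x)))) (Ft (lift D q b x))"
        using dR l2 l3 by (intro cmp_assoc[symmetric]) (auto simp: rem_comm)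
      also have "\<dots> = cmp q (FF (rem D q b x)) (Ft (lift D q b x))" unfolding 2 by (simp add: rem_comm)
      finally show ?thesis .
    qed
  qed
  have bd: "FF (tbd \<alpha> k x) = d \<alpha> k (FF x)" if x: "x \<in> tcells B D (Suc q)" and k: "k < Suc q" for x k \<alpha>
  proof -
    have t: "tbd \<alpha> k x \<in> tcells B D q" using tbd_tcells[OF x, of k \<alpha>] tcells_mono[of _ B D k q] k by simp
    show ?thesis
    proof (cases "k = q")
      case True
      then show ?thesis using FF0[OF t] dFF[OF x] by simp
    next
      case False
      then have kq: "k < q" using k by simp
      have tq: "tbd Neg q x \<in> tcells B D q" using tbd_tcells[OF x, of q Neg] by simp
      have "d \<alpha> k (FF x) = d \<alpha> k (d Neg q (FF x))" using d_d_less[of "FF x" k q \<alpha> Neg] dFF[OF x] kq by simp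
      also have "\<dots> = F (tbd \<alpha> k (tbd Neg q x))" using dFF[OF x] thomD(2)[OF F tq kq] by simp
      finally show ?thesis using FF0[OF t] kq by (simp add: tbd_tbd_less)
    qed
  qed
  \<comment> \<open>A generator picked for \<open>y\<close> is also enabled in the composite, where
    it need not be the picked one; thanks to \<open>peel\<close> it can be split off there
    first.\<close>
  have cq: "FF (tcmp q x y) = cmp q (FF x) (FF y)"
    if "x \<in> tcells B D (Suc q)" "y \<in> tcells B D (Suc q)" "tbd Neg q x = tbd Pos q y" for x y
    using that
  proof (induction "mass q y" arbitrary: y)
    case 0
    then have y: "y \<in> tcells B D q" using mass_0_tcells by metis
    have y': "tbd Neg q x = y" using 0(4) tbd_id[OF y, of q] by simp
    have "tcmp q x y = x" unfolding tcmp_def y' by (intro ext) simp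
    moreover have "FF y = d Neg q (FF x)" using dFF[OF 0(2)] y' FF0[OF y] by simp
    ultimately show ?case using cmp_unit_right[of "FF x" q] dFF[OF 0(2), of Neg] by simp
  next
    case (Suc n)
    note x = Suc.prems(1) and y = Suc.prems(2) and c = Suc.prems(3)
    have m0: "mass q y \<noteq> 0" using Suc.hyps(2) by simp
    define m where "m = pick y"
    note p = pick'[OF y m0, folded m_def]
    have z: "tcmp q x y \<in> tcells B D (Suc q)" using tcmp_tcells[OF x y c] by simp
    have zq: "tcmp q x y q Neg = y q Neg" by (simp add: tcmp_eq)
    have "ks (x (Suc q) Neg + y (Suc q) Neg) = ks (x (Suc q) Neg) \<union> ks (y (Suc q) Neg)"
      by (rule keys_nonneg_add) (use tcellsD(1)[OF x] tcellsD(1)[OF y] in auto)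
    then have zk: "m \<in> ks (tcmp q x y (Suc q) Neg)" using p(1) by (simp add: tcmp_eq)
    have ze: "enabled D q m (tcmp q x y)" using p(3) zq by (simp add: enabled_def)
    note cr = tcmp_comm_rem[OF c, of D m]
    note l = lift[OF y p(2,3)]
    have IH: "FF (tcmp q x (rem D q m y)) = cmp q (FF x) (FF (rem D q m y))"
      using Suc.hyps(1)[OF _ x p(4) cr(3)] Suc.hyps(2) p(5) by simp
    have "FF (tcmp q x y) = cmp q (cmp q (FF x) (FF (rem D q m y))) (Ft (lift D q m y))"
      using peel[OF z zk ze] cr IH by simp
    also have "\<dots> = cmp q (FF x) (cmp q (FF (rem D q m y)) (Ft (lift D q m y)))"
      using dFF[OF x] dFF[OF p(4)] l cr(3) by (intro cmp_assoc) auto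
    finally show ?case using FFS[OF y m0] m_def by simp
  qed
  \<comment> \<open>A step of either factor is a step of the composite, with the
    \<open>q\<close>-source of the other factor as additional context; interchange separates the two
    factors again.\<close>
  have ck: "FF (tcmp k x y) = cmp k (FF x) (FF y)"
    if "x \<in> tcells B D (Suc q)" "y \<in> tcells B D (Suc q)" "tbd Neg k x = tbd Pos k y" "k < q" for x y k
    using that
  proof (induction "mass q x + mass q y" arbitrary: x y rule: less_induct)
    case less
    note x = less.prems(1) and y = less.prems(2) and c = less.prems(3) and k = less.prems(4)
    have kS: "k < Suc q" using k by simp
    have z: "tcmp k x y \<in> tcells B D (Suc q)" using tcmp_tcells[OF x y c] k by simp
    have zq: "tcmp k x y j Neg = x j Neg + y j Neg" if "k < j" for j using that by (simp add: tcmp_eq)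
    have zk: "ks (tcmp k x y (Suc q) Neg) = ks (x (Suc q) Neg) \<union> ks (y (Suc q) Neg)"
      unfolding zq[OF kS] by (rule keys_nonneg_add) (use tcellsD(1)[OF x] tcellsD(1)[OF y] in auto)
    have en: "enabled D q m (tcmp k x y)" if "enabled D q m x \<or> enabled D q m y" for m
      unfolding enabled_def zq[OF k]
    proof
      fix a
      have "0 \<le> lk (x q Neg) a" "0 \<le> lk (y q Neg) a" using tcellsD(1)[OF x] tcellsD(1)[OF y] by (auto simp: nonneg_def)
      then show "lk (part Neg (D m)) a \<le> lk (x q Neg + y q Neg) a"
        using that unfolding enabled_def lookup_add by (metis add_increasing add_increasing2)
    qed
    have cF: "d Neg k (FF x) = d Pos k (FF y)" using bd[OF x kS, of Neg] bd[OF y kS, of Pos] c by simp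
    have xM: "FF x \<in> M" "FF y \<in> M" using dFF x y by auto
    have xq: "tbd Neg q x \<in> tcells B D q" "tbd Neg q y \<in> tcells B D q" using tbd_tcells[OF x, of q Neg] tbd_tcells[OF y, of q Neg] by auto
    consider "mass q y \<noteq> 0" | "mass q x \<noteq> 0" | "mass q x = 0" "mass q y = 0" by blast
    then show ?case
    proof cases
      case 1
      define m where "m = pick y"
      note p = pick'[OF y 1, folded m_def]
      note cr = tcmp_comm_rem_right[OF k c, of D m]
      note l = lift[OF y p(2,3)]
      have IH: "FF (tcmp k x (rem D q m y)) = cmp k (FF x) (FF (rem D q m y))"
        using less.hyps[OF _ x p(4) cr(3) k] p(5) by simp
      have "Ft (tcmp k (tbd Neg q x) (lift D q m y)) = cmp k (Ft (tbd Neg q x)) (Ft (lift D q m y))"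
        using thomD(3)[OF Ft subsetD[OF up xq(1)] l(1) k cr(4)] .
      then have L: "Ft (lift D q m (tcmp k x y)) = cmp k (d Neg q (FF x)) (Ft (lift D q m y))"
        using cr(2) FtF[OF xq(1)] dFF[OF x] by simp
      have "FF (tcmp k x y) = cmp q (cmp k (FF x) (FF (rem D q m y))) (cmp k (d Neg q (FF x)) (Ft (lift D q m y)))"
        using peel[OF z, of m] en[of m] zk p(1,3) cr(1) IH L by simp
      also have "\<dots> = cmp k (cmp q (FF x) (d Neg q (FF x))) (cmp q (FF (rem D q m y)) (Ft (lift D q m y)))"
        using k xM dFF[OF p(4)] l d_closed d_d_ge bd[OF x kS, of Neg] bd[OF p(4) kS, of Pos] cr(3)
        by (intro cmp_interchange[symmetric]) auto
      also have "\<dots> = cmp k (FF x) (FF y)" using FFS[OF y 1] m_def cmp_unit_right[OF xM(1)] by simp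
      finally show ?thesis .
    next
      case 2
      define m where "m = pick x"
      note p = pick'[OF x 2, folded m_def]
      note cr = tcmp_comm_rem_left[OF k c, of D m]
      note l = lift[OF x p(2,3)]
      have IH: "FF (tcmp k (rem D q m x) y) = cmp k (FF (rem D q m x)) (FF y)"
        using less.hyps[OF _ p(4) y cr(3) k] p(5) by simp
      have "Ft (tcmp k (lift D q m x) (tbd Neg q y)) = cmp k (Ft (lift D q m x)) (Ft (tbd Neg q y))"
        using thomD(3)[OF Ft l(1) subsetD[OF up xq(2)] k cr(4)] .
      then have L: "Ft (lift D q m (tcmp k x y)) = cmp k (Ft (lift D q m x)) (d Neg q (FF y))"
        using cr(2) FtF[OF xq(2)] dFF[OF y] by simp
      have "FF (tcmp k x y) = cmp q (cmp k (FF (rem D q m x)) (FF y)) (cmp k (Ft (lift D q m x)) (d Neg q (FF y)))"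
        using peel[OF z, of m] en[of m] zk p(1,3) cr(1) IH L by simp
      also have "\<dots> = cmp k (cmp q (FF (rem D q m x)) (Ft (lift D q m x))) (cmp q (FF y) (d Neg q (FF y)))"
        using k xM dFF[OF p(4)] l d_closed d_d_ge bd[OF y kS, of Pos] bd[OF p(4) kS, of Neg] cr(3)
        by (intro cmp_interchange[symmetric]) auto
      also have "\<dots> = cmp k (FF x) (FF y)" using FFS[OF x 2] m_def cmp_unit_right[OF xM(2)] by simp
      finally show ?thesis .
    next
      case 3
      then have x0: "x \<in> tcells B D q" and y0: "y \<in> tcells B D q" using mass_0_tcells x y by metis+
      then show ?thesis using FF0 tcmp_tcells[OF x0 y0 c k] thomD(3)[OF F x0 y0 k c] by simp
    qed
  qed
  have "thom (Suc q) B D FF"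
    unfolding thom_def using dFF bd cq ck by (metis less_antisym)
  moreover have "FF (atom D (Suc q) b) = \<phi> b" if b: "b \<in> B (Suc q)" for b
  proof -
    let ?x = "atom D (Suc q) b"
    have bE: "b \<in> E" using b by (simp add: E_def)
    note x = atom_tcells[OF lf b]
    have 1: "?x (Suc q) Neg = frag_of b" by (simp add: atom_def)
    have 2: "?x q Neg = part Neg (D b)" by (simp add: atom_def)
    have en: "enabled D q b ?x" unfolding enabled_def 2 by simp
    have r: "rem D q b ?x \<in> tcells B D (Suc q)" by (rule rem_tcells[OF lf E x _ en]) (simp add: 1)
    then have r': "rem D q b ?x \<in> tcells B D q" by (rule tcells_Suc_zero) (simp add: rem_def 1)
    have "lift D q b ?x = atom D' q b"
      unfolding D'_def by (intro ext) (use atom_demD_E[OF lf E bE] 2 in \<open>auto simp: lift_def\<close>)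
    then have "FF ?x = cmp q (F (rem D q b ?x)) (\<phi> b)" using peel[OF x _ en] FF0[OF r'] FtE[OF bE] 1 by simp
    moreover have "F (rem D q b ?x) = d Pos q (\<phi> b)"
      using phi(2)[OF bE, of Pos] peel_composable(3)[OF lf E x bE] tbd_id[OF r', of q] by simp
    ultimately show ?thesis using cmp_unit_left phi(1)[OF bE] by simp
  qed
  ultimately show ?case using FF0 by auto
qed

end

section \<open>A cell as one generator surrounded by whiskers\<close>

text \<open>A whisker along \<open>k\<close> has dimension at most \<open>k + 1\<close>, the shape
  that \<open>solve_left\<close> and \<open>solve_right\<close> require. The condition on the
  coefficient of \<open>g\<close> has content only for \<open>Suc k = q\<close>; for smaller
  \<open>k\<close> the entry of \<open>y\<close> in dimension \<open>q\<close> is zero.\<close>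

inductive whisk :: "(nat \<Rightarrow> 'b set) \<Rightarrow> ('b \<Rightarrow> 'b \<Rightarrow>\<^sub>0 int) \<Rightarrow> 'b \<Rightarrow> nat \<Rightarrow> 'b table \<Rightarrow> bool"
  for B D g q where
  base: "whisk B D g q (atom D q g)"
| left: "\<lbrakk>whisk B D g q x; k < q; y \<in> tcells B D (Suc k); lk (y q Neg) g = 0; tbd Neg k y = tbd Pos k x\<rbrakk>
    \<Longrightarrow> whisk B D g q (tcmp k y x)"
| right: "\<lbrakk>whisk B D g q x; k < q; y \<in> tcells B D (Suc k); lk (y q Neg) g = 0; tbd Neg k x = tbd Pos k y\<rbrakk>
    \<Longrightarrow> whisk B D g q (tcmp k x y)"

lemma whisk_tcells:
  assumes "loop_free \<kappa> B D" "g \<in> B q" "whisk B D g q x" shows "x \<in> tcells B D q"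
  using assms(3)
proof induction
  case base
  then show ?case using atom_tcells assms by metis
next
  case (left x k y)
  then show ?case using tcmp_tcells tcells_mono[of y B D "Suc k" q] by (metis Suc_leI)
next
  case (right x k y)
  then show ?case using tcmp_tcells tcells_mono[of y B D "Suc k" q] by (metis Suc_leI)
qed

text \<open>Whiskers occurring in a \<open>q\<close>-cell have dimension at most \<open>q\<close>,
  so those that avoid the demoted \<open>g\<close> are already cells of the original
  complex.\<close>

lemma prom_lower:
  assumes lf: "loop_free \<kappa> B D" and g: "g \<in> B (Suc q)" and k: "k < q"
    and y: "y \<in> tcells (demB {g} q B) (demD {g} D) (Suc k)" and y0: "lk (y q Neg) g = 0"
  shows "y \<in> tcells B D (Suc k)" "prom {g} D q y = y"
proof -
  note Y = tcellsD[OF y]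
  have E: "{g} \<subseteq> B (Suc q)" using g by simp
  have "y \<in> tcells (demB {g} q B) (demD {g} D) q" using tcells_mono[OF y] k by simp
  then have "y q Neg = y q Pos" using tcellsD(4) by blast
  then have y0': "g \<notin> ks (y q \<alpha>)" for \<alpha> using y0 by (cases \<alpha>) (auto simp: in_keys_iff)
  have kq: "ks (y j \<alpha>) \<subseteq> B j" if j: "j \<le> Suc k" for j \<alpha>
  proof (cases "j = q")
    case True
    then show ?thesis using Y(2)[OF j, of \<alpha>] y0'[of \<alpha>] by (auto simp: demB_def)
  next
    case False
    then show ?thesis using Y(2)[OF j, of \<alpha>] j k by (simp add: demB_def)
  qed
  have "frag_extend D (y (Suc j) \<alpha>) = frag_extend (demD {g} D) (y (Suc j) \<alpha>)" if "j < Suc k" for j \<alpha>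
    using kq[of "Suc j" \<alpha>] that k by (intro extend_demD[OF lf E, of "Suc j", symmetric]) auto
  then show "y \<in> tcells B D (Suc k)" unfolding tcells_def mem_Collect_eq
    using kq Y(1) Y(3-6) by simp
  show "prom {g} D q y = y"
  proof (intro ext)
    fix j \<alpha>
    have "frag_extend (\<lambda>h. if h \<in> {g} then part \<alpha> (D h) else frag_of h) (y q \<alpha>) = y q \<alpha>"
      by (rule frag_extend_id) (use y0' in auto)
    moreover have "frag_extend (\<lambda>h. if h \<in> {g} then frag_of h else 0) (y q \<alpha>) = 0"
      by (rule frag_extend_eq_0) (use y0' in auto)
    moreover have "y j \<alpha> = 0" if "q < j" using Y(3)[of j \<alpha>] that k by simp
    ultimately show "prom {g} D q y j \<alpha> = y j \<alpha>" by (simp add: prom_def)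
  qed
qed

lemma whisk_prom:
  assumes lf: "loop_free \<kappa> B D" and g: "g \<in> B (Suc q)"
    and w: "whisk (demB {g} q B) (demD {g} D) g q x"
  shows "whisk B D g (Suc q) (prom {g} D q x)"
  using w
proof induction
  case base
  have "{g} \<subseteq> B (Suc q)" using g by simp
  from prom_atom[OF lf this, of g] show ?case by (simp add: whisk.base)
next
  case (left x k y)
  note p = prom_lower[OF lf g left.hyps(2,3,4)]
  have y0: "lk (y (Suc q) Neg) g = 0" using tcellsD(3)[OF p(1), of "Suc q" Neg] left.hyps(2) by simp
  show ?case unfolding prom_tcmp[OF left.hyps(2)] p(2)
    by (rule whisk.left[OF left.IH _ p(1) y0]) (use left.hyps in \<open>simp_all add: tbd_prom\<close>)
next
  case (right x k y)
  note p = prom_lower[OF lf g right.hyps(2,3,4)]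
  have y0: "lk (y (Suc q) Neg) g = 0" using tcellsD(3)[OF p(1), of "Suc q" Neg] right.hyps(2) by simp
  show ?case unfolding prom_tcmp[OF right.hyps(2)] p(2)
    by (rule whisk.right[OF right.IH _ p(1) y0]) (use right.hyps in \<open>simp_all add: tbd_prom\<close>)
qed

text \<open>Generators other than \<open>g\<close> are peeled off as right whiskers along the top
  dimension until \<open>g\<close> itself is peeled; all that follows \<open>g\<close> is then a
  single left whisker. There remains \<open>g\<close> in its context, a cell of the complex with
  \<open>g\<close> demoted, in which \<open>g\<close> occurs once; the induction on \<open>q\<close>
  treats it.\<close>

theorem whisk_exists:
  assumes "loop_free \<kappa> B D" "g \<in> B q" "x \<in> tcells B D q" "lk (x q Neg) g = 1"
  shows "whisk B D g q x"
  using assms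
proof (induction q arbitrary: B D x)
  case 0
  then obtain b where x: "x = atom D 0 b" using atom_0 by metis
  have "b = g" using 0(4) unfolding x by (auto simp: atom_def split: if_splits)
  then show ?case unfolding x by (simp add: whisk.base)
next
  case (Suc q)
  note lf = Suc.prems(1) and g = Suc.prems(2)
  show ?case using Suc.prems(3,4)
  proof (induction "mass q x" arbitrary: x)
    case 0
    then show ?case using mass_0 by fastforce
  next
    case (Suc n)
    note x = Suc.prems(1)
    have "x (Suc q) Neg \<noteq> 0" using Suc.prems(2) by auto
    then obtain m where m: "removable D q m x" using removable_exists[OF lf x] by blast
    have mk: "m \<in> ks (x (Suc q) Neg)" using m by (simp add: removable_def)
    have mB: "m \<in> B (Suc q)" using tcellsD(2)[OF x, of "Suc q" Neg] mk by auto
    have M: "{m} \<subseteq> B (Suc q)" using mB by simp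
    note en = removable_enabled[OF x m]
    note r = rem_tcells[OF lf M x mk en] and l = lift_tcells[OF lf M x _ en] and pc = peel_composable[OF lf M x]
    have p: "prom {m} D q (lift D q m x) \<in> tcells B D (Suc q)" by (rule prom_tcells[OF lf M l]) simp
    show ?case
    proof (cases "m = g")
      case False
      have "whisk B D g (Suc q) (rem D q m x)"
        using Suc.hyps(1)[OF _ r] Suc.hyps(2) mass_rem[OF x mk] Suc.prems(2) False by (simp add: rem_def lookup_minus)
      then have "whisk B D g (Suc q) (tcmp q (rem D q m x) (prom {m} D q (lift D q m x)))"
        by (rule whisk.right[OF _ _ p])
          (use False pc(1) prom_lift[OF lf M x] in auto)
      then show ?thesis using pc(4) by simp
    next
      case True
      have gE: "{g} \<subseteq> B (Suc q)" using g by simp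
      have gB: "g \<notin> B q" using E_disjoint[OF lf gE, of q g] by auto
      have "g \<notin> ks (x q Neg)" "g \<notin> ks (part Neg (D g))"
        using tcellsD(2)[OF x, of q Neg] part_D_keys[OF lf gE, of g Neg] gB by auto
      then have c: "lk (lift D q g x q Neg) g = 1" by (simp add: lift_def lookup_add lookup_minus in_keys_iff)
      have lt: "lift D q g x \<in> tcells (demB {g} q B) (demD {g} D) q" using l True by simp
      have "whisk (demB {g} q B) (demD {g} D) g q (lift D q g x)"
        by (rule \<open>\<And>B D x. \<lbrakk>loop_free \<kappa> B D; g \<in> B q; x \<in> tcells B D q; lk (x q Neg) g = 1\<rbrakk> \<Longrightarrow> whisk B D g q x\<close>
          [OF loop_free_dem[OF lf gE] _ lt c]) (simp add: demB_def)
      then have "whisk B D g (Suc q) (prom {g} D q (lift D q g x))" by (rule whisk_prom[OF lf g])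
      then have "whisk B D g (Suc q) (tcmp q (rem D q g x) (prom {g} D q (lift D q g x)))"
        by (rule whisk.left[OF _ _ r[unfolded True]])
          (use Suc.prems(2) pc(1) True in \<open>auto simp: rem_def lookup_minus\<close>)
      then show ?thesis using pc(4) True by simp
    qed
  qed
qed

context one_sorted
begin

text \<open>Whether a value has the right boundary can be said only by a map that already exists one
  dimension lower. Hence \<open>compat\<close> refers to every map that takes the prescribed values
  up to dimension \<open>q\<close>.\<close>

theorem thom_free:
  assumes lf: "loop_free \<kappa> B D" and \<phi>: "\<And>k b. b \<in> B k \<Longrightarrow> cell k (\<phi> b)"
    and compat: "\<And>q F b \<alpha>. \<lbrakk>thom q B D F; \<And>k c. \<lbrakk>k \<le> q; c \<in> B k\<rbrakk> \<Longrightarrow> F (atom D k c) = \<phi> c; b \<in> B (Suc q)\<rbrakk>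
      \<Longrightarrow> d \<alpha> q (\<phi> b) = F (tbd \<alpha> q (atom D (Suc q) b))"
  shows "\<exists>F. thom N B D F \<and> (\<forall>k\<le>N. \<forall>b\<in>B k. F (atom D k b) = \<phi> b) \<and> (\<forall>x\<in>tcells B D N. cell N (F x))"
proof (induction N)
  case 0
  obtain F where F: "thom 0 B D F" "\<forall>b\<in>B 0. F (atom D 0 b) = \<phi> b"
    using thom_extend[OF lf, of 0 undefined \<phi>] \<phi> cell_closed by (metis less_nat_zero_code)
  moreover have "cell 0 (F x)" if "x \<in> tcells B D 0" for x using that atom_0 F(2) \<phi> by metis
  ultimately show ?case by auto
next
  case (Suc N)
  then obtain F where F: "thom N B D F" "\<And>k b. \<lbrakk>k \<le> N; b \<in> B k\<rbrakk> \<Longrightarrow> F (atom D k b) = \<phi> b" "\<And>x. x \<in> tcells B D N \<Longrightarrow> cell N (F x)"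
    by blast
  have "\<exists>F'. thom (Suc N) B D F' \<and> (0 < Suc N \<longrightarrow> (\<forall>x\<in>tcells B D (Suc N - 1). F' x = F x)) \<and> (\<forall>b\<in>B (Suc N). F' (atom D (Suc N) b) = \<phi> b)"
    by (rule thom_extend[OF lf]) (use F compat[OF F(1,2)] cell_closed[OF \<phi>] in auto)
  then obtain F' where F': "thom (Suc N) B D F'" "\<And>x. x \<in> tcells B D N \<Longrightarrow> F' x = F x" "\<And>b. b \<in> B (Suc N) \<Longrightarrow> F' (atom D (Suc N) b) = \<phi> b"
    by auto
  have "d Neg (Suc N) (F' x) = F' x" if x: "x \<in> tcells B D (Suc N)" for x
    by (rule thom_unique[OF lf thom_d[OF F'(1)] F'(1) _ _ x])
      (use F'(2,3) d_cell[OF F(3)] d_cell[OF \<phi>] in auto)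
  then have "cell (Suc N) (F' x)" if "x \<in> tcells B D (Suc N)" for x using that thomD(1)[OF F'(1)] by (simp add: cell_def)
  moreover have "F' (atom D k b) = \<phi> b" if "k \<le> Suc N" "b \<in> B k" for k b
    using that F'(2,3) F(2) atom_tcells[OF lf that(2)] tcells_mono by (metis le_Suc_eq)
  ultimately show ?case using F'(1) by blast
qed

lemma thom_unique_atoms:
  assumes lf: "loop_free \<kappa> B D" and F: "thom N B D F" and G: "thom N B D G"
    and eq: "\<And>k b. \<lbrakk>k \<le> N; b \<in> B k\<rbrakk> \<Longrightarrow> F (atom D k b) = G (atom D k b)" and x: "x \<in> tcells B D N"
  shows "F x = G x"
proof -
  have "\<forall>x\<in>tcells B D q. F x = G x" if "q \<le> N" for q
    using that
  proof (induction q)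
    case 0
    then show ?case using eq atom_0 by (metis le0)
  next
    case (Suc q)
    have "tcells B D (Suc q) \<subseteq> tcells B D N" using tcells_le Suc.prems by blast
    then show ?case
      using thom_unique[OF lf thom_mono[OF F Suc.prems] thom_mono[OF G Suc.prems]] Suc eq by auto
  qed
  then show ?thesis using x by blast
qed

end

subsection \<open>Simplices as finite sets of vertices\<close>

definition sg :: "nat set \<Rightarrow> nat \<Rightarrow> int" where "sg S v = (- 1) ^ card {u\<in>S. u < v}"

text \<open>The boundary of a vertex is the empty simplex, so that \<open>bdry\<close> squares to zero in all degrees.\<close>

definition bdry :: "nat set \<Rightarrow> (nat set \<Rightarrow>\<^sub>0 int)" where
  "bdry S = (\<Sum>v\<in>S. frag_cmul (sg S v) (frag_of (S - {v})))"

text \<open>The cardinality \<open>Suc k\<close> excludes the empty simplex, which exists for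
  \<open>bdry\<close> only.\<close>

definition spx :: "nat set set \<Rightarrow> nat \<Rightarrow> nat set set" where
  "spx \<A> k = {S\<in>\<A>. finite S \<and> card S = Suc k}"

definition complex_on :: "nat \<Rightarrow> nat set set \<Rightarrow> bool" where
  "complex_on n \<A> \<longleftrightarrow> (\<forall>S\<in>\<A>. S \<subseteq> {..n} \<and> (\<forall>T\<subseteq>S. T \<noteq> {} \<longrightarrow> T \<in> \<A>))"

text \<open>Deleting \<open>v\<close> removes the term of \<open>v\<close> and reverses the signs of
  all later terms. Powers of 3 let the removed term dominate, because twice the sum of the later
  powers is still less than \<open>3 ^ (n - v)\<close>. The sign of \<open>v\<close> alone thus
  decides whether the key rises or falls.\<close>

definition key :: "nat \<Rightarrow> nat set \<Rightarrow> int" where "key n S = - (\<Sum>u\<in>S. sg S u * 3 ^ (n - u))"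

lemma sg_cases: "sg S v = 1 \<or> sg S v = - 1"
  unfolding sg_def by (metis minus_one_power_iff)

lemma sg_sq [simp]: "sg S v * sg S v = 1"
  using sg_cases[of S v] by auto

lemma sg_min: "(\<And>u. u \<in> S \<Longrightarrow> \<not> u < v) \<Longrightarrow> sg S v = 1"
proof -
  assume "\<And>u. u \<in> S \<Longrightarrow> \<not> u < v"
  then have "{u\<in>S. u < v} = {}" by auto
  then show ?thesis unfolding sg_def by (simp only: card.empty power_0)
qed

lemma sg_remove:
  assumes "finite S" "v \<in> S"
  shows "sg (S - {v}) w = (if v < w then - sg S w else sg S w)"
proof (cases "v < w")
  case True
  then have "{u\<in>S. u < w} = insert v {u\<in>S - {v}. u < w}" using assms by auto
  then have "card {u\<in>S. u < w} = Suc (card {u\<in>S - {v}. u < w})" using assms by simp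
  then show ?thesis using True by (simp add: sg_def)
next
  case False
  then have "{u\<in>S - {v}. u < w} = {u\<in>S. u < w}" using assms by auto
  then show ?thesis using False by (simp add: sg_def)
qed

lemma lookup_bdry:
  assumes "finite S" shows "lk (bdry S) T = (\<Sum>v\<in>S. if T = S - {v} then sg S v else 0)"
  unfolding bdry_def lookup_sum by (rule sum.cong) auto

lemma lookup_bdry_face:
  assumes "finite S" "v \<in> S" shows "lk (bdry S) (S - {v}) = sg S v"
proof -
  have "(\<Sum>w\<in>S. if S - {v} = S - {w} then sg S w else 0) = (\<Sum>w\<in>S. if w = v then sg S w else 0)"
    by (rule sum.cong) (use assms in auto)
  then show ?thesis using assms by (simp add: lookup_bdry)
qed

lemma lookup_bdry_nonzero:
  assumes "finite S" "lk (bdry S) T \<noteq> 0" obtains v where "v \<in> S" "T = S - {v}" "lk (bdry S) T = sg S v"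
proof -
  have "\<exists>v\<in>S. T = S - {v}"
  proof (rule ccontr)
    assume "\<not> ?thesis"
    then have "lk (bdry S) T = 0" unfolding lookup_bdry[OF assms(1)] by (intro sum.neutral) auto
    then show False using assms(2) by simp
  qed
  then show ?thesis using that lookup_bdry_face[OF assms(1)] by blast
qed

lemma keys_bdry: "finite S \<Longrightarrow> ks (bdry S) \<subseteq> (\<lambda>v. S - {v}) ` S"
  by (auto simp: in_keys_iff elim: lookup_bdry_nonzero)

lemma bdry_bdry:
  assumes "finite S" shows "frag_extend bdry (bdry S) = 0"
proof -
  define f where "f = (\<lambda>v w. if v = w then 0 else frag_cmul (sg S v * sg (S - {v}) w) (frag_of (S - {v} - {w})))"
  have anti: "f w v = - f v w" if "v \<in> S" "w \<in> S" for v w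
  proof (cases "v = w")
    case False
    have "S - {w} - {v} = S - {v} - {w}" by blast
    moreover have "sg S w * sg (S - {w}) v = - (sg S v * sg (S - {v}) w)"
      using sg_remove[OF assms that(1), of w] sg_remove[OF assms that(2), of v] False by (cases "v < w") auto
    ultimately show ?thesis using False by (simp add: f_def)
  qed (simp add: f_def)
  have "frag_extend bdry (bdry S) = (\<Sum>v\<in>S. frag_cmul (sg S v) (bdry (S - {v})))"
    unfolding bdry_def[of S] by (simp add: frag_extend_sum frag_extend_cmul assms)
  also have "\<dots> = (\<Sum>v\<in>S. \<Sum>w\<in>S. f v w)"
  proof (rule sum.cong[OF refl])
    fix v assume v: "v \<in> S"
    have "frag_cmul (sg S v) (bdry (S - {v})) = (\<Sum>w\<in>S - {v}. f v w)"
      unfolding bdry_def frag_cmul_sum by (rule sum.cong) (auto simp: f_def)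
    also have "\<dots> = (\<Sum>w\<in>S. f v w)" by (rule sum.mono_neutral_left) (use assms in \<open>auto simp: f_def\<close>)
    finally show "frag_cmul (sg S v) (bdry (S - {v})) = (\<Sum>w\<in>S. f v w)" .
  qed
  finally have X: "frag_extend bdry (bdry S) = (\<Sum>v\<in>S. \<Sum>w\<in>S. f v w)" .
  have "(\<Sum>v\<in>S. \<Sum>w\<in>S. f v w) = (\<Sum>w\<in>S. \<Sum>v\<in>S. f v w)" by (rule sum.swap)
  also have "\<dots> = (\<Sum>w\<in>S. \<Sum>v\<in>S. - f w v)" by (intro sum.cong refl anti)
  also have "\<dots> = - (\<Sum>w\<in>S. \<Sum>v\<in>S. f w v)" by (simp add: sum_negf)
  finally have neg: "frag_extend bdry (bdry S) = - frag_extend bdry (bdry S)" using X by simp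
  show ?thesis
  proof (rule poly_mapping_eqI)
    fix a
    have "lk (frag_extend bdry (bdry S)) a = - lk (frag_extend bdry (bdry S)) a" using neg lookup_uminus by metis
    then show "lk (frag_extend bdry (bdry S)) a = lk 0 a" by simp
  qed
qed

lemma frag_extend_bdry_bdry:
  assumes "\<And>S. S \<in> ks c \<Longrightarrow> finite S" shows "frag_extend bdry (frag_extend bdry c) = 0"
  unfolding frag_extend_extend by (rule frag_extend_eq_0) (use bdry_bdry assms in auto)

lemma augmentation_bdry:
  assumes "card S = 2" shows "augmentation (bdry S) = 0"
proof -
  have fin: "finite S" using assms card.infinite by fastforce
  obtain a b where "S = {a, b}" "a < b" using assms unfolding card_2_iff by (metis insert_commute nat_neq_iff)
  moreover have "sg {a, b} a = 1" by (rule sg_min) (use \<open>a < b\<close> in auto)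
  moreover have "{u \<in> {a, b}. u < b} = {a}" using \<open>a < b\<close> by auto
  then have "sg {a, b} b = - 1" by (simp add: sg_def)
  ultimately show ?thesis unfolding bdry_def augmentation_sum augmentation_cmul
    by simp
qed

lemma sum_powers_bound: "finite U \<Longrightarrow> U \<subseteq> {..<m} \<Longrightarrow> 2 * (\<Sum>i\<in>U. (3::int) ^ i) < 3 ^ m"
proof -
  assume "finite U" "U \<subseteq> {..<m}"
  then have "(\<Sum>i\<in>U. (3::int) ^ i) \<le> (\<Sum>i<m. 3 ^ i)" by (intro sum_mono2) auto
  moreover have "2 * (\<Sum>i<m. (3::int) ^ i) < 3 ^ m" by (induction m) auto
  ultimately show ?thesis by simp
qed

lemma key_face:
  assumes "S \<subseteq> {..n}" "v \<in> S"
  shows "sg S v = - 1 \<Longrightarrow> key n (S - {v}) < key n S" "sg S v = 1 \<Longrightarrow> key n S < key n (S - {v})"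
proof -
  have fin: "finite S" using assms(1) finite_subset by blast
  let ?U = "{u\<in>S - {v}. v < u}" and ?p = "\<lambda>u. (3::int) ^ (n - u)"
  have "key n (S - {v}) - key n S = sg S v * ?p v + ((\<Sum>u\<in>S - {v}. sg S u * ?p u) - (\<Sum>u\<in>S - {v}. sg (S - {v}) u * ?p u))"
    unfolding key_def using sum.remove[OF fin assms(2), of "\<lambda>u. sg S u * ?p u"] by simp
  also have "(\<Sum>u\<in>S - {v}. sg S u * ?p u) - (\<Sum>u\<in>S - {v}. sg (S - {v}) u * ?p u)
      = (\<Sum>u\<in>S - {v}. if v < u then 2 * (sg S u * ?p u) else 0)"
    unfolding sum_subtractf[symmetric] by (rule sum.cong) (simp_all add: sg_remove[OF fin assms(2)])
  also have "\<dots> = 2 * (\<Sum>u\<in>?U. sg S u * ?p u)"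
    unfolding sum_distrib_left by (rule sum.inter_filter[symmetric]) (use fin in simp)
  finally have diff: "key n (S - {v}) - key n S = sg S v * ?p v + 2 * (\<Sum>u\<in>?U. sg S u * ?p u)" .
  have inj: "inj_on (\<lambda>u. n - u) ?U"
  proof (rule inj_onI)
    fix x y assume "x \<in> ?U" "y \<in> ?U" "n - x = n - y"
    then show "x = y" using assms(1) diff_diff_cancel[of x n] diff_diff_cancel[of y n] by fastforce
  qed
  have "\<bar>\<Sum>u\<in>?U. sg S u * ?p u\<bar> \<le> (\<Sum>u\<in>?U. \<bar>sg S u * ?p u\<bar>)" by (rule sum_abs)
  also have "\<dots> = (\<Sum>u\<in>?U. ?p u)" 
  proof (rule sum.cong[OF refl])
    fix u
    show "\<bar>sg S u * ?p u\<bar> = ?p u" using sg_cases[of S u] by auto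
  qed
  also have "\<dots> = (\<Sum>i\<in>(\<lambda>u. n - u) ` ?U. 3 ^ i)" using sum.reindex[OF inj, of "\<lambda>i. (3::int) ^ i"] by (simp add: o_def)
  finally have le: "\<bar>\<Sum>u\<in>?U. sg S u * ?p u\<bar> \<le> (\<Sum>i\<in>(\<lambda>u. n - u) ` ?U. 3 ^ i)" .
  have "(\<lambda>u. n - u) ` ?U \<subseteq> {..<n - v}" using assms(1) by fastforce
  then have "2 * (\<Sum>i\<in>(\<lambda>u. n - u) ` ?U. (3::int) ^ i) < ?p v" by (intro sum_powers_bound) (use fin in auto)
  then have "2 * \<bar>\<Sum>u\<in>?U. sg S u * ?p u\<bar> < ?p v" using le by linarith
  then show "sg S v = - 1 \<Longrightarrow> key n (S - {v}) < key n S" "sg S v = 1 \<Longrightarrow> key n S < key n (S - {v})"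
    using diff by auto
qed

text \<open>The cone with apex \<open>a\<close>. The apex will always precede the other vertices, so
  that \<open>bdry_insert\<close> has a single sign and simplices can be built up from the largest
  vertex downwards.\<close>

definition cone_chain :: "nat \<Rightarrow> (nat set \<Rightarrow>\<^sub>0 int) \<Rightarrow> (nat set \<Rightarrow>\<^sub>0 int)" where
  "cone_chain a c = frag_extend (\<lambda>T. frag_of (insert a T)) c"

context
  fixes a :: nat and S :: "nat set"
  assumes fin: "finite S" and a: "\<And>v. v \<in> S \<Longrightarrow> a < v"
begin

lemma bdry_insert:
  assumes "T \<subseteq> S" shows "bdry (insert a T) = frag_of T - cone_chain a (bdry T)"
proof -
  have T: "finite T" "a \<notin> T" "\<And>v. v \<in> T \<Longrightarrow> a < v" using assms fin a finite_subset by auto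
  have sa: "sg (insert a T) a = 1" by (rule sg_min) (auto dest: T(3))
  have sv: "sg (insert a T) v = - sg T v" if "v \<in> T" for v
    using sg_remove[of "insert a T" a v] T that by auto
  have "bdry (insert a T) = frag_cmul (sg (insert a T) a) (frag_of (insert a T - {a}))
      + (\<Sum>v\<in>T. frag_cmul (sg (insert a T) v) (frag_of (insert a T - {v})))"
    unfolding bdry_def using T by simp
  also have "(\<Sum>v\<in>T. frag_cmul (sg (insert a T) v) (frag_of (insert a T - {v}))) = (\<Sum>v\<in>T. - frag_cmul (sg T v) (frag_of (insert a (T - {v}))))"
    by (rule sum.cong) (use sv T(2) in \<open>auto simp: insert_Diff_if\<close>)
  also have "\<dots> = - cone_chain a (bdry T)"
    unfolding cone_chain_def bdry_def by (simp add: frag_extend_sum frag_extend_cmul T sum_negf del: minus_frag_cmul)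
  finally show ?thesis using sa T(2) by simp
qed

lemma extend_bdry_cone:
  assumes "ks c \<subseteq> Pow S" shows "frag_extend bdry (cone_chain a c) = c - cone_chain a (frag_extend bdry c)"
proof -
  have "frag_extend bdry (cone_chain a c) = frag_extend (\<lambda>T. frag_of T - cone_chain a (bdry T)) c"
    unfolding cone_chain_def[of a c] frag_extend_extend by (rule frag_extend_eq) (use bdry_insert assms in auto)
  also have "\<dots> = frag_extend frag_of c - frag_extend (\<lambda>T. cone_chain a (bdry T)) c"
    by (rule frag_extend_fun_diff[symmetric])
  also have "frag_extend (\<lambda>T. cone_chain a (bdry T)) c = cone_chain a (frag_extend bdry c)"
    unfolding cone_chain_def frag_extend_extend ..
  finally show ?thesis using frag_expansion[of c] by simp
qed

lemma lookup_cone: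
  assumes "ks c \<subseteq> Pow S" shows "lk (cone_chain a c) T = (if a \<in> T then lk c (T - {a}) else 0)"
proof -
  have "lk (cone_chain a c) T = (\<Sum>U\<in>ks c. if U = T - {a} \<and> a \<in> T then lk c U else 0)"
    unfolding cone_chain_def lookup_frag_extend
  proof (rule sum.cong[OF refl])
    fix U assume "U \<in> ks c"
    then have "a \<notin> U" using assms a by blast
    then have "insert a U = T \<longleftrightarrow> U = T - {a} \<and> a \<in> T" by auto
    then show "lk c U * lk (frag_of (insert a U)) T = (if U = T - {a} \<and> a \<in> T then lk c U else 0)" by auto
  qed
  also have "\<dots> = (if a \<in> T then lk c (T - {a}) else 0)" by (auto simp: in_keys_iff)
  finally show ?thesis .
qed

text \<open>Simplices of \<open>P\<close> avoid \<open>a\<close> and those of the cone contain it,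
  so nothing cancels and the parts can be taken separately. The minus sign exchanges the two parts
  of \<open>Q\<close>.\<close>

lemma part_cone:
  assumes "ks P \<subseteq> Pow S" "ks Q \<subseteq> Pow S" "nonneg P"
  shows "part Neg (P - cone_chain a Q) = cone_chain a (part Pos Q)" "part Pos (P - cone_chain a Q) = P + cone_chain a (part Neg Q)"
proof -
  have z: "lk P T = 0" if "a \<in> T" for T
  proof -
    have "T \<notin> ks P" using that assms(1) a by blast
    then show ?thesis by (simp add: in_keys_iff)
  qed
  have p: "0 \<le> lk P T" for T using assms(3) by (simp add: nonneg_def)
  have k: "ks (part \<alpha> Q) \<subseteq> Pow S" for \<alpha> using keys_part[of \<alpha> Q] assms(2) by (rule subset_trans)
  show "part Neg (P - cone_chain a Q) = cone_chain a (part Pos Q)"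
  proof (rule poly_mapping_eqI)
    fix T
    show "lk (part Neg (P - cone_chain a Q)) T = lk (cone_chain a (part Pos Q)) T"
      using z[of T] p[of T] by (cases "a \<in> T") (simp_all add: lookup_part lookup_minus lookup_cone[OF assms(2)] lookup_cone[OF k])
  qed
  show "part Pos (P - cone_chain a Q) = P + cone_chain a (part Neg Q)"
  proof (rule poly_mapping_eqI)
    fix T
    show "lk (part Pos (P - cone_chain a Q)) T = lk (P + cone_chain a (part Neg Q)) T"
      using z[of T] p[of T] by (cases "a \<in> T") (simp_all add: lookup_part lookup_minus lookup_add lookup_cone[OF assms(2)] lookup_cone[OF k])
  qed
qed

lemma keys_bdry_Pow: "ks c \<subseteq> Pow S \<Longrightarrow> ks (frag_extend bdry c) \<subseteq> Pow S"
  by (rule keys_frag_extend_subset) (use keys_bdry fin finite_subset in blast)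

lemma spine_Pow: "ks (spine bdry S i) \<subseteq> Pow S"
proof (induction i)
  case (Suc i)
  then show ?case using keys_bdry_Pow keys_part by (metis spine.simps(2) subset_trans)
qed (simp add: keys_frag_of)

text \<open>Iterates \<open>bdry_insert\<close>: at each stage the negative part is a cone over a
  positive part computed in \<open>S\<close>. The atom of a simplex is thereby reduced to that of
  its face opposite the smallest vertex.\<close>

lemma spine_insert:
  "spine bdry (insert a S) (Suc i) = cone_chain a (part Pos (frag_extend bdry (spine bdry S i))) \<and>
    frag_extend bdry (spine bdry (insert a S) (Suc i))
      = part Pos (frag_extend bdry (spine bdry S i)) - cone_chain a (frag_extend bdry (spine bdry S (Suc i)))"
proof (induction i)
  let ?d = "frag_extend bdry"
  have step: "?d (cone_chain a (part Pos (?d (spine bdry S i)))) = part Pos (?d (spine bdry S i)) - cone_chain a (?d (spine bdry S (Suc i)))" for i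
  proof -
    let ?c = "?d (spine bdry S i)"
    have k: "ks ?c \<subseteq> Pow S" by (rule keys_bdry_Pow[OF spine_Pow])
    have "?d ?c = 0" by (rule frag_extend_bdry_bdry) (use spine_Pow[of i] fin finite_subset in blast)
    then have "?d (part Pos ?c) = ?d (part Neg ?c)" by (simp add: part_Pos frag_extend_add)
    moreover have "ks (part Pos ?c) \<subseteq> Pow S" using keys_part k by (rule subset_trans)
    ultimately show ?thesis using extend_bdry_cone by simp
  qed
  {
    case 0
    have "spine bdry (insert a S) (Suc 0) = cone_chain a (part Pos (?d (spine bdry S 0)))"
      using bdry_insert[OF order_refl] part_cone(1)[of "frag_of S" "bdry S"] keys_bdry_Pow[of "frag_of S"]
      by (simp add: keys_frag_of)
    with step[of 0] show ?case by simp
  next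
    case (Suc i)
    have "ks (part Pos (?d (spine bdry S i))) \<subseteq> Pow S" using keys_part keys_bdry_Pow[OF spine_Pow] by (rule subset_trans)
    from part_cone(1)[OF this keys_bdry_Pow[OF spine_Pow] nonneg_part, of "Suc i"]
    have "spine bdry (insert a S) (Suc (Suc i)) = cone_chain a (part Pos (?d (spine bdry S (Suc i))))"
      unfolding spine.simps(2)[of bdry "insert a S" "Suc i"] conjunct2[OF Suc.IH] .
    with step[of "Suc i"] show ?case by simp
  }
qed

end

text \<open>The augmentation is the boundary into the empty simplex; this is what the convention for
  \<open>bdry\<close> is good for.\<close>

lemma extend_bdry_vertices:
  assumes "\<And>T. T \<in> ks c \<Longrightarrow> finite T \<and> card T = 1"
  shows "frag_extend bdry c = frag_cmul (augmentation c) (frag_of {})"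
proof -
  have "bdry T = frag_of {}" if T: "T \<in> ks c" for T
  proof -
    obtain v where "T = {v}" using assms[OF T] card_1_singletonE by blast
    moreover have "sg {v} v = 1" by (rule sg_min) auto
    ultimately show ?thesis by (simp add: bdry_def)
  qed
  then have "frag_extend bdry c = frag_extend (\<lambda>T. frag_of {}) c" by (intro frag_extend_eq) auto
  also have "\<dots> = frag_cmul (augmentation c) (frag_of {})"
    by (rule poly_mapping_eqI) (simp add: lookup_frag_extend augmentation_def sum_distrib_right)
  finally show ?thesis .
qed

lemma spine_card: "\<lbrakk>finite S; T \<in> ks (spine bdry S i); i \<le> card S\<rbrakk> \<Longrightarrow> finite T \<and> card T = card S - i"
proof (induction i arbitrary: T)
  case (Suc i)
  then obtain U where U: "U \<in> ks (spine bdry S i)" "T \<in> ks (bdry U)"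
    using keys_part keys_frag_extend by (metis (no_types, lifting) UN_E spine.simps(2) subsetD)
  then have "finite U" "card U = card S - i" using Suc by auto
  then show ?case using keys_bdry[of U] U(2) by auto
qed (simp add: keys_frag_of)

lemma min_split:
  fixes S :: "nat set"
  assumes "finite S" "card S = Suc (Suc k)"
  shows "\<exists>a S'. S = insert a S' \<and> a = Min S \<and> finite S' \<and> card S' = Suc k \<and> (\<forall>v\<in>S'. a < v)"
proof -
  have ne: "S \<noteq> {}" using assms by auto
  have aS: "Min S \<in> S" using assms(1) ne by (rule Min_in)
  have "Min S < v" if "v \<in> S - {Min S}" for v
  proof -
    have "v \<noteq> Min S" "Min S \<le> v" using that Min_le[OF assms(1)] by auto
    then show ?thesis by linarith
  qed
  moreover have "S = insert (Min S) (S - {Min S})" "finite (S - {Min S})" "card (S - {Min S}) = Suc k"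
    using aS assms by auto
  ultimately show ?thesis by blast
qed

text \<open>When a new smallest vertex is added, the cone formula moves the source to the apex and
  leaves the target alone. Besides unitality of the basis this supplies the end points that matter
  for inner horns.\<close>

lemma atom_ends:
  assumes "finite S" "card S = Suc (Suc k)"
  shows "atom bdry (Suc k) S 0 Neg = frag_of {Min S} \<and> atom bdry (Suc k) S 0 Pos = frag_of {Max S}"
  using assms
proof (induction k arbitrary: S)
  case (0 S)
  have split: "\<exists>a S'. S = insert a S' \<and> a = Min S \<and> finite S' \<and> card S' = Suc 0 \<and> (\<forall>v\<in>S'. a < v)"
    using min_split[OF 0] by blast
  then obtain a S' where S: "S = insert a S'" "a = Min S" "finite S'" "card S' = Suc 0" and lt: "\<And>v. v \<in> S' \<Longrightarrow> a < v" by blast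
  let ?d = "frag_extend bdry"
  obtain b where b: "S' = {b}" using S(4) card_1_singletonE by (metis One_nat_def)
  have ab: "a < b" using lt b by simp
  have bd: "?d (spine bdry S 0) = frag_of S' - cone_chain a (frag_of {})"
    using bdry_insert[OF S(3) lt order_refl] extend_bdry_vertices[of "frag_of S'"] b S(1) by (simp add: keys_frag_of)
  have "atom bdry (Suc 0) S 0 \<alpha> = part \<alpha> (?d (spine bdry S 0))" for \<alpha> by (simp add: atom_def)
  moreover have "part Neg (?d (spine bdry S 0)) = cone_chain a (frag_of {})" "part Pos (?d (spine bdry S 0)) = frag_of S'"
    unfolding bd using part_disjoint[of "cone_chain a (frag_of {})" "frag_of S'"] b ab by (auto simp: cone_chain_def keys_frag_of)
  moreover have "Max S = b" using S(1) b ab by simp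
  ultimately show ?case using S(2) b by (simp add: cone_chain_def)
next
  case (Suc i S)
  have split: "\<exists>a S'. S = insert a S' \<and> a = Min S \<and> finite S' \<and> card S' = Suc (Suc i) \<and> (\<forall>v\<in>S'. a < v)"
    using min_split[OF Suc.prems] by blast
  then obtain a S' where S: "S = insert a S'" "a = Min S" "finite S'" "card S' = Suc (Suc i)" and lt: "\<And>v. v \<in> S' \<Longrightarrow> a < v" by blast
  let ?d = "frag_extend bdry"
  note IH = Suc.IH[OF S(3,4)]
  have A: "atom bdry (Suc i) S' 0 \<beta> = part \<beta> (?d (spine bdry S' i))" for \<beta> by (simp add: atom_def)
  have one: "augmentation (spine bdry S' (Suc i)) = 1" using IH A[of Neg] by simp
  have "?d (spine bdry S' (Suc i)) = frag_cmul (augmentation (spine bdry S' (Suc i))) (frag_of {})"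
    by (rule extend_bdry_vertices) (use spine_card[OF S(3), of _ "Suc i"] S(4) in auto)
  then have "?d (spine bdry S' (Suc i)) = frag_of {}" unfolding one by simp
  then have bd: "?d (spine bdry S (Suc i)) = part Pos (?d (spine bdry S' i)) - cone_chain a (frag_of {})"
    unfolding S(1) using conjunct2[OF spine_insert[OF S(3), of a i]] lt by (simp del: spine.simps)
  have k: "ks (part Pos (?d (spine bdry S' i))) \<subseteq> Pow S'"
    using keys_part keys_bdry_Pow[OF S(3) lt spine_Pow[OF S(3) lt]] by (rule subset_trans)
  have pc: "part Neg (frag_of ({} :: nat set)) = 0" "part Pos (frag_of ({} :: nat set)) = frag_of {}"
    by (rule poly_mapping_eqI; simp add: lookup_part)+
  have "part Neg (?d (spine bdry S (Suc i))) = cone_chain a (frag_of {})"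
    "part Pos (?d (spine bdry S (Suc i))) = part Pos (?d (spine bdry S' i)) + cone_chain a 0"
    unfolding bd using part_cone[OF S(3) lt k _ nonneg_part, of "frag_of {}"] pc by (auto simp: keys_frag_of)
  moreover have "Max S = Max S'"
  proof -
    have ne: "S' \<noteq> {}" using S(4) by auto
    have "a < Max S'" using lt[OF Max_in[OF S(3) ne]] .
    then show ?thesis using S(1,3) ne by simp
  qed
  moreover have "atom bdry (Suc (Suc i)) S 0 \<alpha> = part \<alpha> (?d (spine bdry S (Suc i)))" for \<alpha> by (simp add: atom_def)
  ultimately show ?case using IH A[of Pos] S(2) by (simp add: cone_chain_def)
qed

lemma atom_vertices:
  assumes "finite S" "card S = Suc k" shows "augmentation (atom bdry k S 0 \<alpha>) = 1"
proof (cases k)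
  case 0
  then show ?thesis by (simp add: atom_def)
next
  case (Suc i)
  then show ?thesis using atom_ends[of S i] assms by (cases \<alpha>) auto
qed

lemma spx_finite: "S \<in> spx \<A> k \<Longrightarrow> finite S" "S \<in> spx \<A> k \<Longrightarrow> card S = Suc k" "S \<in> spx \<A> k \<Longrightarrow> S \<in> \<A>"
  by (auto simp: spx_def)

theorem loop_free_spx:
  assumes "complex_on n \<A>" shows "loop_free (key n) (spx \<A>) bdry"
proof -
  have sub: "S \<subseteq> {..n}" "\<And>T. \<lbrakk>T \<subseteq> S; T \<noteq> {}\<rbrakk> \<Longrightarrow> T \<in> \<A>" if "S \<in> \<A>" for S
    using assms that unfolding complex_on_def by auto
  have f1: "ks (bdry S) \<subseteq> spx \<A> k" if S: "S \<in> spx \<A> (Suc k)" for k S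
  proof
    fix T assume "T \<in> ks (bdry S)"
    then obtain v where v: "v \<in> S" "T = S - {v}" using keys_bdry[OF spx_finite(1)[OF S]] by auto
    then have T: "card T = Suc k" "finite T" using spx_finite[OF S] by auto
    then have "T \<noteq> {}" by auto
    then show "T \<in> spx \<A> k" using sub(2)[OF spx_finite(3)[OF S], of T] v T by (auto simp: spx_def)
  qed
  have f2: "(lk (bdry S) T < 0 \<longrightarrow> key n T < key n S) \<and> (0 < lk (bdry S) T \<longrightarrow> key n S < key n T)"
    if S: "S \<in> spx \<A> (Suc k)" for k S T
  proof (cases "lk (bdry S) T = 0")
    case False
    then obtain v where v: "v \<in> S" "T = S - {v}" "lk (bdry S) T = sg S v"
      using lookup_bdry_nonzero[OF spx_finite(1)[OF S]] by blast
    then show ?thesis using key_face[OF sub(1)[OF spx_finite(3)[OF S]] v(1)] sg_cases[of S v] by auto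
  qed simp
  have f3: "spx \<A> i \<inter> spx \<A> j = {}" if "i \<noteq> j" for i j using that by (auto simp: spx_def)
  have f4: "augmentation (bdry S) = 0" if "S \<in> spx \<A> (Suc 0)" for S
    using augmentation_bdry[of S] spx_finite(2)[OF that] by simp
  show ?thesis unfolding loop_free_def
    by (intro conjI allI impI ballI)
      (simp_all add: f1 f3 f4 f2[THEN conjunct1, rule_format] f2[THEN conjunct2, rule_format]
        bdry_bdry[OF spx_finite(1)] atom_vertices[OF spx_finite(1,2)])
qed


subsection \<open>Nondegenerate simplices of the standard simplex\<close>

definition nd :: "nat \<Rightarrow> nat \<Rightarrow> (nat \<Rightarrow> nat) set" where
  "nd n k = {s \<in> simplex_hom k n. inj_on s {..k}}"

definition full :: "nat \<Rightarrow> nat set set" where "full n = {S. S \<subseteq> {..n} \<and> S \<noteq> {}}"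

definition en :: "nat \<Rightarrow> nat set \<Rightarrow> nat \<Rightarrow> nat" where
  "en k S = restrict (\<lambda>j. sorted_list_of_set S ! j) {..k}"

lemma complex_on_full: "complex_on n (full n)"
  unfolding complex_on_def full_def by blast

lemma spx_full: "S \<in> spx (full n) k \<longleftrightarrow> S \<subseteq> {..n} \<and> card S = Suc k"
  unfolding spx_def full_def using finite_subset[of S "{..n}"] by auto

lemma simplex_homD:
  assumes "s \<in> simplex_hom k n"
  shows "i \<le> k \<Longrightarrow> s i \<le> n" "\<lbrakk>i \<le> j; j \<le> k\<rbrakk> \<Longrightarrow> s i \<le> s j" "\<not> i \<le> k \<Longrightarrow> s i = undefined"
  using assms unfolding simplex_hom_def mono_on_def PiE_def extensional_def by auto

lemma simplex_homI:
  assumes "\<And>i. i \<le> k \<Longrightarrow> s i \<le> n" "\<And>i j. \<lbrakk>i \<le> j; j \<le> k\<rbrakk> \<Longrightarrow> s i \<le> s j"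
  shows "restrict s {..k} \<in> simplex_hom k n"
  using assms unfolding simplex_hom_def mono_on_def by auto

lemma simplex_hom_compose:
  assumes "f \<in> simplex_hom l m" "g \<in> simplex_hom m n"
  shows "compose {..l} g f \<in> simplex_hom l n"
  unfolding compose_def
  by (rule simplex_homI) (use simplex_homD[OF assms(1)] simplex_homD[OF assms(2)] in auto)

lemma nd_less:
  assumes "s \<in> nd n k" "i < j" "j \<le> k" shows "s i < s j"
proof -
  have s: "s \<in> simplex_hom k n" "inj_on s {..k}" using assms(1) by (auto simp: nd_def)
  have "s i \<le> s j" using simplex_homD(2)[OF s(1)] assms by simp
  moreover have "s i \<noteq> s j" using inj_onD[OF s(2), of i j] assms by auto
  ultimately show ?thesis by simp
qed

lemma standard_simplex_simps:
  "simplices (standard_simplex n) m = simplex_hom m n" "act (standard_simplex n) m k f s = compose {..m} s f"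
  by (simp_all add: standard_simplex_def)

text \<open>The coface skipping \<open>Suc i\<close>, the second of the two equal places, is a
  section of the codegeneracy.\<close>

lemma codegenerate:
  assumes "s \<in> simplex_hom (Suc m) n" "i \<le> m" "s i = s (Suc i)"
  shows "s = compose {..Suc m} (compose {..m} s (coface m (Suc i))) (codegeneracy m i)"
proof
  fix j
  show "s j = compose {..Suc m} (compose {..m} s (coface m (Suc i))) (codegeneracy m i) j"
  proof (cases "j \<le> Suc m")
    case True
    consider "j \<le> i" | "j = Suc i" | "Suc i < j" by linarith
    then show ?thesis
      by cases (use True assms in \<open>auto simp: compose_def codegeneracy_def coface_def\<close>)
  next
    case False
    then show ?thesis using simplex_homD(3)[OF assms(1)] by (simp add: compose_def)
  qed
qed

lemma coface_simplex_hom: "i \<le> Suc n \<Longrightarrow> coface n i \<in> simplex_hom n (Suc n)"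
  unfolding coface_def by (rule simplex_homI) auto

lemma nondegenerate_standard_simplex: "nondegenerate (standard_simplex n) k = nd n k"
proof -
  have "s \<in> nondegenerate (standard_simplex n) k \<longleftrightarrow> s \<in> nd n k" for s
  proof (cases "s \<in> simplex_hom k n")
    case True
    have "(\<exists>m i y. s = compose {..Suc m} y (codegeneracy m i) \<and> k = Suc m \<and> i \<le> m \<and> y \<in> simplex_hom m n)
        \<longleftrightarrow> \<not> inj_on s {..k}" (is "?L \<longleftrightarrow> ?R")
    proof
      assume ?L
      then obtain m i y where d: "s = compose {..Suc m} y (codegeneracy m i)" "k = Suc m" "i \<le> m" by blast
      then have "s i = s (Suc i)" by (simp add: compose_def codegeneracy_def)
      then show ?R using d inj_onD[of s "{..k}" i "Suc i"] by auto
    next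
      assume ?R
      then obtain a b where ab: "a < b" "b \<le> k" "s a = s b"
        unfolding inj_on_def by (metis atMost_iff linorder_neqE_nat)
      then obtain m where m: "k = Suc m" by (cases k) auto
      have "s a \<le> s (Suc a)" "s (Suc a) \<le> s b" using simplex_homD(2)[OF True, of a "Suc a"] simplex_homD(2)[OF True, of "Suc a" b] ab by auto
      then have "s a = s (Suc a)" using ab by simp
      moreover have "a \<le> m" using ab m by simp
      ultimately show ?L
        using codegenerate[OF True[unfolded m], of a] m simplex_hom_compose[OF coface_simplex_hom[of "Suc a" m] True[unfolded m]]
        by blast
    qed
    then show ?thesis using True by (auto simp: nondegenerate_def nd_def standard_simplex_simps)
  qed (simp add: nondegenerate_def nd_def standard_simplex_simps)
  then show ?thesis by blast
qed

lemma nd_image: "s \<in> nd n k \<Longrightarrow> s ` {..k} \<in> spx (full n) k"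
  using card_image[of s "{..k}"] simplex_homD(1) unfolding spx_full nd_def by fastforce

lemma en_nd:
  assumes "S \<in> spx (full n) k"
  shows "en k S \<in> nd n k" "en k S ` {..k} = S"
proof -
  have S: "finite S" "card S = Suc k" "S \<subseteq> {..n}" using assms spx_full[of S n k] finite_subset[of S "{..n}"] by auto
  let ?l = "sorted_list_of_set S"
  have l: "length ?l = Suc k" "sorted ?l" "distinct ?l" "set ?l = S" using S by auto
  have "en k S ` {..k} = set ?l"
    unfolding en_def set_conv_nth l(1) by (auto simp: less_Suc_eq_le image_def)
  then show img: "en k S ` {..k} = S" using l by simp
  have "inj_on (en k S) {..k}"
    using nth_eq_iff_index_eq[OF l(3)] l(1) unfolding inj_on_def en_def by auto
  moreover have "en k S \<in> simplex_hom k n"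
  proof -
    have "?l ! i \<le> n" if "i \<le> k" for i using nth_mem[of i ?l] l S that by auto
    then show ?thesis unfolding en_def
      by (intro simplex_homI) (use sorted_nth_mono[OF l(2)] l(1) in auto)
  qed
  ultimately show "en k S \<in> nd n k" by (simp add: nd_def)
qed

lemma en_image:
  assumes "s \<in> nd n k" shows "en k (s ` {..k}) = s"
proof -
  let ?l = "map s [0..<Suc k]"
  have nth: "?l ! i = s i" if "i \<le> k" for i using that nth_map_upt[of i "Suc k" 0 s] by simp
  have s: "s \<in> simplex_hom k n" "inj_on s {..k}" using assms by (auto simp: nd_def)
  have "sorted ?l"
    unfolding sorted_iff_nth_mono
  proof (intro allI impI)
    fix i j assume "i \<le> j" "j < length ?l"
    then have "i \<le> j" "j \<le> k" by simp_all
    then show "?l ! i \<le> ?l ! j" using simplex_homD(2)[OF s(1), of i j] nth[of i] nth[of j] by simp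
  qed
  moreover have set: "set [0..<Suc k] = {..k}" by (simp only: set_upt atLeast0LessThan lessThan_Suc_atMost)
  moreover have "distinct ?l" using s(2) by (simp only: distinct_map distinct_upt set simp_thms)
  moreover have "set ?l = s ` {..k}" by (simp only: set_map set)
  ultimately have l: "sorted_list_of_set (s ` {..k}) = ?l"
    using sorted_list_of_set.idem_if_sorted_distinct by metis
  show ?thesis
  proof
    fix j
    show "en k (s ` {..k}) j = s j"
      using nth[of j] simplex_homD(3)[OF s(1), of j] unfolding en_def l by simp
  qed
qed

lemma positive_chains_iff: "c \<in> positive_chains K k \<longleftrightarrow> nonneg c \<and> ks c \<subseteq> nondegenerate K k"
proof
  assume "c \<in> positive_chains K k"
  then show "nonneg c \<and> ks c \<subseteq> nondegenerate K k"
  proof induction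
    case (plus c d)
    then show ?case using nonneg_add Poly_Mapping.keys_add[of c d] by blast
  qed (auto simp: keys_frag_of)
next
  assume "nonneg c \<and> ks c \<subseteq> nondegenerate K k"
  then show "c \<in> positive_chains K k"
  proof (induction "nat (augmentation c)" arbitrary: c)
    case 0
    then have "c = 0" using nonneg_augmentation_0[of c] augmentation_nonneg[of c] by simp
    then show ?case by (simp add: positive_chains.zero)
  next
    case (Suc m)
    then have "c \<noteq> 0" by auto
    then obtain a where a: "a \<in> ks c" by (metis keys_eq_empty ex_in_conv)
    have aK: "a \<in> nondegenerate K k" using a Suc.prems by auto
    have "nonneg (c - frag_of a)" by (rule nonneg_minus_frag_of) (use Suc.prems a in simp_all)
    moreover have "ks (c - frag_of a) \<subseteq> nondegenerate K k"
      by (rule subset_trans[OF keys_diff Un_least]) (use Suc.prems aK in \<open>simp_all add: keys_frag_of\<close>)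
    moreover have "m = nat (augmentation (c - frag_of a))" using Suc.hyps(2) by (simp add: augmentation_diff)
    ultimately have "c - frag_of a \<in> positive_chains K k" using Suc.hyps(1)[of "c - frag_of a"] by simp
    from positive_chains.plus[OF this positive_chains.generator[OF aK]] show ?case by simp
  qed
qed

text \<open>An injective monotone map is determined by its image, so chains can be moved to vertex
  sets and back. The way back needs the degree \<open>k\<close>, because the maps produced by
  \<open>en\<close> are undefined outside \<open>{..k}\<close>.\<close>

definition tr :: "nat \<Rightarrow> ((nat \<Rightarrow> nat) \<Rightarrow>\<^sub>0 int) \<Rightarrow> (nat set \<Rightarrow>\<^sub>0 int)" where
  "tr k c = frag_extend (\<lambda>s. frag_of (s ` {..k})) c"

definition tr' :: "nat \<Rightarrow> (nat set \<Rightarrow>\<^sub>0 int) \<Rightarrow> ((nat \<Rightarrow> nat) \<Rightarrow>\<^sub>0 int)" where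
  "tr' k c = frag_extend (\<lambda>S. frag_of (en k S)) c"

lemma tr_tr': "ks c \<subseteq> spx (full n) k \<Longrightarrow> tr k (tr' k c) = c"
  unfolding tr_def tr'_def frag_extend_extend by (rule frag_extend_id) (use en_nd(2) in auto)

lemma tr'_tr: "ks c \<subseteq> nd n k \<Longrightarrow> tr' k (tr k c) = c"
  unfolding tr_def tr'_def frag_extend_extend by (rule frag_extend_id) (use en_image in auto)

lemma tr_chain: "\<lbrakk>nonneg c; ks c \<subseteq> nd n k\<rbrakk> \<Longrightarrow> nonneg (tr k c) \<and> ks (tr k c) \<subseteq> spx (full n) k"
  unfolding tr_def
  by (intro conjI nonneg_frag_extend keys_frag_extend_subset) (use nd_image in \<open>auto simp: keys_frag_of\<close>)

lemma tr'_chain: "\<lbrakk>nonneg c; ks c \<subseteq> spx (full n) k\<rbrakk> \<Longrightarrow> nonneg (tr' k c) \<and> ks (tr' k c) \<subseteq> nd n k"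
  unfolding tr'_def
  by (intro conjI nonneg_frag_extend keys_frag_extend_subset) (use en_nd(1) in \<open>auto simp: keys_frag_of\<close>)

lemma nd_face:
  assumes "s \<in> nd n (Suc k)" "i \<le> Suc k"
  shows "compose {..k} s (coface k i) \<in> nd n k" "compose {..k} s (coface k i) ` {..k} = s ` {..Suc k} - {s i}"
proof -
  have s: "s \<in> simplex_hom (Suc k) n" "inj_on s {..Suc k}" using assms(1) by (auto simp: nd_def)
  have c: "coface k i ` {..k} = {..Suc k} - {i}"
  proof (rule Set.set_eqI)
    fix j
    show "j \<in> coface k i ` {..k} \<longleftrightarrow> j \<in> {..Suc k} - {i}"
    proof
      assume "j \<in> coface k i ` {..k}"
      then obtain l where "l \<le> k" "j = coface k i l" by auto
      then show "j \<in> {..Suc k} - {i}" by (cases "l < i") (auto simp: coface_def)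
    next
      assume j: "j \<in> {..Suc k} - {i}"
      show "j \<in> coface k i ` {..k}"
      proof (cases "j < i")
        case True
        then have "j = coface k i j" "j \<le> k" using assms(2) by (auto simp: coface_def)
        then show ?thesis by blast
      next
        case False
        then have "j = coface k i (j - 1)" "j - 1 \<le> k" using j by (auto simp: coface_def)
        then show ?thesis by blast
      qed
    qed
  qed
  have ci: "inj_on (coface k i) {..k}" by (rule inj_onI) (auto simp: coface_def split: if_splits)
  have "inj_on (compose {..k} s (coface k i)) {..k}"
  proof (rule inj_onI)
    fix a b assume ab: "a \<in> {..k}" "b \<in> {..k}" "compose {..k} s (coface k i) a = compose {..k} s (coface k i) b"
    then have "coface k i a = coface k i b"
      using c inj_onD[OF s(2), of "coface k i a" "coface k i b"] by (auto simp: compose_def)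
    then show "a = b" using inj_onD[OF ci] ab by blast
  qed
  then show "compose {..k} s (coface k i) \<in> nd n k"
    using simplex_hom_compose[OF coface_simplex_hom[OF assms(2)] s(1)] by (simp add: nd_def)
  have "compose {..k} s (coface k i) ` {..k} = s ` (coface k i ` {..k})" by (auto simp: compose_def)
  also have "\<dots> = s ` {..Suc k} - {s i}" unfolding c using inj_on_image_set_diff[OF s(2), of "{..Suc k}" "{i}"] assms(2) by auto
  finally show "compose {..k} s (coface k i) ` {..k} = s ` {..Suc k} - {s i}" .
qed

lemma sg_nd:
  assumes "s \<in> nd n k" "i \<le> k" shows "sg (s ` {..k}) (s i) = (- 1) ^ i"
proof -
  have "{u \<in> s ` {..k}. u < s i} = s ` {..<i}"
  proof (rule Set.set_eqI)
    fix u
    have "s j < s i \<longleftrightarrow> j < i" if "j \<le> k" for j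
      using nd_less[OF assms(1), of j i] nd_less[OF assms(1), of i j] assms(2) that by (metis less_asym linorder_neqE_nat less_irrefl)
    then show "u \<in> {u \<in> s ` {..k}. u < s i} \<longleftrightarrow> u \<in> s ` {..<i}" using assms(2)
      by (auto simp: image_iff) 
  qed
  moreover have "card (s ` {..<i}) = i"
  proof -
    have "inj_on s {..<i}" using assms by (auto simp: nd_def intro: inj_on_subset)
    then show ?thesis by (simp add: card_image)
  qed
  ultimately show ?thesis by (simp add: sg_def)
qed

lemma chain_boundary_nd:
  assumes "s \<in> nd n (Suc k)"
  shows "ks (chain_boundary (standard_simplex n) k (frag_of s)) \<subseteq> nd n k"
    "tr k (chain_boundary (standard_simplex n) k (frag_of s)) = bdry (s ` {..Suc k})"
proof -
  have inj: "inj_on s {..Suc k}" using assms by (simp add: nd_def)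
  have e: "chain_boundary (standard_simplex n) k (frag_of s) = (\<Sum>i\<le>Suc k. frag_cmul ((- 1) ^ i) (frag_of (compose {..k} s (coface k i))))"
    unfolding chain_boundary_def frag_extend_of
    by (rule sum.cong) (use nd_face(1)[OF assms] in \<open>auto simp: simplex_chain_def nondegenerate_standard_simplex standard_simplex_simps\<close>)
  show "ks (chain_boundary (standard_simplex n) k (frag_of s)) \<subseteq> nd n k"
    unfolding e
  proof
    fix t assume "t \<in> ks (\<Sum>i\<le>Suc k. frag_cmul ((- 1) ^ i) (frag_of (compose {..k} s (coface k i))))"
    then obtain i where "i \<le> Suc k" "t \<in> ks (frag_cmul ((- 1) ^ i) (frag_of (compose {..k} s (coface k i))))"
      using keys_sum[of "\<lambda>i. frag_cmul ((- 1) ^ i) (frag_of (compose {..k} s (coface k i)))" "{..Suc k}"] by fastforce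
    then show "t \<in> nd n k" using nd_face(1)[OF assms] by (auto simp: keys_frag_of)
  qed
  have "tr k (chain_boundary (standard_simplex n) k (frag_of s))
      = (\<Sum>i\<le>Suc k. frag_cmul ((- 1) ^ i) (frag_of (s ` {..Suc k} - {s i})))"
    unfolding e tr_def by (simp only: frag_extend_sum finite_atMost)
      (rule sum.cong, use nd_face(2)[OF assms] in \<open>auto simp: frag_extend_cmul\<close>)
  also have "\<dots> = (\<Sum>i\<le>Suc k. frag_cmul (sg (s ` {..Suc k}) (s i)) (frag_of (s ` {..Suc k} - {s i})))"
    by (rule sum.cong) (use sg_nd[OF assms] in auto)
  also have "\<dots> = bdry (s ` {..Suc k})" unfolding bdry_def sum.reindex[OF inj] o_def ..
  finally show "tr k (chain_boundary (standard_simplex n) k (frag_of s)) = bdry (s ` {..Suc k})" .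
qed

lemma chain_boundary_extend:
  "chain_boundary K k c = frag_extend (\<lambda>s. chain_boundary K k (frag_of s)) c"
  unfolding chain_boundary_def by simp

lemma tr_boundary:
  assumes "ks c \<subseteq> nd n (Suc k)"
  shows "tr k (chain_boundary (standard_simplex n) k c) = frag_extend bdry (tr (Suc k) c)"
    "ks (chain_boundary (standard_simplex n) k c) \<subseteq> nd n k"
proof -
  have "tr k (chain_boundary (standard_simplex n) k c) = frag_extend (\<lambda>s. bdry (s ` {..Suc k})) c"
    unfolding chain_boundary_extend[of _ _ c] tr_def frag_extend_extend
    by (rule frag_extend_eq) (use chain_boundary_nd(2)[unfolded tr_def] assms in auto)
  then show "tr k (chain_boundary (standard_simplex n) k c) = frag_extend bdry (tr (Suc k) c)"
    unfolding tr_def frag_extend_extend by simp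
  show "ks (chain_boundary (standard_simplex n) k c) \<subseteq> nd n k"
    unfolding chain_boundary_extend[of _ _ c] by (rule keys_frag_extend_subset) (use chain_boundary_nd(1) assms in blast)
qed

definition totab :: "oriental_cell \<Rightarrow> nat set table" where "totab x = (\<lambda>k \<alpha>. tr k (x k \<alpha>))"
definition fromtab :: "nat set table \<Rightarrow> oriental_cell" where "fromtab x = (\<lambda>k \<alpha>. tr' k (x k \<alpha>))"

abbreviation ocells :: "nat \<Rightarrow> nat \<Rightarrow> nat set table set" where "ocells n p \<equiv> tcells (spx (full n)) bdry p"

lemma tr_0 [simp]: "tr k 0 = 0" "tr' k 0 = 0"
  by (simp_all add: tr_def tr'_def)

lemma tr_diff: "tr k (a - b) = tr k a - tr k b" "tr' k (c - e) = tr' k c - tr' k e"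
  by (simp_all add: tr_def tr'_def frag_extend_diff)

lemma tr_add: "tr k (a + b) = tr k a + tr k b"
  by (simp add: tr_def frag_extend_add)

lemma augmentation_tr: "augmentation (tr k c) = augmentation c" "augmentation (tr' k c') = augmentation c'"
  unfolding tr_def tr'_def by (rule augmentation_frag_extend_1; simp)+

lemma oriental_cells_iff:
  "x \<in> oriental_cells n p \<longleftrightarrow> (\<forall>k \<alpha>. ks (x k \<alpha>) \<subseteq> nd n k) \<and> totab x \<in> ocells n p"
proof
  assume x: "x \<in> oriental_cells n p"
  have c: "nonneg (x k \<alpha>)" "ks (x k \<alpha>) \<subseteq> nd n k" if "k \<le> p" for k \<alpha>
    using x that unfolding oriental_cells_def by (auto simp: positive_chains_iff nondegenerate_standard_simplex)
  have z: "x k \<alpha> = 0" if "p < k" for k \<alpha> using x that unfolding oriental_cells_def by auto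
  have b: "chain_boundary (standard_simplex n) k (x (Suc k) \<alpha>) = x k Pos - x k Neg" if "k < p" for k \<alpha>
  proof -
    have "\<forall>k \<alpha>. 0 < k \<and> k \<le> p \<longrightarrow> chain_boundary (standard_simplex n) (k - 1) (x k \<alpha>) = x (k - 1) Pos - x (k - 1) Neg"
      using x unfolding oriental_cells_def by simp
    from this[rule_format, of "Suc k" \<alpha>] that show ?thesis by simp
  qed
  have k: "ks (x k \<alpha>) \<subseteq> nd n k" for k \<alpha> using c(2) z by (cases "k \<le> p") auto
  have "frag_extend bdry (tr (Suc k) (x (Suc k) \<alpha>)) = tr k (x k Pos) - tr k (x k Neg)" if "k < p" for k \<alpha>
    unfolding tr_boundary(1)[OF k, symmetric] b[OF that] tr_diff ..
  then have "totab x \<in> ocells n p"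
    unfolding tcells_def totab_def mem_Collect_eq
    using tr_chain[OF c] z x unfolding oriental_cells_def by (simp add: augmentation_tr)
  then show "(\<forall>k \<alpha>. ks (x k \<alpha>) \<subseteq> nd n k) \<and> totab x \<in> ocells n p" using k by blast
next
  assume "(\<forall>k \<alpha>. ks (x k \<alpha>) \<subseteq> nd n k) \<and> totab x \<in> ocells n p"
  then have k: "\<And>k \<alpha>. ks (x k \<alpha>) \<subseteq> nd n k" and t: "totab x \<in> ocells n p" by auto
  have inv: "x k \<alpha> = tr' k (totab x k \<alpha>)" for k \<alpha> using tr'_tr[OF k] by (simp add: totab_def)
  note T = tcellsD[OF t]
  have "nonneg (x k \<alpha>)" if "k \<le> p" for k \<alpha> using tr'_chain[OF T(1) T(2)[OF that]] inv by metis
  moreover have "chain_boundary (standard_simplex n) k (x (Suc k) \<alpha>) = x k Pos - x k Neg" if "k < p" for k \<alpha>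
  proof -
    have "chain_boundary (standard_simplex n) k (x (Suc k) \<alpha>) = tr' k (frag_extend bdry (totab x (Suc k) \<alpha>))"
      unfolding totab_def tr_boundary(1)[OF k, symmetric] using tr'_tr[OF tr_boundary(2)[OF k]] by simp
    then show ?thesis using T(5)[OF that] inv by (simp add: tr_diff)
  qed
  moreover have "augmentation (x 0 \<alpha>) = 1" for \<alpha> using T(6)[of \<alpha>] by (simp add: totab_def augmentation_tr)
  moreover have "x k \<alpha> = 0" if "p < k" for k \<alpha> using T(3)[OF that] inv by simp
  moreover have "x p Neg = x p Pos" using T(4) inv by metis
  ultimately show "x \<in> oriental_cells n p"
    using k unfolding oriental_cells_def
    by (auto simp: positive_chains_iff nondegenerate_standard_simplex gr0_conv_Suc)
qed

lemma fromtab_cells: "y \<in> ocells n p \<Longrightarrow> fromtab y \<in> oriental_cells n p" "y \<in> ocells n p \<Longrightarrow> totab (fromtab y) = y"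
proof -
  assume y: "y \<in> ocells n p"
  note Y = tcellsD[OF y]
  have k: "ks (y k \<alpha>) \<subseteq> spx (full n) k" for k \<alpha> using Y(2,3)[of k \<alpha>] by (cases "k \<le> p") auto
  show t: "totab (fromtab y) = y" unfolding totab_def fromtab_def using tr_tr'[OF k] by simp
  have "ks (fromtab y k \<alpha>) \<subseteq> nd n k" for k \<alpha> using tr'_chain[OF Y(1) k] by (simp add: fromtab_def)
  then show "fromtab y \<in> oriental_cells n p" using oriental_cells_iff t y by simp
qed

lemma totab_cells: "x \<in> oriental_cells n p \<Longrightarrow> totab x \<in> ocells n p" "x \<in> oriental_cells n p \<Longrightarrow> fromtab (totab x) = x"
proof -
  assume x: "x \<in> oriental_cells n p"
  then show "totab x \<in> ocells n p" unfolding oriental_cells_iff by simp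
  have k: "ks (x k \<alpha>) \<subseteq> nd n k" for k \<alpha> using x unfolding oriental_cells_iff by simp
  show "fromtab (totab x) = x" by (intro ext) (simp add: totab_def fromtab_def tr'_tr[OF k])
qed

lemma oriental_bd_tbd: "oriental_bd = tbd"
  by (intro ext) (simp add: oriental_bd_def tbd_def)

lemma oriental_simps:
  "cells (oriental n) p = oriental_cells n p" "bd (oriental n) \<alpha> p k x = tbd \<alpha> k x"
  "ccomp (oriental n) p k x y = tcmp k x y" "unit_cell (oriental n) p m x = x"
  by (simp_all add: oriental_def oriental_bd_tbd tcmp_def)

lemma totab_tbd: "totab (tbd \<alpha> k x) = tbd \<alpha> k (totab x)"
  by (intro ext) (simp add: totab_def tbd_eq)

lemma totab_tcmp: "totab (tcmp k x y) = tcmp k (totab x) (totab y)"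
  by (intro ext) (simp add: totab_def tcmp_eq tr_add tr_diff)

lemma fromtab_tbd: "fromtab (tbd \<alpha> k x) = tbd \<alpha> k (fromtab x)"
  by (intro ext) (simp add: fromtab_def tbd_eq)

lemma fromtab_tcmp: "fromtab (tcmp k x y) = tcmp k (fromtab x) (fromtab y)"
  by (intro ext) (simp add: fromtab_def tcmp_eq tr'_def frag_extend_add frag_extend_diff)

text \<open>Above dimension \<open>n\<close> there are no nondegenerate simplices, so the top entry
  of a cell vanishes.\<close>

lemma ocells_ge: "n \<le> p \<Longrightarrow> ocells n p = ocells n n"
proof (induction p rule: nat_induct_at_least)
  case (Suc p)
  have "x \<in> ocells n p" if x: "x \<in> ocells n (Suc p)" for x
  proof (rule tcells_Suc_zero[OF x])
    have "S \<notin> spx (full n) (Suc p)" for S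
    proof
      assume "S \<in> spx (full n) (Suc p)"
      then have "S \<subseteq> {..n}" "card S = Suc (Suc p)" by (auto simp: spx_full)
      then show False using card_mono[of "{..n}" S] Suc.hyps by simp
    qed
    then have "ks (x (Suc p) Neg) = {}" using tcellsD(2)[OF x, of "Suc p" Neg] by blast
    then show "x (Suc p) Neg = 0" by simp
  qed
  then show ?case using Suc.IH tcells_Suc by blast
qed simp


subsection \<open>The cells of a fixed dimension as a one-sorted category\<close>

text \<open>Faces of \<open>N\<close>-cells are raised back to dimension \<open>N\<close> by units,
  which makes the \<open>N\<close>-cells a \<open>one_sorted\<close> structure. For
  \<open>k \<ge> N\<close> the operation is the identity, and \<open>Cc\<close> correspondingly
  returns its first argument.\<close>

definition Cd :: "('c, 'e) omega_cat_scheme \<Rightarrow> nat \<Rightarrow> polarity \<Rightarrow> nat \<Rightarrow> 'c \<Rightarrow> 'c" where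
  "Cd C N \<alpha> k x = (if k < N then unit_cell C k N (bd C \<alpha> N k x) else x)"

definition Cc :: "('c, 'e) omega_cat_scheme \<Rightarrow> nat \<Rightarrow> nat \<Rightarrow> 'c \<Rightarrow> 'c \<Rightarrow> 'c" where
  "Cc C N k x y = (if k < N then ccomp C N k x y else x)"

text \<open>Recovers a \<open>p\<close>-cell from its image among the \<open>N\<close>-cells. For
  \<open>p < N\<close> it is meant for units on \<open>p\<close>-cells, whose two
  \<open>p\<close>-faces coincide, so that \<open>Neg\<close> is an arbitrary choice.\<close>

definition down :: "('c, 'e) omega_cat_scheme \<Rightarrow> nat \<Rightarrow> nat \<Rightarrow> 'c \<Rightarrow> 'c" where
  "down C N p z = (if p < N then bd C Neg N p z else if p = N then z else unit_cell C N p z)"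

context strict_omega_category
begin

lemma bd_Cd:
  assumes "x \<in> cells C N" "k < N" shows "bd C \<beta> N k (Cd C N \<alpha> k x) = bd C \<alpha> N k x"
  using assms by (simp add: Cd_def bd_unit bd_closed)

lemma Cd_closed: "x \<in> cells C N \<Longrightarrow> Cd C N \<alpha> k x \<in> cells C N"
  by (simp add: Cd_def unit_closed bd_closed)

lemma composable_Cd:
  assumes "x \<in> cells C N" "y \<in> cells C N" "k < N"
  shows "composable C N k x y \<longleftrightarrow> Cd C N Neg k x = Cd C N Pos k y"
  using assms bd_Cd[of x N k Neg Neg] bd_Cd[of y N k Neg Pos]
  by (auto simp: composable_def) (simp add: Cd_def)

lemma one_sorted_cells: "one_sorted (cells C N) (Cd C N) (Cc C N)"
proof
  fix x y z w \<alpha> \<beta> j k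
  assume x: "x \<in> cells C N"
  show "Cd C N \<alpha> k x \<in> cells C N" using x by (rule Cd_closed)
  { assume j: "j < k"
    show "Cd C N \<beta> j (Cd C N \<alpha> k x) = Cd C N \<beta> j x"
    proof (cases "k < N")
      case True
      then have "bd C \<beta> N j (Cd C N \<alpha> k x) = bd C \<beta> N j x"
        using x j bd_unit_lower[of k N j "bd C \<alpha> N k x" \<beta>] globular[of j k N x \<beta> \<alpha>] bd_closed[of k N x \<alpha>]
        by (simp add: Cd_def)
      then show ?thesis using j True by (simp add: Cd_def[of C N \<beta> j])
    qed (simp add: Cd_def)
  }
  { assume j: "k \<le> j"
    show "Cd C N \<beta> j (Cd C N \<alpha> k x) = Cd C N \<alpha> k x"
    proof (cases "j < N")
      case True
      have y: "bd C \<alpha> N k x \<in> cells C k" using x j True bd_closed by simp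
      show ?thesis
      proof (cases "j = k")
        case jk: True
        then show ?thesis using bd_Cd[OF x, of k \<beta> \<alpha>] True by (simp add: Cd_def)
      next
        case False
        then show ?thesis using y j True bd_unit_upper[of k j N "bd C \<alpha> N k x" \<beta>] unit_unit[of k j N "bd C \<alpha> N k x"]
          by (simp add: Cd_def)
      qed
    qed (simp add: Cd_def)
  }
  show "Cc C N k x (Cd C N Neg k x) = x" using x by (simp add: Cc_def Cd_def comp_unit_right)
  show "Cc C N k (Cd C N Pos k x) x = x" using x by (simp add: Cc_def Cd_def comp_unit_left)
  assume y: "y \<in> cells C N"
  { assume xy: "Cd C N Neg k x = Cd C N Pos k y"
    then have eq: "x = y" if "\<not> k < N" using that by (simp add: Cd_def)
    have c: "composable C N k x y" if "k < N" using composable_Cd[OF x y that] xy by simp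
    show "Cc C N k x y \<in> cells C N" using c comp_closed x by (auto simp: Cc_def)
    show "Cd C N Neg k (Cc C N k x y) = Cd C N Neg k y" using c bd_Neg_comp[of N k x y] eq by (cases "k < N") (auto simp: Cc_def Cd_def)
    show "Cd C N Pos k (Cc C N k x y) = Cd C N Pos k x" using c bd_Pos_comp[of N k x y] eq by (cases "k < N") (auto simp: Cc_def Cd_def)
    { assume j: "k < j"
      show "Cd C N \<alpha> j (Cc C N k x y) = Cc C N k (Cd C N \<alpha> j x) (Cd C N \<alpha> j y)"
      proof (cases "j < N")
        case True
        have cj: "composable C j k (bd C \<alpha> N j x) (bd C \<alpha> N j y)"
          using c j True x y globular[of k j N x Neg \<alpha>] globular[of k j N y Pos \<alpha>] bd_closed
          by (simp add: composable_def)
        show ?thesis using c j True bd_comp[of N k x y j \<alpha>] unit_comp[OF cj True] by (simp add: Cc_def Cd_def)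
      qed (simp add: Cc_def Cd_def)
    }
    assume z: "z \<in> cells C N"
    { assume "Cd C N Neg k y = Cd C N Pos k z"
      then have "composable C N k y z" if "k < N" using composable_Cd[OF y z that] by simp
      then show "Cc C N k (Cc C N k x y) z = Cc C N k x (Cc C N k y z)"
        using c comp_assoc by (simp add: Cc_def)
    }
    assume w: "w \<in> cells C N" and zw: "Cd C N Neg k z = Cd C N Pos k w"
      and xz: "Cd C N Neg j x = Cd C N Pos j z" and j: "j < k"
    show "Cc C N j (Cc C N k x y) (Cc C N k z w) = Cc C N k (Cc C N j x z) (Cc C N j y w)"
      using interchange[of j k N x y z w] c composable_Cd[OF z w] composable_Cd[OF x z] zw xz j
      by (simp add: Cc_def)
  }
qed

lemma cell_iff:
  assumes "k < N"
  shows "one_sorted.cell (cells C N) (Cd C N) k z \<longleftrightarrow> z \<in> cells C N \<and> z = unit_cell C k N (bd C Neg N k z)"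
proof -
  interpret one_sorted "cells C N" "Cd C N" "Cc C N" by (rule one_sorted_cells)
  show ?thesis using assms unfolding cell_def by (auto simp: Cd_def)
qed

lemma down_closed: "z \<in> cells C N \<Longrightarrow> down C N p z \<in> cells C p"
  by (simp add: down_def bd_closed unit_closed)

end

subsection \<open>Pushing forward along maps of the vertices\<close>

text \<open>A simplex on which \<open>f\<close> is not injective becomes degenerate and hence counts
  as zero.\<close>

definition push :: "(nat \<Rightarrow> nat) \<Rightarrow> (nat set \<Rightarrow>\<^sub>0 int) \<Rightarrow> (nat set \<Rightarrow>\<^sub>0 int)" where
  "push f c = frag_extend (\<lambda>S. if inj_on f S then frag_of (f ` S) else 0) c"

definition pushT :: "(nat \<Rightarrow> nat) \<Rightarrow> nat set table \<Rightarrow> nat set table" where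
  "pushT f x = (\<lambda>k \<alpha>. push f (x k \<alpha>))"

lemma sg_image:
  assumes "inj_on f S" "mono_on S f" "v \<in> S" shows "sg (f ` S) (f v) = sg S v"
proof -
  have "{u \<in> f ` S. u < f v} = f ` {u\<in>S. u < v}"
  proof (rule Set.set_eqI)
    fix u
    have "f w < f v \<longleftrightarrow> w < v" if "w \<in> S" for w
      using mono_onD[OF assms(2) that assms(3)] mono_onD[OF assms(2) assms(3) that] inj_onD[OF assms(1) _ that assms(3)]
      by (metis linorder_le_cases linorder_not_le order_antisym)
    then show "u \<in> {u \<in> f ` S. u < f v} \<longleftrightarrow> u \<in> f ` {u\<in>S. u < v}" by (auto simp: image_iff)
  qed
  moreover have "card (f ` {u\<in>S. u < v}) = card {u\<in>S. u < v}"
    by (rule card_image) (rule inj_on_subset[OF assms(1)], simp)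
  ultimately show ?thesis by (simp add: sg_def)
qed

lemma push_bdry_inj:
  assumes "inj_on f S" "mono_on S f" "finite S" shows "push f (bdry S) = bdry (f ` S)"
proof -
  have "push f (bdry S) = (\<Sum>v\<in>S. frag_cmul (sg S v) (frag_of (f ` S - {f v})))"
    unfolding push_def bdry_def frag_extend_sum[OF assms(3)] o_def
  proof (rule sum.cong[OF refl])
    fix v assume v: "v \<in> S"
    have "inj_on f (S - {v})" using assms(1) by (rule inj_on_subset) auto
    moreover have "f ` (S - {v}) = f ` S - {f v}" using inj_on_image_set_diff[OF assms(1), of S "{v}"] v by simp
    ultimately show "frag_extend (\<lambda>S. if inj_on f S then frag_of (f ` S) else 0) (frag_cmul (sg S v) (frag_of (S - {v})))
      = frag_cmul (sg S v) (frag_of (f ` S - {f v}))" by (simp add: frag_extend_cmul)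
  qed
  also have "\<dots> = (\<Sum>v\<in>S. frag_cmul (sg (f ` S) (f v)) (frag_of (f ` S - {f v})))"
    by (rule sum.cong) (use sg_image[OF assms(1,2)] in auto)
  also have "\<dots> = bdry (f ` S)" unfolding bdry_def sum.reindex[OF assms(1)] o_def ..
  finally show ?thesis .
qed

text \<open>Two consecutive vertices \<open>u\<close> and \<open>v\<close> have the same image.
  Deleting either of them gives the same image with opposite signs, and every other face still
  contains both and is degenerate.\<close>

lemma push_bdry_noninj:
  assumes "\<not> inj_on f S" "mono_on S f" "finite S" shows "push f (bdry S) = 0"
proof -
  obtain u y where uy: "u \<in> S" "y \<in> S" "f u = f y" "u < y"
    using assms(1) unfolding inj_on_def by (metis linorder_neqE_nat)
  \<comment> \<open>The vertex of \<open>S\<close> next after \<open>u\<close>; monotonicity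
    squeezes its image between \<open>f u\<close> and \<open>f y\<close>.\<close>
  define v where "v = Min {w\<in>S. u < w}"
  have fin: "finite {w\<in>S. u < w}" using assms(3) by simp
  have v: "v \<in> S" "u < v" "v \<le> y" and least: "\<And>w. \<lbrakk>w \<in> S; u < w\<rbrakk> \<Longrightarrow> v \<le> w"
    using Min_in[OF fin] Min_le[OF fin] uy unfolding v_def by auto
  have fv: "f v = f u" using mono_onD[OF assms(2) uy(1) v(1)] mono_onD[OF assms(2) v(1) uy(2)] v uy by simp
  have "{w\<in>S. w < v} = insert u {w\<in>S. w < u}"
  proof (rule Set.set_eqI)
    fix w
    show "w \<in> {w\<in>S. w < v} \<longleftrightarrow> w \<in> insert u {w\<in>S. w < u}"
      using least[of w] uy(1) v(2) by (cases w u rule: linorder_cases) auto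
  qed
  then have s: "sg S v = - sg S u" using assms(3) by (simp add: sg_def)
  let ?h = "\<lambda>S. if inj_on f S then frag_of (f ` S) else 0"
  have other: "?h (S - {w}) = 0" if "w \<noteq> u" "w \<noteq> v" for w
  proof -
    have "\<not> inj_on f (S - {w})" using inj_onD[of f "S - {w}" v u] fv v uy that by auto
    then show ?thesis by simp
  qed
  have img: "f ` (S - {u}) = f ` S" "f ` (S - {v}) = f ` S" using uy v fv by (auto simp: image_iff) (metis Diff_iff fv nat_neq_iff singletonD)+
  have "inj_on f (S - {u}) \<longleftrightarrow> card (f ` S) = card S - 1" "inj_on f (S - {v}) \<longleftrightarrow> card (f ` S) = card S - 1"
    using inj_on_iff_eq_card[of "S - {u}" f] inj_on_iff_eq_card[of "S - {v}" f] img uy(1) v(1) assms(3) by simp_all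
  then have same: "?h (S - {u}) = ?h (S - {v})" using img by simp
  have "push f (bdry S) = (\<Sum>w\<in>S. frag_cmul (sg S w) (?h (S - {w})))"
    unfolding push_def bdry_def frag_extend_sum[OF assms(3)] o_def by (simp add: frag_extend_cmul)
  also have "\<dots> = (\<Sum>w\<in>{u, v}. frag_cmul (sg S w) (?h (S - {w})))"
    by (rule sum.mono_neutral_right) (use uy v other assms(3) in auto)
  also have "\<dots> = frag_cmul (sg S u) (?h (S - {u})) + frag_cmul (sg S v) (?h (S - {v}))" using v(2) by simp
  also have "\<dots> = 0" unfolding s same by (rule poly_mapping_eqI) (simp add: lookup_add)
  finally show ?thesis .
qed

lemma push_bdry:
  assumes "\<And>S. S \<in> ks c \<Longrightarrow> finite S \<and> mono_on S f"
  shows "frag_extend bdry (push f c) = push f (frag_extend bdry c)"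
proof -
  have "frag_extend bdry (push f c) = frag_extend (\<lambda>S. push f (bdry S)) c"
    unfolding push_def[of f c] frag_extend_extend
    by (rule frag_extend_eq) (use assms push_bdry_inj push_bdry_noninj in auto)
  then show ?thesis unfolding push_def frag_extend_extend .
qed

lemma simplex_hom_mono: "\<lbrakk>f \<in> simplex_hom m n; S \<subseteq> {..m}\<rbrakk> \<Longrightarrow> mono_on S f"
  unfolding simplex_hom_def using mono_on_subset by blast

lemma push_spx:
  assumes "f \<in> simplex_hom m n" "ks c \<subseteq> spx (full m) k"
  shows "ks (push f c) \<subseteq> spx (full n) k"
  unfolding push_def
proof (rule keys_frag_extend_subset)
  fix S assume "S \<in> ks c"
  then have S: "S \<subseteq> {..m}" "card S = Suc k" using subsetD[OF assms(2)] spx_full[of S m k] by auto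
  then have "f ` S \<subseteq> {..n}" using simplex_homD(1)[OF assms(1)] by auto
  then show "ks (if inj_on f S then frag_of (f ` S) else 0) \<subseteq> spx (full n) k"
    using S card_image[of f S] by (simp add: keys_frag_of spx_full)
qed

lemma nonneg_push: "nonneg c \<Longrightarrow> nonneg (push f c)"
  unfolding push_def by (rule nonneg_frag_extend) auto

lemma pushT_cells:
  assumes f: "f \<in> simplex_hom m n" and x: "x \<in> ocells m p"
  shows "pushT f x \<in> ocells n p"
proof -
  note X = tcellsD[OF x]
  have "frag_extend bdry (push f (x (Suc k) \<alpha>)) = push f (x k Pos) - push f (x k Neg)" if "k < p" for k \<alpha>
  proof -
    have "finite S \<and> mono_on S f" if "S \<in> ks (x (Suc k) \<alpha>)" for S
    proof -
      have "S \<subseteq> {..m}" using X(2)[of "Suc k" \<alpha>] \<open>k < p\<close> that spx_full[of S m "Suc k"] by auto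
      then show ?thesis using simplex_hom_mono[OF f] finite_subset[of S "{..m}"] by simp
    qed
    then show ?thesis using push_bdry[of "x (Suc k) \<alpha>" f] X(5)[OF that] by (simp add: push_def frag_extend_diff)
  qed
  moreover have "augmentation (push f (x 0 \<alpha>)) = 1" for \<alpha>
  proof -
    have "inj_on f S" if "S \<in> ks (x 0 \<alpha>)" for S
    proof -
      have "card S = 1" using X(2)[of 0 \<alpha>] that spx_full[of S m 0] by auto
      then obtain v where "S = {v}" using card_1_singletonE by blast
      then show ?thesis by simp
    qed
    then have "augmentation (push f (x 0 \<alpha>)) = augmentation (x 0 \<alpha>)"
      unfolding push_def by (intro augmentation_frag_extend_1) simp
    then show ?thesis using X(6) by simp
  qed
  ultimately show ?thesis
    using nonneg_push X push_spx[OF f X(2)] unfolding tcells_def pushT_def mem_Collect_eq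
    by (simp add: push_def)
qed

lemma pushT_tbd: "pushT f (tbd \<alpha> k x) = tbd \<alpha> k (pushT f x)"
  by (intro ext) (simp add: pushT_def tbd_eq push_def)

lemma pushT_tcmp: "pushT f (tcmp k x y) = tcmp k (pushT f x) (pushT f y)"
  by (intro ext) (simp add: pushT_def tcmp_eq push_def frag_extend_add frag_extend_diff)

text \<open>On subsets of \<open>S\<close> the push-forward is a relabelling, inverted by taking
  preimages in \<open>S\<close>. Without injectivity on \<open>S\<close> different simplices could
  cancel, and parts would not be preserved.\<close>

lemma push_part:
  assumes "inj_on f S" "ks c \<subseteq> Pow S" shows "push f (part \<alpha> c) = part \<alpha> (push f c)"
proof (rule poly_mapping_eqI)
  fix T
  have look: "lk (push f e) T = (if \<exists>U\<subseteq>S. T = f ` U then lk e (S \<inter> f -` T) else 0)" if e: "ks e \<subseteq> Pow S" for e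
  proof -
    have "lk (push f e) T = (\<Sum>U\<in>ks e. if f ` U = T then lk e U else 0)"
      unfolding push_def lookup_frag_extend
    proof (rule sum.cong[OF refl])
      fix U assume "U \<in> ks e"
      then have "inj_on f U" using e inj_on_subset[OF assms(1)] by blast
      then show "lk e U * lk (if inj_on f U then frag_of (f ` U) else 0) T = (if f ` U = T then lk e U else 0)" by simp
    qed
    also have "\<dots> = (\<Sum>U\<in>ks e. if (\<exists>U\<subseteq>S. T = f ` U) \<and> U = S \<inter> f -` T then lk e U else 0)"
    proof (rule sum.cong[OF refl])
      fix U assume "U \<in> ks e"
      then have U: "U \<subseteq> S" using e by blast
      have pre: "S \<inter> f -` (f ` V) = V" if "V \<subseteq> S" for V
        using inj_on_image_mem_iff[OF assms(1) _ that] that by blast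
      have "f ` U = T \<longleftrightarrow> (\<exists>U\<subseteq>S. T = f ` U) \<and> U = S \<inter> f -` T"
        using pre U by metis
      then show "(if f ` U = T then lk e U else 0) = (if (\<exists>U\<subseteq>S. T = f ` U) \<and> U = S \<inter> f -` T then lk e U else 0)" by simp
    qed
    also have "\<dots> = (if \<exists>U\<subseteq>S. T = f ` U then lk e (S \<inter> f -` T) else 0)"
    proof (cases "\<exists>U\<subseteq>S. T = f ` U")
      case True
      then show ?thesis by (simp only: True simp_thms if_True) (simp add: in_keys_iff)
    next
      case False
      then show ?thesis by (simp only: False simp_thms if_False sum.neutral_const)
    qed
    finally show ?thesis .
  qed
  define b where "b \<longleftrightarrow> (\<exists>U\<subseteq>S. T = f ` U)"
  have "ks (part \<alpha> c) \<subseteq> Pow S" using keys_part assms(2) by (rule subset_trans)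
  then show "lk (push f (part \<alpha> c)) T = lk (part \<alpha> (push f c)) T"
    using look[OF assms(2)] look[of "part \<alpha> c"] unfolding b_def[symmetric] by (cases \<alpha>; cases b) (simp_all add: lookup_part)
qed

lemma pushT_atom:
  assumes "inj_on f S" "mono_on S f" "finite S"
  shows "pushT f (atom bdry k S) = atom bdry k (f ` S)"
proof -
  have P: "ks (frag_extend bdry c) \<subseteq> Pow S" if "ks c \<subseteq> Pow S" for c
  proof (rule keys_frag_extend_subset)
    fix U assume "U \<in> ks c"
    then have "U \<subseteq> S" "finite U" using that assms(3) finite_subset[of U S] by auto
    then show "ks (bdry U) \<subseteq> Pow S" using keys_bdry[of U] by auto
  qed
  have sP: "ks (spine bdry S i) \<subseteq> Pow S" for i
  proof (induction i)
    case (Suc i)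
    show ?case by (simp only: spine.simps) (rule subset_trans[OF keys_part P[OF Suc]])
  qed (simp add: keys_frag_of)
  have b: "frag_extend bdry (push f c) = push f (frag_extend bdry c)" if "ks c \<subseteq> Pow S" for c
  proof (rule push_bdry)
    fix U assume "U \<in> ks c"
    then have "U \<subseteq> S" using that by auto
    then show "finite U \<and> mono_on U f" using finite_subset[of U S] mono_on_subset[OF assms(2), of U] assms(3) by simp
  qed
  have sp: "spine bdry (f ` S) i = push f (spine bdry S i)" for i
  proof (induction i)
    case 0
    then show ?case using assms(1) by (simp add: push_def)
  next
    case (Suc i)
    then show ?case using b[OF sP] push_part[OF assms(1) P[OF sP]] by simp
  qed
  show ?thesis
  proof (intro ext)
    fix j \<alpha>
    show "pushT f (atom bdry k S) j \<alpha> = atom bdry k (f ` S) j \<alpha>"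
      using sp[of "k - Suc j"] b[OF sP] push_part[OF assms(1) P[OF sP]] assms(1)
      by (simp add: pushT_def atom_def) (simp add: push_def)
  qed
qed

lemma pushT_compose:
  assumes "f \<in> simplex_hom l m" "x \<in> ocells l p"
  shows "pushT (compose {..l} g f) x = pushT g (pushT f x)"
proof (intro ext)
  fix k \<alpha>
  have kx: "ks (x k \<alpha>) \<subseteq> spx (full l) k" using tcellsD(2,3)[OF assms(2), of k \<alpha>] by (cases "k \<le> p") auto
  have "push (compose {..l} g f) (x k \<alpha>) = push g (push f (x k \<alpha>))"
    unfolding push_def frag_extend_extend
  proof (rule frag_extend_eq)
    fix S assume "S \<in> ks (x k \<alpha>)"
    then have "S \<subseteq> {..l}" using kx spx_full[of S l k] by auto
    then have e: "\<And>v. v \<in> S \<Longrightarrow> compose {..l} g f v = g (f v)" by (auto simp: compose_def)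
    then have "inj_on (compose {..l} g f) S \<longleftrightarrow> inj_on f S \<and> inj_on g (f ` S)"
      using inj_on_cong[of S "compose {..l} g f" "g \<circ> f"] comp_inj_on_iff[of f S g] inj_on_imageI2[of g f S] by (auto simp: comp_def)
    moreover have "compose {..l} g f ` S = g ` f ` S" using e by (simp add: image_image)
    ultimately show "(if inj_on (compose {..l} g f) S then frag_of (compose {..l} g f ` S) else 0)
      = frag_extend (\<lambda>S. if inj_on g S then frag_of (g ` S) else 0) (if inj_on f S then frag_of (f ` S) else 0)"
      by simp
  qed
  then show "pushT (compose {..l} g f) x k \<alpha> = pushT g (pushT f x) k \<alpha>" by (simp add: pushT_def)
qed

lemma pushT_id:
  assumes "x \<in> ocells n p" shows "pushT (restrict id {..n}) x = x"
proof (intro ext)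
  fix k \<alpha>
  have kx: "ks (x k \<alpha>) \<subseteq> spx (full n) k" using tcellsD(2,3)[OF assms, of k \<alpha>] by (cases "k \<le> p") auto
  show "pushT (restrict id {..n}) x k \<alpha> = x k \<alpha>"
    unfolding pushT_def push_def
  proof (rule frag_extend_id)
    fix S assume "S \<in> ks (x k \<alpha>)"
    then have S: "S \<subseteq> {..n}" using kx spx_full[of S n k] by auto
    then have "inj_on (restrict id {..n}) S" "restrict id {..n} ` S = S" by (auto simp: inj_on_def image_iff)
    then show "(if inj_on (restrict id {..n}) S then frag_of (restrict id {..n} ` S) else 0) = frag_of S" by simp
  qed
qed

lemma oriental_map_eq:
  assumes f: "f \<in> simplex_hom m n" and x: "x \<in> oriental_cells m p"
  shows "oriental_map m n f p x = fromtab (pushT f (totab x))"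
proof -
  have kx: "ks (x k \<alpha>) \<subseteq> nd m k" for k \<alpha> using x unfolding oriental_cells_iff by simp
  have "chain_map (standard_simplex n) (\<lambda>k s. compose {..k} f s) k c = tr' k (push f (tr k c))" if c: "ks c \<subseteq> nd m k" for k c
  proof -
    have "tr' k (push f (tr k c)) = frag_extend (\<lambda>s. tr' k (push f (frag_of (s ` {..k})))) c"
      unfolding tr'_def push_def tr_def by (simp add: frag_extend_extend)
    moreover have "simplex_chain (standard_simplex n) k (compose {..k} f s) = tr' k (push f (frag_of (s ` {..k})))"
      if "s \<in> ks c" for s
  proof -
    note that
    then have s: "s \<in> nd m k" using c by blast
    then have sh: "s \<in> simplex_hom k m" "inj_on s {..k}" by (auto simp: nd_def)
    have fs: "compose {..k} f s \<in> simplex_hom k n" using simplex_hom_compose[OF sh(1) f] .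
    have img: "compose {..k} f s ` {..k} = f ` s ` {..k}" by (auto simp: compose_def image_image)
    have "inj_on (compose {..k} f s) {..k} \<longleftrightarrow> inj_on f (s ` {..k})"
      using inj_on_cong[of "{..k}" "compose {..k} f s" "f \<circ> s"] comp_inj_on_iff[OF sh(2), of f] by (simp add: compose_def)
    then have nd: "compose {..k} f s \<in> nd n k \<longleftrightarrow> inj_on f (s ` {..k})" using fs by (simp add: nd_def)
    show ?thesis
      using en_image[of "compose {..k} f s" n k] img nd
      by (simp add: simplex_chain_def nondegenerate_standard_simplex tr'_def push_def)
  qed
    ultimately show ?thesis unfolding chain_map_def by (simp cong: frag_extend_eq)
  qed
  then show ?thesis
    using x kx by (simp add: oriental_map_def oriental_simps fromtab_def pushT_def totab_def)
qed


subsection \<open>Maps of orientals into an omega-category\<close>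

lemma omega_homD:
  assumes "F \<in> omega_hom (oriental n) C"
  shows "x \<in> oriental_cells n p \<Longrightarrow> F p x \<in> cells C p" "x \<notin> oriental_cells n p \<Longrightarrow> F p x = undefined"
    "\<lbrakk>x \<in> oriental_cells n p; k < p\<rbrakk> \<Longrightarrow> F k (tbd \<alpha> k x) = bd C \<alpha> p k (F p x)"
    "\<lbrakk>x \<in> oriental_cells n p; y \<in> oriental_cells n p; k < p; tbd Neg k x = tbd Pos k y\<rbrakk>
      \<Longrightarrow> F p (tcmp k x y) = ccomp C p k (F p x) (F p y)"
    "\<lbrakk>x \<in> oriental_cells n p; p < m\<rbrakk> \<Longrightarrow> F m x = unit_cell C p m (F p x)"
  using assms unfolding omega_hom_def composable_def oriental_simps PiE_def extensional_def by auto

lemma omega_homI: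
  assumes "\<And>p x. x \<in> oriental_cells n p \<Longrightarrow> F p x \<in> cells C p"
    "\<And>p x. x \<notin> oriental_cells n p \<Longrightarrow> F p x = undefined"
    "\<And>p x k \<alpha>. \<lbrakk>x \<in> oriental_cells n p; k < p\<rbrakk> \<Longrightarrow> F k (tbd \<alpha> k x) = bd C \<alpha> p k (F p x)"
    "\<And>p x y k. \<lbrakk>x \<in> oriental_cells n p; y \<in> oriental_cells n p; k < p; tbd Neg k x = tbd Pos k y\<rbrakk>
      \<Longrightarrow> F p (tcmp k x y) = ccomp C p k (F p x) (F p y)"
    "\<And>p x m. \<lbrakk>x \<in> oriental_cells n p; p < m\<rbrakk> \<Longrightarrow> F m x = unit_cell C p m (F p x)"
  shows "F \<in> omega_hom (oriental n) C"
  unfolding omega_hom_def composable_def oriental_simps PiE_def extensional_def mem_Collect_eq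
  using assms by (intro conjI allI impI ballI IntI CollectI Pi_I) auto

lemma oriental_cells_mono: "\<lbrakk>x \<in> oriental_cells n p; p \<le> q\<rbrakk> \<Longrightarrow> x \<in> oriental_cells n q"
  unfolding oriental_cells_iff using tcells_mono by blast

lemma oriental_cells_ge: "\<lbrakk>x \<in> oriental_cells n p; n \<le> p; n \<le> q\<rbrakk> \<Longrightarrow> x \<in> oriental_cells n q"
  unfolding oriental_cells_iff using ocells_ge[of n p] ocells_ge[of n q] by simp

context strict_omega_category
begin

sublocale S: one_sorted "cells C N" "Cd C N" "Cc C N" for N
  by (rule one_sorted_cells)

lemma hom_down:
  assumes F: "F \<in> omega_hom (oriental n) C" and "n \<le> N" and x: "x \<in> oriental_cells n p"
  shows "F p x = down C N p (F N x)"
proof -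
  note h = omega_homD[OF F]
  consider "p < N" | "p = N" | "N < p" by linarith
  then show ?thesis
  proof cases
    case 1
    then have "F N x = unit_cell C p N (F p x)" using h(5)[OF x] by simp
    then show ?thesis using 1 h(1)[OF x] bd_unit[of p N "F p x" Neg] by (simp add: down_def)
  next
    case 3
    have "x \<in> oriental_cells n N" by (rule oriental_cells_ge[OF x]) (use 3 assms(2) in auto)
    then show ?thesis using 3 h(5) by (simp add: down_def)
  qed (simp add: down_def)
qed

text \<open>Up to units every cell of the oriental is an \<open>N\<close>-cell, so the component in
  dimension \<open>N\<close> determines a map.\<close>

lemma hom_eqI:
  assumes "F \<in> omega_hom (oriental n) C" "G \<in> omega_hom (oriental n) C" "n \<le> N"
    "\<And>z. z \<in> ocells n N \<Longrightarrow> F N (fromtab z) = G N (fromtab z)"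
  shows "F = G"
proof (intro ext)
  fix p x
  show "F p x = G p x"
  proof (cases "x \<in> oriental_cells n p")
    case True
    have "x \<in> oriental_cells n N"
    proof (cases "p \<le> N")
      case True
      then show ?thesis using oriental_cells_mono \<open>x \<in> oriental_cells n p\<close> by blast
    next
      case False
      then show ?thesis using oriental_cells_ge[OF \<open>x \<in> oriental_cells n p\<close>, of N] assms(3) by simp
    qed
    then have "F N x = G N x" using assms(4)[OF totab_cells(1)] totab_cells(2) by metis
    then show ?thesis using hom_down[OF assms(1,3) True] hom_down[OF assms(2,3) True] by simp
  next
    case False
    then show ?thesis using omega_homD(2)[OF assms(1)] omega_homD(2)[OF assms(2)] by simp
  qed
qed

lemma hom_thom:
  assumes F: "F \<in> omega_hom (oriental n) C"
  shows "S.thom N N (spx (full n)) bdry (\<lambda>z. F N (fromtab z))"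
proof -
  note h = omega_homD[OF F]
  have 1: "F N (fromtab (tbd \<alpha> k x)) = Cd C N \<alpha> k (F N (fromtab x))" if x: "x \<in> ocells n N" and k: "k < N" for x k \<alpha>
  proof -
    have "tbd \<alpha> k x \<in> ocells n k" using tbd_tcells[OF x, of k] k by simp
    then have "F N (fromtab (tbd \<alpha> k x)) = unit_cell C k N (F k (fromtab (tbd \<alpha> k x)))"
      using h(5) fromtab_cells(1) k by blast
    then show ?thesis using h(3)[OF fromtab_cells(1)[OF x] k, of \<alpha>] k by (simp add: Cd_def fromtab_tbd)
  qed
  have 2: "F N (fromtab (tcmp k x y)) = Cc C N k (F N (fromtab x)) (F N (fromtab y))"
    if "x \<in> ocells n N" "y \<in> ocells n N" "k < N" "tbd Neg k x = tbd Pos k y" for x y k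
    using h(4)[OF fromtab_cells(1)[OF that(1)] fromtab_cells(1)[OF that(2)] that(3)] that
    by (simp add: Cc_def fromtab_tcmp fromtab_tbd[symmetric])
  show ?thesis unfolding S.thom_def using 1 2 h(1) fromtab_cells(1) by blast
qed

text \<open>Inverse to \<open>hom_thom\<close>. The components outside dimension \<open>N\<close>
  are forced: below \<open>N\<close> by taking faces, above it by units, since
  \<open>n \<le> N\<close> leaves no new cells there.\<close>

lemma thom_hom:
  assumes G: "S.thom N N (spx (full n)) bdry G" and nN: "n \<le> N"
  defines "F \<equiv> (\<lambda>p. restrict (\<lambda>x. down C N p (G (totab x))) (oriental_cells n p))"
  shows "F \<in> omega_hom (oriental n) C" "\<And>z. z \<in> ocells n N \<Longrightarrow> F N (fromtab z) = G z"
proof -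
  note g = S.thomD[OF G]
  have tN: "totab x \<in> ocells n N" if x: "x \<in> oriental_cells n p" for x p
  proof (cases "p \<le> N")
    case True
    then show ?thesis using tcells_mono[OF totab_cells(1)[OF x]] by blast
  next
    case False
    then show ?thesis using totab_cells(1)[OF x] ocells_ge[of n p] ocells_ge[of n N] nN by simp
  qed
  have Gc: "G (totab x) \<in> cells C N" if "x \<in> oriental_cells n p" for x p using g(1) tN[OF that] by blast
  have Gb: "G (totab (tbd \<alpha> k x)) = Cd C N \<alpha> k (G (totab x))" if "x \<in> oriental_cells n p" "k < N" for x p k \<alpha>
    using g(2)[OF tN[OF that(1)] that(2)] by (simp add: totab_tbd)
  have Fx: "F p x = down C N p (G (totab x))" if "x \<in> oriental_cells n p" for p x using that by (simp add: F_def)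
  have low: "G (totab x) = unit_cell C p N (bd C Neg N p (G (totab x)))" if "x \<in> oriental_cells n p" "p < N" for x p
    using S.thom_cell[OF G totab_cells(1)[OF that(1)] that(2)] cell_iff[OF that(2)] by simp
  have tbdc: "tbd \<alpha> k x \<in> oriental_cells n k" if x: "x \<in> oriental_cells n p" and k: "k \<le> p" for x p k \<alpha>
  proof -
    have "tbd \<alpha> k x = fromtab (tbd \<alpha> k (totab x))" using totab_cells(2)[OF x] by (simp add: fromtab_tbd)
    then show ?thesis using fromtab_cells(1)[OF tbd_tcells[OF totab_cells(1)[OF x] k]] by simp
  qed
  have tid: "tbd \<alpha> k (totab x) = totab x" if "x \<in> oriental_cells n p" "N \<le> k" for x p k \<alpha>
    using tbd_id[OF tN[OF that(1)] that(2)] .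
  show "F \<in> omega_hom (oriental n) C"
  proof (rule omega_homI)
    fix p x assume x: "x \<in> oriental_cells n p"
    let ?g = "G (totab x)"
    show "F p x \<in> cells C p" using Fx[OF x] down_closed Gc[OF x] by simp
    {
      fix k \<alpha> assume k: "k < p"
      have L: "F k (tbd \<alpha> k x) = down C N k (G (totab (tbd \<alpha> k x)))" using Fx tbdc[OF x] k by simp
      consider "p \<le> N" | "N < p" "k < N" | "N < p" "N \<le> k" by linarith
      then show "F k (tbd \<alpha> k x) = bd C \<alpha> p k (F p x)"
      proof cases
        case 1
        then have "F k (tbd \<alpha> k x) = bd C \<alpha> N k ?g"
          using L Gb[OF x, of k \<alpha>] bd_Cd[OF Gc[OF x], of k Neg \<alpha>] k by (simp add: down_def)
        moreover have "bd C \<alpha> p k (F p x) = bd C \<alpha> N k ?g"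
          using 1 Fx[OF x] globular[OF k, of N ?g \<alpha> Neg] Gc[OF x] by (simp add: down_def)
        ultimately show ?thesis by simp
      next
        case 2
        then have "F k (tbd \<alpha> k x) = bd C \<alpha> N k ?g"
          using L Gb[OF x, of k \<alpha>] bd_Cd[OF Gc[OF x], of k Neg \<alpha>] by (simp add: down_def)
        then show ?thesis using 2 Fx[OF x] bd_unit_lower[of N p k ?g \<alpha>] Gc[OF x] by (simp add: down_def)
      next
        case 3
        have "F k (tbd \<alpha> k x) = down C N k ?g" using L tid[OF x 3(2)] by (simp add: totab_tbd)
        then show ?thesis
          using 3 k Fx[OF x] bd_unit[of N p ?g \<alpha>] bd_unit_upper[of N k p ?g \<alpha>] Gc[OF x] by (cases "k = N") (auto simp: down_def)
      qed
    }
    {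
      fix m assume pm: "p < m"
      have xm: "x \<in> oriental_cells n m" using oriental_cells_mono[OF x] pm by simp
      let ?y = "bd C Neg N p ?g"
      consider "p < N" "m < N" | "p < N" "m = N" | "p < N" "N < m" | "p = N" | "N < p" by linarith
      then show "F m x = unit_cell C p m (F p x)"
      proof cases
        case 1
        have "bd C Neg N m ?g = unit_cell C p m ?y"
          using bd_unit_upper[OF pm 1(2), of ?y Neg] low[OF x 1(1)] bd_closed[OF 1(1) Gc[OF x], of Neg] by simp
        then show ?thesis using 1 Fx[OF x] Fx[OF xm] by (simp add: down_def)
      next
        case 2
        then show ?thesis using low[OF x] Fx[OF x] Fx[OF xm] by (simp add: down_def)
      next
        case 3
        have "unit_cell C N m ?g = unit_cell C p m ?y"
          using unit_unit[OF 3, of ?y] low[OF x 3(1)] bd_closed[OF 3(1) Gc[OF x], of Neg] by simp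
        then show ?thesis using 3 Fx[OF x] Fx[OF xm] by (simp add: down_def)
      next
        case 4
        then show ?thesis using pm Fx[OF x] Fx[OF xm] by (simp add: down_def)
      next
        case 5
        then show ?thesis using pm Fx[OF x] Fx[OF xm] unit_unit[of N p m ?g] Gc[OF x] by (simp add: down_def)
      qed
    }
    fix y k assume y: "y \<in> oriental_cells n p" and k: "k < p" and c: "tbd Neg k x = tbd Pos k y"
    let ?h = "G (totab y)"
    have ct: "tbd Neg k (totab x) = tbd Pos k (totab y)" using arg_cong[OF c, of totab] by (simp add: totab_tbd)
    have z: "tcmp k x y \<in> oriental_cells n p"
    proof -
      have "tcmp k x y = fromtab (tcmp k (totab x) (totab y))" using totab_cells(2) x y by (simp add: fromtab_tcmp)
      then show ?thesis using fromtab_cells(1)[OF tcmp_tcells[OF totab_cells(1)[OF x] totab_cells(1)[OF y] ct k]] by simp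
    qed
    show "F p (tcmp k x y) = ccomp C p k (F p x) (F p y)"
    proof (cases "k < N")
      case True
      have co: "composable C N k ?g ?h"
        unfolding composable_Cd[OF Gc[OF x] Gc[OF y] True] using g(4)[OF tN[OF x] tN[OF y] True ct] .
      have Gz: "G (totab (tcmp k x y)) = ccomp C N k ?g ?h"
        using g(3)[OF tN[OF x] tN[OF y] True ct] True by (simp add: totab_tcmp Cc_def)
      show ?thesis
        using Fx[OF x] Fx[OF y] Fx[OF z] Gz bd_comp[OF co k, of Neg] unit_comp[OF co, of p] by (simp add: down_def)
    next
      case False
      \<comment> \<open>From dimension \<open>N\<close> on, cells are their own faces. Composable
        cells therefore coincide, and what is composed is a unit with itself.\<close>
      then have e: "totab x = totab y" using ct tid[OF x, of k Neg] tid[OF y, of k Pos] by simp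
      have "tcmp k (totab x) (totab x) = totab x"
        unfolding tcmp_def using tid[OF x, of k Neg] False by (intro ext) simp
      then have "F p (tcmp k x y) = F p x" using Fx[OF z] Fx[OF x] e by (simp add: totab_tcmp)
      moreover have u: "F p x = unit_cell C N p ?g" using Fx[OF x] False k by (simp add: down_def)
      have "unit_cell C k p (bd C Neg p k (F p x)) = F p x"
        using u k False bd_unit[of N p ?g Neg] bd_unit_upper[of N k p ?g Neg] unit_unit[of N k p ?g] Gc[OF x]
        by (cases "k = N") auto
      then have "ccomp C p k (F p x) (F p x) = F p x"
        using comp_unit_right[OF k, of "F p x"] Fx[OF x] down_closed[OF Gc[OF x], of p] by simp
      moreover have "F p y = F p x" using Fx[OF x] Fx[OF y] e by simp
      ultimately show ?thesis by simp
    qed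
  qed (simp add: F_def)
  show "F N (fromtab z) = G z" if "z \<in> ocells n N" for z
    using Fx[OF fromtab_cells(1)[OF that]] fromtab_cells(2)[OF that] by (simp add: down_def)
qed

lemma nerve_simps:
  "simplices (nerve C) n = omega_hom (oriental n) C"
  "act (nerve C) m n f F p = compose (oriental_cells m p) (F p) (oriental_map m n f p)"
  by (simp_all add: nerve_def oriental_simps)

lemma act_fromtab:
  assumes "f \<in> simplex_hom m n" "z \<in> ocells m p"
  shows "act (nerve C) m n f F p (fromtab z) = F p (fromtab (pushT f z))"
  unfolding nerve_simps using oriental_map_eq[OF assms(1) fromtab_cells(1)[OF assms(2)]] fromtab_cells[OF assms(2)]
  by (simp add: compose_def)

lemma nerve_act_closed:
  assumes f: "f \<in> simplex_hom m n" and F: "F \<in> omega_hom (oriental n) C"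
  shows "act (nerve C) m n f F \<in> omega_hom (oriental m) C"
proof -
  note h = omega_homD[OF F]
  let ?o = "\<lambda>x. fromtab (pushT f (totab x))"
  have o: "?o x \<in> oriental_cells n p" if "x \<in> oriental_cells m p" for x p
    using fromtab_cells(1)[OF pushT_cells[OF f totab_cells(1)[OF that]]] .
  have e: "act (nerve C) m n f F p x = F p (?o x)" if "x \<in> oriental_cells m p" for x p
    using oriental_map_eq[OF f that] that by (simp add: nerve_simps compose_def)
  have t: "?o (tbd \<alpha> k x) = tbd \<alpha> k (?o x)" for \<alpha> k x by (simp add: totab_tbd pushT_tbd fromtab_tbd)
  have c: "?o (tcmp k x y) = tcmp k (?o x) (?o y)" for k x y by (simp add: totab_tcmp pushT_tcmp fromtab_tcmp)
  have tc: "tbd \<alpha> k x \<in> oriental_cells m k" if x: "x \<in> oriental_cells m p" "k < p" for x p k \<alpha>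
    using fromtab_cells(1)[OF tbd_tcells[OF totab_cells(1)[OF x(1)], of k \<alpha>]] totab_cells(2)[OF x(1)] x(2) by (simp add: fromtab_tbd)
  have cc: "tcmp k x y \<in> oriental_cells m p"
    if "x \<in> oriental_cells m p" "y \<in> oriental_cells m p" "k < p" "tbd Neg k x = tbd Pos k y" for x y p k
    using fromtab_cells(1)[OF tcmp_tcells[OF totab_cells(1)[OF that(1)] totab_cells(1)[OF that(2)] _ that(3)]]
      arg_cong[OF that(4), of totab] totab_cells(2) that(1,2) by (simp add: fromtab_tcmp totab_tbd)
  show ?thesis
  proof (rule omega_homI)
    fix p x assume x: "x \<in> oriental_cells m p"
    show "act (nerve C) m n f F p x \<in> cells C p" using e[OF x] h(1)[OF o[OF x]] by simp
    show "act (nerve C) m n f F k (tbd \<alpha> k x) = bd C \<alpha> p k (act (nerve C) m n f F p x)" if "k < p" for k \<alpha>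
      using e[OF x] e[OF tc[OF x that]] h(3)[OF o[OF x] that] t by simp
    show "act (nerve C) m n f F p (tcmp k x y) = ccomp C p k (act (nerve C) m n f F p x) (act (nerve C) m n f F p y)"
      if "y \<in> oriental_cells m p" "k < p" "tbd Neg k x = tbd Pos k y" for y k
    proof -
      have "tbd Neg k (?o x) = tbd Pos k (?o y)" using that(3) t by metis
      then show ?thesis using e[OF x] e[OF that(1)] e[OF cc[OF x that]] h(4)[OF o[OF x] o[OF that(1)] that(2)] c by simp
    qed
    show "act (nerve C) m n f F l x = unit_cell C p l (act (nerve C) m n f F p x)" if "p < l" for l
      using e[OF x] e[OF oriental_cells_mono[OF x, of l]] h(5)[OF o[OF x] that] that by simp
  qed (simp add: nerve_simps compose_def)
qed

lemma nerve_act_compose: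
  assumes "f \<in> simplex_hom l m" "g \<in> simplex_hom m n" "F \<in> omega_hom (oriental n) C"
  shows "act (nerve C) l n (compose {..l} g f) F = act (nerve C) l m f (act (nerve C) m n g F)"
proof (rule hom_eqI[of _ l _ l])
  note gf = simplex_hom_compose[OF assms(1,2)]
  show "act (nerve C) l n (compose {..l} g f) F \<in> omega_hom (oriental l) C" using nerve_act_closed[OF gf assms(3)] .
  show "act (nerve C) l m f (act (nerve C) m n g F) \<in> omega_hom (oriental l) C"
    using nerve_act_closed[OF assms(1) nerve_act_closed[OF assms(2,3)]] .
  fix z assume z: "z \<in> ocells l l"
  show "act (nerve C) l n (compose {..l} g f) F l (fromtab z) = act (nerve C) l m f (act (nerve C) m n g F) l (fromtab z)"
    using act_fromtab[OF gf z] act_fromtab[OF assms(1) z] act_fromtab[OF assms(2) pushT_cells[OF assms(1) z]]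
      pushT_compose[OF assms(1) z] by simp
qed simp

lemma nerve_simplicial: "simplicial_set (nerve C)"
proof
  show "act (nerve C) m n f x \<in> simplices (nerve C) m" if "f \<in> simplex_hom m n" "x \<in> simplices (nerve C) n" for f m n x
    using that nerve_act_closed unfolding nerve_simps by blast
  show "act (nerve C) l n (compose {..l} g f) x = act (nerve C) l m f (act (nerve C) m n g x)"
    if "f \<in> simplex_hom l m" "g \<in> simplex_hom m n" "x \<in> simplices (nerve C) n" for f l m g n x
    using that nerve_act_compose unfolding nerve_simps(1) by blast
  show "act (nerve C) n n (restrict id {..n}) x = x" if "x \<in> simplices (nerve C) n" for x n
  proof (rule hom_eqI[of _ n _ n])
    have i: "restrict id {..n} \<in> simplex_hom n n" by (rule simplex_homI) auto
    have x: "x \<in> omega_hom (oriental n) C" using that by (simp add: nerve_simps)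
    show "act (nerve C) n n (restrict id {..n}) x \<in> omega_hom (oriental n) C" using nerve_act_closed[OF i x] .
    show "x \<in> omega_hom (oriental n) C" using x .
    fix z assume "z \<in> ocells n n"
    then show "act (nerve C) n n (restrict id {..n}) x n (fromtab z) = x n (fromtab z)"
      using act_fromtab[OF i] pushT_id by metis
  qed simp
qed

end

section \<open>Subcomplexes of a simplex\<close>

lemma spx_mono: "\<A> \<subseteq> \<B> \<Longrightarrow> spx \<A> k \<subseteq> spx \<B> k"
  by (auto simp: spx_def)

lemma spx_dim:
  assumes "complex_on n \<A>" "S \<in> spx \<A> k" shows "k \<le> n" "S \<subseteq> {..n}" "S \<in> spx (full n) k"
proof -
  show "S \<subseteq> {..n}" using assms unfolding complex_on_def spx_def by auto
  moreover have "card S = Suc k" using spx_finite(2)[OF assms(2)] .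
  ultimately show "k \<le> n" "S \<in> spx (full n) k" using card_mono[of "{..n}" S] by (auto simp: spx_full)
qed

lemma tcells_keys:
  assumes "x \<in> tcells B D p" "\<And>k \<alpha>. k \<le> p \<Longrightarrow> ks (x k \<alpha>) \<subseteq> B' k" shows "x \<in> tcells B' D p"
  using assms unfolding tcells_def by simp

lemma atom_simplex: "atom bdry k {..k} \<in> ocells k k"
  by (rule atom_tcells[OF loop_free_spx[OF complex_on_full]]) (simp add: spx_full)

lemma pushT_atom_nd:
  assumes "s \<in> nd n m" "T \<in> spx (full m) k" shows "pushT s (atom bdry k T) = atom bdry k (s ` T)"
proof -
  have s: "s \<in> simplex_hom m n" "inj_on s {..m}" using assms(1) by (auto simp: nd_def)
  have T: "T \<subseteq> {..m}" "finite T" using assms(2) spx_full[of T m k] finite_subset[of T "{..m}"] by auto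
  show ?thesis by (rule pushT_atom[OF inj_on_subset[OF s(2) T(1)] simplex_hom_mono[OF s(1) T(1)] T(2)])
qed

lemma pushT_sub:
  assumes c: "complex_on n \<A>" and sh: "s \<in> simplex_hom m n" and S: "s ` {..m} \<in> \<A>" and z: "z \<in> ocells m p"
  shows "pushT s z \<in> tcells (spx \<A>) bdry p"
proof (rule tcells_keys)
  show "pushT s z \<in> ocells n p" using pushT_cells[OF sh z] .
  fix k \<alpha> assume k: "k \<le> p"
  show "ks (pushT s z k \<alpha>) \<subseteq> spx \<A> k"
    unfolding pushT_def push_def
  proof (rule keys_frag_extend_subset)
    fix T assume "T \<in> ks (z k \<alpha>)"
    then have T: "T \<subseteq> {..m}" "card T = Suc k" "T \<noteq> {}" using tcellsD(2)[OF z k, of \<alpha>] spx_full[of T m k] by auto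
    then have "s ` T \<in> \<A>" using c S unfolding complex_on_def by (metis image_is_empty image_mono)
    then show "ks (if inj_on s T then frag_of (s ` T) else 0) \<subseteq> spx \<A> k"
      using T card_image[of s T] finite_subset[OF T(1)] by (simp add: keys_frag_of spx_def)
  qed
qed

lemma pushT_into:
  assumes "complex_on n \<A>" "s \<in> nd n m" "s ` {..m} \<in> \<A>" "z \<in> ocells m p"
  shows "pushT s z \<in> tcells (spx \<A>) bdry p"
  using pushT_sub[OF assms(1) _ assms(3,4)] assms(2) by (simp add: nd_def)

lemma tbd_tcmp_eq:
  assumes "tbd Neg k x = tbd Pos k y"
  shows "tbd Neg k (tcmp k x y) = tbd Neg k y" "tbd Pos k (tcmp k x y) = tbd Pos k x"
proof -
  note e = tcmp_entry[OF assms] and l = tbd_eqD(1)[OF assms]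
  show "tbd Neg k (tcmp k x y) = tbd Neg k y" by (intro ext) (simp add: tbd_eq e)
  show "tbd Pos k (tcmp k x y) = tbd Pos k x" by (intro ext) (simp add: tbd_eq e l)
qed

lemma tcmp_unit:
  assumes "tbd Neg k x = tbd Pos k y"
  shows "x \<in> tcells B D k \<Longrightarrow> tcmp k x y = y" "y \<in> tcells B D k \<Longrightarrow> tcmp k x y = x"
proof -
  show "tcmp k x y = y" if "x \<in> tcells B D k"
    using tbd_id[OF that, of k Neg] by (intro ext) (simp add: tcmp_def)
  show "tcmp k x y = x" if "y \<in> tcells B D k"
    using tbd_id[OF that, of k Pos] assms by (intro ext) (simp add: tcmp_def)
qed

subsection \<open>Paths between the extreme vertices\<close>

text \<open>On vertices this is their number, so every edge raises the potential by at least
  1.\<close>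

definition potential :: "(nat set \<Rightarrow>\<^sub>0 int) \<Rightarrow> int" where
  "potential c = (\<Sum>S\<in>ks c. lk c S * int (Max S))"

lemma potential_superset: "\<lbrakk>finite A; ks c \<subseteq> A\<rbrakk> \<Longrightarrow> potential c = (\<Sum>S\<in>A. lk c S * int (Max S))"
  unfolding potential_def by (rule sum.mono_neutral_left) (auto simp: in_keys_iff)

lemma potential_diff: "potential (c - c') = potential c - potential c'"
  using potential_superset[of "ks c \<union> ks c'" "c - c'"] potential_superset[of "ks c \<union> ks c'" c]
    potential_superset[of "ks c \<union> ks c'" c'] keys_diff[of c c']
  by (simp add: lookup_minus left_diff_distrib sum_subtractf)

lemma bdry_edge: "a < b \<Longrightarrow> bdry {a, b} = frag_of {b} - frag_of {a}"
proof -
  assume ab: "a < b"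
  have "sg {a, b} a = 1" by (rule sg_min) (use ab in auto)
  moreover have "{u \<in> {a, b}. u < b} = {a}" using ab by auto
  then have "sg {a, b} b = - 1" by (simp add: sg_def)
  moreover have "{a, b} - {a} = {b}" "{a, b} - {b} = {a}" using ab by auto
  ultimately show ?thesis using ab by (simp add: bdry_def)
qed

text \<open>The potential rises along the 1-dimensional entry by at least the number of its edges,
  but it cannot rise when the path starts at \<open>n\<close> or ends at 0. For inner horns this
  rules out whiskers that contain edges.\<close>

lemma no_edge_at_extreme:
  assumes c: "complex_on n \<A>" and y: "y \<in> tcells (spx \<A>) bdry (Suc 0)"
    and e: "y 0 Neg = frag_of {n} \<or> y 0 Pos = frag_of {0}"
  shows "y \<in> tcells (spx \<A>) bdry 0"
proof (rule tcells_Suc_zero[OF y])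
  note Y = tcellsD[OF y]
  have vertex: "\<exists>v\<le>n. y 0 \<alpha> = frag_of {v}" for \<alpha>
  proof -
    obtain S where S: "y 0 \<alpha> = frag_of S" using nonneg_augmentation_1[OF Y(1,6)] by blast
    then have "S \<in> spx \<A> 0" using Y(2)[of 0 \<alpha>] by (simp add: keys_frag_of)
    then have "S \<subseteq> {..n}" "card S = 1" using spx_dim[OF c] spx_finite(2)[of S \<A> 0] by auto
    then obtain v where "S = {v}" "v \<le> n" by (metis atMost_iff card_1_singletonE insert_subset)
    then show ?thesis using S by blast
  qed
  let ?c = "y (Suc 0) Neg"
  have pos: "1 \<le> potential (bdry S)" if "S \<in> ks ?c" for S
  proof -
    have "card S = 2" using Y(2)[of "Suc 0" Neg] that spx_finite(2)[of S \<A> "Suc 0"] by auto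
    then obtain a b where "S = {a, b}" "a < b" unfolding card_2_iff by (metis insert_commute nat_neq_iff)
    then show ?thesis by (simp add: bdry_edge potential_diff) (simp add: potential_def)
  qed
  have pot: "potential (frag_extend bdry ?c) = (\<Sum>S\<in>ks ?c. lk ?c S * potential (bdry S))"
  proof -
    let ?A = "(\<Union>S\<in>ks ?c. ks (bdry S))"
    have "potential (frag_extend bdry ?c) = (\<Sum>T\<in>?A. (\<Sum>S\<in>ks ?c. lk ?c S * lk (bdry S) T) * int (Max T))"
      using potential_superset[of ?A "frag_extend bdry ?c"] keys_frag_extend[of bdry ?c] by (simp add: lookup_frag_extend)
    also have "\<dots> = (\<Sum>T\<in>?A. \<Sum>S\<in>ks ?c. lk ?c S * (lk (bdry S) T * int (Max T)))"
      by (simp add: sum_distrib_right mult.assoc)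
    also have "\<dots> = (\<Sum>S\<in>ks ?c. lk ?c S * (\<Sum>T\<in>?A. lk (bdry S) T * int (Max T)))"
      unfolding sum_distrib_left by (rule sum.swap)
    also have "\<dots> = (\<Sum>S\<in>ks ?c. lk ?c S * potential (bdry S))"
    proof (rule sum.cong[OF refl])
      fix S assume "S \<in> ks ?c"
      then have "ks (bdry S) \<subseteq> ?A" by blast
      then show "lk ?c S * (\<Sum>T\<in>?A. lk (bdry S) T * int (Max T)) = lk ?c S * potential (bdry S)"
        using potential_superset[of ?A "bdry S"] by simp
    qed
    finally show ?thesis .
  qed
  have "augmentation ?c \<le> potential (frag_extend bdry ?c)"
    unfolding pot augmentation_def
  proof (rule sum_mono)
    fix S assume "S \<in> ks ?c"
    then show "lk ?c S \<le> lk ?c S * potential (bdry S)"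
      using mult_left_mono[OF pos, of S "lk ?c S"] Y(1)[of "Suc 0" Neg] by (simp add: nonneg_def)
  qed
  also have "frag_extend bdry ?c = y 0 Pos - y 0 Neg" using Y(5)[of 0 Neg] by simp
  also have "potential (y 0 Pos - y 0 Neg) \<le> 0"
  proof -
    obtain v w where "y 0 Pos = frag_of {v}" "y 0 Neg = frag_of {w}" "v \<le> n" "w \<le> n" using vertex by metis
    then show ?thesis using e by (auto simp: potential_diff frag_of_eq) (simp_all add: potential_def)
  qed
  finally show "?c = 0" using nonneg_augmentation_0[OF Y(1)] augmentation_nonneg[OF Y(1)] by (metis order_antisym)
qed

context strict_omega_category
begin

text \<open>A simplicial map from a subcomplex to the nerve. Membership is tested on the image of a
  simplex, so degenerate simplices are covered although \<open>\<A>\<close> contains vertex sets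
  only.\<close>

definition sub_map :: "nat set set \<Rightarrow> nat \<Rightarrow> (nat \<Rightarrow> (nat \<Rightarrow> nat) \<Rightarrow> nat \<Rightarrow> oriental_cell \<Rightarrow> 'c) \<Rightarrow> bool" where
  "sub_map \<A> n H \<longleftrightarrow> (\<forall>k. \<forall>s\<in>simplex_hom k n. s ` {..k} \<in> \<A> \<longrightarrow> H k s \<in> omega_hom (oriental k) C) \<and>
     (\<forall>l k. \<forall>t\<in>simplex_hom l k. \<forall>s\<in>simplex_hom k n. s ` {..k} \<in> \<A> \<longrightarrow>
        H l (compose {..l} s t) = act (nerve C) l k t (H k s))"

definition val :: "(nat \<Rightarrow> (nat \<Rightarrow> nat) \<Rightarrow> nat \<Rightarrow> oriental_cell \<Rightarrow> 'c) \<Rightarrow> nat \<Rightarrow> nat set \<Rightarrow> 'c" where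
  "val H N S = H (card S - 1) (en (card S - 1) S) N (fromtab (atom bdry (card S - 1) {..card S - 1}))"

lemma val_eval:
  assumes H: "sub_map \<A> n H" and s: "s \<in> nd n m" and S: "s ` {..m} \<in> \<A>" and T: "T \<in> spx (full m) k" and m: "m \<le> N"
  shows "H m s N (fromtab (atom bdry k T)) = val H N (s ` T)"
proof -
  have sh: "s \<in> simplex_hom m n" "inj_on s {..m}" using s by (auto simp: nd_def)
  note t = en_nd[OF T]
  have th: "en k T \<in> simplex_hom k m" "inj_on (en k T) {..k}" using t(1) by (auto simp: nd_def)
  have Tm: "T \<subseteq> {..m}" "card T = Suc k" "k \<le> m" using spx_dim[OF complex_on_full T] spx_finite(2)[OF T] by auto
  have z: "atom bdry k {..k} \<in> ocells k N" using tcells_mono[OF atom_simplex] Tm(3) m by simp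
  have kk: "{..k} \<in> spx (full k) k" by (simp add: spx_full)
  have "H m s N (fromtab (atom bdry k T)) = H m s N (fromtab (pushT (en k T) (atom bdry k {..k})))"
    using pushT_atom_nd[OF t(1) kk] t(2) by simp
  also have "\<dots> = act (nerve C) k m (en k T) (H m s) N (fromtab (atom bdry k {..k}))"
    using act_fromtab[OF th(1) z] by simp
  also have "\<dots> = H k (compose {..k} s (en k T)) N (fromtab (atom bdry k {..k}))"
    using H th(1) sh(1) S unfolding sub_map_def by metis
  also have "compose {..k} s (en k T) = en k (s ` T)"
  proof -
    have "inj_on s (en k T ` {..k})" using t(2) Tm(1) inj_on_subset[OF sh(2)] by simp
    then have "inj_on (compose {..k} s (en k T)) {..k}"
      using comp_inj_on[OF th(2), of s] inj_on_cong[of "{..k}" "compose {..k} s (en k T)" "s \<circ> en k T"] by (simp add: compose_def)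
    then have "compose {..k} s (en k T) \<in> nd n k" using simplex_hom_compose[OF th(1) sh(1)] by (simp add: nd_def)
    moreover have "compose {..k} s (en k T) ` {..k} = s ` en k T ` {..k}" by (simp add: compose_def image_image)
    then have "compose {..k} s (en k T) ` {..k} = s ` T" unfolding t(2) .
    ultimately show ?thesis using en_image by metis
  qed
  also have "card (s ` T) = Suc k" using card_image[OF inj_on_subset[OF sh(2) Tm(1)]] Tm(2) by simp
  then have "H k (en k (s ` T)) N (fromtab (atom bdry k {..k})) = val H N (s ` T)" by (simp add: val_def)
  finally show ?thesis .
qed

text \<open>By freeness only the boundaries of top cells need checking. The boundary of
  \<open>S\<close> is computed inside the map that \<open>H\<close> assigns to \<open>S\<close>; by
  uniqueness on atoms this map agrees with the functor built so far, transported along the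
  enumeration of \<open>S\<close>.\<close>

theorem functor_of_sub_map:
  assumes c: "complex_on n \<A>" and nN: "n < N" and H: "sub_map \<A> n H"
  shows "\<exists>F. S.thom N N (spx \<A>) bdry F \<and> (\<forall>k\<le>N. \<forall>S\<in>spx \<A> k. F (atom bdry k S) = val H N S)"
proof -
  note lf = loop_free_spx[OF c]
  have en: "en k S \<in> nd n k" "en k S ` {..k} = S" "en k S ` {..k} \<in> \<A>" "k \<le> n" "en k S \<in> simplex_hom k n"
    "card S = Suc k" if "S \<in> spx \<A> k" for S k
    using en_nd[OF spx_dim(3)[OF c that]] spx_finite[OF that] spx_dim(1)[OF c that] by (auto simp: nd_def)
  have Hs: "H k (en k S) \<in> omega_hom (oriental k) C" if "S \<in> spx \<A> k" for S k
    using H en[OF that] unfolding sub_map_def by blast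
  have cell: "S.cell N k (val H N S)" if "S \<in> spx \<A> k" for S k
  proof -
    have "S.cell N k (H k (en k S) N (fromtab (atom bdry k {..k})))"
      by (rule S.thom_cell[OF hom_thom[OF Hs[OF that]] atom_simplex]) (use en(4)[OF that] nN in simp)
    then show ?thesis using en(6)[OF that] by (simp add: val_def)
  qed
  have "\<exists>F. S.thom N N (spx \<A>) bdry F \<and> (\<forall>k\<le>N. \<forall>S\<in>spx \<A> k. F (atom bdry k S) = val H N S) \<and> (\<forall>x\<in>tcells (spx \<A>) bdry N. S.cell N N (F x))"
  proof (rule S.thom_free[OF lf cell])
    fix q F S \<alpha>
    assume F: "S.thom N q (spx \<A>) bdry F" and Fa: "\<And>k T. \<lbrakk>k \<le> q; T \<in> spx \<A> k\<rbrakk> \<Longrightarrow> F (atom bdry k T) = val H N T"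
      and S: "S \<in> spx \<A> (Suc q)"
    let ?s = "en (Suc q) S"
    note s = en[OF S]
    have E: "S.thom N N (spx (full (Suc q))) bdry (\<lambda>z. H (Suc q) ?s N (fromtab z))" using hom_thom[OF Hs[OF S]] .
    have P: "S.thom N q (spx (full (Suc q))) bdry (\<lambda>z. F (pushT ?s z))"
      unfolding S.thom_def
      using S.thomD[OF F] pushT_into[OF c s(1,3)] pushT_tbd pushT_tcmp by metis
    have eq: "H (Suc q) ?s N (fromtab z) = F (pushT ?s z)" if z: "z \<in> ocells (Suc q) q" for z
    proof (rule S.thom_unique_atoms[OF loop_free_spx[OF complex_on_full] _ P _ z])
      show "S.thom N q (spx (full (Suc q))) bdry (\<lambda>z. H (Suc q) ?s N (fromtab z))"
        by (rule S.thom_mono[OF E]) (use s(4) nN in \<open>auto intro: tcells_mono\<close>)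
      fix k T assume k: "k \<le> q" and T: "T \<in> spx (full (Suc q)) k"
      have "?s ` T \<in> spx \<A> k"
      proof -
        have "atom bdry k T \<in> ocells (Suc q) k" by (rule atom_tcells[OF loop_free_spx[OF complex_on_full] T])
        from tcellsD(2)[OF pushT_into[OF c s(1,3) this], of k Neg]
        show ?thesis unfolding pushT_atom_nd[OF s(1) T] by (simp add: atom_def keys_frag_of)
      qed
      then show "H (Suc q) ?s N (fromtab (atom bdry k T)) = F (pushT ?s (atom bdry k T))"
        using val_eval[OF H s(1,3) T, of N] Fa[OF k] s(4) nN pushT_atom_nd[OF s(1) T] by simp
    qed
    have a: "atom bdry (Suc q) {..Suc q} \<in> ocells (Suc q) N" using tcells_mono[OF atom_simplex] s(4) nN by simp
    have t: "tbd \<alpha> q (atom bdry (Suc q) {..Suc q}) \<in> ocells (Suc q) q" using tbd_tcells[OF a, of q] s(4) nN by simp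
    have "Cd C N \<alpha> q (val H N S) = Cd C N \<alpha> q (H (Suc q) ?s N (fromtab (atom bdry (Suc q) {..Suc q})))"
      using s(6) by (simp add: val_def)
    also have "\<dots> = H (Suc q) ?s N (fromtab (tbd \<alpha> q (atom bdry (Suc q) {..Suc q})))"
      using S.thomD(2)[OF E a, of q \<alpha>] s(4) nN by simp
    also have "\<dots> = F (tbd \<alpha> q (pushT ?s (atom bdry (Suc q) {..Suc q})))" using eq[OF t] by (simp add: pushT_tbd)
    also have "pushT ?s (atom bdry (Suc q) {..Suc q}) = atom bdry (Suc q) S"
      using pushT_atom_nd[OF s(1), of "{..Suc q}" "Suc q"] s(2) by (simp add: spx_full)
    finally show "Cd C N \<alpha> q (val H N S) = F (tbd \<alpha> q (atom bdry (Suc q) S))" .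
  qed
  then show ?thesis by blast
qed

text \<open>All proper faces of \<open>T\<close> lie in \<open>\<A>\<close>, so the only new
  condition concerns the boundary of \<open>T\<close>; uniqueness keeps the old values.\<close>

lemma attach:
  assumes c: "complex_on n \<A>" and c': "complex_on n (insert T \<A>)" and T: "T \<in> spx (insert T \<A>) q" "T \<notin> \<A>" and nN: "n < N"
    and F: "S.thom N N (spx \<A>) bdry F" and b: "S.cell N q \<beta>"
    and bd: "\<And>\<alpha>. 0 < q \<Longrightarrow> Cd C N \<alpha> (q - 1) \<beta> = F (tbd \<alpha> (q - 1) (atom bdry q T))"
  shows "\<exists>F'. S.thom N N (spx (insert T \<A>)) bdry F' \<and> (\<forall>x\<in>tcells (spx \<A>) bdry N. F' x = F x) \<and> F' (atom bdry q T) = \<beta>"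
proof -
  note lf = loop_free_spx[OF c] and lf' = loop_free_spx[OF c']
  define \<phi> where "\<phi> = (\<lambda>S. if S = T then \<beta> else F (atom bdry (card S - 1) S))"
  have old: "S \<in> spx \<A> k \<and> \<phi> S = F (atom bdry k S)" if "S \<in> spx (insert T \<A>) k" "S \<noteq> T" for S k
    using that spx_finite(2)[OF that(1)] by (auto simp: \<phi>_def spx_def)
  have sub: "spx \<A> k \<subseteq> spx (insert T \<A>) k" for k by (rule spx_mono) auto
  have dimT: "k = q" if "T \<in> spx (insert T \<A>) k" for k using spx_finite(2)[OF that] spx_finite(2)[OF T(1)] by simp
  have "\<exists>F'. S.thom N N (spx (insert T \<A>)) bdry F' \<and> (\<forall>k\<le>N. \<forall>S\<in>spx (insert T \<A>) k. F' (atom bdry k S) = \<phi> S)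
      \<and> (\<forall>x\<in>tcells (spx (insert T \<A>)) bdry N. S.cell N N (F' x))"
  proof (rule S.thom_free[OF lf'])
    fix k S assume S: "S \<in> spx (insert T \<A>) k"
    show "S.cell N k (\<phi> S)"
    proof (cases "S = T")
      case True
      then show ?thesis using dimT S b by (simp add: \<phi>_def)
    next
      case False
      have "S.cell N k (F (atom bdry k S))"
        by (rule S.thom_cell[OF F atom_tcells[OF lf]]) (use old[OF S False] spx_dim(1)[OF c' S] nN in auto)
      then show ?thesis using old[OF S False] by simp
    qed
  next
    fix p G S \<alpha>
    assume G: "S.thom N p (spx (insert T \<A>)) bdry G"
      and Ga: "\<And>k S. \<lbrakk>k \<le> p; S \<in> spx (insert T \<A>) k\<rbrakk> \<Longrightarrow> G (atom bdry k S) = \<phi> S"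
      and S: "S \<in> spx (insert T \<A>) (Suc p)"
    have p: "p < N" using spx_dim(1)[OF c' S] nN by simp
    \<comment> \<open>\<open>G\<close> is an arbitrary map with the prescribed values on atoms; on
      the old subcomplex uniqueness identifies it with \<open>F\<close>.\<close>
    have GF: "G x = F x" if x: "x \<in> tcells (spx \<A>) bdry p" for x
    proof (rule S.thom_unique_atoms[OF lf _ _ _ x])
      show "S.thom N p (spx \<A>) bdry G" by (rule S.thom_mono[OF G order_refl tcells_subset[OF sub]])
      show "S.thom N p (spx \<A>) bdry F" by (rule S.thom_mono[OF F]) (use p in \<open>auto intro: tcells_mono\<close>)
      fix k S assume k: "k \<le> p" and S: "S \<in> spx \<A> k"
      have "S \<noteq> T" using T(2) spx_finite(3)[OF S] by blast
      then show "G (atom bdry k S) = F (atom bdry k S)" using Ga[OF k subsetD[OF sub S]] old[OF subsetD[OF sub S]] by simp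
    qed
    show "Cd C N \<alpha> p (\<phi> S) = G (tbd \<alpha> p (atom bdry (Suc p) S))"
    proof (cases "S = T")
      case True
      then have q: "q = Suc p" using dimT S by simp
      have t: "tbd \<alpha> p (atom bdry q T) \<in> tcells (spx (insert T \<A>)) bdry p"
        using tbd_tcells[OF atom_tcells[OF lf' T(1)], of p] q by simp
      have "tbd \<alpha> p (atom bdry q T) \<in> tcells (spx \<A>) bdry p"
        by (rule tcells_keys[OF t]) (use tcellsD(2)[OF t] old dimT q in force)
      then show ?thesis using GF bd[of \<alpha>] True q by (simp add: \<phi>_def)
    next
      case False
      note o = old[OF S False]
      have a: "atom bdry (Suc p) S \<in> tcells (spx \<A>) bdry (Suc p)" by (rule atom_tcells[OF lf]) (use o in simp)
      then have "Cd C N \<alpha> p (F (atom bdry (Suc p) S)) = F (tbd \<alpha> p (atom bdry (Suc p) S))"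
        using S.thomD(2)[OF F, of "atom bdry (Suc p) S" p \<alpha>] tcells_mono[OF a, of N] p by simp
      then show ?thesis using o GF[of "tbd \<alpha> p (atom bdry (Suc p) S)"] tbd_tcells[OF a, of p \<alpha>] by simp
    qed
  qed
  then obtain F' where F': "S.thom N N (spx (insert T \<A>)) bdry F'" "\<And>k S. \<lbrakk>k \<le> N; S \<in> spx (insert T \<A>) k\<rbrakk> \<Longrightarrow> F' (atom bdry k S) = \<phi> S"
    by blast
  have "F' x = F x" if x: "x \<in> tcells (spx \<A>) bdry N" for x
  proof (rule S.thom_unique_atoms[OF lf _ F _ x])
    show "S.thom N N (spx \<A>) bdry F'" by (rule S.thom_mono[OF F'(1) order_refl tcells_subset[OF sub]])
    fix k S assume k: "k \<le> N" and S: "S \<in> spx \<A> k"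
    have "S \<noteq> T" using T(2) spx_finite(3)[OF S] by blast
    then show "F' (atom bdry k S) = F (atom bdry k S)" using F'(2)[OF k subsetD[OF sub S]] old[OF subsetD[OF sub S]] by simp
  qed
  moreover have "F' (atom bdry q T) = \<beta>" using F'(2)[OF _ T(1)] spx_dim(1)[OF c' T(1)] nN by (simp add: \<phi>_def)
  ultimately show ?thesis using F'(1) by blast
qed

end

section \<open>Filling horns\<close>

definition hornset :: "nat \<Rightarrow> nat \<Rightarrow> nat set set" where
  "hornset i n = {S. S \<subseteq> {..n} \<and> S \<noteq> {} \<and> (\<exists>j\<le>n. j \<noteq> i \<and> j \<notin> S)}"

lemma complex_hornset: "complex_on n (hornset i n)"
  unfolding complex_on_def hornset_def by blast

lemma horn_simplices: "s \<in> simplices (horn i n) m \<longleftrightarrow> s \<in> simplex_hom m n \<and> s ` {..m} \<in> hornset i n"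
proof -
  have "s ` {..m} \<subseteq> {..n}" if "s \<in> simplex_hom m n" using simplex_homD(1)[OF that] by auto
  then show ?thesis unfolding horn_def opposite_face_def hornset_def standard_simplex_simps by auto
qed

text \<open>The injective factor enumerates the image of \<open>s\<close>. It reduces questions
  about all simplices to nondegenerate ones, whose dimension is bounded.\<close>

lemma epi_mono:
  assumes s: "s \<in> simplex_hom m n"
  obtains l r \<sigma> where "r \<in> nd n l" "\<sigma> \<in> simplex_hom m l" "s = compose {..m} r \<sigma>" "r ` {..l} = s ` {..m}"
proof -
  let ?S = "s ` {..m}"
  define l where "l = card ?S - 1"
  define r where "r = en l ?S"
  have "finite ?S" "?S \<noteq> {}" by auto
  then have cS: "card ?S = Suc l" using card_gt_0_iff[of ?S] by (simp add: l_def)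
  have "?S \<subseteq> {..n}" using simplex_homD(1)[OF s] by auto
  then have S: "?S \<in> spx (full n) l" using cS by (simp add: spx_full)
  have r: "r \<in> nd n l" "r ` {..l} = ?S" using en_nd[OF S] by (simp_all add: r_def)
  define f where "f = (\<lambda>j. SOME i. i \<le> l \<and> r i = s j)"
  have f: "f j \<le> l \<and> r (f j) = s j" if "j \<le> m" for j
  proof -
    have "s j \<in> r ` {..l}" using r(2) that by simp
    then have "\<exists>i. i \<le> l \<and> r i = s j" by (auto simp: image_iff)
    then show ?thesis unfolding f_def by (rule someI_ex)
  qed
  have "restrict f {..m} \<in> simplex_hom m l"
  proof (rule simplex_homI)
    fix a b assume ab: "a \<le> b" "b \<le> m"
    show "f a \<le> f b"
    proof (rule ccontr)
      assume "\<not> ?thesis"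
      then have "r (f b) < r (f a)" using nd_less[OF r(1), of "f b" "f a"] f[of a] ab by simp
      then show False using f[of a] f[of b] ab simplex_homD(2)[OF s, of a b] by simp
    qed
  qed (use f in blast)
  moreover have "s = compose {..m} r (restrict f {..m})"
  proof
    fix j
    show "s j = compose {..m} r (restrict f {..m}) j"
      using f[of j] simplex_homD(3)[OF s, of j] by (simp add: compose_def)
  qed
  ultimately show ?thesis using that r by blast
qed

context strict_omega_category
begin

text \<open>Induction over the whiskers around the missing face \<open>g\<close>. At each stage
  \<open>T\<close> is divided by the value \<open>Y\<close> of the outermost whisker, which avoids
  \<open>g\<close> and is therefore known. The first conjunct carries the end points along: for
  inner horns they make every whisker along 0 trivial, so division is needed only along
  \<open>k \<ge> lo\<close>.\<close>

lemma whisk_solve: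
  assumes c: "complex_on n \<A>" and c': "complex_on n (insert g \<A>)" and g: "g \<in> spx (insert g \<A>) q" "g \<notin> \<A>" and nN: "n < N"
    and F: "S.thom N N (spx \<A>) bdry F"
    and inv: "\<And>j. \<lbrakk>lo \<le> j; j \<le> q\<rbrakk> \<Longrightarrow> S.invertible_dim N j"
    and lo: "lo = 0 \<or> lo = 1 \<and> atom bdry q g 0 Neg = frag_of {0} \<and> atom bdry q g 0 Pos = frag_of {n}"
    and w: "whisk (spx (insert g \<A>)) bdry g q x"
  shows "(lo = 0 \<or> x 0 Neg = frag_of {0} \<and> x 0 Pos = frag_of {n}) \<and>
    (\<forall>T. S.cell N q T \<longrightarrow> (0 < q \<longrightarrow> (\<forall>\<alpha>. Cd C N \<alpha> (q - 1) T = F (tbd \<alpha> (q - 1) x))) \<longrightarrow>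
      (\<exists>F'. S.thom N N (spx (insert g \<A>)) bdry F' \<and> (\<forall>y\<in>tcells (spx \<A>) bdry N. F' y = F y) \<and> S.arrow N q (F' x) T))"
  using w
proof induction
  case base
  have "\<exists>F'. S.thom N N (spx (insert g \<A>)) bdry F' \<and> (\<forall>y\<in>tcells (spx \<A>) bdry N. F' y = F y) \<and> S.arrow N q (F' (atom bdry q g)) T"
    if T: "S.cell N q T" "0 < q \<longrightarrow> (\<forall>\<alpha>. Cd C N \<alpha> (q - 1) T = F (tbd \<alpha> (q - 1) (atom bdry q g)))" for T
    using attach[OF c c' g nN F T(1)] T(2) S.arrow_refl[OF T(1)] by metis
  then show ?case using lo by blast
next
  case (left x k y)
  let ?E = "\<lambda>F'. S.thom N N (spx (insert g \<A>)) bdry F' \<and> (\<forall>y\<in>tcells (spx \<A>) bdry N. F' y = F y)"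
  note k = left.hyps(2) and co = left.hyps(5)
  have qN: "q < N" using spx_dim(1)[OF c' g(1)] nN by simp
  have x: "x \<in> tcells (spx (insert g \<A>)) bdry q" by (rule whisk_tcells[OF loop_free_spx[OF c'] g(1) left.hyps(1)])
  have old: "S \<in> spx \<A> j" if "S \<in> spx (insert g \<A>) j" "S \<noteq> g" for S j using that by (auto simp: spx_def)
  have dimg: "j = q" if "g \<in> spx (insert g \<A>) j" for j using spx_finite(2)[OF that] spx_finite(2)[OF g(1)] by simp
  have yA: "y \<in> tcells (spx \<A>) bdry (Suc k)"
  proof (rule tcells_keys[OF left.hyps(3)])
    fix j \<alpha> assume j: "j \<le> Suc k"
    show "ks (y j \<alpha>) \<subseteq> spx \<A> j"
    proof
      fix S assume S: "S \<in> ks (y j \<alpha>)"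
      then have S': "S \<in> spx (insert g \<A>) j" using tcellsD(2)[OF left.hyps(3) j] by blast
      have "S \<noteq> g"
      proof
        assume e: "S = g"
        then have "j = q" using dimg S' by simp
        then have "Suc k = q" using j k by simp
        then have "g \<notin> ks (y q \<alpha>)" using tcellsD(4)[OF left.hyps(3)] left.hyps(4) by (cases \<alpha>) (auto simp: in_keys_iff)
        then show False using S e \<open>j = q\<close> by simp
      qed
      then show "S \<in> spx \<A> j" using old[OF S'] by simp
    qed
  qed
  show ?case
  proof (cases "y \<in> tcells (spx \<A>) bdry k")
    case True
    have "tcmp k y x = x" using tcmp_unit(1)[OF co True] .
    then show ?thesis using left.IH by simp
  next
    case False
    \<comment> \<open>A left whisker along 0 would start at the last vertex \<open>n\<close> and
      hence contain no edge, but then it would be a unit.\<close>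
    have lok: "lo \<le> k"
    proof (rule ccontr)
      assume "\<not> lo \<le> k"
      then have l: "lo = 1" "k = 0" using lo by auto
      then have "y 0 Neg = frag_of {n}" using left.IH tbd_eqD(2)[OF co] by simp
      then show False using no_edge_at_extreme[OF c] yA False l by simp
    qed
    have ends: "lo = 0 \<or> tcmp k y x 0 Neg = frag_of {0} \<and> tcmp k y x 0 Pos = frag_of {n}"
      using left.IH lok lo tcmp_entry[OF co, of 0] by auto
    have inN: "z \<in> tcells (spx \<A>) bdry N" if "z \<in> tcells (spx \<A>) bdry p" "p \<le> q" for z p
      using tcells_mono[OF that(1), of N] that(2) qN by simp
    note f = S.thomD[OF F]
    have low: "tbd \<alpha> j x \<in> tcells (spx \<A>) bdry j" if j: "j < q" for \<alpha> j
    proof -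
      have t: "tbd \<alpha> j x \<in> tcells (spx (insert g \<A>)) bdry j" using tbd_tcells[OF x] j by simp
      have s: "spx (insert g \<A>) i \<subseteq> spx \<A> i" if "i \<le> j" for i
      proof
        fix S assume S: "S \<in> spx (insert g \<A>) i"
        then have "S \<noteq> g" using dimg[of i] that j by auto
        then show "S \<in> spx \<A> i" using old[OF S] by simp
      qed
      show ?thesis by (rule tcells_keys[OF t]) (rule subset_trans[OF tcellsD(2)[OF t] s])
    qed
    define Y s t where "Y = F y" and "s = F (tbd Neg (q - 1) x)" and "t = F (tbd Pos (q - 1) x)"
    have yN: "y \<in> tcells (spx \<A>) bdry N" using inN[OF yA] k by simp
    have YM: "Y \<in> cells C N" "S.cell N (Suc k) Y" unfolding Y_def using f(1)[OF yN] S.thom_cell[OF F yA] k qN by auto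
    have q1: "q - 1 < q" "q - 1 < N" "k \<le> q - 1" using k qN by auto
    have xN: "tbd \<alpha> (q - 1) x \<in> tcells (spx \<A>) bdry N" for \<alpha> using inN[OF low[OF q1(1)]] by simp
    have stc: "S.cell N (q - 1) s" "S.cell N (q - 1) t"
      unfolding s_def t_def using S.thom_cell[OF F low[OF q1(1)] q1(2)] by auto
    have Fx: "Cd C N \<beta> j (F (tbd \<alpha> (q - 1) x)) = F (tbd \<beta> j x)" if "j < q - 1" for \<alpha> \<beta> j
      using f(2)[OF xN, of j \<beta> \<alpha>] that q1(2) by (simp add: tbd_tbd_less)
    have Yk: "Cd C N \<alpha> k Y = F (tbd \<alpha> k y)" for \<alpha> using f(2)[OF yN, of k \<alpha>] k qN by (simp add: Y_def)
    have sk: "q = Suc k \<or> Cd C N Pos k s = Cd C N Neg k Y"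
      using Fx[of k Pos Neg] co q1(3) k unfolding Yk s_def by (cases "q = Suc k") auto
    have par: "q = Suc k \<or> (\<forall>\<alpha>. Cd C N \<alpha> (q - 2) s = Cd C N \<alpha> (q - 2) t)"
      using Fx[of "q - 2"] k unfolding s_def t_def by auto
    have main: "\<exists>F'. ?E F' \<and> S.arrow N q (F' (tcmp k y x)) T"
      if T: "S.cell N q T" and bT: "\<And>\<alpha>. Cd C N \<alpha> (q - 1) T = F (tbd \<alpha> (q - 1) (tcmp k y x))" for T
    proof -
      have wb: "S.whisker_boundary N k q Y s t T"
      proof (cases "q = Suc k")
        case True
        then show ?thesis unfolding S.whisker_boundary_def
          using bT[of Neg] bT[of Pos] tbd_tcmp_eq[OF co] co Yk by (simp add: s_def t_def)
      next
        case False
        then have kq: "k < q - 1" using q1(3) k by linarith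
        have "F (tbd \<alpha> (q - 1) (tcmp k y x)) = Cc C N k Y (F (tbd \<alpha> (q - 1) x))" for \<alpha>
        proof -
          have "tbd \<alpha> (q - 1) y = y" by (rule tbd_id[OF yA]) (use kq in simp)
          then have "tbd \<alpha> (q - 1) (tcmp k y x) = tcmp k y (tbd \<alpha> (q - 1) x)" using tbd_tcmp[OF kq, of \<alpha> y x] by simp
          moreover have "tbd Neg k y = tbd Pos k (tbd \<alpha> (q - 1) x)" using co tbd_tbd_less[OF kq] by metis
          ultimately show ?thesis using f(3)[OF yN xN, of k \<alpha>] k qN by (simp add: Y_def)
        qed
        then show ?thesis unfolding S.whisker_boundary_def using False bT by (simp add: s_def t_def)
      qed
      have "\<exists>T'. S.cell N q T' \<and> Cd C N Neg (q - 1) T' = s \<and> Cd C N Pos (q - 1) T' = t \<and> S.arrow N q (Cc C N k Y T') T"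
        by (rule S.solve_left[OF k T stc YM(2) sk par _ wb]) (use inv lok in auto)
      then obtain T' where T': "S.cell N q T'" "Cd C N Neg (q - 1) T' = s" "Cd C N Pos (q - 1) T' = t" "S.arrow N q (Cc C N k Y T') T"
        by blast
      have al: "\<forall>\<alpha>. Cd C N \<alpha> (q - 1) T' = F (tbd \<alpha> (q - 1) x)"
      proof
        fix \<alpha> show "Cd C N \<alpha> (q - 1) T' = F (tbd \<alpha> (q - 1) x)"
          using T'(2,3) unfolding s_def t_def by (cases \<alpha>) simp_all
      qed
      have "\<exists>F'. ?E F' \<and> S.arrow N q (F' x) T'"
        unfolding conj_assoc by (rule left.IH[THEN conjunct2, THEN spec, THEN mp, THEN mp, OF T'(1)]) (intro impI al)
      then obtain F' where F': "?E F'" "S.arrow N q (F' x) T'" by blast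
      note f' = S.thomD[OF conjunct1[OF F'(1)]]
      have xg: "x \<in> tcells (spx (insert g \<A>)) bdry N" using tcells_mono[OF x] qN by simp
      have yg: "y \<in> tcells (spx (insert g \<A>)) bdry N" using tcells_mono[OF left.hyps(3), of N] k qN by simp
      have Fy: "F' y = Y" using F'(1) yN by (simp add: Y_def)
      have "F' (tcmp k y x) = Cc C N k Y (F' x)" "Cd C N Neg k Y = Cd C N Pos k (F' x)"
        using f'(3,4)[OF yg xg _ co] k qN Fy by auto
      then have "S.arrow N q (F' (tcmp k y x)) (Cc C N k Y T')"
        using S.arrow_whisker_left[OF F'(2) S.cell_mono[OF YM(2)] k] k by simp
      from S.arrow_trans[OF this T'(4)] F'(1) show ?thesis by blast
    qed
    show ?thesis using ends main k by blast
  qed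
next
  case (right x k y)
  let ?E = "\<lambda>F'. S.thom N N (spx (insert g \<A>)) bdry F' \<and> (\<forall>y\<in>tcells (spx \<A>) bdry N. F' y = F y)"
  note k = right.hyps(2) and co = right.hyps(5)
  have qN: "q < N" using spx_dim(1)[OF c' g(1)] nN by simp
  have x: "x \<in> tcells (spx (insert g \<A>)) bdry q" by (rule whisk_tcells[OF loop_free_spx[OF c'] g(1) right.hyps(1)])
  have old: "S \<in> spx \<A> j" if "S \<in> spx (insert g \<A>) j" "S \<noteq> g" for S j using that by (auto simp: spx_def)
  have dimg: "j = q" if "g \<in> spx (insert g \<A>) j" for j using spx_finite(2)[OF that] spx_finite(2)[OF g(1)] by simp
  have yA: "y \<in> tcells (spx \<A>) bdry (Suc k)"
  proof (rule tcells_keys[OF right.hyps(3)])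
    fix j \<alpha> assume j: "j \<le> Suc k"
    show "ks (y j \<alpha>) \<subseteq> spx \<A> j"
    proof
      fix S assume S: "S \<in> ks (y j \<alpha>)"
      then have S': "S \<in> spx (insert g \<A>) j" using tcellsD(2)[OF right.hyps(3) j] by blast
      have "S \<noteq> g"
      proof
        assume e: "S = g"
        then have "j = q" using dimg S' by simp
        then have "Suc k = q" using j k by simp
        then have "g \<notin> ks (y q \<alpha>)" using tcellsD(4)[OF right.hyps(3)] right.hyps(4) by (cases \<alpha>) (auto simp: in_keys_iff)
        then show False using S e \<open>j = q\<close> by simp
      qed
      then show "S \<in> spx \<A> j" using old[OF S'] by simp
    qed
  qed
  show ?case
  proof (cases "y \<in> tcells (spx \<A>) bdry k")
    case True
    have "tcmp k x y = x" using tcmp_unit(2)[OF co True] .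
    then show ?thesis using right.IH by simp
  next
    case False
    \<comment> \<open>Symmetrically, a right whisker along 0 would end at the first vertex.\<close>
    have lok: "lo \<le> k"
    proof (rule ccontr)
      assume "\<not> lo \<le> k"
      then have l: "lo = 1" "k = 0" using lo by auto
      then have "y 0 Pos = frag_of {0}" using right.IH tbd_eqD(2)[OF co] by simp
      then show False using no_edge_at_extreme[OF c] yA False l by simp
    qed
    have ends: "lo = 0 \<or> tcmp k x y 0 Neg = frag_of {0} \<and> tcmp k x y 0 Pos = frag_of {n}"
      using right.IH lok lo tcmp_entry[OF co, of 0] tbd_eqD(1)[OF co, of 0] by auto
    have inN: "z \<in> tcells (spx \<A>) bdry N" if "z \<in> tcells (spx \<A>) bdry p" "p \<le> q" for z p
      using tcells_mono[OF that(1), of N] that(2) qN by simp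
    note f = S.thomD[OF F]
    have low: "tbd \<alpha> j x \<in> tcells (spx \<A>) bdry j" if j: "j < q" for \<alpha> j
    proof -
      have t: "tbd \<alpha> j x \<in> tcells (spx (insert g \<A>)) bdry j" using tbd_tcells[OF x] j by simp
      have s: "spx (insert g \<A>) i \<subseteq> spx \<A> i" if "i \<le> j" for i
      proof
        fix S assume S: "S \<in> spx (insert g \<A>) i"
        then have "S \<noteq> g" using dimg[of i] that j by auto
        then show "S \<in> spx \<A> i" using old[OF S] by simp
      qed
      show ?thesis by (rule tcells_keys[OF t]) (rule subset_trans[OF tcellsD(2)[OF t] s])
    qed
    define Y s t where "Y = F y" and "s = F (tbd Neg (q - 1) x)" and "t = F (tbd Pos (q - 1) x)"
    have yN: "y \<in> tcells (spx \<A>) bdry N" using inN[OF yA] k by simp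
    have YM: "Y \<in> cells C N" "S.cell N (Suc k) Y" unfolding Y_def using f(1)[OF yN] S.thom_cell[OF F yA] k qN by auto
    have q1: "q - 1 < q" "q - 1 < N" "k \<le> q - 1" using k qN by auto
    have xN: "tbd \<alpha> (q - 1) x \<in> tcells (spx \<A>) bdry N" for \<alpha> using inN[OF low[OF q1(1)]] by simp
    have stc: "S.cell N (q - 1) s" "S.cell N (q - 1) t"
      unfolding s_def t_def using S.thom_cell[OF F low[OF q1(1)] q1(2)] by auto
    have Fx: "Cd C N \<beta> j (F (tbd \<alpha> (q - 1) x)) = F (tbd \<beta> j x)" if "j < q - 1" for \<alpha> \<beta> j
      using f(2)[OF xN, of j \<beta> \<alpha>] that q1(2) by (simp add: tbd_tbd_less)
    have Yk: "Cd C N \<alpha> k Y = F (tbd \<alpha> k y)" for \<alpha> using f(2)[OF yN, of k \<alpha>] k qN by (simp add: Y_def)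
    have sk: "q = Suc k \<or> Cd C N Neg k s = Cd C N Pos k Y"
      using Fx[of k Neg Neg] co q1(3) k unfolding Yk s_def by (cases "q = Suc k") auto
    have par: "q = Suc k \<or> (\<forall>\<alpha>. Cd C N \<alpha> (q - 2) s = Cd C N \<alpha> (q - 2) t)"
      using Fx[of "q - 2"] k unfolding s_def t_def by auto
    have main: "\<exists>F'. ?E F' \<and> S.arrow N q (F' (tcmp k x y)) T"
      if T: "S.cell N q T" and bT: "\<And>\<alpha>. Cd C N \<alpha> (q - 1) T = F (tbd \<alpha> (q - 1) (tcmp k x y))" for T
    proof -
      have wb: "S.whisker_boundary' N k q Y s t T"
      proof (cases "q = Suc k")
        case True
        then show ?thesis unfolding S.whisker_boundary'_def
          using bT[of Neg] bT[of Pos] tbd_tcmp_eq[OF co] co Yk by (simp add: s_def t_def)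
      next
        case False
        then have kq: "k < q - 1" using q1(3) k by linarith
        have "F (tbd \<alpha> (q - 1) (tcmp k x y)) = Cc C N k (F (tbd \<alpha> (q - 1) x)) Y" for \<alpha>
        proof -
          have "tbd \<alpha> (q - 1) y = y" by (rule tbd_id[OF yA]) (use kq in simp)
          then have "tbd \<alpha> (q - 1) (tcmp k x y) = tcmp k (tbd \<alpha> (q - 1) x) y" using tbd_tcmp[OF kq, of \<alpha> x y] by simp
          moreover have "tbd Neg k (tbd \<alpha> (q - 1) x) = tbd Pos k y" using co tbd_tbd_less[OF kq] by metis
          ultimately show ?thesis using f(3)[OF xN yN, of k \<alpha>] k qN by (simp add: Y_def)
        qed
        then show ?thesis unfolding S.whisker_boundary'_def using False bT by (simp add: s_def t_def)
      qed
      have "\<exists>T'. S.cell N q T' \<and> Cd C N Neg (q - 1) T' = s \<and> Cd C N Pos (q - 1) T' = t \<and> S.arrow N q (Cc C N k T' Y) T"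
        by (rule S.solve_right[OF k T stc YM(2) sk par _ wb]) (use inv lok in auto)
      then obtain T' where T': "S.cell N q T'" "Cd C N Neg (q - 1) T' = s" "Cd C N Pos (q - 1) T' = t" "S.arrow N q (Cc C N k T' Y) T"
        by blast
      have al: "\<forall>\<alpha>. Cd C N \<alpha> (q - 1) T' = F (tbd \<alpha> (q - 1) x)"
      proof
        fix \<alpha> show "Cd C N \<alpha> (q - 1) T' = F (tbd \<alpha> (q - 1) x)"
          using T'(2,3) unfolding s_def t_def by (cases \<alpha>) simp_all
      qed
      have "\<exists>F'. ?E F' \<and> S.arrow N q (F' x) T'"
        unfolding conj_assoc by (rule right.IH[THEN conjunct2, THEN spec, THEN mp, THEN mp, OF T'(1)]) (intro impI al)
      then obtain F' where F': "?E F'" "S.arrow N q (F' x) T'" by blast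
      note f' = S.thomD[OF conjunct1[OF F'(1)]]
      have xg: "x \<in> tcells (spx (insert g \<A>)) bdry N" using tcells_mono[OF x] qN by simp
      have yg: "y \<in> tcells (spx (insert g \<A>)) bdry N" using tcells_mono[OF right.hyps(3), of N] k qN by simp
      have Fy: "F' y = Y" using F'(1) yN by (simp add: Y_def)
      have "F' (tcmp k x y) = Cc C N k (F' x) Y" "Cd C N Neg k (F' x) = Cd C N Pos k Y"
        using f'(3,4)[OF xg yg _ co] k qN Fy by auto
      then have "S.arrow N q (F' (tcmp k x y)) (Cc C N k T' Y)"
        using S.arrow_whisker_right[OF F'(2) S.cell_mono[OF YM(2)] k] k by simp
      from S.arrow_trans[OF this T'(4)] F'(1) show ?thesis by blast
    qed
    show ?thesis using ends main k by blast
  qed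
qed

text \<open>Dimension \<open>Suc n\<close> leaves room for the cells that witness invertibility of
  \<open>n\<close>-cells. The bound \<open>lo\<close> is 1 for inner horns when nothing is assumed
  about 1-cells, and 0 when 1-cells are invertible too.\<close>

theorem fill_horn:
  assumes n: "0 < n" "i \<le> n" and H: "sub_map (hornset i n) n H"
    and inv: "\<And>j. \<lbrakk>lo \<le> j; j < n\<rbrakk> \<Longrightarrow> S.invertible_dim (Suc n) j" and lo: "lo = 0 \<or> lo = 1 \<and> 0 < i \<and> i < n"
  shows "\<exists>y\<in>omega_hom (oriental n) C. \<forall>m s. s \<in> simplex_hom m n \<longrightarrow> s ` {..m} \<in> hornset i n \<longrightarrow> act (nerve C) m n s y = H m s"
proof -
  let ?A = "hornset i n" and ?N = "Suc n" and ?q = "n - 1"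
  define g where "g = {..n} - {i}"
  define T0 where "T0 = {..n}"
  have q: "?q < n" "Suc ?q = n" using n by auto
  have cardg: "card g = n" "finite g" using n by (auto simp: g_def)
  have ge: "g \<noteq> {}" using cardg n by auto
  have gA: "g \<notin> ?A" unfolding hornset_def g_def by blast
  have S1: "insert g ?A = full n - {T0}"
  proof (rule Set.set_eqI)
    fix S
    have "S \<in> full n - {T0} \<longleftrightarrow> S \<subseteq> {..n} \<and> S \<noteq> {} \<and> (\<exists>j\<le>n. j \<notin> S)" unfolding full_def T0_def by blast
    moreover have "S = g \<or> S \<in> ?A \<longleftrightarrow> S \<subseteq> {..n} \<and> S \<noteq> {} \<and> (\<exists>j\<le>n. j \<notin> S)"
    proof
      assume "S = g \<or> S \<in> ?A"
      then show "S \<subseteq> {..n} \<and> S \<noteq> {} \<and> (\<exists>j\<le>n. j \<notin> S)" using n(2) ge unfolding hornset_def g_def by blast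
    next
      assume S: "S \<subseteq> {..n} \<and> S \<noteq> {} \<and> (\<exists>j\<le>n. j \<notin> S)"
      show "S = g \<or> S \<in> ?A"
      proof (cases "\<exists>j\<le>n. j \<noteq> i \<and> j \<notin> S")
        case True
        then show ?thesis using S unfolding hornset_def by blast
      next
        case False
        then have "S = g" using S unfolding g_def by blast
        then show ?thesis ..
      qed
    qed
    ultimately show "S \<in> insert g ?A \<longleftrightarrow> S \<in> full n - {T0}" by blast
  qed
  have T0: "T0 \<in> full n" "card T0 = Suc n" by (auto simp: T0_def full_def)
  have S2: "insert T0 (insert g ?A) = full n" unfolding S1 using T0(1) by blast
  have c: "complex_on n ?A" by (rule complex_hornset)
  have c1: "complex_on n (insert g ?A)" unfolding S1 complex_on_def full_def T0_def by blast
  have c2: "complex_on n (insert T0 (insert g ?A))" unfolding S2 by (rule complex_on_full)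
  have gs: "g \<in> spx (insert g ?A) ?q" using cardg q by (simp add: spx_def)
  obtain F where F: "S.thom ?N ?N (spx ?A) bdry F" and Fv: "\<And>k S. \<lbrakk>k \<le> ?N; S \<in> spx ?A k\<rbrakk> \<Longrightarrow> F (atom bdry k S) = val H ?N S"
    using functor_of_sub_map[OF c lessI H] by blast
  define a where "a = atom bdry n T0"
  have T0s: "T0 \<in> spx (full n) n" by (simp add: T0_def spx_full)
  have a: "a \<in> ocells n n" unfolding a_def by (rule atom_tcells[OF loop_free_spx[OF complex_on_full] T0s])
  have low: "spx (full n) k \<subseteq> spx (insert g ?A) k" if "k < n" for k
    using that T0(2) by (auto simp: S1 spx_def)
  have xa: "tbd \<alpha> ?q a \<in> tcells (spx (insert g ?A)) bdry ?q" for \<alpha>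
  proof -
    have t: "tbd \<alpha> ?q a \<in> ocells n ?q" using tbd_tcells[OF a] by simp
    show ?thesis by (rule tcells_keys[OF t]) (rule subset_trans[OF tcellsD(2)[OF t] low], use q in auto)
  qed
  have aq: "a ?q \<alpha> = part \<alpha> (bdry T0)" for \<alpha> using q by (simp add: a_def atom_def)
  \<comment> \<open>The side of the boundary of the interior cell on which the missing face occurs,
    given by its sign.\<close>
  define \<epsilon> where "\<epsilon> = (if sg T0 i = 1 then Pos else Neg)"
  have lkg: "lk (bdry T0) g = sg T0 i" unfolding g_def using lookup_bdry_face[of T0 i] n by (simp add: T0_def)
  have e1: "lk (a ?q \<epsilon>) g = 1" "lk (a ?q (flip \<epsilon>)) g = 0"
    unfolding aq lookup_part using lkg sg_cases[of T0 i] by (auto simp: \<epsilon>_def)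
  have xo: "tbd (flip \<epsilon>) ?q a \<in> tcells (spx ?A) bdry ?q"
  proof (rule tcells_keys[OF xa])
    fix k \<alpha> assume k: "k \<le> ?q"
    show "ks (tbd (flip \<epsilon>) ?q a k \<alpha>) \<subseteq> spx ?A k"
    proof
      fix S assume S: "S \<in> ks (tbd (flip \<epsilon>) ?q a k \<alpha>)"
      then have S': "S \<in> spx (insert g ?A) k" using tcellsD(2)[OF xa k] by blast
      have "S \<noteq> g"
      proof
        assume "S = g"
        then have "k = ?q" using spx_finite(2)[OF S'] cardg q by simp
        then show False using S \<open>S = g\<close> e1(2) by (simp add: tbd_eq in_keys_iff)
      qed
      then show "S \<in> spx ?A k" using S' by (auto simp: spx_def)
    qed
  qed
  have w: "whisk (spx (insert g ?A)) bdry g ?q (tbd \<epsilon> ?q a)"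
    by (rule whisk_exists[OF loop_free_spx[OF c1] gs xa]) (use e1 in \<open>simp add: tbd_eq\<close>)
  \<comment> \<open>In an inner horn the missing face contains both extreme vertices.\<close>
  have lo': "lo = 0 \<or> lo = 1 \<and> atom bdry ?q g 0 Neg = frag_of {0} \<and> atom bdry ?q g 0 Pos = frag_of {n}"
  proof (cases "lo = 0")
    case False
    then have i: "lo = 1" "0 < i" "i < n" using lo by auto
    then obtain k where k: "n = Suc (Suc k)" by (metis Suc_lessE less_imp_Suc_add not_less_eq gr0_conv_Suc)
    have "Min g = 0" "Max g = n"
      by (rule Min_eqI; use i cardg(2) in \<open>simp add: g_def\<close>) (rule Max_eqI; use i cardg(2) in \<open>simp add: g_def\<close>)
    then show ?thesis using atom_ends[of g k] cardg k i by simp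
  qed simp
  \<comment> \<open>The side without \<open>g\<close> is determined by the horn; the side with
    \<open>g\<close> has to match its value up to an arrow.\<close>
  define T where "T = F (tbd (flip \<epsilon>) ?q a)"
  have xoN: "tbd (flip \<epsilon>) ?q a \<in> tcells (spx ?A) bdry ?N" using tcells_mono[OF xo] by simp
  have Tc: "S.cell ?N ?q T" unfolding T_def by (rule S.thom_cell[OF F xo]) simp
  have Tb: "Cd C ?N \<alpha> (?q - 1) T = F (tbd \<alpha> (?q - 1) (tbd \<epsilon> ?q a))" if "0 < ?q" for \<alpha>
    using S.thomD(2)[OF F xoN, of "?q - 1" \<alpha>] that by (simp add: T_def tbd_tbd_less)
  have "\<exists>F'. S.thom ?N ?N (spx (insert g ?A)) bdry F' \<and> (\<forall>y\<in>tcells (spx ?A) bdry ?N. F' y = F y) \<and> S.arrow ?N ?q (F' (tbd \<epsilon> ?q a)) T"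
    using whisk_solve[OF c c1 gs gA lessI F _ lo' w] inv q Tc Tb by auto
  then obtain F1 where F1: "S.thom ?N ?N (spx (insert g ?A)) bdry F1" "\<And>y. y \<in> tcells (spx ?A) bdry ?N \<Longrightarrow> F1 y = F y"
    "S.arrow ?N ?q (F1 (tbd \<epsilon> ?q a)) (F1 (tbd (flip \<epsilon>) ?q a))"
    using xoN T_def by auto
  \<comment> \<open>The arrow found runs from the side of \<open>g\<close> to the opposite side. If
    \<open>g\<close> lies in the target, this is the wrong direction and the arrow is
    reversed.\<close>
  have "S.arrow ?N ?q (F1 (tbd Neg ?q a)) (F1 (tbd Pos ?q a))"
  proof (cases \<epsilon>)
    case Neg
    then show ?thesis using F1(3) by simp
  next
    case Pos
    have "S.invertible_dim ?N ?q" by (rule inv) (use lo n in auto)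
    from S.arrow_sym[OF this F1(3)] show ?thesis using Pos by simp
  qed
  then obtain Z where Z: "S.cell ?N n Z" "Cd C ?N Neg ?q Z = F1 (tbd Neg ?q a)" "Cd C ?N Pos ?q Z = F1 (tbd Pos ?q a)"
    unfolding S.arrow_def q(2) by blast
  have Zb: "Cd C ?N \<alpha> (n - 1) Z = F1 (tbd \<alpha> (n - 1) (atom bdry n T0))" for \<alpha> using Z by (cases \<alpha>) (simp_all add: a_def)
  have "T0 \<notin> insert g ?A" unfolding S1 by simp
  then obtain F2 where F2: "S.thom ?N ?N (spx (full n)) bdry F2" "\<And>x. x \<in> tcells (spx (insert g ?A)) bdry ?N \<Longrightarrow> F2 x = F1 x"
    using attach[OF c1 c2 _ _ lessI F1(1) Z(1) Zb] T0s unfolding S2 by blast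
  have F2v: "F2 (atom bdry k S) = val H ?N S" if "S \<in> spx ?A k" for k S
  proof -
    have k: "k \<le> ?N" using spx_dim(1)[OF c that] by simp
    have at: "atom bdry k S \<in> tcells (spx ?A) bdry ?N" using tcells_mono[OF atom_tcells[OF loop_free_spx[OF c] that] k] .
    moreover have "tcells (spx ?A) bdry ?N \<subseteq> tcells (spx (insert g ?A)) bdry ?N" by (rule tcells_subset) (rule spx_mono, blast)
    ultimately show ?thesis using F2(2) F1(2) Fv[OF k that] by auto
  qed
  define y where "y = (\<lambda>p. restrict (\<lambda>x. down C ?N p (F2 (totab x))) (oriental_cells n p))"
  have y: "y \<in> omega_hom (oriental n) C" "\<And>z. z \<in> ocells n ?N \<Longrightarrow> y ?N (fromtab z) = F2 z"
    unfolding y_def using thom_hom[OF F2(1)] by auto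
  have Hh: "H k s \<in> omega_hom (oriental k) C" if "s \<in> simplex_hom k n" "s ` {..k} \<in> ?A" for k s
    using H that unfolding sub_map_def by blast
  \<comment> \<open>Nondegenerate simplices are compared on atoms; the others follow through
    \<open>epi_mono\<close>.\<close>
  have inj: "act (nerve C) l n r y = H l r" if r: "r \<in> nd n l" "r ` {..l} \<in> ?A" for l r
  proof -
    have rs: "r \<in> simplex_hom l n" using r by (simp add: nd_def)
    have l: "l \<le> n" using spx_dim(1)[OF complex_on_full nd_image[OF r(1)]] .
    show ?thesis
    proof (rule hom_eqI[OF nerve_act_closed[OF rs y(1)] Hh[OF rs r(2)], of ?N])
      fix z assume z: "z \<in> ocells l ?N"
      show "act (nerve C) l n r y ?N (fromtab z) = H l r ?N (fromtab z)"
      proof (rule S.thom_unique_atoms[OF loop_free_spx[OF complex_on_full] hom_thom[OF nerve_act_closed[OF rs y(1)]]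
            hom_thom[OF Hh[OF rs r(2)]] _ z])
        fix k T assume k: "k \<le> ?N" and T: "T \<in> spx (full l) k"
        have at: "atom bdry k T \<in> ocells l k" by (rule atom_tcells[OF loop_free_spx[OF complex_on_full] T])
        have rT: "r ` T \<in> spx ?A k"
          using tcellsD(2)[OF pushT_into[OF c r at], of k Neg] unfolding pushT_atom_nd[OF r(1) T] by (simp add: atom_def keys_frag_of)
        have "act (nerve C) l n r y ?N (fromtab (atom bdry k T)) = y ?N (fromtab (atom bdry k (r ` T)))"
          using act_fromtab[OF rs tcells_mono[OF at k]] pushT_atom_nd[OF r(1) T] by simp
        also have "\<dots> = F2 (atom bdry k (r ` T))"
          by (rule y(2)) (use tcells_mono[OF pushT_cells[OF rs at] k] pushT_atom_nd[OF r(1) T] in simp)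
        also have "\<dots> = H l r ?N (fromtab (atom bdry k T))"
          using F2v[OF rT] val_eval[OF H r T, of ?N] l by simp
        finally show "act (nerve C) l n r y ?N (fromtab (atom bdry k T)) = H l r ?N (fromtab (atom bdry k T))" .
      qed
    qed (use l in simp)
  qed
  have "act (nerve C) m n s y = H m s" if s: "s \<in> simplex_hom m n" "s ` {..m} \<in> ?A" for m s
  proof -
    obtain l r \<sigma> where d: "r \<in> nd n l" "\<sigma> \<in> simplex_hom m l" "s = compose {..m} r \<sigma>" "r ` {..l} = s ` {..m}"
      by (rule epi_mono[OF s(1)])
    have rs: "r \<in> simplex_hom l n" using d by (simp add: nd_def)
    have "act (nerve C) m n s y = act (nerve C) m l \<sigma> (act (nerve C) l n r y)"
      unfolding d(3) by (rule nerve_act_compose[OF d(2) rs y(1)])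
    also have "\<dots> = act (nerve C) m l \<sigma> (H l r)" using inj d(1,4) s(2) by simp
    also have "\<dots> = H m (compose {..m} r \<sigma>)"
    proof (rule sym)
      have "r ` {..l} \<in> ?A" using d(4) s(2) by simp
      then show "H m (compose {..m} r \<sigma>) = act (nerve C) m l \<sigma> (H l r)"
        using conjunct2[OF H[unfolded sub_map_def]] d(2) rs by blast
    qed
    finally show ?thesis unfolding d(3) .
  qed
  then show ?thesis using y(1) by blast
qed

lemma horn_sub_map:
  assumes "sset_map (horn i n) (nerve C) H" shows "sub_map (hornset i n) n H"
proof -
  have a: "act (horn i n) l k t s = compose {..l} s t" for l k t s
    by (simp add: horn_def standard_simplex_simps)
  note h = assms[unfolded sset_map_def nerve_simps(1) a]
  show ?thesis unfolding sub_map_def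
  proof (intro conjI allI ballI impI)
    fix k s assume "s \<in> simplex_hom k n" "s ` {..k} \<in> hornset i n"
    then have s: "s \<in> simplices (horn i n) k" by (simp add: horn_simplices)
    show "H k s \<in> omega_hom (oriental k) C" by (rule conjunct1[OF h, THEN spec, THEN bspec, OF s])
  next
    fix l k t s assume t: "t \<in> simplex_hom l k" and "s \<in> simplex_hom k n" "s ` {..k} \<in> hornset i n"
    then have s: "s \<in> simplices (horn i n) k" by (simp add: horn_simplices)
    show "H l (compose {..l} s t) = act (nerve C) l k t (H k s)"
      by (rule conjunct2[OF h, THEN spec, THEN spec, THEN bspec, THEN bspec, OF t s])
  qed
qed

lemma has_horn_fillers_fill:
  assumes "0 < n" "i \<le> n" "\<And>j. \<lbrakk>lo \<le> j; j < n\<rbrakk> \<Longrightarrow> S.invertible_dim (Suc n) j" "lo = 0 \<or> lo = 1 \<and> 0 < i \<and> i < n"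
  shows "has_horn_fillers (nerve C) i n"
  unfolding has_horn_fillers_def right_lifting_def
proof (intro allI impI)
  fix H assume H: "sset_map (horn i n) (nerve C) H"
  obtain y where y: "y \<in> omega_hom (oriental n) C"
    "\<And>m s. \<lbrakk>s \<in> simplex_hom m n; s ` {..m} \<in> hornset i n\<rbrakk> \<Longrightarrow> act (nerve C) m n s y = H m s"
    using fill_horn[OF assms(1,2) horn_sub_map[OF H] assms(3,4)] by blast
  have "sset_map (standard_simplex n) (nerve C) (\<lambda>m s. act (nerve C) m n s y)"
    unfolding sset_map_def standard_simplex_simps nerve_simps(1)
    using nerve_act_closed[OF _ y(1)] nerve_act_compose[OF _ _ y(1)] by blast
  moreover have "\<forall>m. \<forall>s\<in>simplices (horn i n) m. act (nerve C) m n s y = H m s"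
    using y(2) horn_simplices by blast
  ultimately show "\<exists>G. sset_map (standard_simplex n) (nerve C) G \<and> (\<forall>m. \<forall>s\<in>simplices (horn i n) m. G m s = H m s)" by blast
qed

section \<open>Weak invertibility inside a fixed dimension\<close>

definition up :: "nat \<Rightarrow> nat \<Rightarrow> 'c \<Rightarrow> 'c" where "up N p z = (if p < N then unit_cell C p N z else z)"

lemma arrow_up:
  assumes "cell_from_to C q c a b" "q < N" shows "S.arrow N q (up N q a) (up N q b)"
proof -
  have c: "c \<in> cells C (Suc q)" "bd C Neg (Suc q) q c = a" "bd C Pos (Suc q) q c = b"
    using assms(1) by (auto simp: cell_from_to_def)
  show ?thesis
  proof (cases "Suc q = N")
    case True
    have "S.cell N (Suc q) c" unfolding S.cell_def using c True by (simp add: Cd_def)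
    then show ?thesis unfolding S.arrow_def using c True by (auto simp: Cd_def up_def)
  next
    case False
    then have qN: "Suc q < N" using assms(2) by simp
    have "S.cell N (Suc q) (unit_cell C (Suc q) N c)"
      unfolding S.cell_def using unit_closed[OF qN c(1)] bd_unit[OF qN c(1)] qN by (simp add: Cd_def)
    moreover have "Cd C N \<alpha> q (unit_cell C (Suc q) N c) = up N q (bd C \<alpha> (Suc q) q c)" for \<alpha>
      using bd_unit_lower[OF qN _ c(1), of q \<alpha>] assms(2) by (simp add: Cd_def up_def)
    ultimately show ?thesis unfolding S.arrow_def using c by blast
  qed
qed

text \<open>The witnesses \<open>c\<close> and \<open>c'\<close> lie in the same invertibility set
  and so have weak inverses themselves. The boundaries of these are reversed, which gives the
  opposite arrows that \<open>inverts\<close> asks for.\<close>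

lemma invertible_dim_of_trivial:
  assumes t: "k_trivial m C" and j: "m \<le> j" and N: "Suc j < N" shows "S.invertible_dim N j"
  unfolding S.invertible_dim_def
proof (intro allI impI)
  fix Y assume Y: "S.cell N (Suc j) Y"
  define b where "b = bd C Neg N (Suc j) Y"
  have YM: "Y \<in> cells C N" "Y = unit_cell C (Suc j) N b" using Y cell_iff[OF N] by (auto simp: b_def)
  have b: "b \<in> cells C (Suc j)" unfolding b_def using bd_closed[OF N YM(1)] .
  obtain E where E: "invertibility_set C E" "(Suc j, b) \<in> E"
    using t b j unfolding k_trivial_def weakly_invertible_def by (meson le_imp_less_Suc)
  have inv: "\<exists>b' c c'. (Suc n, b') \<in> E \<and> (n + 2, c) \<in> E \<and> (n + 2, c') \<in> E \<and>
           composable C (Suc n) n b' b \<and> composable C (Suc n) n b b' \<and>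
           cell_from_to C (Suc n) c (unit_cell C n (Suc n) (bd C Neg (Suc n) n b)) (ccomp C (Suc n) n b' b) \<and>
           cell_from_to C (Suc n) c' (unit_cell C n (Suc n) (bd C Pos (Suc n) n b)) (ccomp C (Suc n) n b b')"
    if "(Suc n, b) \<in> E" for n b
    using E(1) that unfolding invertibility_set_def by blast
  obtain b' c c' where b': "(Suc j, b') \<in> E" "(j + 2, c) \<in> E" "(j + 2, c') \<in> E"
    "composable C (Suc j) j b' b" "composable C (Suc j) j b b'"
    "cell_from_to C (Suc j) c (unit_cell C j (Suc j) (bd C Neg (Suc j) j b)) (ccomp C (Suc j) j b' b)"
    "cell_from_to C (Suc j) c' (unit_cell C j (Suc j) (bd C Pos (Suc j) j b)) (ccomp C (Suc j) j b b')"
    using inv[OF E(2)] by blast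
  have rev: "\<exists>c2. cell_from_to C (Suc j) c2 y x" if cc: "cell_from_to C (Suc j) c1 x y" "(j + 2, c1) \<in> E" for c1 x y
  proof -
    obtain c2 where "composable C (Suc (Suc j)) (Suc j) c2 c1" "composable C (Suc (Suc j)) (Suc j) c1 c2"
      using inv[of "Suc j" c1] cc(2) by auto
    then show ?thesis using cc(1) by (auto simp: cell_from_to_def composable_def)
  qed
  define Y' where "Y' = unit_cell C (Suc j) N b'"
  have bc: "b' \<in> cells C (Suc j)" using b'(4) by (simp add: composable_def)
  have Yc: "S.cell N (Suc j) Y'"
    unfolding S.cell_def Y'_def using unit_closed[OF N bc] bd_unit[OF N bc] N by (simp add: Cd_def)
  have dY: "Cd C N \<alpha> j (unit_cell C (Suc j) N x) = unit_cell C j N (bd C \<alpha> (Suc j) j x)" if "x \<in> cells C (Suc j)" for \<alpha> x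
    using bd_unit_lower[OF N _ that, of j \<alpha>] N by (simp add: Cd_def)
  have u: "up N (Suc j) (unit_cell C j (Suc j) (bd C \<alpha> (Suc j) j b)) = Cd C N \<alpha> j Y" for \<alpha>
    using dY[OF b] unit_unit[OF _ N, of j] bd_closed[of j "Suc j" b \<alpha>] b N by (simp add: up_def YM(2)[symmetric])
  have m: "up N (Suc j) (ccomp C (Suc j) j b' b) = Cc C N j Y' Y" "up N (Suc j) (ccomp C (Suc j) j b b') = Cc C N j Y Y'"
    using unit_comp[OF b'(4) N] unit_comp[OF b'(5) N] N YM(2) by (simp_all add: up_def Cc_def Y'_def)
  have ar: "S.arrow N (Suc j) (Cd C N Neg j Y) (Cc C N j Y' Y)" "S.arrow N (Suc j) (Cd C N Pos j Y) (Cc C N j Y Y')"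
    using arrow_up[OF b'(6) N] arrow_up[OF b'(7) N] unfolding u m .
  have "S.arrow N (Suc j) (Cc C N j Y' Y) (Cd C N Neg j Y)" "S.arrow N (Suc j) (Cc C N j Y Y') (Cd C N Pos j Y)"
    using rev[OF b'(6,2)] rev[OF b'(7,3)] arrow_up[OF _ N] unfolding u[symmetric] m[symmetric] by blast+
  moreover have "Cd C N Neg j Y' = Cd C N Pos j Y" "Cd C N Pos j Y' = Cd C N Neg j Y"
    using dY[OF b] dY[OF bc] b'(4,5) YM(2) unfolding Y'_def composable_def by simp_all
  ultimately show "\<exists>Y'. S.inverts N j Y' Y" unfolding S.inverts_def using Yc ar by blast
qed

theorem kan_of_trivial:
  assumes "k_trivial 0 C" shows "kan_complex (nerve C)"
  unfolding kan_complex_def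
proof (intro conjI allI impI)
  show "simplicial_set (nerve C)" by (rule nerve_simplicial)
  fix n i :: nat assume "0 < n" "i \<le> n"
  then show "has_horn_fillers (nerve C) i n"
    by (rule has_horn_fillers_fill[where lo = 0]) (use invertible_dim_of_trivial[OF assms] in auto)
qed

theorem quasi_of_trivial:
  assumes "k_trivial 1 C" shows "quasi_category (nerve C)"
  unfolding quasi_category_def
proof (intro conjI allI impI)
  show "simplicial_set (nerve C)" by (rule nerve_simplicial)
  fix n i :: nat assume i: "0 < i \<and> i < n"
  show "has_horn_fillers (nerve C) i n"
    by (rule has_horn_fillers_fill[where lo = 1]) (use i invertible_dim_of_trivial[OF assms] in auto)
qed

end


subsection \<open>Functors that factor through a globe\<close>

text \<open>The labelling \<open>f\<close> encodes a map to the complex of a globe, which has a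
  generator of each sign in every dimension below the top one; \<open>None\<close> stands for zero.
  The count is the coefficient of the image of \<open>c\<close> at the generator of sign
  \<open>\<beta>\<close>.\<close>

definition cnt :: "('b \<Rightarrow> polarity option) \<Rightarrow> polarity \<Rightarrow> ('b \<Rightarrow>\<^sub>0 int) \<Rightarrow> int" where
  "cnt f \<beta> c = augmentation (frag_extend (\<lambda>b. if f b = Some \<beta> then frag_of b else 0) c)"

definition tot :: "('b \<Rightarrow> polarity option) \<Rightarrow> ('b \<Rightarrow>\<^sub>0 int) \<Rightarrow> int" where
  "tot f c = cnt f Neg c + cnt f Pos c"

lemma cnt_sum: "cnt f \<beta> c = (\<Sum>b\<in>ks c. lk c b * (if f b = Some \<beta> then 1 else 0))"
  unfolding cnt_def augmentation_frag_extend by (rule sum.cong) auto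

lemma tot_sum: "tot f c = (\<Sum>b\<in>ks c. lk c b * (if f b = None then 0 else 1))"
proof -
  have "lk c b * (if f b = Some Neg then 1 else 0) + lk c b * (if f b = Some Pos then 1 else 0)
      = lk c b * (if f b = None then 0 else 1)" for b
    by (cases "f b"; cases "the (f b)") auto
  then show ?thesis unfolding tot_def cnt_sum sum.distrib[symmetric] by simp
qed

lemma cnt_add: "cnt f \<beta> (c + c') = cnt f \<beta> c + cnt f \<beta> c'"
  by (simp add: cnt_def frag_extend_add augmentation_add)

lemma cnt_diff: "cnt f \<beta> (c - c') = cnt f \<beta> c - cnt f \<beta> c'"
  by (simp add: cnt_def frag_extend_diff augmentation_diff)

lemma cnt_zero [simp]: "cnt f \<beta> 0 = 0" "tot f 0 = 0"
  by (simp_all add: cnt_def tot_def)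

lemma cnt_extend: "cnt f \<beta> (frag_extend D c) = (\<Sum>b\<in>ks c. lk c b * cnt f \<beta> (D b))"
  unfolding cnt_def frag_extend_extend augmentation_frag_extend ..

lemma cnt_nonneg: "nonneg c \<Longrightarrow> 0 \<le> cnt f \<beta> c"
  unfolding cnt_sum by (rule sum_nonneg) (simp add: nonneg_def)

text \<open>A cell of a globe is determined by its highest nonzero entry: this names the cell to
  which \<open>x\<close> is mapped.\<close>

definition top_at :: "('b \<Rightarrow> polarity option) \<Rightarrow> 'b table \<Rightarrow> nat \<Rightarrow> polarity \<Rightarrow> bool" where
  "top_at f x k \<epsilon> \<longleftrightarrow> tot f (x (Suc k) Neg) = 0 \<and> cnt f \<epsilon> (x k Neg) = 1"

text \<open>The assumption \<open>bnd\<close> says that the labelling commutes with boundaries, as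
  every generator of positive dimension of the globe has boundary \<open>Pos\<close> minus
  \<open>Neg\<close>. The assumption \<open>vert\<close> says that it preserves the
  augmentation.\<close>

context
  fixes B :: "nat \<Rightarrow> 'b set" and D f
  assumes vert: "\<And>b. b \<in> B 0 \<Longrightarrow> f b \<noteq> None"
    and bnd: "\<And>k b \<beta>. b \<in> B (Suc k) \<Longrightarrow> cnt f \<beta> (D b) = (if f b = None then 0 else if \<beta> = Pos then 1 else - 1)"
begin

lemma cnt_boundary:
  assumes "ks c \<subseteq> B (Suc k)"
  shows "cnt f Pos (frag_extend D c) = tot f c" "cnt f Neg (frag_extend D c) = - tot f c"
  unfolding cnt_extend tot_sum sum_negf[symmetric] using assms by (auto intro!: sum.cong simp: bnd)

lemma cnt_step:
  assumes x: "x \<in> tcells B D p"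
  shows "cnt f Pos (x k Pos) = cnt f Pos (x k Neg) + tot f (x (Suc k) \<alpha>)"
    "cnt f Neg (x k Neg) = cnt f Neg (x k Pos) + tot f (x (Suc k) \<alpha>)"
proof -
  note X = tcellsD[OF x]
  have "cnt f Pos (x k Pos) = cnt f Pos (x k Neg) + tot f (x (Suc k) \<alpha>) \<and>
    cnt f Neg (x k Neg) = cnt f Neg (x k Pos) + tot f (x (Suc k) \<alpha>)"
  proof (cases "k < p")
    case True
    then show ?thesis
      using cnt_boundary[of "x (Suc k) \<alpha>" k] X(2)[of "Suc k" \<alpha>] cnt_diff[of f _ "x k Pos" "x k Neg"] X(5)[of k \<alpha>] by simp
  next
    case False
    have "x k Pos = x k Neg" by (cases "k = p") (use False X(3,4) in auto)
    then show ?thesis using False X(3)[of "Suc k" \<alpha>] by simp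
  qed
  then show "cnt f Pos (x k Pos) = cnt f Pos (x k Neg) + tot f (x (Suc k) \<alpha>)"
    "cnt f Neg (x k Neg) = cnt f Neg (x k Pos) + tot f (x (Suc k) \<alpha>)" by blast+
qed

lemma tot_vertex:
  assumes x: "x \<in> tcells B D p" shows "tot f (x 0 \<alpha>) = 1"
proof -
  have h: "f b \<noteq> None" if "b \<in> ks (x 0 \<alpha>)" for b using vert[OF subsetD[OF tcellsD(2)[OF x] that]] by simp
  then have "tot f (x 0 \<alpha>) = augmentation (x 0 \<alpha>)" 
    unfolding tot_sum augmentation_def by (intro sum.cong refl) (simp add: h del: not_None_eq)
  then show ?thesis using tcellsD(6)[OF x] by simp
qed

text \<open>The total is 1 in dimension 0, and the equations of \<open>cnt_step\<close> prevent an
  increase. So the totals form a block of ones followed by zeros, and the end of the block is the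
  dimension of the image.\<close>

lemma tot_props:
  assumes x: "x \<in> tcells B D p"
  shows "tot f (x (Suc k) \<alpha>) \<le> tot f (x k \<beta>)" "tot f (x k Pos) = tot f (x k Neg)" "0 \<le> tot f (x k \<alpha>)"
    "0 \<le> cnt f \<beta> (x k \<alpha>)" "tot f (x k \<alpha>) \<le> 1"
proof -
  show n: "0 \<le> cnt f \<beta> (x k \<alpha>)" for \<beta> k \<alpha> using cnt_nonneg[OF tcellsD(1)[OF x]] .
  show "0 \<le> tot f (x k \<alpha>)" using n by (simp add: tot_def)
  show "tot f (x k Pos) = tot f (x k Neg)" using cnt_step[OF x, of k Pos] by (simp add: tot_def)
  show s: "tot f (x (Suc k) \<alpha>) \<le> tot f (x k \<beta>)" for k \<alpha> \<beta>
    using cnt_step[OF x, of k \<alpha>] n[of Pos k Pos] n[of Neg k Pos] n[of Pos k Neg] n[of Neg k Neg]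
    by (cases \<beta>) (simp_all add: tot_def)
  show "tot f (x k \<alpha>) \<le> 1"
  proof (induction k arbitrary: \<alpha>)
    case 0
    show ?case using tot_vertex[OF x, of \<alpha>] by simp
  next
    case (Suc k)
    show ?case using Suc[of Pos] s[of k \<alpha> Pos] by linarith
  qed
qed

lemma tot_zero:
  assumes x: "x \<in> tcells B D p" and "tot f (x k \<alpha>) = 0" "k \<le> j" shows "tot f (x j \<beta>) = 0" "cnt f \<gamma> (x j \<beta>) = 0"
proof -
  have "tot f (x j \<beta>) = 0" using assms(3)
  proof (induction j arbitrary: \<beta> rule: dec_induct)
    case base
    then show ?case using tot_props(2)[OF x, of k] assms(2) by (cases \<alpha>; cases \<beta>) simp_all
  next
    case (step j)
    then show ?case using tot_props(1)[OF x, of j \<beta> Neg] tot_props(3)[OF x, of "Suc j" \<beta>] by simp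
  qed
  then show "tot f (x j \<beta>) = 0" "cnt f \<gamma> (x j \<beta>) = 0"
    using tot_props(4)[OF x, of Neg j \<beta>] tot_props(4)[OF x, of Pos j \<beta>] by (cases \<gamma>; simp add: tot_def)+
qed

lemma top_at_exists:
  assumes x: "x \<in> tcells B D p" shows "\<exists>k \<epsilon>. top_at f x k \<epsilon>"
proof -
  have ex: "tot f (x (Suc p) Neg) = 0" using tcellsD(3)[OF x, of "Suc p" Neg] by simp
  define k where "k = (LEAST k. tot f (x (Suc k) Neg) = 0)"
  have k: "tot f (x (Suc k) Neg) = 0" unfolding k_def by (rule LeastI[of "\<lambda>k. tot f (x (Suc k) Neg) = 0", OF ex])
  have "tot f (x k Neg) = 1"
  proof (cases k)
    case 0
    then show ?thesis using tot_vertex[OF x] by simp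
  next
    case (Suc j)
    have "tot f (x (Suc j) Neg) \<noteq> 0" using not_less_Least[of j "\<lambda>k. tot f (x (Suc k) Neg) = 0"] Suc k_def by simp
    then show ?thesis using Suc tot_props(3,5)[OF x, of k Neg] by simp
  qed
  then have "cnt f Neg (x k Neg) = 1 \<or> cnt f Pos (x k Neg) = 1"
    using tot_props(4)[OF x, of Neg k Neg] tot_props(4)[OF x, of Pos k Neg] by (simp add: tot_def) linarith
  then show ?thesis using k unfolding top_at_def by blast
qed

lemma top_at_unique:
  assumes x: "x \<in> tcells B D p" and "top_at f x k \<epsilon>" "top_at f x j \<delta>" shows "k = j \<and> \<epsilon> = \<delta>"
proof -
  have le: "k \<le> j" if "top_at f x k \<epsilon>" "top_at f x j \<delta>" for k j \<epsilon> \<delta>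
  proof (rule ccontr)
    assume "\<not> k \<le> j"
    then have "cnt f \<epsilon> (x k Neg) = 0" using tot_zero(2)[OF x, of "Suc j" Neg k] that by (simp add: top_at_def)
    then show False using that by (simp add: top_at_def)
  qed
  have "k = j" using le[OF assms(2,3)] le[OF assms(3,2)] by simp
  then show ?thesis using assms(2,3) tot_props(5)[OF x, of j Neg] by (cases \<epsilon>; cases \<delta>) (simp_all add: top_at_def tot_def)
qed

lemma top_at_tbd:
  assumes x: "x \<in> tcells B D p" and t: "top_at f x k \<epsilon>"
  shows "k \<le> j \<Longrightarrow> top_at f (tbd \<alpha> j x) k \<epsilon>" "j < k \<Longrightarrow> top_at f (tbd \<alpha> j x) j \<alpha>"
proof -
  have z: "tot f (x (Suc k) \<beta>) = 0" for \<beta> using tot_zero(1)[OF x] t by (auto simp: top_at_def)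
  have "cnt f \<epsilon> (x k \<beta>) = 1" for \<beta>
    using cnt_step[OF x, of k Neg] z[of Neg] t by (cases \<epsilon>; cases \<beta>) (simp_all add: top_at_def)
  then show "top_at f (tbd \<alpha> j x) k \<epsilon>" if "k \<le> j" using that z t
    by (cases "j = k"; cases "j = Suc k") (simp_all add: top_at_def tbd_eq)
  show "top_at f (tbd \<alpha> j x) j \<alpha>" if j: "j < k"
  proof -
    have "tot f (x (Suc j) Neg) \<noteq> 0" using tot_zero(2)[OF x, of "Suc j" Neg k \<epsilon> Neg] t j by (auto simp: top_at_def)
    then have "tot f (x (Suc j) Neg) = 1" using tot_props(3,5)[OF x, of "Suc j" Neg] by simp
    then have "cnt f \<alpha> (x j \<alpha>) = 1"
      using cnt_step[OF x, of j Neg] tot_props(5)[OF x, of j \<alpha>] tot_props(4)[OF x, of Pos j \<alpha>] tot_props(4)[OF x, of Neg j \<alpha>]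
        tot_props(4)[OF x, of Pos j Neg] tot_props(4)[OF x, of Neg j Pos]
      by (cases \<alpha>) (simp_all add: tot_def)
    then show ?thesis by (simp add: top_at_def tbd_eq)
  qed
qed

lemma top_at_tcmp:
  assumes x: "x \<in> tcells B D p" and y: "y \<in> tcells B D p" and co: "tbd Neg k x = tbd Pos k y"
  shows "\<lbrakk>tot f (x (Suc k) Neg) = 0; top_at f y i \<epsilon>\<rbrakk> \<Longrightarrow> top_at f (tcmp k x y) i \<epsilon>"
    "\<lbrakk>tot f (y (Suc k) Neg) = 0; top_at f x i \<epsilon>\<rbrakk> \<Longrightarrow> top_at f (tcmp k x y) i \<epsilon>"
proof -
  note e = tcmp_entry[OF co] and l = tbd_eqD[OF co]
  have "cnt f \<gamma> (tcmp k x y j Neg) = cnt f \<gamma> (y j Neg)" if "tot f (x (Suc k) Neg) = 0" for \<gamma> j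
    using tot_zero(2)[OF x that, of j \<gamma> Neg] by (auto simp: e cnt_add)
  then show "top_at f (tcmp k x y) i \<epsilon>" if "tot f (x (Suc k) Neg) = 0" "top_at f y i \<epsilon>"
    using that by (simp add: top_at_def tot_def)
  have "cnt f \<gamma> (tcmp k x y j Neg) = cnt f \<gamma> (x j Neg)" if t: "tot f (y (Suc k) Neg) = 0" for \<gamma> j
  proof -
    consider "j < k" | "j = k" | "k < j" by linarith
    then show ?thesis
    proof cases
      case 1
      then show ?thesis using l(1)[OF 1, of Neg] by (simp add: e)
    next
      case 2
      have "cnt f \<gamma> (y k Neg) = cnt f \<gamma> (y k Pos)" using cnt_step[OF y, of k Neg] t by (cases \<gamma>) simp_all
      then show ?thesis using l(2) 2 by (simp add: e)
    next
      case 3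
      then show ?thesis using tot_zero(2)[OF y t, of j \<gamma> Neg] by (simp add: e cnt_add)
    qed
  qed
  then show "top_at f (tcmp k x y) i \<epsilon>" if "tot f (y (Suc k) Neg) = 0" "top_at f x i \<epsilon>"
    using that by (simp add: top_at_def tot_def)
qed

text \<open>A globe classifies single cells. The map constructed is the labelling followed by the
  functor classifying \<open>b\<close>, so it takes each \<open>x\<close> to the face of
  \<open>b\<close> that \<open>top_at\<close> names.\<close>

lemma globe_thom:
  assumes S: "one_sorted M d cmp" and b: "b \<in> M"
  shows "\<exists>H. one_sorted.thom M d cmp N B D H \<and> (\<forall>x\<in>tcells B D N. \<forall>k \<epsilon>. top_at f x k \<epsilon> \<longrightarrow> H x = d \<epsilon> k b)"
proof -
  interpret one_sorted M d cmp by (rule S)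
  define H where "H = (\<lambda>x. let a = (SOME a. top_at f x (fst a) (snd a)) in d (snd a) (fst a) b)"
  have H: "H x = d \<epsilon> k b" if x: "x \<in> tcells B D p" and t: "top_at f x k \<epsilon>" for x p k \<epsilon>
  proof -
    have "(SOME a. top_at f x (fst a) (snd a)) = (k, \<epsilon>)"
    proof (rule some_equality)
      show "top_at f x (fst (k, \<epsilon>)) (snd (k, \<epsilon>))" using t by simp
      fix a assume "top_at f x (fst a) (snd a)"
      from top_at_unique[OF x this t] show "a = (k, \<epsilon>)" by (simp add: prod_eq_iff)
    qed
    then show ?thesis by (simp add: H_def)
  qed
  have bd: "H x \<in> M \<and> H (tbd \<alpha> j x) = d \<alpha> j (H x)" if x: "x \<in> tcells B D N" and j: "j < N" for x \<alpha> j
  proof -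
    obtain k \<epsilon> where t: "top_at f x k \<epsilon>" using top_at_exists[OF x] by blast
    have y: "tbd \<alpha> j x \<in> tcells B D j" using tbd_tcells[OF x] j by simp
    show ?thesis
    proof (cases "k \<le> j")
      case True
      show ?thesis unfolding H[OF x t] H[OF y top_at_tbd(1)[OF x t True]] using d_d_ge[OF b True] d_closed[OF b] by simp
    next
      case False
      then have jk: "j < k" by simp
      show ?thesis unfolding H[OF x t] H[OF y top_at_tbd(2)[OF x t jk]] using d_d_less[OF b jk] d_closed[OF b] by simp
    qed
  qed
  have HM: "H x \<in> M" if x: "x \<in> tcells B D N" for x
    proof -
      obtain k \<epsilon> where t: "top_at f x k \<epsilon>" using top_at_exists[OF x] by blast
      show ?thesis unfolding H[OF x t] by (rule d_closed[OF b])
    qed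
  have low: "cell k (H x)" if x: "x \<in> tcells B D N" and z: "tot f (x (Suc k) Neg) = 0" for x k
  proof -
    obtain i \<epsilon> where t: "top_at f x i \<epsilon>" using top_at_exists[OF x] by blast
    have "i \<le> k"
    proof (rule ccontr)
      assume "\<not> i \<le> k"
      then have "cnt f \<epsilon> (x i Neg) = 0" using tot_zero(2)[OF x z, of i] by simp
      then show False using t by (simp add: top_at_def)
    qed
    then show ?thesis unfolding H[OF x t] using cell_mono[OF cell_d[OF b]] by blast
  qed
  have cmp: "H (tcmp k x y) = cmp k (H x) (H y)"
    if x: "x \<in> tcells B D N" and y: "y \<in> tcells B D N" and k: "k < N" and co: "tbd Neg k x = tbd Pos k y" for x y k
  proof -
    have z: "tcmp k x y \<in> tcells B D N" by (rule tcmp_tcells[OF x y co k])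
    have dd: "d Neg k (H x) = d Pos k (H y)" using bd[OF x k, of Neg] bd[OF y k, of Pos] co by simp
    \<comment> \<open>The totals of the factors in dimension \<open>k + 1\<close> add up to at most
      1. Hence one factor is sent to a cell of dimension at most \<open>k\<close>, and the composite
      is the value of the other.\<close>
    have "tot f (x (Suc k) Neg) + tot f (y (Suc k) Neg) = tot f (tcmp k x y (Suc k) Neg)"
      by (simp add: tcmp_entry[OF co] tot_def cnt_add)
    then have "tot f (x (Suc k) Neg) + tot f (y (Suc k) Neg) \<le> 1" using tot_props(5)[OF z] by metis
    then consider "tot f (x (Suc k) Neg) = 0" | "tot f (y (Suc k) Neg) = 0"
      using tot_props(3)[OF x, of "Suc k" Neg] tot_props(3)[OF y, of "Suc k" Neg] by linarith
    then show ?thesis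
    proof cases
      case 1
      obtain i \<epsilon> where t: "top_at f y i \<epsilon>" using top_at_exists[OF y] by blast
      show ?thesis unfolding cmp_unit_left'[OF HM[OF y] low[OF x 1] dd]
        using H[OF z top_at_tcmp(1)[OF x y co 1 t]] H[OF y t] by simp
    next
      case 2
      obtain i \<epsilon> where t: "top_at f x i \<epsilon>" using top_at_exists[OF x] by blast
      show ?thesis unfolding cmp_unit_right'[OF HM[OF x] low[OF y 2] dd]
        using H[OF z top_at_tcmp(2)[OF x y co 2 t]] H[OF x t] by simp
    qed
  qed
  have "thom N B D H" unfolding thom_def by (intro conjI ballI allI impI) (simp_all add: HM bd cmp)
  moreover have "\<forall>x\<in>tcells B D N. \<forall>k \<epsilon>. top_at f x k \<epsilon> \<longrightarrow> H x = d \<epsilon> k b"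
    by (intro ballI allI impI) (rule H)
  ultimately show ?thesis by (intro exI[of _ H] conjI)
qed

end

text \<open>The label of the \<open>k\<close>-simplex consisting of \<open>m\<close> and the last
  \<open>k\<close> vertices, for the globe of dimension \<open>V - 1\<close>; other simplices go to
  zero. In top dimension the face opposite 0, where \<open>m = 1\<close>, is the generator. Its
  boundary forces \<open>Pos\<close> for \<open>m = 2\<close> and \<open>Neg\<close> for
  \<open>m = 1\<close> one dimension lower. Choosing \<open>Pos\<close> for \<open>m = 0\<close> too
  makes the boundary of the face opposite 1 vanish. The face opposite 2 would then have boundary
  \<open>Neg\<close> minus \<open>Pos\<close>, which no label realises: a filler has to send it to
  an inverse.\<close>

definition globe_label :: "nat \<Rightarrow> nat \<Rightarrow> nat \<Rightarrow> polarity option" where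
  "globe_label V k m = (if Suc k = V then (if m = 1 then Some Pos else None)
     else if k + 2 = V then Some (if m = 1 then Neg else Pos)
     else Some (if m + k = V then Pos else Neg))"

definition globe_map :: "nat \<Rightarrow> nat set \<Rightarrow> polarity option" where
  "globe_map V S = (let k = card S - 1 in if S = insert (Min S) {V + 1 - k..V} then globe_label V k (Min S) else None)"

lemma globe_map_tail:
  assumes "m + k \<le> V" shows "globe_map V (insert m {V + 1 - k..V}) = globe_label V k m"
proof -
  have "card (insert m {V + 1 - k..V}) = Suc k" using assms by simp
  moreover have "Min (insert m {V + 1 - k..V}) = m" by (rule Min_eqI) (use assms in auto)
  ultimately show ?thesis unfolding globe_map_def Let_def by simp
qed

lemma globe_map_tailD:
  assumes "S \<subseteq> {..V}" "card S = Suc k" "globe_map V S \<noteq> None"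
  shows "\<exists>m. m + k \<le> V \<and> S = insert m {V + 1 - k..V}"
proof -
  have S: "S = insert (Min S) {V + 1 - k..V}" using assms(2,3) unfolding globe_map_def Let_def by (auto split: if_splits)
  have fS: "finite S" "S \<noteq> {}" using finite_subset[OF assms(1)] assms(2) by (simp, force)
  have "Min S \<notin> {V + 1 - k..V}"
  proof
    assume "Min S \<in> {V + 1 - k..V}"
    then have "insert (Min S) {V + 1 - k..V} = {V + 1 - k..V}" by (rule insert_absorb)
    with S have "card S = card {V + 1 - k..V}" by (rule arg_cong[OF trans])
    then have "Suc k = Suc V - (V + 1 - k)" unfolding assms(2) card_atLeastAtMost .
    then show False by arith
  qed
  moreover have "Min S \<le> V" using Min_in[OF fS] assms(1) by blast
  ultimately have "Min S + k \<le> V" unfolding atLeastAtMost_iff by arith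
  then show ?thesis using S by blast
qed

lemma globe_map_vertex:
  assumes "2 \<le> V" "S \<subseteq> {..V}" "card S = 1" shows "globe_map V S \<noteq> None"
proof -
  obtain m where "S = {m}" using assms(3) card_1_singletonE by blast
  then show ?thesis using globe_map_tail[of m 0 V] assms by (simp add: globe_label_def)
qed

text \<open>Faces with a label contain the last \<open>k\<close> vertices. If \<open>S\<close>
  contains these, its two further vertices \<open>a < b\<close> yield the only relevant faces: the
  one without \<open>a\<close> with sign 1, the one without \<open>b\<close> with sign -1. It
  remains to compare labels.\<close>

lemma globe_map_boundary:
  assumes V: "2 \<le> V" and S: "S \<in> hornset 2 V" "card S = Suc (Suc k)"
  shows "cnt (globe_map V) \<beta> (bdry S) = (if globe_map V S = None then 0 else if \<beta> = Pos then 1 else - 1)"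
proof -
  let ?R = "{V + 1 - k..V}"
  have SV: "S \<subseteq> {..V}" using S(1) by (simp add: hornset_def)
  have fin: "finite S" using finite_subset[OF SV] by simp
  obtain j where j: "j \<le> V" "j \<noteq> 2" "j \<notin> S" using S(1) unfolding hornset_def by blast
  have "S \<subseteq> {..V} - {j}" using SV j by blast
  from card_mono[OF _ this] have kV: "k + 2 \<le> V" using j(1) S(2) by simp
  define \<chi> where "\<chi> = (\<lambda>v. if globe_map V (S - {v}) = Some \<beta> then 1 else (0::int))"
  have "cnt (globe_map V) \<beta> (bdry S) = (\<Sum>v\<in>S. sg S v * \<chi> v)"
    unfolding cnt_def bdry_def
    by (simp add: frag_extend_sum[OF fin] frag_extend_cmul augmentation_sum augmentation_cmul \<chi>_def o_def) (rule sum.cong; simp)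
  moreover have face: "?R \<subseteq> S - {v}" if "v \<in> S" "globe_map V (S - {v}) \<noteq> None" for v
    using globe_map_tailD[of "S - {v}" V k] that SV fin S(2) by auto
  moreover have "(\<Sum>v\<in>S. sg S v * \<chi> v) = (if globe_map V S = None then 0 else if \<beta> = Pos then 1 else - 1)"
  proof (cases "?R \<subseteq> S")
    case False
    have "globe_map V S = None"
    proof (rule ccontr)
      assume "globe_map V S \<noteq> None"
      from globe_map_tailD[OF SV S(2) this] show False using False by auto
    qed
    moreover have "\<chi> v = 0" if "v \<in> S" for v using face[OF that] False unfolding \<chi>_def by auto
    ultimately show ?thesis by simp
  next
    case True
    have "card (S - ?R) = 2" using card_Diff_subset[of ?R S] True S(2) kV by simp
    then obtain a b where ab: "S - ?R = {a, b}" "a < b" unfolding card_2_iff by (metis insert_commute nat_neq_iff)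
    have Sab: "S = insert a (insert b ?R)" using ab True by blast
    have mem: "a \<in> S - ?R" "b \<in> S - ?R" unfolding ab(1) by simp_all
    then have "a \<le> V" "b \<le> V" "a \<notin> ?R" "b \<notin> ?R" using SV by blast+
    then have lt: "a + k < V" "b + k \<le> V" "a \<notin> ?R" "b \<notin> ?R" using ab(2) by auto
    have "\<chi> v = 0" if v: "v \<in> S - {a, b}" for v
    proof (rule ccontr)
      assume "\<chi> v \<noteq> 0"
      then have "globe_map V (S - {v}) \<noteq> None" unfolding \<chi>_def by (auto split: if_splits)
      then have "?R \<subseteq> S - {v}" using face v by blast
      moreover have "v \<in> ?R" using v Sab by blast
      ultimately show False by blast
    qed
    then have "(\<Sum>v\<in>S. sg S v * \<chi> v) = (\<Sum>v\<in>{a, b}. sg S v * \<chi> v)"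
      by (intro sum.mono_neutral_right) (use fin mem in auto)
    then have s1: "(\<Sum>v\<in>S. sg S v * \<chi> v) = sg S a * \<chi> a + sg S b * \<chi> b" using ab(2) by simp
    have s2: "sg S a = 1" by (rule sg_min) (use Sab lt ab(2) in auto)
    have "{u\<in>S. u < b} = {a}"
    proof (rule Set.set_eqI)
      fix u show "u \<in> {u\<in>S. u < b} \<longleftrightarrow> u \<in> {a}" using Sab lt ab(2) by auto
    qed
    then have s3: "sg S b = - 1" by (simp add: sg_def)
    have "S - {a} = insert b ?R" "S - {b} = insert a ?R" using Sab ab(2) lt(3,4) by blast+
    then have s4: "\<chi> a = (if globe_label V k b = Some \<beta> then 1 else 0)" "\<chi> b = (if globe_label V k a = Some \<beta> then 1 else 0)"
      using globe_map_tail[of b k V] globe_map_tail[of a k V] lt unfolding \<chi>_def by simp_all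
    have s5: "globe_map V S = (if b + k = V then globe_label V (Suc k) a else None)"
    proof (cases "b + k = V")
      case True
      then have "insert b ?R = {V + 1 - Suc k..V}" by auto
      then show ?thesis using globe_map_tail[of a "Suc k" V] lt True Sab by simp
    next
      case False
      have "globe_map V S = None"
      proof (rule ccontr)
        assume "globe_map V S \<noteq> None"
        from globe_map_tailD[OF SV S(2) this] have "V - k \<in> S" using kV by auto
        moreover have "V - k \<notin> ?R" "V - k \<noteq> a" "V - k \<noteq> b" using False lt(1,2) kV by auto
        ultimately show False using Sab by blast
      qed
      then show ?thesis using False by simp
    qed
    \<comment> \<open>In top dimension \<open>S\<close> omits exactly one vertex, and the horn
      forbids that it be 2; hence \<open>b = 2\<close>. This is where the choice of the horn
      enters.\<close>
    have "j \<le> 1" if "k + 2 = V"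
    proof -
      have "\<not> Suc V - k \<le> j" using j Sab by auto
      then show ?thesis using that j(2) by simp
    qed
    moreover have "j \<noteq> a" "j \<noteq> b" using j(3) Sab by blast+
    ultimately consider (top) "b = 2" "k + 2 = V" "a = 0 \<or> a = 1" | (low) "b + k = V" "k + 3 \<le> V" | (none) "b + k \<noteq> V" "k + 3 \<le> V"
      using lt(1,2) ab(2) kV by linarith
    then show ?thesis
    proof cases
      case top
      then show ?thesis unfolding s1 s2 s3 s4 s5 by (cases \<beta>) (auto simp: globe_label_def)
    next
      case low
      then show ?thesis unfolding s1 s2 s3 s4 s5 using lt(1) by (cases \<beta>) (auto simp: globe_label_def)
    next
      case none
      then show ?thesis unfolding s1 s2 s3 s4 s5 using lt(1) by (cases \<beta>) (auto simp: globe_label_def)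
    qed
  qed
  ultimately show ?thesis by simp
qed


subsection \<open>Right inverses from fillers of the horns \<open>\<Lambda>\<^sup>2\<close>\<close>

lemma hornset_face:
  assumes "S \<in> spx (full V) k" "S \<noteq> {..V} - {i}" "S \<noteq> {..V}" shows "S \<in> hornset i V"
proof -
  have S: "S \<subseteq> {..V}" "S \<noteq> {}" using assms(1) by (auto simp: spx_full)
  have "\<exists>j\<le>V. j \<noteq> i \<and> j \<notin> S"
  proof (rule ccontr)
    assume "\<not> ?thesis"
    then have "{..V} - {i} \<subseteq> S" by auto
    then show False using S(1) assms(2,3) by blast
  qed
  then show ?thesis using S by (simp add: hornset_def)
qed

context one_sorted
begin

lemma arrow_boundary: "arrow (Suc k) A B \<Longrightarrow> d \<alpha> k A = d \<alpha> k B"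
  unfolding arrow_def cell_def using d_d_less[of _ k "Suc k"] by (metis lessI)

text \<open>The computation known from monoids, up to arrows:
  \<open>r' = (b r) r' = b (r r') = b\<close>. So \<open>r b\<close> is linked to
  \<open>r r'\<close>, and that to an identity.\<close>

lemma left_inverse_of_right_inverses:
  assumes b: "cell (Suc k) b" and r: "cell (Suc k) r" "d Neg k b = d Pos k r" "arrow (Suc k) (d Pos k b) (cmp k b r)"
    and r': "cell (Suc k) r'" "d Neg k r = d Pos k r'" "arrow (Suc k) (d Pos k r) (cmp k r r')"
    and sym: "\<And>A B. arrow (Suc k) A B \<Longrightarrow> arrow (Suc k) B A"
  shows "d Neg k r = d Pos k b" "arrow (Suc k) (d Neg k b) (cmp k r b)"
proof -
  note M = cell_closed[OF b] cell_closed[OF r(1)] cell_closed[OF r'(1)]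
  have "d Neg k (d Pos k b) = d Neg k (cmp k b r)" by (rule arrow_boundary[OF r(3)])
  then show rb: "d Neg k r = d Pos k b" using d_Neg_cmp[OF M(1,2) r(2)] d_d_ge[OF M(1), of k k] by simp
  have "arrow (Suc k) (cmp k (d Pos k b) r') (cmp k (cmp k b r) r')"
    by (rule arrow_whisker_right[OF r(3) r'(1)]) (use d_d_ge[OF M(1), of k k] rb r'(2) in simp_all)
  moreover have "cmp k (d Pos k b) r' = r'" using cmp_unit_left[OF M(3), of k] rb r'(2) by simp
  moreover have "cmp k (cmp k b r) r' = cmp k b (cmp k r r')" by (rule cmp_assoc[OF M r(2) r'(2)])
  ultimately have 1: "arrow (Suc k) r' (cmp k b (cmp k r r'))" by simp
  have "arrow (Suc k) (cmp k b (cmp k r r')) (cmp k b (d Pos k r))"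
    by (rule arrow_whisker_left[OF sym[OF r'(3)] b]) (use d_Pos_cmp[OF M(2,3) r'(2)] r(2) in simp_all)
  moreover have "cmp k b (d Pos k r) = b" using cmp_unit_right[OF M(1), of k] r(2) by simp
  ultimately have "arrow (Suc k) r' b" using arrow_trans[OF 1] by simp
  then have "arrow (Suc k) (cmp k r r') (cmp k r b)"
    by (rule arrow_whisker_left[OF _ r(1)]) (use r'(2) in simp_all)
  from arrow_trans[OF r'(3) this] show "arrow (Suc k) (d Neg k b) (cmp k r b)" using r(2) by simp
qed

end

context strict_omega_category
begin

text \<open>Translates lifting of simplicial maps into extension of functors from the subcomplex to
  the oriental. By Yoneda the filler is given by one simplex \<open>y\<close>, the image of the
  identity.\<close>

lemma functor_of_right_lifting:
  assumes R: "right_lifting (nerve C) (horn i V) (standard_simplex V) (\<lambda>m s. s)" and VN: "V \<le> N"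
    and H: "S.thom N N (spx (hornset i V)) bdry H"
  shows "\<exists>G. S.thom N N (spx (full V)) bdry G \<and> (\<forall>x\<in>tcells (spx (hornset i V)) bdry N. G x = H x)"
proof -
  let ?A = "hornset i V"
  have c: "complex_on V ?A" by (rule complex_hornset)
  define F where "F = (\<lambda>m s p. restrict (\<lambda>x. down C N p (H (pushT s (totab x)))) (oriental_cells m p))"
  have Fh: "F l r \<in> omega_hom (oriental l) C" if r: "r \<in> simplex_hom l V" "r ` {..l} \<in> ?A" and l: "l \<le> N" for l r
  proof -
    have "S.thom N N (spx (full l)) bdry (\<lambda>z. H (pushT r z))"
      unfolding S.thom_def using S.thomD[OF H] pushT_sub[OF c r] pushT_tbd pushT_tcmp by metis
    from thom_hom(1)[OF this l] show ?thesis unfolding F_def .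
  qed
  have nat: "F m (compose {..m} r t) = act (nerve C) m l t (F l r)" if t: "t \<in> simplex_hom m l" for m l t r
  proof (intro ext)
    fix p x
    show "F m (compose {..m} r t) p x = act (nerve C) m l t (F l r) p x"
    proof (cases "x \<in> oriental_cells m p")
      case True
      note z = totab_cells(1)[OF True]
      note w = fromtab_cells[OF pushT_cells[OF t z]]
      show ?thesis using True w pushT_compose[OF t z, of r]
        by (simp add: nerve_simps(2) compose_def oriental_map_eq[OF t True] F_def)
    next
      case False
      then show ?thesis by (simp add: nerve_simps(2) compose_def F_def)
    qed
  qed
  \<comment> \<open>\<open>thom_hom\<close> applies up to dimension \<open>N\<close> only; simplices
    of larger dimension are degenerate and are reached through their injective factor.\<close>
  have Fs: "F m s \<in> omega_hom (oriental m) C" if s: "s \<in> simplex_hom m V" "s ` {..m} \<in> ?A" for m s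
  proof -
    obtain l r \<sigma> where e: "r \<in> nd V l" "\<sigma> \<in> simplex_hom m l" "s = compose {..m} r \<sigma>" "r ` {..l} = s ` {..m}"
      by (rule epi_mono[OF s(1)])
    have "l \<le> N" using spx_dim(1)[OF complex_on_full nd_image[OF e(1)]] VN by simp
    moreover have "r \<in> simplex_hom l V" using e(1) by (simp add: nd_def)
    moreover have "r ` {..l} \<in> ?A" using e(4) s(2) by simp
    ultimately have "F l r \<in> omega_hom (oriental l) C" using Fh by blast
    then show ?thesis unfolding e(3) nat[OF e(2)] by (rule nerve_act_closed[OF e(2)])
  qed
  have "sset_map (horn i V) (nerve C) F"
    unfolding sset_map_def
  proof (intro conjI allI ballI)
    fix m s assume "s \<in> simplices (horn i V) m"
    then show "F m s \<in> simplices (nerve C) m" using Fs by (simp add: horn_simplices nerve_simps(1))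
  next
    fix m n t s assume "t \<in> simplex_hom m n"
    then show "F m (act (horn i V) m n t s) = act (nerve C) m n t (F n s)"
      by (simp add: horn_def standard_simplex_simps nat)
  qed
  then obtain \<Gamma> where \<Gamma>: "sset_map (standard_simplex V) (nerve C) \<Gamma>" "\<forall>m. \<forall>s\<in>simplices (horn i V) m. \<Gamma> m s = F m s"
    using R unfolding right_lifting_def by blast
  note \<Gamma>' = \<Gamma>(1)[unfolded sset_map_def standard_simplex_simps nerve_simps(1)]
  let ?e = "restrict id {..V}"
  have e: "?e \<in> simplex_hom V V" by (rule simplex_homI) auto
  define y where "y = \<Gamma> V ?e"
  have y: "y \<in> omega_hom (oriental V) C" unfolding y_def using \<Gamma>' e by blast
  have ya: "act (nerve C) m V s y = F m s" if s: "s \<in> simplex_hom m V" "s ` {..m} \<in> ?A" for m s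
  proof -
    have "compose {..m} ?e s = s"
      by (rule ext) (use simplex_homD(1,3)[OF s(1)] in \<open>auto simp: compose_def restrict_def\<close>)
    moreover have "\<Gamma> m (compose {..m} ?e s) = act (nerve C) m V s y" unfolding y_def using \<Gamma>' s(1) e by blast
    moreover have "\<Gamma> m s = F m s" using \<Gamma>(2) s horn_simplices by blast
    ultimately show ?thesis by simp
  qed
  define G where "G = (\<lambda>z. y N (fromtab z))"
  have G: "S.thom N N (spx (full V)) bdry G" unfolding G_def by (rule hom_thom[OF y])
  have sub: "spx ?A k \<subseteq> spx (full V) k" for k using spx_dim(3)[OF c] by blast
  have "G x = H x" if x: "x \<in> tcells (spx ?A) bdry N" for x
  proof (rule S.thom_unique_atoms[OF loop_free_spx[OF c] _ H _ x])
    show "S.thom N N (spx ?A) bdry G" by (rule S.thom_mono[OF G order_refl tcells_subset[OF sub]])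
    fix k S assume k: "k \<le> N" and S: "S \<in> spx ?A k"
    note s = en_nd[OF spx_dim(3)[OF c S]]
    have sh: "en k S \<in> simplex_hom k V" "en k S ` {..k} \<in> ?A" using s spx_finite(3)[OF S] by (simp_all add: nd_def)
    have z: "atom bdry k {..k} \<in> ocells k N" using tcells_mono[OF atom_simplex k] .
    have p: "pushT (en k S) (atom bdry k {..k}) = atom bdry k S"
      using pushT_atom_nd[OF s(1), of "{..k}" k] s(2) by (simp add: spx_full)
    have "G (atom bdry k S) = act (nerve C) k V (en k S) y N (fromtab (atom bdry k {..k}))"
      unfolding act_fromtab[OF sh(1) z] p G_def ..
    also have "\<dots> = H (atom bdry k S)"
      unfolding ya[OF sh] using fromtab_cells[OF z] p by (simp add: F_def down_def)
    finally show "G (atom bdry k S) = H (atom bdry k S)" .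
  qed
  then show ?thesis using G by blast
qed

text \<open>Of the faces of dimension \<open>k + 1\<close>, \<open>D0\<close> goes to
  \<open>b\<close>, the missing \<open>D2\<close> is free, and all others collapse to lower cells.
  \<open>D0\<close> and \<open>D2\<close> both have sign 1: they meet in the target of the filler,
  while the source contains neither and therefore collapses.\<close>

lemma right_inverse:
  assumes R: "right_lifting (nerve C) (horn 2 (Suc (Suc k))) (standard_simplex (Suc (Suc k))) (\<lambda>m s. s)"
    and N: "N = Suc (Suc k)" and b: "S.cell N (Suc k) b"
  shows "\<exists>X. S.cell N (Suc k) X \<and> Cd C N Neg k b = Cd C N Pos k X \<and> S.arrow N (Suc k) (Cd C N Pos k b) (Cc C N k b X)"
proof -
  let ?A = "hornset 2 N" and ?f = "globe_map N"
  define D0 where "D0 = {..N} - {0}"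
  define D2 where "D2 = {..N} - {2}"
  have c: "complex_on N ?A" by (rule complex_hornset)
  note lf = loop_free_spx[OF complex_on_full[of N]]
  have bM: "b \<in> cells C N" using S.cell_closed[OF b] .
  have vert: "?f S \<noteq> None" if "S \<in> spx ?A 0" for S
    by (rule globe_map_vertex) (use spx_dim(2)[OF c that] spx_finite(2)[OF that] N in auto)
  have bnd: "cnt ?f \<beta> (bdry S) = (if ?f S = None then 0 else if \<beta> = Pos then 1 else - 1)" if "S \<in> spx ?A (Suc j)" for S j \<beta>
    by (rule globe_map_boundary) (use spx_finite(2,3)[OF that] N in auto)
  obtain H where H: "S.thom N N (spx ?A) bdry H"
    and Ht: "\<forall>x\<in>tcells (spx ?A) bdry N. \<forall>j \<epsilon>. top_at ?f x j \<epsilon> \<longrightarrow> H x = Cd C N \<epsilon> j b"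
  proof -
    have "\<exists>H. S.thom N N (spx ?A) bdry H \<and> (\<forall>x\<in>tcells (spx ?A) bdry N. \<forall>j \<epsilon>. top_at ?f x j \<epsilon> \<longrightarrow> H x = Cd C N \<epsilon> j b)"
    proof (rule globe_thom[OF _ _ S.one_sorted_axioms[of N] bM])
      show "\<And>S. S \<in> spx ?A 0 \<Longrightarrow> ?f S \<noteq> None" by (rule vert)
      show "\<And>j S \<beta>. S \<in> spx ?A (Suc j) \<Longrightarrow>
        cnt ?f \<beta> (bdry S) = (if ?f S = None then 0 else if \<beta> = Pos then 1 else - 1)" by (rule bnd)
    qed
    then show thesis using that by blast
  qed
  obtain G where G: "S.thom N N (spx (full N)) bdry G" and GH: "\<forall>x\<in>tcells (spx ?A) bdry N. G x = H x"
    using functor_of_right_lifting[OF R _ H[unfolded N]] unfolding N by blast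
  note g = S.thomD[OF G]
  have up: "x \<in> ocells N N" if "x \<in> ocells N (Suc k)" for x using tcells_mono[OF that] N by simp
  have D: "D0 \<in> spx (full N) (Suc k)" "D2 \<in> spx (full N) (Suc k)" "D0 \<noteq> D2" "card D2 = N"
  proof -
    have "card D0 = N" "card D2 = N" "D0 \<subseteq> {..N}" "D2 \<subseteq> {..N}" unfolding D0_def D2_def using N by simp_all
    moreover have "2 \<in> D0" "2 \<notin> D2" unfolding D0_def D2_def using N by simp_all
    then show "D0 \<noteq> D2" by blast
    ultimately show "D0 \<in> spx (full N) (Suc k)" "D2 \<in> spx (full N) (Suc k)" "card D2 = N"
      unfolding spx_full using N by simp_all
  qed
  have inA: "x \<in> tcells (spx ?A) bdry (Suc k)" if x: "x \<in> ocells N (Suc k)" and n: "lk (x (Suc k) Neg) D2 = 0" for x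
  proof (rule tcells_keys[OF x])
    fix j \<alpha> assume j: "j \<le> Suc k"
    show "ks (x j \<alpha>) \<subseteq> spx ?A j"
    proof
      fix S assume S: "S \<in> ks (x j \<alpha>)"
      have Sf: "S \<in> spx (full N) j" using tcellsD(2)[OF x j] S by blast
      have "S \<noteq> D2"
      proof
        assume e: "S = D2"
        then have "j = Suc k" using spx_finite(2)[OF Sf] D(4) N by simp
        then have "x j \<alpha> = x (Suc k) Neg" using tcellsD(4)[OF x] by (cases \<alpha>) simp_all
        then show False using S n e by (simp add: in_keys_iff)
      qed
      moreover have "card S \<noteq> card {..N}" using spx_finite(2)[OF Sf] j N by simp
      then have "S \<noteq> {..N}" by blast
      ultimately have "S \<in> ?A" using hornset_face[OF Sf] by (simp add: D2_def)
      then show "S \<in> spx ?A j" using spx_finite(1,2)[OF Sf] by (simp add: spx_def)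
    qed
  qed
  have tail: "D0 = insert 1 {N + 1 - Suc k..N}"
  proof (rule Set.set_eqI)
    have "N + 1 - Suc k = 2" using N by simp
    then show "v \<in> D0 \<longleftrightarrow> v \<in> insert 1 {N + 1 - Suc k..N}" for v using N unfolding D0_def by auto
  qed
  have fD: "?f S = (if S = D0 then Some Pos else None)" if S: "S \<in> spx (full N) (Suc k)" for S
  proof (cases "?f S = None")
    case True
    moreover have "?f D0 = Some Pos" unfolding tail using globe_map_tail[of 1 "Suc k" N] N by (simp add: globe_label_def)
    ultimately show ?thesis by auto
  next
    case False
    have "S \<subseteq> {..N}" "card S = Suc (Suc k)" using S by (auto simp: spx_full)
    from globe_map_tailD[OF this False] obtain m where m: "m + Suc k \<le> N" "S = insert m {N + 1 - Suc k..N}" by blast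
    have l: "?f S = globe_label N (Suc k) m" unfolding m(2) by (rule globe_map_tail[OF m(1)])
    then have "m = 1" using False N by (auto simp: globe_label_def split: if_splits)
    then show ?thesis using l m(2) tail N by (simp add: globe_label_def)
  qed
  have cD: "cnt ?f Pos (x (Suc k) Neg) = lk (x (Suc k) Neg) D0" "cnt ?f Neg (x (Suc k) Neg) = 0"
    if x: "x \<in> ocells N (Suc k)" for x
  proof -
    have fk: "?f S = (if S = D0 then Some Pos else None)" if "S \<in> ks (x (Suc k) Neg)" for S
      using fD[OF subsetD[OF tcellsD(2)[OF x order_refl] that]] .
    have "cnt ?f Pos (x (Suc k) Neg) = (\<Sum>S\<in>ks (x (Suc k) Neg). if S = D0 then lk (x (Suc k) Neg) S else 0)"
      unfolding cnt_sum by (rule sum.cong[OF refl]) (simp add: fk)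
    then show "cnt ?f Pos (x (Suc k) Neg) = lk (x (Suc k) Neg) D0" by (simp add: in_keys_iff)
    show "cnt ?f Neg (x (Suc k) Neg) = 0"
      unfolding cnt_sum by (rule sum.neutral) (simp add: fk)
  qed
  have G1: "G x = b" if x: "x \<in> ocells N (Suc k)" and l: "lk (x (Suc k) Neg) D2 = 0" "lk (x (Suc k) Neg) D0 = 1" for x
  proof -
    have xA: "x \<in> tcells (spx ?A) bdry N" using tcells_mono[OF inA[OF x l(1)]] N by simp
    have "top_at ?f x (Suc k) Pos" using cD[OF x] l(2) tcellsD(3)[OF x, of "Suc (Suc k)" Neg] by (simp add: top_at_def tot_def)
    then have "G x = Cd C N Pos (Suc k) b" using GH Ht xA by simp
    then show ?thesis using S.d_cell[OF b] by simp
  qed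
  have G0: "S.cell N k (G x)" if x: "x \<in> ocells N (Suc k)" and l: "lk (x (Suc k) Neg) D2 = 0" "lk (x (Suc k) Neg) D0 = 0" for x
  proof -
    have xA: "x \<in> tcells (spx ?A) bdry N" using tcells_mono[OF inA[OF x l(1)]] N by simp
    have "\<exists>j \<epsilon>. top_at ?f x j \<epsilon>"
    proof (rule top_at_exists[OF _ _ xA])
      show "\<And>S. S \<in> spx ?A 0 \<Longrightarrow> ?f S \<noteq> None" by (rule vert)
      show "\<And>j S \<beta>. S \<in> spx ?A (Suc j) \<Longrightarrow>
        cnt ?f \<beta> (bdry S) = (if ?f S = None then 0 else if \<beta> = Pos then 1 else - 1)" by (rule bnd)
    qed
    then obtain j \<epsilon> where t: "top_at ?f x j \<epsilon>" by blast
    have z: "cnt ?f \<epsilon> (x (Suc k) Neg) = 0" using cD[OF x] l(2) by (cases \<epsilon>) simp_all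
    have "j \<le> k"
    proof (rule ccontr)
      assume "\<not> j \<le> k"
      then consider "j = Suc k" | "Suc k < j" by linarith
      then have "cnt ?f \<epsilon> (x j Neg) = 0" by cases (use z tcellsD(3)[OF x, of j Neg] in simp_all)
      then show False using t by (simp add: top_at_def tot_def)
    qed
    moreover have "G x = Cd C N \<epsilon> j b" using GH Ht xA t by simp
    ultimately show ?thesis using S.cell_mono[OF S.cell_d[OF bM]] by simp
  qed
  \<comment> \<open>\<open>D2\<close> acts before \<open>D0\<close>, so \<open>D0\<close> is never
    peeled while \<open>D2\<close> is present. Other steps peeled in the meantime are absorbed into
    \<open>X\<close> on the right; once \<open>D2\<close> has been peeled, the remainder contains
    \<open>D0\<close> without \<open>D2\<close> and has value \<open>b\<close>.\<close>
  have split: "\<exists>X. S.cell N (Suc k) X \<and> Cd C N Neg k b = Cd C N Pos k X \<and> G x = Cc C N k b X"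
    if "x \<in> ocells N (Suc k)" "lk (x (Suc k) Neg) D0 = 1" "lk (x (Suc k) Neg) D2 = 1" for x
    using that
  proof (induction "mass k x" arbitrary: x rule: less_induct)
    case less
    note x = less.prems(1)
    let ?E = "spx (full N) (Suc k)"
    have "x (Suc k) Neg \<noteq> 0" using less.prems(2) by auto
    from removable_exists[OF lf x this] obtain m where m: "removable bdry k m x" by blast
    have mk: "m \<in> ks (x (Suc k) Neg)" using m by (simp add: removable_def)
    have mE: "m \<in> ?E" using tcellsD(2)[OF x order_refl] mk by blast
    note en = removable_enabled[OF x m]
    define r where "r = rem bdry k m x"
    define L where "L = prom ?E bdry k (lift bdry k m x)"
    have r: "r \<in> ocells N (Suc k)" unfolding r_def by (rule rem_tcells[OF lf order_refl x mk en])
    have L: "L \<in> ocells N (Suc k)" unfolding L_def by (rule prom_tcells[OF lf order_refl lift_tcells[OF lf order_refl x mE en]])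
    have co: "tbd Neg k r = tbd Pos k L" and xe: "tcmp k r L = x"
      unfolding r_def L_def by (rule peel_composable[OF lf order_refl x mE])+
    have kN: "k < N" "Suc k < N" using N by simp_all
    have Gx: "G x = Cc C N k (G r) (G L)" using g(3)[OF up[OF r] up[OF L] kN(1) co] xe by simp
    have dG: "Cd C N Neg k (G r) = Cd C N Pos k (G L)" by (rule g(4)[OF up[OF r] up[OF L] kN(1) co])
    have cL: "S.cell N (Suc k) (G L)" by (rule S.thom_cell[OF G L kN(2)])
    have re: "lk (r (Suc k) Neg) S = lk (x (Suc k) Neg) S - (if S = m then 1 else 0)" for S
      by (simp add: r_def rem_def lookup_minus)
    \<comment> \<open>The face \<open>?a\<close>, which omits both 0 and 2, belongs to the source of
      \<open>D0\<close> and to the target of \<open>D2\<close>; hence \<open>D0\<close> is not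
      removable.\<close>
    have m0: "m \<noteq> D0"
    proof
      assume e: "m = D0"
      let ?a = "{..N} - {0} - {2}"
      have fin: "finite D0" "finite D2" "2 \<in> D0" "0 \<in> D2" using N by (simp_all add: D0_def D2_def)
      have "lk (bdry D0) ?a = sg D0 2" using lookup_bdry_face[OF fin(1,3)] by (simp add: D0_def)
      moreover have "u \<in> {u\<in>D0. u < 2} \<longleftrightarrow> u \<in> {1}" for u using N unfolding D0_def by auto
      then have "{u\<in>D0. u < 2} = {1}" by (rule Set.set_eqI)
      ultimately have "lk (bdry D0) ?a < 0" by (simp add: sg_def)
      moreover have "D2 \<in> ks (x (Suc k) Neg)" using less.prems(3) by (simp add: in_keys_iff)
      ultimately have "lk (bdry D2) ?a \<le> 0" using m e unfolding removable_def by blast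
      moreover have "D2 - {0} = ?a" unfolding D2_def by blast
      then have "lk (bdry D2) ?a = sg D2 0" using lookup_bdry_face[OF fin(2,4)] by simp
      moreover have "sg D2 0 = 1" by (rule sg_min) simp
      ultimately show False by simp
    qed
    show ?case
    proof (cases "m = D2")
      case True
      have "G r = b" by (rule G1[OF r]) (use re less.prems D(3) True in simp_all)
      then show ?thesis using Gx dG cL by auto
    next
      case False
      have "mass k r < mass k x" using mass_rem[OF x mk] by (simp add: r_def)
      moreover have "lk (r (Suc k) Neg) D0 = 1" "lk (r (Suc k) Neg) D2 = 1" using re less.prems m0 False by simp_all
      ultimately obtain X where X: "S.cell N (Suc k) X" "Cd C N Neg k b = Cd C N Pos k X" "G r = Cc C N k b X"
        using less.hyps[OF _ r] by blast
      note M = bM S.cell_closed[OF X(1)] S.cell_closed[OF cL]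
      have XL: "Cd C N Neg k X = Cd C N Pos k (G L)" using dG S.d_Neg_cmp[OF M(1,2) X(2)] X(3) by simp
      have "S.cell N (Suc k) (Cc C N k X (G L))" by (rule S.cell_cmp[OF X(1) cL XL])
      moreover have "Cd C N Neg k b = Cd C N Pos k (Cc C N k X (G L))" using S.d_Pos_cmp[OF M(2,3) XL] X(2) by simp
      moreover have "G x = Cc C N k b (Cc C N k X (G L))" using S.cmp_assoc[OF M X(2) XL] Gx X(3) by simp
      ultimately show ?thesis by blast
    qed
  qed
  define a where "a = atom bdry N {..N}"
  have a: "a \<in> ocells N N" unfolding a_def by (rule atom_simplex)
  have kN: "k < N" "Suc k < N" using N by simp_all
  have ta: "tbd \<alpha> (Suc k) a \<in> ocells N (Suc k)" for \<alpha> using tbd_tcells[OF a] N by simp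
  have entry: "tbd \<alpha> (Suc k) a (Suc k) Neg = part \<alpha> (bdry {..N})" for \<alpha>
    using N by (simp add: tbd_eq a_def atom_def)
  have "u \<in> {u\<in>{..N}. u < 2} \<longleftrightarrow> u \<in> {0, 1}" for u using N by auto
  then have "{u\<in>{..N}. u < 2} = {0, 1}" by (rule Set.set_eqI)
  then have "sg {..N} 2 = 1" by (simp add: sg_def)
  moreover have "sg {..N} 0 = 1" by (rule sg_min) simp
  ultimately have bd: "lk (bdry {..N}) D0 = 1" "lk (bdry {..N}) D2 = 1"
    using lookup_bdry_face[of "{..N}" 0] lookup_bdry_face[of "{..N}" 2] N by (simp_all add: D0_def D2_def)
  define Y where "Y = G a"
  have Y: "Y \<in> cells C N" unfolding Y_def using g(1)[OF a] .
  have GY: "G (tbd \<alpha> (Suc k) a) = Cd C N \<alpha> (Suc k) Y" for \<alpha> unfolding Y_def by (rule g(2)[OF a kN(2)])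
  obtain X where X: "S.cell N (Suc k) X" "Cd C N Neg k b = Cd C N Pos k X" "G (tbd Pos (Suc k) a) = Cc C N k b X"
    using split[OF ta[of Pos]] unfolding entry lookup_part using bd by auto
  \<comment> \<open>Being a \<open>k\<close>-cell, the source of the filler equals its own
    \<open>k\<close>-target, and that is the \<open>k\<close>-target of \<open>b\<close>.\<close>
  have z: "S.cell N k (G (tbd Neg (Suc k) a))" by (rule G0[OF ta]) (simp_all add: entry lookup_part bd)
  have "Cd C N Pos k (G (tbd Neg (Suc k) a)) = Cd C N Pos k (Cc C N k b X)"
    unfolding X(3)[symmetric] GY using S.d_d_less[OF Y, of k "Suc k"] by simp
  also have "\<dots> = Cd C N Pos k b" by (rule S.d_Pos_cmp[OF bM S.cell_closed[OF X(1)] X(2)])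
  finally have "G (tbd Neg (Suc k) a) = Cd C N Pos k b" using S.d_cell[OF z order_refl, of Pos] by simp
  then have "Cd C N Neg (Suc k) Y = Cd C N Pos k b" "Cd C N Pos (Suc k) Y = Cc C N k b X" using GY X(3) by simp_all
  moreover have "S.cell N (Suc (Suc k)) Y" unfolding S.cell_def using Y N by (simp add: Cd_def)
  ultimately have "S.arrow N (Suc k) (Cd C N Pos k b) (Cc C N k b X)" unfolding S.arrow_def by blast
  then show ?thesis using X by blast
qed

section \<open>Back from the one-sorted structure to the cells of \<open>C\<close>\<close>

lemma cell_unit:
  assumes "x \<in> cells C q" "q < N" shows "S.cell N q (unit_cell C q N x)" "bd C \<alpha> N q (unit_cell C q N x) = x"
  using assms unit_closed[OF assms(2,1)] bd_unit[OF assms(2,1)] by (simp_all add: cell_iff)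

lemma cellE:
  assumes "S.cell N q X" "q < N" obtains x where "x \<in> cells C q" "X = unit_cell C q N x"
  using assms bd_closed[OF assms(2)] by (auto simp: cell_iff)

lemma Cd_unit:
  assumes "x \<in> cells C (Suc j)" "Suc j < N"
  shows "Cd C N \<alpha> j (unit_cell C (Suc j) N x) = unit_cell C j N (bd C \<alpha> (Suc j) j x)"
  using bd_unit_lower[OF assms(2) _ assms(1), of j \<alpha>] assms(2) by (simp add: Cd_def)

lemma Cd_unit_eq:
  assumes "x \<in> cells C (Suc j)" "y \<in> cells C (Suc j)" "Suc j < N"
    "Cd C N \<alpha> j (unit_cell C (Suc j) N x) = Cd C N \<beta> j (unit_cell C (Suc j) N y)"
  shows "bd C \<alpha> (Suc j) j x = bd C \<beta> (Suc j) j y"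
proof -
  have jN: "j < N" using assms(3) by simp
  have "bd C Neg N j (unit_cell C j N (bd C \<alpha> (Suc j) j x)) = bd C Neg N j (unit_cell C j N (bd C \<beta> (Suc j) j y))"
    using assms(4) unfolding Cd_unit[OF assms(1,3)] Cd_unit[OF assms(2,3)] by simp
  then show ?thesis using bd_unit[OF jN bd_closed[OF lessI assms(1)]] bd_unit[OF jN bd_closed[OF lessI assms(2)]] by simp
qed

text \<open>With \<open>N = Suc q\<close> the connecting cell has top dimension, so it is a
  \<open>(q+1)\<close>-cell of \<open>C\<close> as it stands, and only its faces have to be freed
  from units.\<close>

lemma arrow_unitD:
  assumes N: "N = Suc q" and ab: "a \<in> cells C q" "b \<in> cells C q" and ar: "S.arrow N q (unit_cell C q N a) (unit_cell C q N b)"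
  shows "\<exists>c. cell_from_to C q c a b"
proof -
  have qN: "q < N" using N by simp
  obtain Z where Z: "S.cell N (Suc q) Z" "Cd C N Neg q Z = unit_cell C q N a" "Cd C N Pos q Z = unit_cell C q N b"
    using ar unfolding S.arrow_def by blast
  have ZM: "Z \<in> cells C N" using S.cell_closed[OF Z(1)] .
  have "bd C Neg N q Z = a" "bd C Pos N q Z = b"
    using bd_Cd[OF ZM qN, of Neg Neg] bd_Cd[OF ZM qN, of Neg Pos] Z(2,3) cell_unit(2)[OF ab(1) qN] cell_unit(2)[OF ab(2) qN] by simp_all
  then show ?thesis using ZM unfolding N cell_from_to_def by blast
qed

text \<open>All cells of dimension above \<open>K\<close> together form the invertibility set. A
  right inverse has a right inverse in turn and is therefore two-sided. That argument uses symmetry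
  of \<open>arrow\<close> before invertibility is known; symmetry is obtained beforehand from right
  inverses one dimension higher.\<close>

theorem trivial_of_right_lifting:
  assumes R: "\<And>n. K < n \<Longrightarrow> right_lifting (nerve C) (horn 2 (n + 1)) (standard_simplex (n + 1)) (\<lambda>m s. s)"
  shows "k_trivial K C"
proof -
  have RI: "\<exists>X. S.cell N (Suc k) X \<and> Cd C N Neg k b = Cd C N Pos k X \<and> S.arrow N (Suc k) (Cd C N Pos k b) (Cc C N k b X)"
    if k: "K \<le> k" and N: "N = Suc (Suc k)" and b: "S.cell N (Suc k) b" for k N b
    by (rule right_inverse[OF _ N b]) (use R[of "Suc k"] k in simp)
  \<comment> \<open>Only the boundary of the right inverse of \<open>Z\<close> matters, as it runs
    in the opposite direction. It is found among the \<open>Suc N\<close>-cells, where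
    \<open>right_inverse\<close> has room for its arrow.\<close>
  have sym: "S.arrow N (Suc k) B A" if k: "K \<le> k" and N: "N = Suc (Suc k)" and ar: "S.arrow N (Suc k) A B" for k N A B
  proof -
    obtain Z where Z: "S.cell N N Z" "Cd C N Neg (Suc k) Z = A" "Cd C N Pos (Suc k) Z = B"
      using ar unfolding S.arrow_def N by blast
    have ZM: "Z \<in> cells C N" using S.cell_closed[OF Z(1)] .
    let ?b = "unit_cell C N (Suc N) Z"
    obtain X where X: "S.cell (Suc N) N X" "Cd C (Suc N) Neg (Suc k) ?b = Cd C (Suc N) Pos (Suc k) X"
      "S.arrow (Suc N) (Suc (Suc k)) (Cd C (Suc N) Pos (Suc k) ?b) (Cc C (Suc N) (Suc k) ?b X)"
      using RI[of "Suc k" "Suc N" ?b] cell_unit(1)[OF ZM, of "Suc N"] k N by auto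
    obtain W where W: "W \<in> cells C N" "X = unit_cell C N (Suc N) W" by (rule cellE[OF X(1)]) simp
    have bM: "?b \<in> cells C (Suc N)" and XM: "X \<in> cells C (Suc N)"
      using S.cell_closed[OF cell_unit(1)[OF ZM, of "Suc N"]] S.cell_closed[OF X(1)] by simp_all
    have "Cd C (Suc N) Neg (Suc k) (Cd C (Suc N) Pos (Suc k) ?b) = Cd C (Suc N) Neg (Suc k) (Cc C (Suc N) (Suc k) ?b X)"
      by (rule S.arrow_boundary[OF X(3)])
    then have e: "Cd C (Suc N) Neg (Suc k) X = Cd C (Suc N) Pos (Suc k) ?b"
      using S.d_Neg_cmp[OF bM XM X(2)] S.d_d_ge[OF bM, of "Suc k" "Suc k"] by simp
    have 1: "bd C Neg N (Suc k) Z = bd C Pos N (Suc k) W" "bd C Neg N (Suc k) W = bd C Pos N (Suc k) Z"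
      using Cd_unit_eq[of Z "Suc k" W "Suc N" Neg Pos] Cd_unit_eq[of W "Suc k" Z "Suc N" Neg Pos] ZM W X(2) e
      unfolding N by simp_all
    have kN: "Suc k < N" using N by simp
    have "Cd C N Neg (Suc k) W = B" "Cd C N Pos (Suc k) W = A" using 1 Z(2,3) kN by (simp_all add: Cd_def)
    moreover have "S.cell N (Suc (Suc k)) W" unfolding S.cell_def using W(1) N by (simp add: Cd_def)
    ultimately show ?thesis unfolding S.arrow_def by blast
  qed
  let ?E = "{(m, x). K < m \<and> x \<in> cells C m}"
  have inv: "\<exists>r c c'. r \<in> cells C (Suc n) \<and> composable C (Suc n) n r b \<and> composable C (Suc n) n b r \<and>
      cell_from_to C (Suc n) c (unit_cell C n (Suc n) (bd C Neg (Suc n) n b)) (ccomp C (Suc n) n r b) \<and>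
      cell_from_to C (Suc n) c' (unit_cell C n (Suc n) (bd C Pos (Suc n) n b)) (ccomp C (Suc n) n b r)"
    if n: "K \<le> n" and b: "b \<in> cells C (Suc n)" for n b
  proof -
    define N where "N = Suc (Suc n)"
    have nN: "Suc n < N" "n < Suc n" "n < N" by (simp_all add: N_def)
    define u where "u = unit_cell C (Suc n) N"
    note B = cell_unit(1)[OF b nN(1), folded u_def]
    obtain X where X: "S.cell N (Suc n) X" "Cd C N Neg n (u b) = Cd C N Pos n X" "S.arrow N (Suc n) (Cd C N Pos n (u b)) (Cc C N n (u b) X)"
      using RI[OF n N_def B] by blast
    obtain X' where X': "S.cell N (Suc n) X'" "Cd C N Neg n X = Cd C N Pos n X'" "S.arrow N (Suc n) (Cd C N Pos n X) (Cc C N n X X')"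
      using RI[OF n N_def X(1)] by blast
    note L = S.left_inverse_of_right_inverses[OF B X X' sym[OF n N_def]]
    obtain r where r: "r \<in> cells C (Suc n)" "X = u r" unfolding u_def by (rule cellE[OF X(1) nN(1)])
    have co: "composable C (Suc n) n b r" "composable C (Suc n) n r b"
      using Cd_unit_eq[OF b r(1) nN(1), of Neg Pos] Cd_unit_eq[OF r(1) b nN(1), of Neg Pos] X(2) L(1) b r nN(2)
      unfolding u_def composable_def by simp_all
    have m: "Cc C N n (u b) (u r) = u (ccomp C (Suc n) n b r)" "Cc C N n (u r) (u b) = u (ccomp C (Suc n) n r b)"
      using unit_comp[OF co(1) nN(1)] unit_comp[OF co(2) nN(1)] nN(3) by (simp_all add: Cc_def u_def)
    have i: "Cd C N \<alpha> n (u b) = u (unit_cell C n (Suc n) (bd C \<alpha> (Suc n) n b))" for \<alpha>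
      unfolding u_def Cd_unit[OF b nN(1)] using unit_unit[OF nN(2,1) bd_closed[OF nN(2) b]] by simp
    have ic: "unit_cell C n (Suc n) (bd C \<alpha> (Suc n) n b) \<in> cells C (Suc n)" for \<alpha>
      by (rule unit_closed[OF nN(2) bd_closed[OF nN(2) b]])
    have "\<exists>c. cell_from_to C (Suc n) c (unit_cell C n (Suc n) (bd C Neg (Suc n) n b)) (ccomp C (Suc n) n r b)"
      by (rule arrow_unitD[OF N_def ic comp_closed[OF co(2)]]) (use L(2) r(2) in \<open>simp add: i m u_def[symmetric]\<close>)
    moreover have "\<exists>c. cell_from_to C (Suc n) c (unit_cell C n (Suc n) (bd C Pos (Suc n) n b)) (ccomp C (Suc n) n b r)"
      by (rule arrow_unitD[OF N_def ic comp_closed[OF co(1)]]) (use X(3) r(2) in \<open>simp add: i m u_def[symmetric]\<close>)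
    ultimately show ?thesis using r(1) co by blast
  qed
  have "invertibility_set C ?E"
    unfolding invertibility_set_def
  proof (intro conjI allI impI)
    show "?E \<subseteq> (SIGMA n:{0<..}. cells C n)" by auto
    fix n b assume "(Suc n, b) \<in> ?E"
    then have b: "K \<le> n" "b \<in> cells C (Suc n)" by simp_all
    obtain r c c' where r: "r \<in> cells C (Suc n)" "composable C (Suc n) n r b" "composable C (Suc n) n b r"
      "cell_from_to C (Suc n) c (unit_cell C n (Suc n) (bd C Neg (Suc n) n b)) (ccomp C (Suc n) n r b)"
      "cell_from_to C (Suc n) c' (unit_cell C n (Suc n) (bd C Pos (Suc n) n b)) (ccomp C (Suc n) n b r)"
      using inv[OF b] by blast
    have "(Suc n, r) \<in> ?E" "(n + 2, c) \<in> ?E" "(n + 2, c') \<in> ?E"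
      using b(1) r(1,4,5) by (simp_all add: cell_from_to_def)
    then show "\<exists>b' c c'. (Suc n, b') \<in> ?E \<and> (n + 2, c) \<in> ?E \<and> (n + 2, c') \<in> ?E \<and>
        composable C (Suc n) n b' b \<and> composable C (Suc n) n b b' \<and>
        cell_from_to C (Suc n) c (unit_cell C n (Suc n) (bd C Neg (Suc n) n b)) (ccomp C (Suc n) n b' b) \<and>
        cell_from_to C (Suc n) c' (unit_cell C n (Suc n) (bd C Pos (Suc n) n b)) (ccomp C (Suc n) n b b')"
      by (intro exI[of _ r] exI[of _ c] exI[of _ c'] conjI r(2-5))
  qed
  then show ?thesis unfolding k_trivial_def weakly_invertible_def by (intro allI impI ballI exI[of _ ?E]) simp
qed

end

theorem mainTheorem4:
  fixes C :: "'c omega_cat"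
  assumes "strict_omega_category C"
  shows "(((\<forall>n>0. right_lifting (nerve C) (horn 2 (n + 1)) (standard_simplex (n + 1)) (\<lambda>m s. s))
             \<longleftrightarrow> kan_complex (nerve C))
          \<and> (kan_complex (nerve C) \<longleftrightarrow> k_trivial 0 C))
       \<and> (((\<forall>n>1. right_lifting (nerve C) (horn 2 (n + 1)) (standard_simplex (n + 1)) (\<lambda>m s. s))
             \<longleftrightarrow> quasi_category (nerve C))
          \<and> (quasi_category (nerve C) \<longleftrightarrow> k_trivial 1 C))"
proof -
  interpret strict_omega_category C by (rule assms)
  let ?R = "\<lambda>n. right_lifting (nerve C) (horn 2 (n + 1)) (standard_simplex (n + 1)) (\<lambda>m s. s)"
  have R0: "\<forall>n>0. ?R n" if "kan_complex (nerve C)"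
  proof (intro allI impI)
    fix n :: nat assume "0 < n"
    then have n: "0 < n + 1" "2 \<le> n + 1" by simp_all
    have "\<forall>n>0. \<forall>i\<le>n. has_horn_fillers (nerve C) i n" using that unfolding kan_complex_def by (rule conjunct2)
    from this[rule_format, OF n] show "?R n" by (simp only: has_horn_fillers_def)
  qed
  \<comment> \<open>For \<open>n > 1\<close> the index 2 is an inner one. The case
    \<open>n = 1\<close>, an outer horn of the triangle, is what distinguishes the two halves of the
    theorem.\<close>
  have R1: "\<forall>n>1. ?R n" if "quasi_category (nerve C)"
  proof (intro allI impI)
    fix n :: nat assume "1 < n"
    then have n: "0 < (2::nat) \<and> 2 < n + 1" by simp
    have "\<forall>n i. 0 < i \<and> i < n \<longrightarrow> has_horn_fillers (nerve C) i n" using that unfolding quasi_category_def by (rule conjunct2)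
    from this[THEN spec, THEN spec, THEN mp, OF n] show "?R n" by (simp only: has_horn_fillers_def)
  qed
  have T: "k_trivial K C" if "\<forall>n>K. ?R n" for K
    by (rule trivial_of_right_lifting) (rule that[THEN spec, THEN mp])
  show ?thesis
  proof (intro conjI iffI)
    assume "\<forall>n>0. ?R n" then show "kan_complex (nerve C)" by (rule kan_of_trivial[OF T])
  next
    assume "kan_complex (nerve C)" then show "\<forall>n>0. ?R n" by (rule R0)
  next
    assume "kan_complex (nerve C)" then show "k_trivial 0 C" by (rule T[OF R0])
  next
    assume "k_trivial 0 C" then show "kan_complex (nerve C)" by (rule kan_of_trivial)
  next
    assume "\<forall>n>1. ?R n" then show "quasi_category (nerve C)" by (rule quasi_of_trivial[OF T])
  next
    assume "quasi_category (nerve C)" then show "\<forall>n>1. ?R n" by (rule R1)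
  next
    assume "quasi_category (nerve C)" then show "k_trivial 1 C" by (rule T[OF R1])
  next
    assume "k_trivial 1 C" then show "quasi_category (nerve C)" by (rule quasi_of_trivial)
  qed
qed


end
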